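(* Let $f:L^2(0,\pi)\to L^2(0,\pi)$ be globally Lipschitz continuous, $\phi\in H_0^1(0,\pi)$ and $\delta>0$, and consider the stochastic damped wave equation on $[0,\pi]$ $$\epsilon^2\,\mathrm{d}u_t+(u_t-\Delta u)\,\mathrm{d}t=f(u)\,\mathrm{d}t+\delta\phi\,\mathrm{d}W,\qquad u(0,x)=u_0(x),\ u_t(0,x)=u_1(x),\ u(t,0)=u(t,\pi)=0 .$$ There exists $\epsilon_0>0$ such that for any $\epsilon\in(0,\epsilon_0)$ this equation (that is, the random dynamical system $\tilde\varphi$ it generates on $E=H_0^1(0,\pi)\times L^2(0,\pi)$) has a stochastic inertial manifold.
   Context: **Noise.** $W$ is the standard two-sided real Wiener process, realized on $C_0(\mathbb R,\mathbb R)$ (continuous $\omega$ with $\omega(0)=0$) with Wiener measure $\mathbb P$ and shifts $\theta_t\omega(\cdot)=\omega(t+\cdot)-\omega(t)$; $\Omega$ is a $\{\theta_t\}$-invariant set of full measure on which $\omega(t)/t\to0$ as $t\to\pm\infty$. Let $z(\theta_t\omega)$ be the stationary solution of $\epsilon^2\mathrm{d}z+z\,\mathrm{d}t=\mathrm{d}W$, i.e. $z(\omega)=-\epsilon^{-4}\int_{-\infty}^0e^{\tau/\epsilon^2}\omega(\tau)\,\mathrm{d}\tau$. **Random dynamical system.** A random dynamical system on a metric space $X$ over $(\Omega,\mathscr F,\mathbb P,(\theta_t)_{t\in\mathbb R})$ is a measurable map $\psi:\mathbb R^+\times\Omega\times X\to X$ with $\psi(0,\omega,\cdot)=\mathrm{id}_X$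 and $\psi(t+s,\omega,\cdot)=\psi(t,\theta_s\omega,\psi(s,\omega,\cdot))$ for all $t,s\ge0$, $\omega\in\Omega$. **Random dynamical system generated by the equation.** Put $\tilde Au=-\Delta u$ (Dirichlet boundary conditions). With $v=u_t$, the substitution $U=(\bar u,\bar v)=(u,v-\delta\phi z)$ turns the equation into the random evolution equation on $E$ $$\dot U=AU+F(\theta_t\omega,U),\quad A=\begin{pmatrix}0&\mathrm{id}\\-\epsilon^{-2}\tilde A&-\epsilon^{-2}\mathrm{id}\end{pmatrix},\quad F(\omega,U)=\begin{pmatrix}\delta\phi z(\omega)\\ \epsilon^{-2}f(\bar u)\end{pmatrix},$$ where $A$ generates a $C^0$-semigroup $e^{At}$ on $E$. Let $\varphi(t,\omega,U_0)$ be its solution at time $t$ starting from $U_0\in E$. With $T(\omega,U)=U-(0,\delta\phi z(\omega))$, the random dynamical system generated by the wave equation is $\tilde\varphi(t,\omega,U_0)=T^{-1}(\theta_t\omega,\varphi(t,\omega,T(\omega,U_0)))$ for the state $(u,u_t)$. **Stochastic inertial manifold.** Let $\psi$ be a random dynamical system on a Hilbert space $H$ with norm $|\cdot|$ (here $\psi=\tilde\varphi$, $H=E$). A random set $M(\omega)$ is invariant for $\psi$ if $\psi(t,\omega,M(\omega))\subset M(\theta_t\omega)$ for all $t\ge0$. It is a Lipschitz (or $C^k$) invariant manifold if it is invariant and $M(\omega)=\{\xi+h(\xi,\omega)\mid\xi\in PH\}$ with a Lipschitz (or $C^k$) map $h(\cdot,\omega):PH\to QH$, where $Q=I-P$ and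 $P$ is a continuous projection realizing a pseudo exponential dichotomy of $e^{At}$: $Pe^{At}=e^{At}P$; for $t\ge0$, $e^{At}$ restricts to an isomorphism of $PH$ onto itself, and $e^{At}$ for $t<0$ denotes the inverse map on $PH$; and for some $0>\alpha>\beta$ and $K>0$, $|e^{At}Px|\le Ke^{\alpha t}|x|$ for $t\le0$ and $|e^{At}Qx|\le Ke^{\beta t}|x|$ for $t\ge0$. It is a stochastic inertial manifold of $\psi$ if, in addition, $PH$ is finite dimensional and $M(\omega)$ attracts exponentially all the orbits of $\psi$ (along each orbit, the distance from $\psi(t,\omega,x)$ to $M(\theta_t\omega)$ tends to zero exponentially fast as $t\to\infty$; no uniformity in $x$ or $\omega$ is asserted). *)

theory Defs
  imports "HOL-Analysis.Analysis" "HOL-Probability.Probability"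
begin

section \<open>The spaces \<open>L\<^sup>2(0,\<pi>)\<close> and \<open>H\<^sub>0\<^sup>1(0,\<pi>)\<close>\<close>

text \<open>
  The carrier functions of \<open>L\<^sup>2(0,\<pi>)\<close> are Borel functions; every Lebesgue measurable function
  agrees almost everywhere with a Borel one, so the quotient is the usual space.
\<close>

abbreviation interval_measure :: "real measure" where
  "interval_measure \<equiv> restrict_space lborel {0<..<pi}"

definition square_integrable :: "(real \<Rightarrow> real) \<Rightarrow> bool" where
  "square_integrable f \<longleftrightarrow>
     f \<in> borel_measurable interval_measure \<and> integrable interval_measure (\<lambda>x. (f x)\<^sup>2)"

definition L2_eq :: "(real \<Rightarrow> real) \<Rightarrow> (real \<Rightarrow> real) \<Rightarrow> bool" where
  "L2_eq f g \<longleftrightarrow> square_integrable f \<and> square_integrable g \<and> (AE x in interval_measure. f x = g x)"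

lemma finite_measure_interval: "finite_measure interval_measure"
  by (rule finite_measureI) (simp add: space_restrict_space emeasure_restrict_space)

lemma square_integrable_times:
  assumes "square_integrable f" "square_integrable g"
  shows "integrable interval_measure (\<lambda>x. f x * g x)"
proof (rule Bochner_Integration.integrable_bound)
  show "integrable interval_measure (\<lambda>x. (f x)\<^sup>2 + (g x)\<^sup>2)"
    using assms by (auto simp: square_integrable_def)
  show "(\<lambda>x. f x * g x) \<in> borel_measurable interval_measure"
    using assms by (auto simp: square_integrable_def intro!: borel_measurable_times)
  have "\<bar>f x * g x\<bar> \<le> \<bar>(f x)\<^sup>2 + (g x)\<^sup>2\<bar>" for x
  proof -
    have "\<bar>f x * g x\<bar> = \<bar>f x\<bar> * \<bar>g x\<bar>" by (simp add: abs_mult)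
    moreover have "0 \<le> (\<bar>f x\<bar> - \<bar>g x\<bar>)\<^sup>2" "0 \<le> \<bar>f x\<bar> * \<bar>g x\<bar>" by auto
    ultimately show ?thesis by (simp add: power2_eq_square algebra_simps)
  qed
  then show "AE x in interval_measure. norm (f x * g x) \<le> norm ((f x)\<^sup>2 + (g x)\<^sup>2)" by simp
qed

lemma square_integrable_add:
  assumes "square_integrable f" "square_integrable g"
  shows "square_integrable (\<lambda>x. f x + g x)"
proof -
  have "integrable interval_measure (\<lambda>x. (f x)\<^sup>2 + (g x)\<^sup>2 + 2 * (f x * g x))"
    using assms square_integrable_times[OF assms]
    by (intro Bochner_Integration.integrable_add integrable_mult_right)
       (auto simp: square_integrable_def)
  then have "integrable interval_measure (\<lambda>x. (f x + g x)\<^sup>2)"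
    by (simp add: power2_sum mult.assoc)
  then show ?thesis
    using assms by (auto simp: square_integrable_def intro!: borel_measurable_add)
qed

lemma square_integrable_scale:
  assumes "square_integrable f"
  shows "square_integrable (\<lambda>x. c * f x)"
  using assms
  by (auto simp: square_integrable_def power_mult_distrib intro!: borel_measurable_times)

lemma square_integrable_minus: "square_integrable f \<Longrightarrow> square_integrable (\<lambda>x. - f x)"
  using square_integrable_scale[of f "-1"] by simp

lemma square_integrable_diff:
  "square_integrable f \<Longrightarrow> square_integrable g \<Longrightarrow> square_integrable (\<lambda>x. f x - g x)"
  using square_integrable_add[OF _ square_integrable_minus, of f g] by simp

lemma square_integrable_const: "square_integrable (\<lambda>x. c)"
proof -
  interpret finite_measure interval_measure by (rule finite_measure_interval)
  show ?thesis by (simp add: square_integrable_def)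
qed

lemma square_integrable_bounded:
  assumes "f \<in> borel_measurable borel" and "\<And>x. \<bar>f x\<bar> \<le> B"
  shows "square_integrable f"
proof -
  interpret finite_measure interval_measure by (rule finite_measure_interval)
  have m: "f \<in> borel_measurable interval_measure"
    using assms(1) by (intro measurable_restrict_space1) simp
  have "integrable interval_measure (\<lambda>x. (f x)\<^sup>2)"
    using m assms(2) by (intro integrable_const_bound[where B = "B\<^sup>2"])
      (auto simp: abs_le_square_iff[symmetric] intro: order_trans[OF _ abs_ge_self])
  with m show ?thesis by (simp add: square_integrable_def)
qed

quotient_type L2 = "real \<Rightarrow> real" / partial: L2_eq
proof (rule part_equivpI)
  show "\<exists>x. L2_eq x x"
    using square_integrable_const[of 0] by (auto simp: L2_eq_def)
  show "symp L2_eq"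
    by (auto simp: L2_eq_def symp_def elim: eventually_mono)
  show "transp L2_eq"
    by (auto simp: L2_eq_def transp_def elim: eventually_elim2)
qed

lemma L2_cases:
  obtains f where "square_integrable f" "x = abs_L2 f"
proof -
  have "L2_eq (rep_L2 x) (rep_L2 x)" "abs_L2 (rep_L2 x) = x"
    by (rule Quotient3_rep_reflp[OF Quotient3_L2], rule Quotient3_abs_rep[OF Quotient3_L2])
  then show ?thesis using that[of "rep_L2 x"] by (simp add: L2_eq_def)
qed

instantiation L2 :: real_vector
begin

lift_definition zero_L2 :: L2 is "\<lambda>_. 0"
  using square_integrable_const[of 0] by (simp add: L2_eq_def)

lift_definition plus_L2 :: "L2 \<Rightarrow> L2 \<Rightarrow> L2" is "\<lambda>f g x. f x + g x"
  by (auto simp: L2_eq_def square_integrable_add elim: eventually_elim2)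

lift_definition uminus_L2 :: "L2 \<Rightarrow> L2" is "\<lambda>f x. - f x"
  by (auto simp: L2_eq_def square_integrable_minus elim: eventually_mono)

lift_definition minus_L2 :: "L2 \<Rightarrow> L2 \<Rightarrow> L2" is "\<lambda>f g x. f x - g x"
  by (auto simp: L2_eq_def square_integrable_diff elim: eventually_elim2)

lift_definition scaleR_L2 :: "real \<Rightarrow> L2 \<Rightarrow> L2" is "\<lambda>c f x. c * f x"
  by (auto simp: L2_eq_def square_integrable_scale elim: eventually_mono)

instance
proof
  fix a b c :: L2 and r s :: real
  show "a + b + c = a + (b + c)"
    by transfer (auto simp: L2_eq_def square_integrable_add add.assoc)
  show "a + b = b + a"
    by transfer (auto simp: L2_eq_def square_integrable_add add.commute)
  show "0 + a = a"
    by transfer (auto simp: L2_eq_def)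
  show "- a + a = 0"
    by transfer (auto simp: L2_eq_def square_integrable_const)
  show "a - b = a + - b"
    by transfer (auto simp: L2_eq_def square_integrable_diff)
  show "r *\<^sub>R (a + b) = r *\<^sub>R a + r *\<^sub>R b"
    by transfer (auto simp: L2_eq_def square_integrable_add square_integrable_scale distrib_left)
  show "(r + s) *\<^sub>R a = r *\<^sub>R a + s *\<^sub>R a"
    by transfer (auto simp: L2_eq_def square_integrable_add square_integrable_scale distrib_right)
  show "r *\<^sub>R s *\<^sub>R a = (r * s) *\<^sub>R a"
    by transfer (auto simp: L2_eq_def square_integrable_scale mult.assoc)
  show "1 *\<^sub>R a = a"
    by transfer (auto simp: L2_eq_def)
qed

end

instantiation L2 :: real_inner
begin

lift_definition inner_L2 :: "L2 \<Rightarrow> L2 \<Rightarrow> real" is "\<lambda>f g. \<integral>x. f x * g x \<partial>interval_measure"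
proof -
  fix f f' g g' assume a: "L2_eq f f'" "L2_eq g g'"
  then have "AE x in interval_measure. f x * g x = f' x * g' x"
    by (auto simp: L2_eq_def elim: eventually_elim2)
  with a show "(\<integral>x. f x * g x \<partial>interval_measure) = (\<integral>x. f' x * g' x \<partial>interval_measure)"
    by (intro integral_cong_AE) (auto simp: L2_eq_def square_integrable_def intro!: borel_measurable_times)
qed

definition norm_L2 :: "L2 \<Rightarrow> real" where "norm_L2 x = sqrt (inner x x)"

definition sgn_L2 :: "L2 \<Rightarrow> L2" where "sgn_L2 x = x /\<^sub>R norm x"

definition dist_L2 :: "L2 \<Rightarrow> L2 \<Rightarrow> real" where "dist_L2 x y = norm (x - y)"

definition uniformity_L2 :: "(L2 \<times> L2) filter" where
  "uniformity_L2 = (INF e\<in>{0 <..}. principal {(x, y). dist x y < e})"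

definition open_L2 :: "L2 set \<Rightarrow> bool" where
  "open_L2 U \<longleftrightarrow> (\<forall>x\<in>U. eventually (\<lambda>(x', y). x' = x \<longrightarrow> y \<in> U) uniformity)"

instance
proof
  fix a b c :: L2 and r :: real and U :: "L2 set"
  show "dist a b = norm (a - b)" by (fact dist_L2_def)
  show "sgn a = a /\<^sub>R norm a" by (fact sgn_L2_def)
  show "uniformity = (INF e\<in>{0 <..}. principal {(x, y :: L2). dist x y < e})"
    by (fact uniformity_L2_def)
  show "open U = (\<forall>x\<in>U. \<forall>\<^sub>F (x', y) in uniformity. x' = x \<longrightarrow> y \<in> U)"
    by (fact open_L2_def)
  show "norm a = sqrt (inner a a)" by (fact norm_L2_def)
  show "inner a b = inner b a"
    by transfer (simp add: mult.commute)
  show "inner (a + b) c = inner a c + inner b c"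
    by transfer (simp add: distrib_right L2_eq_def square_integrable_times)
  show "inner (r *\<^sub>R a) b = r * inner a b"
    by transfer (simp add: mult.assoc)
  show "0 \<le> inner a a"
    by transfer simp
  show "inner a a = 0 \<longleftrightarrow> a = 0"
  proof transfer
    fix f assume f: "L2_eq f f"
    then have "integrable interval_measure (\<lambda>x. f x * f x)"
      by (auto simp: L2_eq_def square_integrable_times)
    then have "(\<integral>x. f x * f x \<partial>interval_measure) = 0 \<longleftrightarrow> (AE x in interval_measure. f x * f x = 0)"
      by (intro integral_nonneg_eq_0_iff_AE) auto
    then show "(\<integral>x. f x * f x \<partial>interval_measure) = 0 \<longleftrightarrow> L2_eq f (\<lambda>_. 0)"
      using f square_integrable_const[of 0] by (simp add: L2_eq_def)
  qed
qed

end

lemma inner_abs_L2: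
  assumes "square_integrable f" "square_integrable g"
  shows "inner (abs_L2 f) (abs_L2 g) = (\<integral>x. f x * g x \<partial>interval_measure)"
  using assms by (simp add: inner_L2.abs_eq L2_eq_def)

lemma minus_abs_L2:
  assumes "square_integrable f" "square_integrable g"
  shows "abs_L2 f - abs_L2 g = abs_L2 (\<lambda>x. f x - g x)"
  using assms by (simp add: minus_L2.abs_eq L2_eq_def)

lemma norm_abs_L2:
  assumes "square_integrable f"
  shows "(norm (abs_L2 f))\<^sup>2 = (\<integral>x. (f x)\<^sup>2 \<partial>interval_measure)"
  using power2_norm_eq_inner[of "abs_L2 f"] inner_abs_L2[OF assms assms]
  by (simp add: power2_eq_square)

lemma integral_abs_le_norm_L2:
  assumes "square_integrable f"
  shows "(\<integral>x. \<bar>f x\<bar> \<partial>interval_measure) \<le> norm (abs_L2 f) * norm (abs_L2 (\<lambda>_. 1))"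
proof -
  have sa: "square_integrable (\<lambda>x. \<bar>f x\<bar>)"
    using assms by (auto simp: square_integrable_def)
  have "(norm (abs_L2 (\<lambda>x. \<bar>f x\<bar>)))\<^sup>2 = (norm (abs_L2 f))\<^sup>2"
    by (simp add: norm_abs_L2 assms sa)
  then have n: "norm (abs_L2 (\<lambda>x. \<bar>f x\<bar>)) = norm (abs_L2 f)"
    by (simp add: power2_eq_iff_nonneg)
  have "(\<integral>x. \<bar>f x\<bar> \<partial>interval_measure) = inner (abs_L2 (\<lambda>x. \<bar>f x\<bar>)) (abs_L2 (\<lambda>_. 1))"
    by (simp add: inner_abs_L2 sa square_integrable_const)
  also have "\<dots> \<le> norm (abs_L2 f) * norm (abs_L2 (\<lambda>_. 1))"
    using norm_cauchy_schwarz[of "abs_L2 (\<lambda>x. \<bar>f x\<bar>)" "abs_L2 (\<lambda>_. 1)"] by (simp add: n)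
  finally show ?thesis .
qed

instance L2 :: complete_space
proof
  fix X :: "nat \<Rightarrow> L2" assume X: "Cauchy X"
  have "\<forall>n. \<exists>f. square_integrable f \<and> X n = abs_L2 f"
    by (meson L2_cases)
  then obtain s where s: "\<And>n. square_integrable (s n) \<and> X n = abs_L2 (s n)"
    using choice[of "\<lambda>n f. square_integrable f \<and> X n = abs_L2 f"] by blast
  interpret finite_measure interval_measure by (rule finite_measure_interval)
  define c where "c = norm (abs_L2 (\<lambda>_. 1)) + 1"
  have c: "c > 0" by (simp add: c_def add_nonneg_pos)
  have int: "integrable interval_measure (s n)" for n
    using square_integrable_times[OF conjunct1[OF s[of n]] square_integrable_const[of 1]] by simp
  have diff: "square_integrable (\<lambda>x. s i x - s j x)" for i j
    using s square_integrable_diff by blast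
  have dXs: "norm (X i - X j) = norm (abs_L2 (\<lambda>x. s i x - s j x))" for i j
    using s[of i] s[of j] minus_abs_L2 by metis
  have L1: "\<exists>N. \<forall>i\<ge>N. \<forall>j\<ge>N. (\<integral>x. norm (s i x - s j x) \<partial>interval_measure) < e" if e: "e > 0" for e
  proof -
    obtain N where N: "\<And>i j. i \<ge> N \<Longrightarrow> j \<ge> N \<Longrightarrow> norm (X i - X j) < e / c"
      using CauchyD[OF X, of "e / c"] e c by auto
    have "(\<integral>x. norm (s i x - s j x) \<partial>interval_measure) < e" if "i \<ge> N" "j \<ge> N" for i j
    proof -
      have "(\<integral>x. norm (s i x - s j x) \<partial>interval_measure) \<le> norm (X i - X j) * (c - 1)"
        using integral_abs_le_norm_L2[OF diff[of i j]] dXs[of i j] by (simp add: c_def)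
      also have "\<dots> \<le> norm (X i - X j) * c" by (simp add: mult_left_mono)
      also have "\<dots> < e / c * c" using N[OF that] c by (intro mult_strict_right_mono)
      finally show ?thesis using c by simp
    qed
    then show ?thesis by blast
  qed
  obtain r where r: "strict_mono r" and aeC: "AE x in interval_measure. Cauchy (\<lambda>i. s (r i) x)"
    using cauchy_L1_AE_cauchy_subseq[of interval_measure s] int L1 by blast
  define g where "g x = lim (\<lambda>i. s (r i) x)" for x
  have gm: "g \<in> borel_measurable interval_measure"
    unfolding g_def using s by (intro borel_measurable_lim_metric) (auto simp: square_integrable_def)
  have sm: "s n \<in> borel_measurable interval_measure" for n
    using s by (auto simp: square_integrable_def)
  have lim: "AE x in interval_measure. (\<lambda>i. s (r i) x) \<longlonglongrightarrow> g x"
    using aeC by eventually_elim (simp add: g_def Cauchy_convergent_iff convergent_LIMSEQ_iff)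
  have fatou: "(\<integral>\<^sup>+x. ennreal ((g x - s n x)\<^sup>2) \<partial>interval_measure) \<le> ennreal (e\<^sup>2)"
    if N: "\<And>i j. i \<ge> N \<Longrightarrow> j \<ge> N \<Longrightarrow> norm (X i - X j) < e" and n: "n \<ge> N" for e N n
  proof -
    have "(\<integral>\<^sup>+x. ennreal ((g x - s n x)\<^sup>2) \<partial>interval_measure)
        = (\<integral>\<^sup>+x. liminf (\<lambda>i. ennreal ((s (r i) x - s n x)\<^sup>2)) \<partial>interval_measure)"
      using lim
      by (intro nn_integral_cong_AE, eventually_elim)
         (auto intro!: lim_imp_Liminf[symmetric] tendsto_intros)
    also have "\<dots> \<le> liminf (\<lambda>i. \<integral>\<^sup>+x. ennreal ((s (r i) x - s n x)\<^sup>2) \<partial>interval_measure)"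
      using sm by (intro nn_integral_liminf) auto
    also have "\<dots> \<le> ennreal (e\<^sup>2)"
    proof (rule Liminf_le)
      show "\<forall>\<^sub>F i in sequentially.
          (\<integral>\<^sup>+x. ennreal ((s (r i) x - s n x)\<^sup>2) \<partial>interval_measure) \<le> ennreal (e\<^sup>2)"
        using eventually_ge_at_top[of N]
      proof eventually_elim
        case (elim i)
        then have ri: "r i \<ge> N" using seq_suble[OF r, of i] by linarith
        have "(\<integral>\<^sup>+x. ennreal ((s (r i) x - s n x)\<^sup>2) \<partial>interval_measure)
            = ennreal (\<integral>x. (s (r i) x - s n x)\<^sup>2 \<partial>interval_measure)"
          using diff by (intro nn_integral_eq_integral) (auto simp: square_integrable_def)
        also have "\<dots> = ennreal ((norm (X (r i) - X n))\<^sup>2)"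
          by (simp add: dXs norm_abs_L2 diff)
        also have "\<dots> \<le> ennreal (e\<^sup>2)"
          using N[OF ri n] by (intro ennreal_leI power_mono) auto
        finally show ?case .
      qed
    qed simp
    finally show ?thesis .
  qed
  have sq: "square_integrable (\<lambda>x. g x - s n x) \<and> norm (abs_L2 (\<lambda>x. g x - s n x)) \<le> e"
    if N: "\<And>i j. i \<ge> N \<Longrightarrow> j \<ge> N \<Longrightarrow> norm (X i - X j) < e" and n: "n \<ge> N" for e N n
  proof -
    have e: "e > 0" using N[OF n n] by simp
    note F = fatou[OF N n]
    have "integrable interval_measure (\<lambda>x. (g x - s n x)\<^sup>2)"
      using gm sm F by (intro integrableI_bounded) (auto intro: le_less_trans)
    then have S: "square_integrable (\<lambda>x. g x - s n x)"
      using gm sm by (simp add: square_integrable_def)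
    then have "ennreal ((norm (abs_L2 (\<lambda>x. g x - s n x)))\<^sup>2) \<le> ennreal (e\<^sup>2)"
      using F by (simp add: norm_abs_L2 nn_integral_eq_integral square_integrable_def)
    then have "(norm (abs_L2 (\<lambda>x. g x - s n x)))\<^sup>2 \<le> e\<^sup>2" by simp
    then show ?thesis using S e by (simp add: power2_le_iff_abs_le)
  qed
  obtain N where N1: "\<And>i j. i \<ge> N \<Longrightarrow> j \<ge> N \<Longrightarrow> norm (X i - X j) < 1"
    using CauchyD[OF X, of 1] by auto
  have "square_integrable (\<lambda>x. (g x - s N x) + s N x)"
    using sq[OF N1, of N] s by (intro square_integrable_add) auto
  then have g: "square_integrable g" by simp
  have "X \<longlonglongrightarrow> abs_L2 g"
  proof (rule LIMSEQ_I)
    fix e :: real assume "e > 0"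
    then obtain N where N: "\<And>i j. i \<ge> N \<Longrightarrow> j \<ge> N \<Longrightarrow> norm (X i - X j) < e / 2"
      using CauchyD[OF X, of "e / 2"] by auto
    have "norm (X n - abs_L2 g) < e" if "n \<ge> N" for n
    proof -
      have "norm (X n - abs_L2 g) = norm (abs_L2 g - abs_L2 (s n))"
        using s[of n] by (simp add: norm_minus_commute)
      also have "\<dots> = norm (abs_L2 (\<lambda>x. g x - s n x))"
        using g s by (simp add: minus_abs_L2)
      also have "\<dots> \<le> e / 2" using sq[OF N that] by simp
      finally show ?thesis using \<open>e > 0\<close> by simp
    qed
    then show "\<exists>no. \<forall>n\<ge>no. norm (X n - abs_L2 g) < e" by blast
  qed
  then show "convergent X" by (auto simp: convergent_def)
qed

text \<open>
  Weak derivatives and \<open>H\<^sub>0\<^sup>1\<close> are defined with continuously differentiable test functions of compact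
  support in the open interval, as in Brezis' textbook.
\<close>

definition test_fun :: "(real \<Rightarrow> real) \<Rightarrow> bool" where
  "test_fun \<phi> \<longleftrightarrow> \<phi> C1_differentiable_on UNIV \<and>
     (\<exists>a b. 0 < a \<and> b < pi \<and> (\<forall>x. x \<notin> {a..b} \<longrightarrow> \<phi> x = 0))"

definition weak_deriv :: "L2 \<Rightarrow> L2 \<Rightarrow> bool" where
  "weak_deriv u g \<longleftrightarrow>
     (\<forall>\<phi>. test_fun \<phi> \<longrightarrow> inner u (abs_L2 (deriv \<phi>)) = - inner g (abs_L2 \<phi>))"

definition wderiv :: "L2 \<Rightarrow> L2" where
  "wderiv u = (THE g. weak_deriv u g)"

definition H1 :: "L2 set" where
  "H1 = {u. \<exists>g. weak_deriv u g}"

definition H10_set :: "L2 set" where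
  "H10_set = {u \<in> H1. \<exists>\<phi>. (\<forall>n::nat. test_fun (\<phi> n)) \<and>
     (\<lambda>n. abs_L2 (\<phi> n)) \<longlonglongrightarrow> u \<and> (\<lambda>n. abs_L2 (deriv (\<phi> n))) \<longlonglongrightarrow> wderiv u}"

lemma DERIV_max_0_power2: "((\<lambda>x::real. (max 0 x)\<^sup>2) has_real_derivative 2 * max 0 x) (at x)"
proof -
  consider "x < 0" | "x = 0" | "x > 0" by linarith
  then show ?thesis
  proof cases
    case 1
    have "((\<lambda>x::real. 0) has_real_derivative 0) (at x)" by simp
    then have "((\<lambda>x::real. (max 0 x)\<^sup>2) has_real_derivative 0) (at x)"
      by (rule has_field_derivative_transform_within_open[where S = "{..<0}"]) (use 1 in auto)
    then show ?thesis using 1 by simp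
  next
    case 2
    have "(\<lambda>h::real. max 0 h) \<midarrow>0\<rightarrow> 0"
      using tendsto_max[OF tendsto_const tendsto_ident_at, of 0 "0::real" UNIV] by simp
    then have "(\<lambda>h::real. ((max 0 (0 + h))\<^sup>2 - (max 0 0)\<^sup>2) / h) \<midarrow>0\<rightarrow> 0"
      by (rule Lim_transform_eventually)
         (auto simp: eventually_at_filter max_def power2_eq_square)
    then show ?thesis using 2 by (simp add: DERIV_def)
  next
    case 3
    have "((\<lambda>x::real. x\<^sup>2) has_real_derivative 2 * x) (at x)"
      by (auto intro!: derivative_eq_intros)
    then have "((\<lambda>x::real. (max 0 x)\<^sup>2) has_real_derivative 2 * x) (at x)"
      by (rule has_field_derivative_transform_within_open[where S = "{0<..}"]) (use 3 in auto)
    then show ?thesis using 3 by simp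
  qed
qed

definition bump_base :: "real \<Rightarrow> real \<Rightarrow> real \<Rightarrow> real" where
  "bump_base a b x = (max 0 (x - a))\<^sup>2 * (max 0 (b - x))\<^sup>2"

definition bump :: "real \<Rightarrow> real \<Rightarrow> real \<Rightarrow> real \<Rightarrow> real" where
  "bump c a b x = c * bump_base a b x / (1 + c * bump_base a b x)"

lemma bump_base_nonneg: "0 \<le> bump_base a b x"
  by (simp add: bump_base_def)

lemma test_fun_bump:
  assumes "0 < a" "b < pi" "0 \<le> c"
  shows "test_fun (bump c a b)"
proof -
  define D where "D x = 2 * max 0 (x - a) * (max 0 (b - x))\<^sup>2
      - (max 0 (x - a))\<^sup>2 * (2 * max 0 (b - x))" for x
  have "((\<lambda>x. (max 0 (x - a))\<^sup>2) has_real_derivative 2 * max 0 (x - a) * 1) (at x)" for x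
    by (rule DERIV_chain2[OF DERIV_max_0_power2]) (auto intro!: derivative_eq_intros)
  moreover have "((\<lambda>x. (max 0 (b - x))\<^sup>2) has_real_derivative 2 * max 0 (b - x) * (- 1)) (at x)" for x
    by (rule DERIV_chain2[OF DERIV_max_0_power2]) (auto intro!: derivative_eq_intros)
  ultimately have B: "(bump_base a b has_real_derivative D x) (at x)" for x
    unfolding bump_base_def[abs_def] D_def
    by (rule DERIV_mult[THEN DERIV_cong]) (simp add: algebra_simps)
  have pos: "1 + c * bump_base a b x > 0" for x
    using bump_base_nonneg[of a b x] assms(3) by (simp add: add_pos_nonneg)
  have bump: "(bump c a b has_real_derivative c * D x / (1 + c * bump_base a b x)\<^sup>2) (at x)" for x
    unfolding bump_def[abs_def]
    using pos[of x] B[of x]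
    by (auto intro!: derivative_eq_intros simp: power2_eq_square field_simps)
  have cD: "continuous_on UNIV D"
    unfolding D_def by (intro continuous_intros)
  have cB: "continuous_on UNIV (bump_base a b)"
    using B by (meson DERIV_continuous_on has_field_derivative_at_within)
  have "continuous_on UNIV (\<lambda>x. c * D x / (1 + c * bump_base a b x)\<^sup>2)"
    using pos by (intro continuous_intros cD cB) (metis less_irrefl power_eq_0_iff)
  then have "bump c a b C1_differentiable_on UNIV"
    unfolding C1_differentiable_on_def
    by (intro exI[of _ "\<lambda>x. c * D x / (1 + c * bump_base a b x)\<^sup>2"])
       (simp add: has_real_derivative_iff_has_vector_derivative[symmetric] bump)
  moreover have "x \<notin> {a..b} \<longrightarrow> bump c a b x = 0" for x
    by (auto simp: bump_def bump_base_def)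
  ultimately show ?thesis using assms by (auto simp: test_fun_def)
qed

lemma square_integrable_continuous:
  assumes "continuous_on UNIV f"
  shows "square_integrable f"
proof -
  interpret finite_measure interval_measure by (rule finite_measure_interval)
  have m: "f \<in> borel_measurable interval_measure"
    using assms by (intro measurable_restrict_space1) (simp add: borel_measurable_continuous_onI)
  have "bounded (f ` {0..pi})"
    using assms by (intro compact_imp_bounded compact_continuous_image) (auto intro: continuous_on_subset)
  then obtain B where "\<forall>y\<in>f ` {0..pi}. norm y \<le> B"
    unfolding bounded_iff by blast
  then have B: "\<And>x. x \<in> {0..pi} \<Longrightarrow> \<bar>f x\<bar> \<le> B" by auto
  have "integrable interval_measure (\<lambda>x. (f x)\<^sup>2)"
  proof (rule integrable_const_bound[where B = "B\<^sup>2"])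
    have "norm ((f x)\<^sup>2) \<le> B\<^sup>2" if "x \<in> {0<..<pi}" for x
      using B[of x] that by (auto simp: abs_le_square_iff[symmetric])
    then show "AE x in interval_measure. norm ((f x)\<^sup>2) \<le> B\<^sup>2"
      by (intro AE_I2) (simp add: space_restrict_space)
  qed (use m in auto)
  with m show ?thesis by (simp add: square_integrable_def)
qed

lemma test_fun_DERIV:
  assumes "test_fun \<phi>"
  shows "(\<phi> has_real_derivative deriv \<phi> x) (at x)" "continuous_on UNIV \<phi>"
    "continuous_on UNIV (deriv \<phi>)"
proof -
  obtain D where D: "\<And>x. (\<phi> has_real_derivative D x) (at x)" "continuous_on UNIV D"
    using assms by (auto simp: test_fun_def C1_differentiable_on_def
        has_real_derivative_iff_has_vector_derivative)
  then have "deriv \<phi> = D" by (auto simp: DERIV_imp_deriv)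
  then show "(\<phi> has_real_derivative deriv \<phi> x) (at x)" "continuous_on UNIV (deriv \<phi>)"
    using D by auto
  show "continuous_on UNIV \<phi>"
    using D(1) by (meson DERIV_continuous_on has_field_derivative_at_within)
qed

lemma test_fun_sq:
  assumes "test_fun \<phi>"
  shows "square_integrable \<phi>" "square_integrable (deriv \<phi>)"
  using test_fun_DERIV[OF assms] square_integrable_continuous by auto

lemma integral_tail_zero:
  assumes h: "square_integrable h"
    and orth: "\<And>\<phi>. test_fun \<phi> \<Longrightarrow> inner (abs_L2 h) (abs_L2 \<phi>) = 0"
    and a: "0 \<le> a" "a < pi"
  shows "(\<integral>x. h x * indicator {a<..} x \<partial>interval_measure) = 0"
proof -
  define \<psi> where "\<psi> n = bump (real n) (a + 1 / real (Suc n)) (pi - 1 / real (Suc n))" for n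
  have T: "test_fun (\<psi> n)" for n
    unfolding \<psi>_def using a by (intro test_fun_bump) (auto intro: add_nonneg_pos)
  have z: "(\<integral>x. h x * \<psi> n x \<partial>interval_measure) = 0" for n
    using orth[OF T] h test_fun_sq[OF T] by (simp add: inner_abs_L2)
  have hm: "h \<in> borel_measurable interval_measure"
    and hi: "integrable interval_measure h"
    using h square_integrable_times[OF h square_integrable_const[of 1]]
    by (auto simp: square_integrable_def)
  have ind: "indicator {a<..} \<in> borel_measurable interval_measure"
    by (intro measurable_restrict_space1) simp
  have \<psi>1: "\<bar>\<psi> n x\<bar> \<le> 1" for n x
  proof -
    have "0 \<le> real n * bump_base (a + 1 / real (Suc n)) (pi - 1 / real (Suc n)) x"
      by (intro mult_nonneg_nonneg bump_base_nonneg) auto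
    then show ?thesis by (simp add: \<psi>_def bump_def)
  qed
  have lim: "(\<lambda>n. \<psi> n x) \<longlonglongrightarrow> indicator {a<..} x" if x: "x \<in> {0<..<pi}" for x
  proof (cases "x > a")
    case False
    then have "x - (a + 1 / real (Suc n)) \<le> 0" for n
      by (smt (verit) divide_nonneg_nonneg of_nat_0_le_iff)
    then have "max 0 (x - (a + 1 / real (Suc n))) = 0" for n
      by (rule max_absorb1)
    then have "\<psi> n x = 0" for n
      by (simp add: \<psi>_def bump_def bump_base_def)
    with False show ?thesis by simp
  next
    case True
    define B where "B n = bump_base (a + 1 / real (Suc n)) (pi - 1 / real (Suc n)) x" for n
    have "B \<longlonglongrightarrow> (max 0 (x - (a + 0)))\<^sup>2 * (max 0 ((pi - 0) - x))\<^sup>2"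
      unfolding B_def bump_base_def
      by (intro tendsto_intros LIMSEQ_Suc[OF lim_1_over_n])
    moreover have "0 < (max 0 (x - (a + 0)))\<^sup>2 * (max 0 ((pi - 0) - x))\<^sup>2"
      using True x by simp
    ultimately have "filterlim (\<lambda>n. B n * real n) at_top sequentially"
      by (rule filterlim_tendsto_pos_mult_at_top) (rule filterlim_real_sequentially)
    then have "filterlim (\<lambda>n. 1 + B n * real n) at_top sequentially"
      by (rule filterlim_tendsto_add_at_top[OF tendsto_const])
    then have "(\<lambda>n. 1 - inverse (1 + B n * real n)) \<longlonglongrightarrow> 1 - 0"
      by (intro tendsto_intros tendsto_inverse_0_at_top)
    moreover have "1 - inverse (1 + B n * real n) = \<psi> n x" for n
    proof -
      have "0 \<le> B n * real n" by (simp add: B_def bump_base_nonneg)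
      then have "1 - inverse (1 + B n * real n) = real n * B n / (1 + real n * B n)"
        by (simp add: field_simps)
      then show ?thesis by (simp only: \<psi>_def bump_def B_def)
    qed
    ultimately show ?thesis using True by simp
  qed
  have "(\<lambda>n. \<integral>x. h x * \<psi> n x \<partial>interval_measure)
      \<longlonglongrightarrow> (\<integral>x. h x * indicator {a<..} x \<partial>interval_measure)"
  proof (rule integral_dominated_convergence[where w = "\<lambda>x. \<bar>h x\<bar>"])
    show "(\<lambda>x. h x * indicator {a<..} x) \<in> borel_measurable interval_measure"
      using hm ind by (intro borel_measurable_times)
    show "(\<lambda>x. h x * \<psi> n x) \<in> borel_measurable interval_measure" for n
      using hm test_fun_sq(1)[OF T] by (auto simp: square_integrable_def intro!: borel_measurable_times)
    show "integrable interval_measure (\<lambda>x. \<bar>h x\<bar>)" using hi by simp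
    show "AE x in interval_measure. (\<lambda>n. h x * \<psi> n x) \<longlonglongrightarrow> h x * indicator {a<..} x"
      using lim by (intro AE_I2 tendsto_mult tendsto_const) (simp add: space_restrict_space)
    show "AE x in interval_measure. norm (h x * \<psi> n x) \<le> \<bar>h x\<bar>" for n
      using \<psi>1 by (intro AE_I2) (simp add: abs_mult mult_left_le)
  qed
  then show ?thesis using z by (simp add: LIMSEQ_const_iff)
qed

lemma orthogonal_test_fun_imp_zero:
  assumes orth: "\<And>\<phi>. test_fun \<phi> \<Longrightarrow> inner u (abs_L2 \<phi>) = 0"
  shows "u = (0 :: L2)"
proof -
  obtain h where h: "square_integrable h" and u: "u = abs_L2 h" by (rule L2_cases)
  define g where "g x = indicator {0<..<pi} x * h x" for x
  have hm: "h \<in> borel_measurable interval_measure"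
    and hi: "integrable interval_measure h"
    using h square_integrable_times[OF h square_integrable_const[of 1]]
    by (auto simp: square_integrable_def)
  have gm [measurable]: "g \<in> borel_measurable borel"
    using hm by (simp add: borel_measurable_restrict_space_iff g_def[abs_def] mult.commute)
  have gi: "integrable lborel g"
    using hi by (simp add: integrable_restrict_space g_def[abs_def])
  have tail: "(\<integral>x. g x * indicator {a<..} x \<partial>lborel) = 0" for a
  proof -
    have pos: "(\<integral>x. g x * indicator {a<..} x \<partial>lborel) = 0" if "0 \<le> a" for a
    proof (cases "a < pi")
      case True
      show ?thesis
        using integral_tail_zero[OF h _ that True] orth u
        by (simp add: integral_restrict_space g_def mult.assoc)
    next
      case False
      then have "g x * indicator {a<..} x = 0" for x
        by (auto simp: g_def indicator_def)
      then show ?thesis by (simp only: Bochner_Integration.integral_zero)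
    qed
    show ?thesis
    proof (cases "0 \<le> a")
      case False
      then have "g x * indicator {a<..} x = g x * indicator {0<..} x" for x
        by (auto simp: g_def indicator_def)
      then show ?thesis using pos[of 0] by (simp only:)
    qed (rule pos)
  qed
  have fin: "(\<integral>\<^sup>+x. ennreal (g x) \<partial>lborel) < \<infinity>" "(\<integral>\<^sup>+x. ennreal (- g x) \<partial>lborel) < \<infinity>"
    using gi by (auto simp: real_integrable_def less_top)
  have "density lborel (\<lambda>x. ennreal (g x)) = density lborel (\<lambda>x. ennreal (- g x))"
  proof (rule measure_eqI_lessThan)
    fix a :: real
    define k where "k x = g x * indicator {a<..} x" for x
    have ki: "integrable lborel k"
      unfolding k_def using gi by (intro integrable_real_mult_indicator) auto
    have e1: "emeasure (density lborel (\<lambda>x. ennreal (g x))) {a<..} = (\<integral>\<^sup>+x. ennreal (k x) \<partial>lborel)"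
      by (simp add: emeasure_density k_def) (intro nn_integral_cong, simp split: split_indicator)
    have e2: "emeasure (density lborel (\<lambda>x. ennreal (- g x))) {a<..} = (\<integral>\<^sup>+x. ennreal (- k x) \<partial>lborel)"
      by (simp add: emeasure_density k_def) (intro nn_integral_cong, simp split: split_indicator)
    have f: "(\<integral>\<^sup>+x. ennreal (k x) \<partial>lborel) \<noteq> \<infinity>" "(\<integral>\<^sup>+x. ennreal (- k x) \<partial>lborel) \<noteq> \<infinity>"
      using ki by (auto simp: real_integrable_def)
    have "enn2real (\<integral>\<^sup>+x. ennreal (k x) \<partial>lborel) = enn2real (\<integral>\<^sup>+x. ennreal (- k x) \<partial>lborel)"
    proof -
      have "integral\<^sup>L lborel k = 0" unfolding k_def by (rule tail)
      then show ?thesis using real_lebesgue_integral_def[OF ki] by simp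
    qed
    then have "(\<integral>\<^sup>+x. ennreal (k x) \<partial>lborel) = (\<integral>\<^sup>+x. ennreal (- k x) \<partial>lborel)"
      using f by (metis ennreal_enn2real infinity_ennreal_def less_top)
    then show "emeasure (density lborel (\<lambda>x. ennreal (g x))) {a<..}
        = emeasure (density lborel (\<lambda>x. ennreal (- g x))) {a<..}"
      by (simp add: e1 e2)
    show "emeasure (density lborel (\<lambda>x. ennreal (g x))) {a<..} < \<infinity>"
      using f by (simp add: e1 less_top)
  qed auto
  then have "AE x in lborel. ennreal (g x) = ennreal (- g x)"
    by (intro sigma_finite_measure.density_unique[OF sigma_finite_lborel]) auto
  then have "AE x in lborel. g x = 0"
    by eventually_elim (metis ennreal_eq_0_iff ennreal_inj le_cases neg_0_le_iff_le
        neg_le_0_iff_le nle_le)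
  then have "AE x in interval_measure. h x = 0"
    by (subst AE_restrict_space_iff) (auto simp: g_def elim: eventually_mono)
  then have "L2_eq h (\<lambda>_. 0)"
    using h square_integrable_const[of 0] by (simp add: L2_eq_def)
  then show ?thesis unfolding u zero_L2_def
    by (simp add: Quotient3_rel_abs[OF Quotient3_L2])
qed

lemma weak_deriv_unique:
  assumes "weak_deriv u g" "weak_deriv u h"
  shows "g = h"
proof -
  have "inner (g - h) (abs_L2 \<phi>) = 0" if "test_fun \<phi>" for \<phi>
    using assms that unfolding weak_deriv_def inner_diff_left by fastforce
  then show ?thesis using orthogonal_test_fun_imp_zero[of "g - h"] by simp
qed

lemma wderiv_eqI: "weak_deriv u g \<Longrightarrow> wderiv u = g"
  unfolding wderiv_def by (blast intro: weak_deriv_unique)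

lemma weak_deriv_wderiv: "u \<in> H1 \<Longrightarrow> weak_deriv u (wderiv u)"
  using wderiv_eqI by (auto simp: H1_def)

lemma weak_deriv_0: "weak_deriv 0 0"
  by (simp add: weak_deriv_def)

lemma weak_deriv_add: "weak_deriv u g \<Longrightarrow> weak_deriv v h \<Longrightarrow> weak_deriv (u + v) (g + h)"
  by (simp add: weak_deriv_def inner_add_left)

lemma weak_deriv_scaleR: "weak_deriv u g \<Longrightarrow> weak_deriv (c *\<^sub>R u) (c *\<^sub>R g)"
  by (simp add: weak_deriv_def)

lemma weak_deriv_tendsto:
  assumes "\<And>n. weak_deriv (u n) (g n)" "u \<longlonglongrightarrow> v" "g \<longlonglongrightarrow> h"
  shows "weak_deriv v h"
  unfolding weak_deriv_def
proof (intro allI impI)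
  fix \<phi> assume \<phi>: "test_fun \<phi>"
  have "(\<lambda>n. inner (u n) (abs_L2 (deriv \<phi>))) \<longlonglongrightarrow> inner v (abs_L2 (deriv \<phi>))"
    by (intro tendsto_intros assms)
  moreover have "(\<lambda>n. inner (u n) (abs_L2 (deriv \<phi>))) = (\<lambda>n. - inner (g n) (abs_L2 \<phi>))"
    using assms(1) \<phi> by (simp add: weak_deriv_def)
  moreover have "(\<lambda>n. - inner (g n) (abs_L2 \<phi>)) \<longlonglongrightarrow> - inner h (abs_L2 \<phi>)"
    by (intro tendsto_intros assms)
  ultimately show "inner v (abs_L2 (deriv \<phi>)) = - inner h (abs_L2 \<phi>)"
    using LIMSEQ_unique by metis
qed

lemma test_fun_add:
  assumes "test_fun \<phi>" "test_fun \<psi>"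
  shows "test_fun (\<lambda>x. \<phi> x + \<psi> x)" "deriv (\<lambda>x. \<phi> x + \<psi> x) = (\<lambda>x. deriv \<phi> x + deriv \<psi> x)"
proof -
  obtain a b where ab: "0 < a" "b < pi" "\<And>x. x \<notin> {a..b} \<Longrightarrow> \<phi> x = 0"
    using assms(1) by (auto simp: test_fun_def)
  obtain a' b' where ab': "0 < a'" "b' < pi" "\<And>x. x \<notin> {a'..b'} \<Longrightarrow> \<psi> x = 0"
    using assms(2) by (auto simp: test_fun_def)
  have "\<phi> x + \<psi> x = 0" if "x \<notin> {min a a'..max b b'}" for x
  proof -
    have "x \<notin> {a..b}" "x \<notin> {a'..b'}" using that by auto
    then show ?thesis using ab(3) ab'(3) by simp
  qed
  then have "0 < min a a' \<and> max b b' < pi \<and>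
      (\<forall>x. x \<notin> {min a a'..max b b'} \<longrightarrow> \<phi> x + \<psi> x = 0)"
    using ab(1,2) ab'(1,2) by simp
  then show "test_fun (\<lambda>x. \<phi> x + \<psi> x)"
    using assms unfolding test_fun_def by (blast intro: C1_differentiable_on_add)
  show "deriv (\<lambda>x. \<phi> x + \<psi> x) = (\<lambda>x. deriv \<phi> x + deriv \<psi> x)"
    using assms by (intro ext DERIV_imp_deriv DERIV_add test_fun_DERIV)
qed

lemma test_fun_scale:
  assumes "test_fun \<phi>"
  shows "test_fun (\<lambda>x. c * \<phi> x)" "deriv (\<lambda>x. c * \<phi> x) = (\<lambda>x. c * deriv \<phi> x)"
proof -
  have d: "((\<lambda>x. c * \<phi> x) has_real_derivative c * deriv \<phi> x) (at x)" for x
    using assms by (intro DERIV_cmult test_fun_DERIV)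
  then show "deriv (\<lambda>x. c * \<phi> x) = (\<lambda>x. c * deriv \<phi> x)"
    by (intro ext DERIV_imp_deriv)
  have "continuous_on UNIV (\<lambda>x. c * deriv \<phi> x)"
    using assms by (intro continuous_intros test_fun_DERIV)
  then have "(\<lambda>x. c * \<phi> x) C1_differentiable_on UNIV"
    unfolding C1_differentiable_on_def
    by (intro exI[of _ "\<lambda>x. c * deriv \<phi> x"])
       (simp add: has_real_derivative_iff_has_vector_derivative[symmetric] d)
  moreover obtain a b where "0 < a" "b < pi" "\<And>x. x \<notin> {a..b} \<Longrightarrow> \<phi> x = 0"
    using assms by (auto simp: test_fun_def)
  ultimately show "test_fun (\<lambda>x. c * \<phi> x)"
    by (auto simp: test_fun_def)
qed

lemma H10_set_iff:
  "u \<in> H10_set \<longleftrightarrow> (\<exists>g. weak_deriv u g \<and> (\<exists>\<phi>. (\<forall>n::nat. test_fun (\<phi> n)) \<and>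
     (\<lambda>n. abs_L2 (\<phi> n)) \<longlonglongrightarrow> u \<and> (\<lambda>n. abs_L2 (deriv (\<phi> n))) \<longlonglongrightarrow> g))"
proof
  assume "u \<in> H10_set"
  then show "\<exists>g. weak_deriv u g \<and> (\<exists>\<phi>. (\<forall>n::nat. test_fun (\<phi> n)) \<and>
     (\<lambda>n. abs_L2 (\<phi> n)) \<longlonglongrightarrow> u \<and> (\<lambda>n. abs_L2 (deriv (\<phi> n))) \<longlonglongrightarrow> g)"
    using weak_deriv_wderiv[of u] by (auto simp: H10_set_def)
next
  assume "\<exists>g. weak_deriv u g \<and> (\<exists>\<phi>. (\<forall>n::nat. test_fun (\<phi> n)) \<and>
     (\<lambda>n. abs_L2 (\<phi> n)) \<longlonglongrightarrow> u \<and> (\<lambda>n. abs_L2 (deriv (\<phi> n))) \<longlonglongrightarrow> g)"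
  then obtain g where g: "weak_deriv u g" and "\<exists>\<phi>. (\<forall>n::nat. test_fun (\<phi> n)) \<and>
     (\<lambda>n. abs_L2 (\<phi> n)) \<longlonglongrightarrow> u \<and> (\<lambda>n. abs_L2 (deriv (\<phi> n))) \<longlonglongrightarrow> g"
    by blast
  then show "u \<in> H10_set"
    using wderiv_eqI[OF g] by (auto simp: H10_set_def H1_def)
qed

lemma H10_set_subset_H1: "H10_set \<subseteq> H1"
  by (auto simp: H10_set_def)

lemma test_fun_0: "test_fun (\<lambda>_. 0)"
proof -
  have "(\<lambda>_. 0::real) C1_differentiable_on UNIV" by simp
  then show ?thesis using pi_gt3 by (auto simp: test_fun_def intro!: exI[of _ 1])
qed

lemma subspace_H10_set: "subspace H10_set"
proof (rule subspaceI)
  show "0 \<in> H10_set"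
    unfolding H10_set_iff
    by (intro exI[of _ 0] exI[of _ "\<lambda>_ _. 0"] conjI weak_deriv_0 allI test_fun_0)
       (simp_all add: zero_L2_def)
next
  fix u v assume "u \<in> H10_set" "v \<in> H10_set"
  then obtain g \<phi> h \<psi> where u: "weak_deriv u g" "\<And>n::nat. test_fun (\<phi> n)"
      "(\<lambda>n. abs_L2 (\<phi> n)) \<longlonglongrightarrow> u" "(\<lambda>n. abs_L2 (deriv (\<phi> n))) \<longlonglongrightarrow> g"
    and v: "weak_deriv v h" "\<And>n::nat. test_fun (\<psi> n)"
      "(\<lambda>n. abs_L2 (\<psi> n)) \<longlonglongrightarrow> v" "(\<lambda>n. abs_L2 (deriv (\<psi> n))) \<longlonglongrightarrow> h"
    unfolding H10_set_iff by blast
  have "abs_L2 (\<lambda>x. \<phi> n x + \<psi> n x) = abs_L2 (\<phi> n) + abs_L2 (\<psi> n)" for n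
    using test_fun_sq[OF u(2)] test_fun_sq[OF v(2)] by (simp add: plus_L2.abs_eq L2_eq_def)
  moreover have "abs_L2 (deriv (\<lambda>x. \<phi> n x + \<psi> n x)) = abs_L2 (deriv (\<phi> n)) + abs_L2 (deriv (\<psi> n))" for n
    using test_fun_sq[OF u(2)] test_fun_sq[OF v(2)] u(2) v(2)
    by (simp add: plus_L2.abs_eq L2_eq_def test_fun_add)
  ultimately show "u + v \<in> H10_set"
    unfolding H10_set_iff using u v
    by (intro exI[of _ "g + h"] conjI exI[of _ "\<lambda>n x. \<phi> n x + \<psi> n x"])
       (auto intro: weak_deriv_add test_fun_add tendsto_add)
next
  fix c u assume "u \<in> H10_set"
  then obtain g \<phi> where u: "weak_deriv u g" "\<And>n::nat. test_fun (\<phi> n)"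
      "(\<lambda>n. abs_L2 (\<phi> n)) \<longlonglongrightarrow> u" "(\<lambda>n. abs_L2 (deriv (\<phi> n))) \<longlonglongrightarrow> g"
    unfolding H10_set_iff by blast
  have "abs_L2 (\<lambda>x. c * \<phi> n x) = c *\<^sub>R abs_L2 (\<phi> n)" for n
    using test_fun_sq[OF u(2)] by (simp add: scaleR_L2.abs_eq L2_eq_def)
  moreover have "abs_L2 (deriv (\<lambda>x. c * \<phi> n x)) = c *\<^sub>R abs_L2 (deriv (\<phi> n))" for n
    using test_fun_sq[OF u(2)] u(2) by (simp add: scaleR_L2.abs_eq L2_eq_def test_fun_scale)
  ultimately show "c *\<^sub>R u \<in> H10_set"
    unfolding H10_set_iff using u
    by (intro exI[of _ "c *\<^sub>R g"] conjI exI[of _ "\<lambda>n x. c * \<phi> n x"])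
       (auto intro: weak_deriv_scaleR test_fun_scale tendsto_scaleR)
qed

typedef H10 = H10_set morphisms H10_L2 Abs_H10
  using subspace_0[OF subspace_H10_set] by blast

definition grad :: "H10 \<Rightarrow> L2" where
  "grad u = wderiv (H10_L2 u)"

lemma weak_deriv_grad: "weak_deriv (H10_L2 u) (grad u)"
  unfolding grad_def using H10_L2[of u] H10_set_subset_H1 weak_deriv_wderiv by blast

instantiation H10 :: real_vector
begin

definition "0 = Abs_H10 0"
definition "u + v = Abs_H10 (H10_L2 u + H10_L2 v)"
definition "- u = Abs_H10 (- H10_L2 u)"
definition "u - v = Abs_H10 (H10_L2 u - H10_L2 v)"
definition "c *\<^sub>R u = Abs_H10 (c *\<^sub>R H10_L2 u)"

lemma H10_L2_linear:
  "H10_L2 0 = 0"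
  "H10_L2 (u + v) = H10_L2 u + H10_L2 v"
  "H10_L2 (- u) = - H10_L2 u"
  "H10_L2 (u - v) = H10_L2 u - H10_L2 v"
  "H10_L2 (c *\<^sub>R u) = c *\<^sub>R H10_L2 u"
  unfolding zero_H10_def plus_H10_def uminus_H10_def minus_H10_def scaleR_H10_def
  by (intro Abs_H10_inverse subspace_0 subspace_add subspace_neg subspace_diff subspace_scale
      subspace_H10_set H10_L2)+

instance
  by standard (simp_all add: H10_L2_inject[symmetric] H10_L2_linear algebra_simps)

end

lemma grad_linear:
  "grad 0 = 0"
  "grad (u + v) = grad u + grad v"
  "grad (u - v) = grad u - grad v"
  "grad (c *\<^sub>R u) = c *\<^sub>R grad u"
proof -
  show "grad 0 = 0"
    by (simp add: grad_def[of 0] grad_def[of "_ + _"] grad_def[of "_ *\<^sub>R _"] H10_L2_linear wderiv_eqI weak_deriv_0)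
  show add: "grad (u + v) = grad u + grad v" for u v
    by (simp add: grad_def[of 0] grad_def[of "_ + _"] grad_def[of "_ *\<^sub>R _"] H10_L2_linear wderiv_eqI weak_deriv_add weak_deriv_grad)
  show sc: "grad (c *\<^sub>R u) = c *\<^sub>R grad u" for c u
    by (simp add: grad_def[of 0] grad_def[of "_ + _"] grad_def[of "_ *\<^sub>R _"] H10_L2_linear wderiv_eqI weak_deriv_scaleR weak_deriv_grad)
  show "grad (u - v) = grad u - grad v"
    using add[of "u - v" v] by simp
qed

instantiation H10 :: real_inner
begin

definition inner_H10 :: "H10 \<Rightarrow> H10 \<Rightarrow> real" where
  "inner_H10 u v = inner (H10_L2 u) (H10_L2 v) + inner (grad u) (grad v)"

definition norm_H10 :: "H10 \<Rightarrow> real" where "norm_H10 x = sqrt (inner x x)"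

definition sgn_H10 :: "H10 \<Rightarrow> H10" where "sgn_H10 x = x /\<^sub>R norm x"

definition dist_H10 :: "H10 \<Rightarrow> H10 \<Rightarrow> real" where "dist_H10 x y = norm (x - y)"

definition uniformity_H10 :: "(H10 \<times> H10) filter" where
  "uniformity_H10 = (INF e\<in>{0 <..}. principal {(x, y). dist x y < e})"

definition open_H10 :: "H10 set \<Rightarrow> bool" where
  "open_H10 U \<longleftrightarrow> (\<forall>x\<in>U. eventually (\<lambda>(x', y). x' = x \<longrightarrow> y \<in> U) uniformity)"

instance
proof
  fix a b c :: H10 and r :: real and U :: "H10 set"
  show "dist a b = norm (a - b)" by (fact dist_H10_def)
  show "sgn a = a /\<^sub>R norm a" by (fact sgn_H10_def)
  show "uniformity = (INF e\<in>{0 <..}. principal {(x, y :: H10). dist x y < e})"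
    by (fact uniformity_H10_def)
  show "open U = (\<forall>x\<in>U. \<forall>\<^sub>F (x', y) in uniformity. x' = x \<longrightarrow> y \<in> U)"
    by (fact open_H10_def)
  show "norm a = sqrt (inner a a)" by (fact norm_H10_def)
  show "inner a b = inner b a"
    by (simp add: inner_H10_def inner_commute)
  show "inner (a + b) c = inner a c + inner b c"
    by (simp add: inner_H10_def H10_L2_linear(2) grad_linear(2) inner_add_left)
  show "inner (r *\<^sub>R a) b = r * inner a b"
    by (simp add: inner_H10_def H10_L2_linear(5) grad_linear(4) distrib_left)
  show "0 \<le> inner a a"
    by (simp add: inner_H10_def)
  show "inner a a = 0 \<longleftrightarrow> a = 0"
  proof
    assume "inner a a = 0"
    then have "H10_L2 a = H10_L2 0"
      by (simp add: inner_H10_def add_nonneg_eq_0_iff H10_L2_linear(1))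
    then show "a = 0" by (simp add: H10_L2_inject)
  qed (simp add: inner_H10_def H10_L2_linear(1) grad_linear(1))
qed

end

lemma norm_H10_power2: "(norm u)\<^sup>2 = (norm (H10_L2 u))\<^sup>2 + (norm (grad u))\<^sup>2"
  by (simp add: power2_norm_eq_inner inner_H10_def)

lemma norm_H10_L2_le: "norm (H10_L2 u) \<le> norm u"
  by (rule power2_le_imp_le) (simp_all add: norm_H10_power2)

lemma norm_grad_le: "norm (grad u) \<le> norm u"
  by (rule power2_le_imp_le) (simp_all add: norm_H10_power2)

lemma norm_H10_le: "norm u \<le> norm (H10_L2 u) + norm (grad u)"
  by (rule power2_le_imp_le) (simp_all add: norm_H10_power2 power2_sum)

instance H10 :: complete_space
proof
  fix X :: "nat \<Rightarrow> H10" assume X: "Cauchy X"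
  have "Cauchy (\<lambda>n. H10_L2 (X n))" "Cauchy (\<lambda>n. grad (X n))"
  proof -
    have a: "norm (H10_L2 (X m) - H10_L2 (X n)) \<le> norm (X m - X n)"
      "norm (grad (X m) - grad (X n)) \<le> norm (X m - X n)" for m n
      using norm_H10_L2_le[of "X m - X n"] norm_grad_le[of "X m - X n"]
      by (simp_all only: H10_L2_linear(4) grad_linear(3))
    show "Cauchy (\<lambda>n. H10_L2 (X n))" "Cauchy (\<lambda>n. grad (X n))"
      using X a unfolding Cauchy_iff by (meson le_less_trans)+
  qed
  then obtain u g where u: "(\<lambda>n. H10_L2 (X n)) \<longlonglongrightarrow> u" and g: "(\<lambda>n. grad (X n)) \<longlonglongrightarrow> g"
    by (auto simp: Cauchy_convergent_iff convergent_def)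
  have wd: "weak_deriv u g"
    using weak_deriv_tendsto[OF weak_deriv_grad u g] .
  have "\<exists>\<phi>. test_fun \<phi> \<and> dist (abs_L2 \<phi>) (H10_L2 (X n)) < 1 / Suc n \<and>
      dist (abs_L2 (deriv \<phi>)) (grad (X n)) < 1 / Suc n" for n
  proof -
    obtain \<phi> where \<phi>: "\<And>k::nat. test_fun (\<phi> k)" "(\<lambda>k. abs_L2 (\<phi> k)) \<longlonglongrightarrow> H10_L2 (X n)"
        "(\<lambda>k. abs_L2 (deriv (\<phi> k))) \<longlonglongrightarrow> grad (X n)"
      using H10_L2[of "X n"] by (auto simp: H10_set_def grad_def)
    have "\<forall>\<^sub>F k in sequentially. dist (abs_L2 (\<phi> k)) (H10_L2 (X n)) < 1 / Suc n \<and>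
        dist (abs_L2 (deriv (\<phi> k))) (grad (X n)) < 1 / Suc n"
      by (intro eventually_conj tendstoD \<phi>) auto
    then show ?thesis using \<phi>(1) by (auto simp: eventually_sequentially)
  qed
  then obtain \<phi> where \<phi>: "\<And>n. test_fun (\<phi> n)"
      "\<And>n. dist (abs_L2 (\<phi> n)) (H10_L2 (X n)) < 1 / Suc n"
      "\<And>n. dist (abs_L2 (deriv (\<phi> n))) (grad (X n)) < 1 / Suc n"
    by metis
  have t: "(\<lambda>n. 1 / real (Suc n)) \<longlonglongrightarrow> 0"
    by (rule LIMSEQ_Suc[OF lim_1_over_n])
  have "(\<lambda>n. dist (abs_L2 (\<phi> n)) (H10_L2 (X n))) \<longlonglongrightarrow> 0"
    by (rule tendsto_sandwich[OF always_eventually always_eventually tendsto_const t])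
       (use \<phi>(2) in \<open>simp_all add: less_imp_le del: of_nat_Suc\<close>)
  moreover have "(\<lambda>n. dist (abs_L2 (deriv (\<phi> n))) (grad (X n))) \<longlonglongrightarrow> 0"
    by (rule tendsto_sandwich[OF always_eventually always_eventually tendsto_const t])
       (use \<phi>(3) in \<open>simp_all add: less_imp_le del: of_nat_Suc\<close>)
  ultimately have z: "(\<lambda>n. abs_L2 (\<phi> n) - H10_L2 (X n)) \<longlonglongrightarrow> 0"
    "(\<lambda>n. abs_L2 (deriv (\<phi> n)) - grad (X n)) \<longlonglongrightarrow> 0"
    by (simp_all add: dist_norm tendsto_norm_zero_iff)
  have "(\<lambda>n. abs_L2 (\<phi> n)) \<longlonglongrightarrow> u" "(\<lambda>n. abs_L2 (deriv (\<phi> n))) \<longlonglongrightarrow> g"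
    using tendsto_add[OF z(1) u] tendsto_add[OF z(2) g] by simp_all
  then have "u \<in> H10_set" using wd \<phi>(1) by (auto simp: H10_set_iff)
  then obtain x where x: "H10_L2 x = u" using Abs_H10_inverse by blast
  have gx: "grad x = g" using x wd wderiv_eqI by (simp add: grad_def)
  have "X \<longlonglongrightarrow> x"
  proof -
    have "(\<lambda>n. norm (H10_L2 (X n) - u) + norm (grad (X n) - g)) \<longlonglongrightarrow> 0 + 0"
      using u g by (intro tendsto_add tendsto_norm_zero LIM_zero)
    then have lim: "(\<lambda>n. norm (H10_L2 (X n) - u) + norm (grad (X n) - g)) \<longlonglongrightarrow> 0" by simp
    have le: "norm (X n - x) \<le> norm (H10_L2 (X n) - u) + norm (grad (X n) - g)" for n
      using norm_H10_le[of "X n - x"] x gx by (simp add: H10_L2_linear(4) grad_linear(3))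
    have "(\<lambda>n. X n - x) \<longlonglongrightarrow> 0"
      by (rule Lim_null_comparison[OF always_eventually[OF allI[OF le]] lim])
    then show ?thesis by (simp add: LIM_zero_iff)
  qed
  then show "convergent X" by (auto simp: convergent_def)
qed

text \<open>The phase space \<open>E = H\<^sub>0\<^sup>1(0,\<pi>) \<times> L\<^sup>2(0,\<pi>)\<close>, with the product Hilbert space structure.\<close>

type_synonym phase_space = "H10 \<times> L2"


section \<open>The Wiener process and its shifts\<close>

definition wiener_paths :: "(real \<Rightarrow> real) set" where
  "wiener_paths = {\<omega>. continuous_on UNIV \<omega> \<and> \<omega> 0 = 0}"

text \<open>
  The Borel \<open>\<sigma>\<close>-algebra of \<open>C\<^sub>0(\<real>,\<real>)\<close> (locally uniform convergence) is generated by the evaluations,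
  i.e. it is the trace of the product \<open>\<sigma>\<close>-algebra.
\<close>

definition wiener_measure :: "(real \<Rightarrow> real) measure \<Rightarrow> bool" where
  "wiener_measure P \<longleftrightarrow>
     prob_space P \<and>
     sets P = sets (restrict_space (\<Pi>\<^sub>M t\<in>(UNIV :: real set). (borel :: real measure)) wiener_paths) \<and>
     (\<forall>s t. s < t \<longrightarrow>
        distributed P lborel (\<lambda>\<omega>. \<omega> t - \<omega> s) (normal_density 0 (sqrt (t - s)))) \<and>
     (\<forall>(n :: nat) t. strict_mono_on {..n} t \<longrightarrow>
        prob_space.indep_vars P (\<lambda>_. borel) (\<lambda>i \<omega>. \<omega> (t (Suc i)) - \<omega> (t i)) {..<n})"

definition wiener_shift :: "real \<Rightarrow> (real \<Rightarrow> real) \<Rightarrow> real \<Rightarrow> real" where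
  "wiener_shift t \<omega> = (\<lambda>s. \<omega> (t + s) - \<omega> t)"

definition sublinear_base :: "(real \<Rightarrow> real) measure \<Rightarrow> (real \<Rightarrow> real) set \<Rightarrow> bool" where
  "sublinear_base P \<Omega> \<longleftrightarrow>
     \<Omega> \<in> sets P \<and> measure P \<Omega> = 1 \<and>
     (\<forall>t. \<forall>\<omega>\<in>\<Omega>. wiener_shift t \<omega> \<in> \<Omega>) \<and>
     (\<forall>\<omega>\<in>\<Omega>. ((\<lambda>t. \<omega> t / t) \<longlongrightarrow> 0) at_top \<and> ((\<lambda>t. \<omega> t / t) \<longlongrightarrow> 0) at_bot)"

text \<open>The stationary Ornstein-Uhlenbeck variable \<open>z\<close> of \<open>\<epsilon>\<^sup>2 dz + z dt = dW\<close>.\<close>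

definition ou :: "real \<Rightarrow> (real \<Rightarrow> real) \<Rightarrow> real" where
  "ou \<epsilon> \<omega> = - (1 / \<epsilon> ^ 4) * (LBINT \<tau>:{..0}. exp (\<tau> / \<epsilon>\<^sup>2) * \<omega> \<tau>)"


section \<open>Random dynamical systems and stochastic inertial manifolds\<close>

definition random_dynamical_system ::
  "'w measure \<Rightarrow> (real \<Rightarrow> 'w \<Rightarrow> 'w) \<Rightarrow> (real \<Rightarrow> 'w \<Rightarrow> 'x :: metric_space \<Rightarrow> 'x) \<Rightarrow> bool" where
  "random_dynamical_system N \<theta> \<psi> \<longleftrightarrow>
     (\<lambda>(t, \<omega>, x). \<psi> t \<omega> x) \<in> borel_measurable (restrict_space borel {0..} \<Otimes>\<^sub>M N \<Otimes>\<^sub>M borel) \<and>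
     (\<forall>\<omega>\<in>space N. \<forall>x. \<psi> 0 \<omega> x = x) \<and>
     (\<forall>t\<ge>0. \<forall>s\<ge>0. \<forall>\<omega>\<in>space N. \<forall>x. \<psi> (t + s) \<omega> x = \<psi> t (\<theta> s \<omega>) (\<psi> s \<omega> x))"

text \<open>
  A semigroup is a function on all of \<open>\<real>\<close> of which only the values at times \<open>t \<ge> 0\<close> are relevant.
\<close>

definition C0_semigroup :: "(real \<Rightarrow> 'h :: real_normed_vector \<Rightarrow> 'h) \<Rightarrow> bool" where
  "C0_semigroup S \<longleftrightarrow>
     (\<forall>t\<ge>0. bounded_linear (S t)) \<and>
     (\<forall>x. S 0 x = x) \<and>
     (\<forall>t\<ge>0. \<forall>s\<ge>0. \<forall>x. S (t + s) x = S t (S s x)) \<and>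
     (\<forall>x. ((\<lambda>t. S t x) \<longlongrightarrow> x) (at_right 0))"

text \<open>The generator, with domain \<open>D\<close>, is \<open>A\<close>; values of \<open>A\<close> outside \<open>D\<close> are irrelevant.\<close>

definition generates ::
  "'h :: real_normed_vector set \<Rightarrow> ('h \<Rightarrow> 'h) \<Rightarrow> (real \<Rightarrow> 'h \<Rightarrow> 'h) \<Rightarrow> bool" where
  "generates D A S \<longleftrightarrow>
     C0_semigroup S \<and>
     (\<forall>x y. ((\<lambda>t. (S t x - x) /\<^sub>R t) \<longlongrightarrow> y) (at_right 0) \<longleftrightarrow> x \<in> D \<and> y = A x)"

text \<open>Global mild solutions of \<open>U' = AU + G(t,U)\<close>, \<open>U(0) = U\<^sub>0\<close>, by variation of constants.\<close>

definition mild_solution ::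
  "(real \<Rightarrow> 'h :: real_normed_vector \<Rightarrow> 'h) \<Rightarrow> (real \<Rightarrow> 'h \<Rightarrow> 'h) \<Rightarrow> 'h \<Rightarrow> (real \<Rightarrow> 'h) \<Rightarrow> bool" where
  "mild_solution S G U\<^sub>0 U \<longleftrightarrow>
     continuous_on {0..} U \<and>
     (\<forall>t\<ge>0. ((\<lambda>s. S (t - s) (G s (U s))) has_integral (U t - S t U\<^sub>0)) {0..t})"

text \<open>
  In the dichotomy, \<open>e\<^sup>A\<^sup>t\<close> for \<open>t \<le> 0\<close> is the inverse on \<open>PH\<close> of \<open>e\<^sup>A\<^sup>|\<^sup>t\<^sup>|\<close>; its boundedness is the
  estimate on \<open>PH\<close>.
\<close>

definition pseudo_exponential_dichotomy ::
  "(real \<Rightarrow> 'h :: real_normed_vector \<Rightarrow> 'h) \<Rightarrow> ('h \<Rightarrow> 'h) \<Rightarrow> bool" where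
  "pseudo_exponential_dichotomy S P \<longleftrightarrow>
     bounded_linear P \<and> (\<forall>x. P (P x) = P x) \<and>
     (\<forall>t\<ge>0. \<forall>x. P (S t x) = S t (P x)) \<and>
     (\<forall>t\<ge>0. bij_betw (S t) (range P) (range P)) \<and>
     (\<exists>\<alpha> \<beta> K. 0 > \<alpha> \<and> \<alpha> > \<beta> \<and> K > 0 \<and>
        (\<forall>t\<le>0. \<forall>x. norm (inv_into (range P) (S (- t)) (P x)) \<le> K * exp (\<alpha> * t) * norm x) \<and>
        (\<forall>t\<ge>0. \<forall>x. norm (S t (x - P x)) \<le> K * exp (\<beta> * t) * norm x))"

text \<open>The usual notion of a random closed set.\<close>

definition random_set :: "'w measure \<Rightarrow> ('w \<Rightarrow> 'h :: metric_space set) \<Rightarrow> bool" where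
  "random_set N M \<longleftrightarrow>
     (\<forall>\<omega>\<in>space N. closed (M \<omega>) \<and> M \<omega> \<noteq> {}) \<and>
     (\<forall>x. (\<lambda>\<omega>. infdist x (M \<omega>)) \<in> borel_measurable N)"

definition lipschitz_invariant_manifold ::
  "'w measure \<Rightarrow> (real \<Rightarrow> 'w \<Rightarrow> 'w) \<Rightarrow> ('h \<Rightarrow> 'h) \<Rightarrow>
   (real \<Rightarrow> 'w \<Rightarrow> 'h :: real_inner \<Rightarrow> 'h) \<Rightarrow> ('w \<Rightarrow> 'h set) \<Rightarrow> bool" where
  "lipschitz_invariant_manifold N \<theta> P \<psi> M \<longleftrightarrow>
     random_set N M \<and>
     (\<forall>\<omega>\<in>space N. \<forall>t\<ge>0. \<psi> t \<omega> ` M \<omega> \<subseteq> M (\<theta> t \<omega>)) \<and>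
     (\<exists>h. \<forall>\<omega>\<in>space N.
        h \<omega> \<in> range P \<rightarrow> range (\<lambda>x. x - P x) \<and>
        (\<exists>L. L-lipschitz_on (range P) (h \<omega>)) \<and>
        M \<omega> = {\<xi> + h \<omega> \<xi> |\<xi>. \<xi> \<in> range P})"

definition stochastic_inertial_manifold ::
  "'w measure \<Rightarrow> (real \<Rightarrow> 'w \<Rightarrow> 'w) \<Rightarrow> (real \<Rightarrow> 'h \<Rightarrow> 'h) \<Rightarrow>
   (real \<Rightarrow> 'w \<Rightarrow> 'h :: {real_inner, complete_space} \<Rightarrow> 'h) \<Rightarrow> ('w \<Rightarrow> 'h set) \<Rightarrow> bool" where
  "stochastic_inertial_manifold N \<theta> S \<psi> M \<longleftrightarrow>
     (\<exists>P. pseudo_exponential_dichotomy S P \<and>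
        lipschitz_invariant_manifold N \<theta> P \<psi> M \<and>
        (\<exists>B. finite B \<and> range P = span B)) \<and>
     (\<forall>\<omega>\<in>space N. \<forall>x. \<exists>C \<gamma>. \<gamma> > 0 \<and>
        (\<forall>t\<ge>0. infdist (\<psi> t \<omega> x) (M (\<theta> t \<omega>)) \<le> C * exp (- \<gamma> * t)))"


section \<open>The stochastic damped wave equation\<close>

text \<open>
  \<open>neg_laplacian\<close> is \<open>u \<mapsto> - u''\<close>; its domain \<open>H\<^sup>2 \<inter> H\<^sub>0\<^sup>1\<close> consists of the \<open>u \<in> H\<^sub>0\<^sup>1\<close> whose weak
  derivative lies in \<open>H\<^sup>1\<close>.
\<close>

definition neg_laplacian :: "H10 \<Rightarrow> L2" where
  "neg_laplacian u = - wderiv (grad u)"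

definition wave_domain :: "phase_space set" where
  "wave_domain = {(u, v). grad u \<in> H1 \<and> v \<in> H10_set}"

definition wave_operator :: "real \<Rightarrow> phase_space \<Rightarrow> phase_space" where
  "wave_operator \<epsilon> =
     (\<lambda>(u, v). (Abs_H10 v, - (1 / \<epsilon>\<^sup>2) *\<^sub>R neg_laplacian u - (1 / \<epsilon>\<^sup>2) *\<^sub>R v))"

text \<open>A semigroup is determined at times \<open>t \<ge> 0\<close> by its generator.\<close>

definition wave_semigroup :: "real \<Rightarrow> real \<Rightarrow> phase_space \<Rightarrow> phase_space" where
  "wave_semigroup \<epsilon> = (SOME S. generates wave_domain (wave_operator \<epsilon>) S)"

definition wave_nonlinearity ::
  "(L2 \<Rightarrow> L2) \<Rightarrow> H10 \<Rightarrow> real \<Rightarrow> real \<Rightarrow> (real \<Rightarrow> real) \<Rightarrow> phase_space \<Rightarrow> phase_space" where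
  "wave_nonlinearity f \<phi> \<delta> \<epsilon> \<omega> U =
     ((\<delta> * ou \<epsilon> \<omega>) *\<^sub>R \<phi>, (1 / \<epsilon>\<^sup>2) *\<^sub>R f (H10_L2 (fst U)))"

definition wave_flow ::
  "(L2 \<Rightarrow> L2) \<Rightarrow> H10 \<Rightarrow> real \<Rightarrow> real \<Rightarrow> real \<Rightarrow> (real \<Rightarrow> real) \<Rightarrow> phase_space \<Rightarrow> phase_space" where
  "wave_flow f \<phi> \<delta> \<epsilon> t \<omega> U\<^sub>0 =
     (THE V. \<exists>U. mild_solution (wave_semigroup \<epsilon>)
                    (\<lambda>s. wave_nonlinearity f \<phi> \<delta> \<epsilon> (wiener_shift s \<omega>)) U\<^sub>0 U \<and> V = U t)"

definition wave_transform ::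
  "H10 \<Rightarrow> real \<Rightarrow> real \<Rightarrow> (real \<Rightarrow> real) \<Rightarrow> phase_space \<Rightarrow> phase_space" where
  "wave_transform \<phi> \<delta> \<epsilon> \<omega> U = U - (0, (\<delta> * ou \<epsilon> \<omega>) *\<^sub>R H10_L2 \<phi>)"

definition wave_rds ::
  "(L2 \<Rightarrow> L2) \<Rightarrow> H10 \<Rightarrow> real \<Rightarrow> real \<Rightarrow> real \<Rightarrow> (real \<Rightarrow> real) \<Rightarrow> phase_space \<Rightarrow> phase_space" where
  "wave_rds f \<phi> \<delta> \<epsilon> t \<omega> U\<^sub>0 =
     inv (wave_transform \<phi> \<delta> \<epsilon> (wiener_shift t \<omega>))
       (wave_flow f \<phi> \<delta> \<epsilon> t \<omega> (wave_transform \<phi> \<delta> \<epsilon> \<omega> U\<^sub>0))"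

end

theory Submission
  imports Defs
begin

text \<open>
  Expanding in the sine functions decouples the linear part into the damped oscillators
  \<open>\<epsilon>\<^sup>2 w'' + w' + \<nu>\<^sup>2 w = 0\<close> with \<open>\<nu> = n + 1\<close>, whose characteristic exponents are
  \<open>(-1 \<plusminus> sqrt (1 - 4 \<epsilon>\<^sup>2 \<nu>\<^sup>2)) / (2 \<epsilon>\<^sup>2)\<close>. For \<open>4 \<epsilon> (N + 2) < 1\<close> the larger (slow) exponents of the
  modes \<open>0, \<dots>, N + 1\<close> are real and comparable to those of the heat equation, and two consecutive
  ones at the end of this range, \<open>\<alpha>\<close> for mode \<open>N\<close> and \<open>\<beta>\<close> for mode \<open>N + 1\<close>, satisfy
  \<open>\<alpha> - \<beta> \<ge> (N + 2)\<^sup>2 - (N + 1)\<^sup>2 = 2 N + 3\<close> (\<open>gap_size\<close>). The slow eigenvectors of the modes up to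
  \<open>N\<close> span the finite-dimensional space \<open>PH\<close>; everything else decays at least like \<open>e\<^sup>\<beta>\<^sup>t\<close>.

  The nonlinearity \<open>(0, f(u)/\<epsilon>\<^sup>2)\<close> carries a large factor, so a gap condition in the norm of \<open>E\<close>
  would not be uniform in \<open>\<epsilon>\<close>. But \<open>f\<close> reads \<open>u\<close> only as an element of \<open>L\<^sup>2\<close>, hence the
  Lyapunov--Perron fixed point can be carried out for this observed component alone. The observed
  response to a force \<open>(0, g/\<epsilon>\<^sup>2)\<close> is bounded by \<open>2 e\<^sup>\<alpha>\<^sup>t |g|\<close> and \<open>2 e\<^sup>\<beta>\<^sup>t |g|\<close> on the two spectral parts,
  since the gap between the two exponents of one mode compensates the factor \<open>1/\<epsilon>\<^sup>2\<close>. With the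
  weight \<open>\<eta> = (\<alpha> + \<beta>)/2\<close> the contraction constant is \<open>8 L / (\<alpha> - \<beta>)\<close>, which is below \<open>1\<close> once \<open>N\<close> is
  large; then \<open>\<epsilon>\<^sub>0 = 1 / (4 (N + 2))\<close>.

  For a fixed noise path, the manifold consists of the end points of the orbits on \<open>(-\<infinity>, 0]\<close> that
  grow at most like \<open>e\<^sup>\<eta>\<^sup>t\<close> as \<open>t \<rightarrow> -\<infinity>\<close>; there is exactly one for each slow part, so the
  end points form a Lipschitz graph. Invariance and attraction come from one estimate
  (\<open>exponential_tracking\<close>). Glue the orbit that starts at \<open>x\<close> and runs up to time \<open>t\<close> to the backward
  orbit whose end point has the same slow part as \<open>x\<close>. The glued function solves the
  Lyapunov--Perron equation belonging to time \<open>t\<close> up to the jump \<open>D\<close> between the two pieces, a fast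
  vector that is transported by the decaying semigroup. By the contraction estimate the state at
  time \<open>t\<close> is within a multiple of \<open>e\<^sup>\<eta>\<^sup>t |D|\<close> of the manifold at time \<open>t\<close>. On the manifold \<open>D = 0\<close>, which
  is invariance; elsewhere the estimate is exponential attraction because \<open>\<eta> < 0\<close>.

  Noise enters only through the path \<open>s \<mapsto> z(\<theta>\<^sub>s \<omega>)\<close>, which is continuous with at most linear
  growth. Flow and graph are Lipschitz in this path for an exponentially weighted supremum norm,
  in which the path is a limit of piecewise linear interpolants determined by finitely many values;
  this yields measurability (\<open>path_functional_measurable\<close>).

  Two facts connect this with the concrete equation: the sine functions are orthogonal bases of
  \<open>L\<^sup>2\<close> and \<open>H\<^sub>0\<^sup>1\<close>, and the semigroup selected by the generator \<open>A\<close> acts on each mode as the oscillator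
  (\<open>wave_semigroup_eq\<close>).
\<close>

section \<open>Integrals over a half-line\<close>

lemma has_integral_exp_halfline:
  fixes c B :: real
  assumes "0 < c"
  shows "((\<lambda>r. B * exp (- (c * r))) has_integral B * exp (- (c * a)) / c) {a..}"
  using has_integral_mult_right[OF has_integral_exp_minus_to_infinity[OF assms, of a], of B] by simp

text \<open>An exponential majorant replaces absolute integrability in the Banach space; the third claim
  measures how fast the integral over \<open>[0, a]\<close> converges, uniformly in families with a common majorant.\<close>

lemma halfline_dominated:
  fixes f :: "real \<Rightarrow> 'b::banach"
  assumes loc: "\<And>t. 0 \<le> t \<Longrightarrow> f integrable_on {0..t}"
    and dom: "\<And>r. 0 \<le> r \<Longrightarrow> norm (f r) \<le> B * exp (- (c * r))" and c: "0 < c"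
  shows "f integrable_on {0..}" "norm (integral {0..} f) \<le> B / c"
    "0 \<le> a \<Longrightarrow> norm (integral {0..} f - integral {0..a} f) \<le> B * exp (- (c * a)) / c"
proof -
  note E = has_integral_exp_halfline[OF c]
  have loc': "f integrable_on {max 0 a..b}" for a b
    by (rule integrable_subinterval_real[OF loc[of "max 0 b"]]) auto
  show int: "f integrable_on {0..}"
  proof (rule integrable_on_all_intervals_integrable_bound[OF _ _ has_integral_integrable[OF E[of B 0]]])
    fix a b :: real
    have "{0..} \<inter> cbox a b = {max 0 a..b}" by auto
    then show "(\<lambda>x. if x \<in> {0..} then f x else 0) integrable_on cbox a b"
      unfolding integrable_restrict_Int using loc'[of a b] by simp
  qed (use dom in auto)
  show "norm (integral {0..} f) \<le> B / c"
    using Henstock_Kurzweil_Integration.integral_norm_bound_integral[OF int has_integral_integrable[OF E[of B 0]]] dom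
      integral_unique[OF E[of B 0]] by simp
  assume a: "0 \<le> a"
  have I: "{0..a} \<inter> {0..} = {0..a}" "{0..} \<inter> {0..a} = {0..a}" by auto
  have h1: "((\<lambda>r. if r \<in> {0..a} then f r else 0) has_integral integral {0..a} f) {0..}"
    using integrable_integral[OF loc[OF a]] by (subst has_integral_restrict_Int) (simp add: I)
  have h2: "((\<lambda>r. f r - (if r \<in> {0..a} then f r else 0)) has_integral (integral {0..} f - integral {0..a} f)) {0..}"
    by (intro has_integral_diff integrable_integral[OF int] h1)
  have J: "{a..} \<inter> {0..} = {a..}" "{0..} \<inter> {a..} = {a..}" using a by auto
  have h3: "((\<lambda>r. if r \<in> {a..} then B * exp (- (c * r)) else 0) has_integral B * exp (- (c * a)) / c) {0..}"
    using E[of B a] by (subst has_integral_restrict_Int) (simp add: J)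
  have "norm (f r - (if r \<in> {0..a} then f r else 0)) \<le> (if r \<in> {a..} then B * exp (- (c * r)) else 0)"
    if "r \<in> {0..}" for r
    using dom[of r] order_trans[OF norm_ge_zero dom[of r]] that by auto
  then show "norm (integral {0..} f - integral {0..a} f) \<le> B * exp (- (c * a)) / c"
    using Henstock_Kurzweil_Integration.integral_norm_bound_integral[OF has_integral_integrable[OF h2] has_integral_integrable[OF h3]]
      integral_unique[OF h2] integral_unique[OF h3] by metis
qed

lemma has_integral_translate_Icc:
  fixes f :: "real \<Rightarrow> 'b::banach"
  assumes "(f has_integral I) {a..b}"
  shows "((\<lambda>r. f (c + r)) has_integral I) {a - c..b - c}"
  using has_integral_affinity'[of f I a b 1 c] assms by (simp add: add.commute)

lemma has_integral_reverse_Icc: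
  fixes f :: "real \<Rightarrow> 'b::banach"
  assumes "(f has_integral I) {a..b}"
  shows "((\<lambda>r. f (c - r)) has_integral I) {c - b..c - a}"
proof -
  have "((\<lambda>r. f (c + r)) has_integral I) {- (c - a)..- (c - b)}"
    using has_integral_translate_Icc[OF assms, of c] by simp
  then have "((\<lambda>r. (\<lambda>x. f (c + (- x))) (- r)) has_integral I) {- (c - a)..- (c - b)}"
    by simp
  then show ?thesis
    by (subst (asm) has_integral_reflect_real) simp
qed

lemma has_integral_shift_atLeast:
  fixes f :: "real \<Rightarrow> 'b::banach"
  assumes "(f has_integral I) {0..}"
  shows "((\<lambda>r. f (r - a)) has_integral I) {a..}"
proof -
  define F where "F r = (if r \<in> {0..} then f r else 0)" for r
  have F: "\<And>p q. F integrable_on {p..q}"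
    "\<And>e. 0 < e \<Longrightarrow> \<exists>B>0. \<forall>p q. ball 0 B \<subseteq> {p..q} \<longrightarrow> norm (integral {p..q} F - I) < e"
    using assms unfolding has_integral_alt'[of f] F_def[abs_def] cbox_interval by blast+
  have eq: "(\<lambda>r. if r \<in> {a..} then f (r - a) else 0) = (\<lambda>r. F (r - a))"
    by (auto simp: F_def)
  have sh: "((\<lambda>r. F (r - a)) has_integral integral {p - a..q - a} F) {p..q}" for p q
    using has_integral_shift_real_ivl[OF integrable_integral[OF F(1)[of "p - a" "q - a"]], of "- a"] by simp
  show ?thesis
    unfolding has_integral_alt'[of "\<lambda>r. f (r - a)"] cbox_interval eq
  proof (intro conjI allI impI)
    show "(\<lambda>r. F (r - a)) integrable_on {p..q}" for p q using sh by blast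
    fix e :: real assume "0 < e"
    then obtain B where B: "B > 0" "\<And>p q. ball 0 B \<subseteq> {p..q} \<Longrightarrow> norm (integral {p..q} F - I) < e"
      using F(2) by blast
    have "norm (integral {p..q} (\<lambda>r. F (r - a)) - I) < e" if b: "ball 0 (B + \<bar>a\<bar>) \<subseteq> {p..q}" for p q
      unfolding integral_unique[OF sh]
    proof (rule B(2), rule subsetI)
      fix x :: real assume "x \<in> ball 0 B"
      then have "x + a \<in> ball 0 (B + \<bar>a\<bar>)" by (auto simp: dist_norm)
      with b have "x + a \<in> {p..q}" by blast
      then show "x \<in> {p - a..q - a}" by auto
    qed
    then show "\<exists>B>0. \<forall>p q. ball 0 B \<subseteq> {p..q} \<longrightarrow> norm (integral {p..q} (\<lambda>r. F (r - a)) - I) < e"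
      using B(1) by (intro exI[of _ "B + \<bar>a\<bar>"]) auto
  qed
qed

lemma has_integral_halfline_join:
  fixes f :: "real \<Rightarrow> 'b::banach"
  assumes "(f has_integral I) {0..a}" "((\<lambda>r. f (a + r)) has_integral J) {0..}" "0 \<le> a"
  shows "(f has_integral I + J) {0..}"
proof -
  have "(f has_integral J) {a..}"
    using has_integral_shift_atLeast[OF assms(2), of a] by simp
  moreover have "{0..a} \<inter> {a..} = {a}" "{0..a} \<union> {a..} = {0..}" using assms(3) by auto
  ultimately show ?thesis
    using has_integral_Un[OF assms(1), of J "{a..}"] by simp
qed

lemma norm_integral_past_le:
  fixes f :: "real \<Rightarrow> 'b::banach"
  assumes "f integrable_on {0..t}" "\<And>r. 0 \<le> r \<Longrightarrow> r \<le> t \<Longrightarrow> norm (f r) \<le> B * exp (- (\<rho> * (t - r)))"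
    "0 < \<rho>" "0 \<le> B" "0 \<le> t"
  shows "norm (integral {0..t} f) \<le> B / \<rho>"
proof -
  have "((\<lambda>r. B * exp (- (\<rho> * (t - r)))) has_integral
      B / \<rho> * exp (- (\<rho> * (t - t))) - B / \<rho> * exp (- (\<rho> * (t - 0)))) {0..t}"
    using assms(3,5)
    by (intro fundamental_theorem_of_calculus)
       (auto simp: has_real_derivative_iff_has_vector_derivative[symmetric] intro!: derivative_eq_intros)
  then have h: "((\<lambda>r. B * exp (- (\<rho> * (t - r)))) has_integral B / \<rho> - B / \<rho> * exp (- (\<rho> * t))) {0..t}"
    by simp
  have "norm (integral {0..t} f) \<le> B / \<rho> - B / \<rho> * exp (- (\<rho> * t))"
    using Henstock_Kurzweil_Integration.integral_norm_bound_integral[OF assms(1) has_integral_integrable[OF h]]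
      assms(2) integral_unique[OF h] by simp
  also have "\<dots> \<le> B / \<rho>" using assms by simp
  finally show ?thesis .
qed

text \<open>The substitution \<open>r = t \<theta>\<close> moves the integral to the fixed interval \<open>[0, 1]\<close>, where continuous
  dependence on a parameter is standard.\<close>

lemma continuous_on_integral_triangle:
  fixes f :: "real \<Rightarrow> real \<Rightarrow> 'b::banach"
  assumes "continuous_on {(t, r). 0 \<le> r \<and> r \<le> t} (\<lambda>(t, r). f t r)"
  shows "continuous_on {0..} (\<lambda>t. integral {0..t} (f t))"
proof -
  have "continuous_on ({0..} \<times> {0..1}) (\<lambda>x. (\<lambda>(t, r). f t r) (fst x, fst x * snd x))"
  proof (rule continuous_on_compose2[OF assms])
    show "continuous_on ({0..} \<times> {0..1}) (\<lambda>x :: real \<times> real. (fst x, fst x * snd x))"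
      by (intro continuous_intros)
  qed (auto simp: mult_left_le)
  then have "continuous_on ({0..} \<times> cbox 0 1) (\<lambda>(t, \<theta>). f t (t * \<theta>))"
    by (simp add: case_prod_beta')
  from integral_continuous_on_param[OF this]
  have "continuous_on {0..} (\<lambda>t. t *\<^sub>R integral {0..1} (\<lambda>\<theta>. f t (t * \<theta>)))"
    by (intro continuous_intros) auto
  moreover have "integral {0..t} (f t) = t *\<^sub>R integral {0..1} (\<lambda>\<theta>. f t (t * \<theta>))" if "t \<in> {0..}" for t
  proof (cases "t = 0")
    case False
    then have t: "t > 0" using that by simp
    have "continuous_on {0..t} (\<lambda>r. (\<lambda>(t, r). f t r) (t, r))"
    proof (rule continuous_on_compose2[OF assms])
      show "continuous_on {0..t} (Pair t)" by (intro continuous_intros)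
    qed auto
    then have "f t integrable_on {0..t}" by (simp add: integrable_continuous_real)
    then have "(f t has_integral integral {0..t} (f t)) (cbox 0 t)"
      by (simp add: integrable_integral)
    from has_integral_affinity'[OF this t, of 0] t
    have "((\<lambda>\<theta>. f t (t * \<theta>)) has_integral (integral {0..t} (f t) /\<^sub>R t)) {0..1}" by simp
    then show ?thesis using t by (simp add: integral_unique)
  qed simp
  ultimately show ?thesis by (subst continuous_on_cong[OF refl]) auto
qed

section \<open>The Lyapunov--Perron equation\<close>

text \<open>The two kernels of a Lyapunov--Perron equation. The semigroup law plays no part in solving the
  equation, so only decay and strong continuity are asked for.\<close>

locale decaying_family =
  fixes V :: "real \<Rightarrow> 'e::banach \<Rightarrow> 'e" and K \<rho> :: real
  assumes linear: "0 \<le> t \<Longrightarrow> bounded_linear (V t)"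
    and cont: "continuous_on {0..} (\<lambda>t. V t x)"
    and decay: "0 \<le> t \<Longrightarrow> norm (V t x) \<le> K * exp (- (\<rho> * t)) * norm x"
    and K: "0 \<le> K" and rate: "0 < \<rho>"
begin

lemma bound: "0 \<le> t \<Longrightarrow> norm (V t x) \<le> K * norm x"
  using order_trans[OF decay[of t x], of "K * norm x"] K rate
  by (simp add: mult_left_le mult_right_mono)

lemma diff: "0 \<le> t \<Longrightarrow> V t (x - y) = V t x - V t y"
  using linear by (simp add: linear_diff bounded_linear.linear)

text \<open>Strong continuity and the uniform bound together give joint continuity, which makes all integrands
  below continuous.\<close>

lemma joint: "continuous_on ({0..} \<times> UNIV) (\<lambda>(t, x). V t x)"
  unfolding continuous_on_iff
proof (intro ballI allI impI)
  fix p :: "real \<times> 'e" and e :: real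
  assume "p \<in> {0..} \<times> UNIV" and e: "0 < e"
  then obtain t x where p: "p = (t, x)" and t: "0 \<le> t" by auto
  obtain d where d: "d > 0" "\<And>s. 0 \<le> s \<Longrightarrow> \<bar>s - t\<bar> < d \<Longrightarrow> norm (V s x - V t x) < e / 2"
    using cont[of x] t e unfolding continuous_on_iff dist_norm by (metis atLeast_iff half_gt_zero real_norm_def)
  define k where "k = min d (e / (2 * (K + 1)))"
  have "norm (V s y - V t x) < e" if s: "0 \<le> s" and n: "norm ((s, y) - (t, x)) < k" for s y
  proof -
    have "\<bar>s - t\<bar> < d" "norm (y - x) < e / (2 * (K + 1))"
      using n norm_fst_le[of "s - t" "y - x"] norm_snd_le[where x="s - t" and y="y - x"]
      by (auto simp: k_def)
    moreover have "norm (V s (y - x)) \<le> (K + 1) * norm (y - x)"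
      using bound[OF s, of "y - x"] by (simp add: distrib_right add_increasing2)
    ultimately have "norm (V s (y - x)) < e / 2" "norm (V s x - V t x) < e / 2"
      using d(2)[OF s] K by (auto simp: field_simps intro: le_less_trans)
    then show ?thesis
      using norm_triangle_ineq[of "V s (y - x)" "V s x - V t x"] s by (simp add: diff)
  qed
  moreover have "0 < k" using d(1) e K by (auto simp: k_def)
  ultimately show "\<exists>d>0. \<forall>q\<in>{0..} \<times> UNIV. dist q p < d \<longrightarrow>
      dist (case q of (t, x) \<Rightarrow> V t x) (case p of (t, x) \<Rightarrow> V t x) < e"
    unfolding p dist_norm by (intro exI[of _ k]) auto
qed

lemma continuous_on_apply:
  assumes "continuous_on A s" "continuous_on A g" "\<And>a. a \<in> A \<Longrightarrow> 0 \<le> s a"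
  shows "continuous_on A (\<lambda>a. V (s a) (g a))"
  using continuous_on_compose2[OF joint continuous_on_Pair[OF assms(1,2)]] assms(3) by auto

lemma past_integrable:
  assumes "continuous_on {0..} g" "0 \<le> t"
  shows "(\<lambda>r. V (t - r) (g r)) integrable_on {0..t}"
  by (intro integrable_continuous_real continuous_on_apply continuous_intros
      continuous_on_subset[OF assms(1)]) auto

lemma past_continuous:
  assumes "continuous_on {0..} g"
  shows "continuous_on {0..} (\<lambda>t. integral {0..t} (\<lambda>r. V (t - r) (g r)))"
proof (rule continuous_on_integral_triangle, unfold case_prod_beta, rule continuous_on_apply)
  show "continuous_on {x. 0 \<le> snd x \<and> snd x \<le> fst x} (\<lambda>x. g (snd x))"
    by (rule continuous_on_compose2[OF assms]) (auto intro: continuous_on_snd continuous_on_id)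
  show "continuous_on {x. 0 \<le> snd x \<and> snd x \<le> fst x} (\<lambda>x :: real \<times> real. fst x - snd x)"
    by (intro continuous_intros)
qed auto

lemma future_dominated:
  assumes "\<And>r. 0 \<le> r \<Longrightarrow> norm (g r) \<le> B" "0 \<le> t" "0 \<le> r"
  shows "norm (V r (g (t + r))) \<le> (K * B) * exp (- (\<rho> * r))"
  using order_trans[OF decay[of r "g (t + r)"] mult_left_mono[OF assms(1)[of "t + r"]]] assms K
  by (simp add: algebra_simps)

lemma future_integrable:
  assumes g: "continuous_on {0..} g" and B: "\<And>r. 0 \<le> r \<Longrightarrow> norm (g r) \<le> B" and t: "0 \<le> t"
  shows "(\<lambda>r. V r (g (t + r))) integrable_on {0..}"
proof (rule halfline_dominated(1)[OF _ future_dominated[OF B t] rate])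
  show "(\<lambda>r. V r (g (t + r))) integrable_on {0..a}" for a
    by (intro integrable_continuous_real continuous_on_apply continuous_intros
        continuous_on_compose2[OF g]) (use t in auto)
qed

text \<open>The truncated integrals are continuous and converge uniformly by the exponential majorant.\<close>

lemma future_continuous:
  assumes g: "continuous_on {0..} g" and B: "\<And>r. 0 \<le> r \<Longrightarrow> norm (g r) \<le> B"
  shows "continuous_on {0..} (\<lambda>t. integral {0..} (\<lambda>r. V r (g (t + r))))"
proof (rule uniform_limit_theorem)
  show "\<forall>\<^sub>F n in sequentially. continuous_on {0..} (\<lambda>t. integral {0..real n} (\<lambda>r. V r (g (t + r))))"
  proof (rule always_eventually, rule allI)
    fix n
    have "continuous_on ({0..} \<times> cbox 0 (real n)) (\<lambda>(t, r). V r (g (t + r)))"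
      unfolding case_prod_beta
      by (intro continuous_on_apply continuous_intros continuous_on_compose2[OF g]) auto
    from integral_continuous_on_param[OF this]
    show "continuous_on {0..} (\<lambda>t. integral {0..real n} (\<lambda>r. V r (g (t + r))))" by simp
  qed
  have lim: "(\<lambda>n. (K * B) * exp (- (\<rho> * real n)) / \<rho>) \<longlonglongrightarrow> 0"
  proof -
    have "(\<lambda>n. exp (- \<rho>) ^ n) \<longlonglongrightarrow> 0"
      using rate by (intro LIMSEQ_realpow_zero) auto
    then have "(\<lambda>n. exp (- (\<rho> * real n))) \<longlonglongrightarrow> 0"
      by (simp add: exp_of_nat_mult[symmetric] mult.commute)
    from tendsto_mult_right_zero[OF this, of "K * B / \<rho>"] show ?thesis by simp
  qed
  show "uniform_limit {0..} (\<lambda>n t. integral {0..real n} (\<lambda>r. V r (g (t + r))))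
      (\<lambda>t. integral {0..} (\<lambda>r. V r (g (t + r)))) sequentially"
  proof (rule uniform_limitI)
    fix e :: real assume "e > 0"
    with lim have "\<forall>\<^sub>F n in sequentially. (K * B) * exp (- (\<rho> * real n)) / \<rho> < e"
      by (simp add: order_tendstoD(2))
    then show "\<forall>\<^sub>F n in sequentially. \<forall>t\<in>{0..}.
        dist (integral {0..real n} (\<lambda>r. V r (g (t + r)))) (integral {0..} (\<lambda>r. V r (g (t + r)))) < e"
    proof eventually_elim
      case (elim n)
      have "norm (integral {0..} (\<lambda>r. V r (g (t + r))) - integral {0..real n} (\<lambda>r. V r (g (t + r))))
          \<le> (K * B) * exp (- (\<rho> * real n)) / \<rho>" if t: "0 \<le> t" for t
      proof (rule halfline_dominated(3)[OF _ future_dominated[OF B t] rate])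
        show "(\<lambda>r. V r (g (t + r))) integrable_on {0..a}" for a
          by (intro integrable_continuous_real continuous_on_apply continuous_intros
              continuous_on_compose2[OF g]) (use t in auto)
      qed auto
      with elim show ?case by (force simp: dist_norm norm_minus_commute)
    qed
  qed
qed simp

end

text \<open>The equation \<open>Z(t) = \<Theta>(t) + \<integral>\<^sub>0\<^sup>t V(t - r) N(r, C Z(r)) dr - \<integral>\<^sub>0\<^sup>\<infinity> T(r) N(t + r, C Z(t + r)) dr\<close> for \<open>t \<ge> 0\<close>.
  The nonlinearity sees \<open>Z\<close> only through the observation \<open>C\<close>, and the constants \<open>L\<^sub>V\<close>, \<open>L\<^sub>T\<close> of the
  contraction condition measure only the observed effect of differences of the nonlinearity. They
  can be far smaller than the product of \<open>K\<close>, \<open>L\<close> and the norm of \<open>C\<close>, and exactly this makes the gap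
  condition uniform in \<open>\<epsilon>\<close> for the wave equation.\<close>

locale lyapunov_perron = V: decaying_family V K \<rho> + T: decaying_family T K \<sigma>
  for V T :: "real \<Rightarrow> 'e::banach \<Rightarrow> 'e" and K \<rho> \<sigma> :: real +
  fixes C :: "'e \<Rightarrow> 'x::banach" and N :: "real \<Rightarrow> 'x \<Rightarrow> 'e" and L L\<^sub>V L\<^sub>T \<nu> :: real
  assumes C: "bounded_linear C"
    and N_cont: "continuous_on ({0..} \<times> UNIV) (\<lambda>(t, x). N t x)"
    and N_lip: "0 \<le> t \<Longrightarrow> norm (N t x - N t y) \<le> L * norm (x - y)"
    and N_0: "0 \<le> t \<Longrightarrow> norm (N t 0) \<le> \<nu>"
    and obs_V: "0 \<le> s \<Longrightarrow> 0 \<le> t \<Longrightarrow> norm (C (V s (N t x - N t y))) \<le> L\<^sub>V * exp (- (\<rho> * s)) * norm (x - y)"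
    and obs_T: "0 \<le> s \<Longrightarrow> 0 \<le> t \<Longrightarrow> norm (C (T s (N t x - N t y))) \<le> L\<^sub>T * exp (- (\<sigma> * s)) * norm (x - y)"
    and nonneg: "0 \<le> L" "0 \<le> L\<^sub>V" "0 \<le> L\<^sub>T"
    and gap: "L\<^sub>V / \<rho> + L\<^sub>T / \<sigma> < 1"
begin

abbreviation \<kappa> :: real where "\<kappa> \<equiv> L\<^sub>V / \<rho> + L\<^sub>T / \<sigma>"

definition past :: "(real \<Rightarrow> 'e) \<Rightarrow> real \<Rightarrow> 'e" where
  "past g t = integral {0..t} (\<lambda>r. V (t - r) (g r))"

definition future :: "(real \<Rightarrow> 'e) \<Rightarrow> real \<Rightarrow> 'e" where
  "future g t = integral {0..} (\<lambda>r. T r (g (t + r)))"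

text \<open>Integrability is part of the notion of a solution, because solutions are later produced by gluing
  and need not be continuous.\<close>

definition admissible :: "(real \<Rightarrow> 'e) \<Rightarrow> bool" where
  "admissible g \<longleftrightarrow> (\<forall>t\<ge>0. (\<lambda>r. V (t - r) (g r)) integrable_on {0..t} \<and>
      (\<lambda>r. T r (g (t + r))) integrable_on {0..})"

definition solves :: "(real \<Rightarrow> 'e) \<Rightarrow> (real \<Rightarrow> 'e) \<Rightarrow> bool" where
  "solves \<Theta> Z \<longleftrightarrow> admissible (\<lambda>r. N r (C (Z r))) \<and>
     (\<forall>t\<ge>0. Z t = \<Theta> t + past (\<lambda>r. N r (C (Z r))) t - future (\<lambda>r. N r (C (Z r))) t)"

lemma past_future_diff:
  assumes "admissible g" "admissible h" "0 \<le> t"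
  shows "past g t - past h t = integral {0..t} (\<lambda>r. V (t - r) (g r - h r))"
    "future g t - future h t = integral {0..} (\<lambda>r. T r (g (t + r) - h (t + r)))"
    "(\<lambda>r. V (t - r) (g r - h r)) integrable_on {0..t}"
    "(\<lambda>r. T r (g (t + r) - h (t + r))) integrable_on {0..}"
proof -
  have i: "(\<lambda>r. V (t - r) (g r)) integrable_on {0..t}" "(\<lambda>r. V (t - r) (h r)) integrable_on {0..t}"
    "(\<lambda>r. T r (g (t + r))) integrable_on {0..}" "(\<lambda>r. T r (h (t + r))) integrable_on {0..}"
    using assms by (auto simp: admissible_def)
  have e: "r \<in> {0..t} \<Longrightarrow> V (t - r) (g r) - V (t - r) (h r) = V (t - r) (g r - h r)"
    "r \<in> {0..} \<Longrightarrow> T r (g (t + r)) - T r (h (t + r)) = T r (g (t + r) - h (t + r))" for r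
    by (auto simp: V.diff T.diff)
  show "past g t - past h t = integral {0..t} (\<lambda>r. V (t - r) (g r - h r))"
    unfolding past_def Henstock_Kurzweil_Integration.integral_diff[OF i(1,2), symmetric]
    by (rule Henstock_Kurzweil_Integration.integral_cong) (rule e)
  show "future g t - future h t = integral {0..} (\<lambda>r. T r (g (t + r) - h (t + r)))"
    unfolding future_def Henstock_Kurzweil_Integration.integral_diff[OF i(3,4), symmetric]
    by (rule Henstock_Kurzweil_Integration.integral_cong) (rule e)
  show "(\<lambda>r. V (t - r) (g r - h r)) integrable_on {0..t}"
    using integrable_diff[OF i(1,2)] by (rule integrable_eq) (rule e)
  show "(\<lambda>r. T r (g (t + r) - h (t + r))) integrable_on {0..}"
    using integrable_diff[OF i(3,4)] by (rule integrable_eq) (rule e)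
qed

lemma past_future_add:
  assumes "admissible g" "admissible h"
  shows "admissible (\<lambda>r. g r + h r)"
    "0 \<le> t \<Longrightarrow> past (\<lambda>r. g r + h r) t = past g t + past h t"
    "0 \<le> t \<Longrightarrow> future (\<lambda>r. g r + h r) t = future g t + future h t"
proof -
  have "((\<lambda>r. V (t - r) (g r + h r)) has_integral past g t + past h t) {0..t} \<and>
      ((\<lambda>r. T r (g (t + r) + h (t + r))) has_integral future g t + future h t) {0..}" if t: "0 \<le> t" for t
  proof
    have i: "(\<lambda>r. V (t - r) (g r)) integrable_on {0..t}" "(\<lambda>r. V (t - r) (h r)) integrable_on {0..t}"
      "(\<lambda>r. T r (g (t + r))) integrable_on {0..}" "(\<lambda>r. T r (h (t + r))) integrable_on {0..}"
      using assms t by (auto simp: admissible_def)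
    show "((\<lambda>r. V (t - r) (g r + h r)) has_integral past g t + past h t) {0..t}"
      using has_integral_add[OF integrable_integral[OF i(1)] integrable_integral[OF i(2)]]
      unfolding past_def by (rule has_integral_eq[rotated]) (simp add: linear_add[OF bounded_linear.linear[OF V.linear]])
    show "((\<lambda>r. T r (g (t + r) + h (t + r))) has_integral future g t + future h t) {0..}"
      using has_integral_add[OF integrable_integral[OF i(3)] integrable_integral[OF i(4)]]
      unfolding future_def by (rule has_integral_eq[rotated]) (simp add: linear_add[OF bounded_linear.linear[OF T.linear]])
  qed
  then show "admissible (\<lambda>r. g r + h r)"
    "0 \<le> t \<Longrightarrow> past (\<lambda>r. g r + h r) t = past g t + past h t"
    "0 \<le> t \<Longrightarrow> future (\<lambda>r. g r + h r) t = future g t + future h t"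
    unfolding admissible_def past_def[of "\<lambda>r. g r + h r"] future_def[of "\<lambda>r. g r + h r"]
    by (blast intro: integral_unique)+
qed

lemma admissible_diff:
  assumes "admissible g" "admissible h"
  shows "admissible (\<lambda>r. g r - h r)"
  unfolding admissible_def using past_future_diff(3,4)[OF assms] by blast

lemma C_minus: "C (x - y) = C x - C y"
  using C by (simp add: linear_diff bounded_linear.linear)

lemma nonlinear_terms_lipschitz:
  assumes adm: "admissible (\<lambda>r. N r (x r))" "admissible (\<lambda>r. N r (y r))"
    and m: "\<And>r. 0 \<le> r \<Longrightarrow> norm (x r - y r) \<le> m" and t: "0 \<le> t"
  shows "norm (C ((past (\<lambda>r. N r (x r)) t - future (\<lambda>r. N r (x r)) t)
      - (past (\<lambda>r. N r (y r)) t - future (\<lambda>r. N r (y r)) t))) \<le> \<kappa> * m"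
    and "norm ((past (\<lambda>r. N r (x r)) t - future (\<lambda>r. N r (x r)) t)
      - (past (\<lambda>r. N r (y r)) t - future (\<lambda>r. N r (y r)) t)) \<le> (K * L / \<rho> + K * L / \<sigma>) * m"
proof -
  let ?\<Delta> = "\<lambda>r. N r (x r) - N r (y r)"
  have m0: "0 \<le> m" using m[of 0] order_trans[OF norm_ge_zero] by blast
  note D = past_future_diff[OF adm t]
  define p f where "p = integral {0..t} (\<lambda>r. V (t - r) (?\<Delta> r))"
    and "f = integral {0..} (\<lambda>r. T r (?\<Delta> (t + r)))"
  have eq: "(past (\<lambda>r. N r (x r)) t - future (\<lambda>r. N r (x r)) t)
      - (past (\<lambda>r. N r (y r)) t - future (\<lambda>r. N r (y r)) t) = p - f"
    unfolding p_def f_def D(1,2)[symmetric] by simp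
  have \<Delta>: "norm (?\<Delta> r) \<le> L * m" if "0 \<le> r" for r
    using order_trans[OF N_lip[OF that] mult_left_mono[OF m[OF that]]] nonneg by simp
  have V1: "norm (V (t - r) (?\<Delta> r)) \<le> (K * L * m) * exp (- (\<rho> * (t - r)))" if "0 \<le> r" "r \<le> t" for r
    using order_trans[OF V.decay[of "t - r" "?\<Delta> r"] mult_left_mono[OF \<Delta>[OF that(1)]]] that V.K
    by (simp add: algebra_simps)
  have V2: "norm (C (V (t - r) (?\<Delta> r))) \<le> (L\<^sub>V * m) * exp (- (\<rho> * (t - r)))" if "0 \<le> r" "r \<le> t" for r
    using order_trans[OF obs_V[of "t - r" r "x r" "y r"] mult_left_mono[OF m[OF that(1)]]] that nonneg
    by (simp add: algebra_simps)
  have T1: "norm (T r (?\<Delta> (t + r))) \<le> (K * L * m) * exp (- (\<sigma> * r))" if "0 \<le> r" for r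
    using order_trans[OF T.decay[of r "?\<Delta> (t + r)"] mult_left_mono[OF \<Delta>[of "t + r"]]] that t T.K
    by (simp add: algebra_simps)
  have T2: "norm (C (T r (?\<Delta> (t + r)))) \<le> (L\<^sub>T * m) * exp (- (\<sigma> * r))" if "0 \<le> r" for r
    using order_trans[OF obs_T[of r "t + r" "x (t + r)" "y (t + r)"] mult_left_mono[OF m[of "t + r"]]] that t nonneg
    by (simp add: algebra_simps)
  have sub: "h integrable_on {0..a}" if "h integrable_on {0..}" "0 \<le> a" for h :: "real \<Rightarrow> 'z::banach" and a
    by (rule integrable_on_subinterval[OF that(1)]) auto
  have "norm p \<le> (K * L * m) / \<rho>" unfolding p_def
    by (rule norm_integral_past_le[OF D(3) V1 V.rate _ t]) (use V.K nonneg m0 in auto)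
  moreover have "norm f \<le> (K * L * m) / \<sigma>" unfolding f_def
    by (rule halfline_dominated(2)[OF sub[OF D(4)] T1 T.rate])
  ultimately show "norm ((past (\<lambda>r. N r (x r)) t - future (\<lambda>r. N r (x r)) t)
      - (past (\<lambda>r. N r (y r)) t - future (\<lambda>r. N r (y r)) t)) \<le> (K * L / \<rho> + K * L / \<sigma>) * m"
    unfolding eq using norm_triangle_ineq4[of p f] by (simp add: distrib_right)
  have Cp: "C p = integral {0..t} (\<lambda>r. C (V (t - r) (?\<Delta> r)))" "(\<lambda>r. C (V (t - r) (?\<Delta> r))) integrable_on {0..t}"
    unfolding p_def using integral_linear[OF D(3) C] integrable_linear[OF D(3) C] by (simp_all add: o_def)
  have Cf: "C f = integral {0..} (\<lambda>r. C (T r (?\<Delta> (t + r))))" "(\<lambda>r. C (T r (?\<Delta> (t + r)))) integrable_on {0..}"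
    unfolding f_def using integral_linear[OF D(4) C] integrable_linear[OF D(4) C] by (simp_all add: o_def)
  have "norm (C p) \<le> (L\<^sub>V * m) / \<rho>" unfolding Cp(1)
    by (rule norm_integral_past_le[OF Cp(2) V2 V.rate _ t]) (use nonneg m0 in auto)
  moreover have "norm (C f) \<le> (L\<^sub>T * m) / \<sigma>" unfolding Cf(1)
    by (rule halfline_dominated(2)[OF sub[OF Cf(2)] T2 T.rate])
  ultimately show "norm (C ((past (\<lambda>r. N r (x r)) t - future (\<lambda>r. N r (x r)) t)
      - (past (\<lambda>r. N r (y r)) t - future (\<lambda>r. N r (y r)) t))) \<le> \<kappa> * m"
    unfolding eq C_minus using norm_triangle_ineq4[of "C p" "C f"] by (simp add: distrib_right)
qed

text \<open>The observed difference satisfies \<open>m \<le> \<kappa> m + \<delta>\<close> for its supremum \<open>m\<close>, which is finite by hypothesis;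
  the full difference is then read off from the equation.\<close>

lemma solutions_close:
  assumes Z: "solves \<Theta> Z" and Y: "solves \<Theta>' Y"
    and bdd: "\<And>t. 0 \<le> t \<Longrightarrow> norm (C (Z t) - C (Y t)) \<le> B"
    and \<delta>: "\<And>t. 0 \<le> t \<Longrightarrow> norm (C (\<Theta> t - \<Theta>' t)) \<le> \<delta>" and t: "0 \<le> t"
  shows "norm (C (Z t) - C (Y t)) \<le> \<delta> / (1 - \<kappa>)"
    "norm (Z t - Y t - (\<Theta> t - \<Theta>' t)) \<le> (K * L / \<rho> + K * L / \<sigma>) * (\<delta> / (1 - \<kappa>))"
proof -
  let ?J = "\<lambda>Z t. past (\<lambda>r. N r (C (Z r))) t - future (\<lambda>r. N r (C (Z r))) t"
  have adm: "admissible (\<lambda>r. N r (C (Z r)))" "admissible (\<lambda>r. N r (C (Y r)))"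
    and ZY: "\<And>t. 0 \<le> t \<Longrightarrow> Z t - Y t - (\<Theta> t - \<Theta>' t) = ?J Z t - ?J Y t"
    using Z Y by (auto simp: solves_def)
  define m where "m = (SUP t\<in>{0..}. norm (C (Z t) - C (Y t)))"
  have bA: "bdd_above ((\<lambda>t. norm (C (Z t) - C (Y t))) ` {0..})"
    using bdd by (intro bdd_aboveI2[where M = B]) auto
  have m: "norm (C (Z t) - C (Y t)) \<le> m" if "0 \<le> t" for t
    unfolding m_def by (rule cSUP_upper[OF _ bA]) (use that in auto)
  have step: "norm (C (Z t) - C (Y t)) \<le> \<kappa> * m + \<delta>" if t: "0 \<le> t" for t
  proof -
    have "C (Z t) - C (Y t) = C (?J Z t - ?J Y t) + C (\<Theta> t - \<Theta>' t)"
      unfolding ZY[OF t, symmetric] by (simp add: C_minus)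
    then show ?thesis
      using norm_triangle_ineq[of "C (?J Z t - ?J Y t)" "C (\<Theta> t - \<Theta>' t)"]
        nonlinear_terms_lipschitz(1)[OF adm m t] \<delta>[OF t] by simp
  qed
  have "m \<le> \<kappa> * m + \<delta>"
    unfolding m_def by (rule cSUP_least) (use step m_def in auto)
  then have "m \<le> \<delta> / (1 - \<kappa>)" using gap by (simp add: field_simps)
  then have m': "norm (C (Z t) - C (Y t)) \<le> \<delta> / (1 - \<kappa>)" if "0 \<le> t" for t
    using m[OF that] by linarith
  then show "norm (C (Z t) - C (Y t)) \<le> \<delta> / (1 - \<kappa>)" using t by blast
  show "norm (Z t - Y t - (\<Theta> t - \<Theta>' t)) \<le> (K * L / \<rho> + K * L / \<sigma>) * (\<delta> / (1 - \<kappa>))"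
    unfolding ZY[OF t] by (rule nonlinear_terms_lipschitz(2)[OF adm m' t])
qed

lemma N_bound: "0 \<le> t \<Longrightarrow> norm (N t x) \<le> \<nu> + L * norm x"
  using N_lip[of t x 0] N_0[of t] norm_triangle_ineq2[of "N t x" "N t 0"] by simp

lemma admissible_continuous:
  assumes "continuous_on {0..} g" "\<And>r. 0 \<le> r \<Longrightarrow> norm (g r) \<le> B"
  shows "admissible g"
  unfolding admissible_def using V.past_integrable[OF assms(1)] T.future_integrable[OF assms] by blast

lemma past_bound:
  assumes "continuous_on {0..} g" "\<And>r. 0 \<le> r \<Longrightarrow> norm (g r) \<le> B" "0 \<le> t"
  shows "norm (past g t) \<le> K * B / \<rho>"
  unfolding past_def
proof (rule norm_integral_past_le[OF V.past_integrable[OF assms(1,3)] _ V.rate _ assms(3)])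
  show "norm (V (t - r) (g r)) \<le> (K * B) * exp (- (\<rho> * (t - r)))" if "0 \<le> r" "r \<le> t" for r
    using order_trans[OF V.decay[of "t - r" "g r"] mult_left_mono[OF assms(2)[OF that(1)]]] that V.K
    by (simp add: algebra_simps)
  show "0 \<le> K * B" using V.K order_trans[OF norm_ge_zero assms(2)[of 0]] by simp
qed

lemma future_bound:
  assumes "continuous_on {0..} g" "\<And>r. 0 \<le> r \<Longrightarrow> norm (g r) \<le> B" "0 \<le> t"
  shows "norm (future g t) \<le> K * B / \<sigma>"
  unfolding future_def
proof (rule halfline_dominated(2)[OF _ T.future_dominated[OF assms(2,3)] T.rate])
  show "(\<lambda>r. T r (g (t + r))) integrable_on {0..a}" for a
    by (rule integrable_on_subinterval[OF T.future_integrable[OF assms]]) auto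
qed

text \<open>The fixed point is taken in the bounded continuous functions with values in the observation space;
  the solution itself is recovered by inserting the observed fixed point into the right-hand side.\<close>

lemma solution_exists:
  assumes \<Theta>: "continuous_on {0..} \<Theta>" and b: "\<And>t. 0 \<le> t \<Longrightarrow> norm (C (\<Theta> t)) \<le> b"
  obtains Z B where "solves \<Theta> Z" "continuous_on {0..} Z" "\<And>t. 0 \<le> t \<Longrightarrow> norm (C (Z t)) \<le> B"
proof -
  let ?g = "\<lambda>(y :: real \<Rightarrow>\<^sub>C 'x) r. N r (y r)"
  define Z where "Z y t = \<Theta> t + past (?g y) t - future (?g y) t" for y t
  have gc: "continuous_on {0..} (?g y)" for y
    using continuous_on_compose2[OF N_cont, of "{0..}" "\<lambda>r. (r, y r)"]
    by (auto simp: continuous_on_Pair continuous_on_id)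
  have gb: "norm (?g y r) \<le> \<nu> + L * norm y" if "0 \<le> r" for y r
    using order_trans[OF N_bound[OF that, of "y r"] add_left_mono[OF mult_left_mono[OF norm_bounded nonneg(1)]]] .
  have Zc: "continuous_on {0..} (Z y)" for y
    unfolding Z_def past_def future_def
    by (intro continuous_intros \<Theta> V.past_continuous T.future_continuous[OF gc gb] gc)
  have adm: "admissible (?g y)" for y
    by (rule admissible_continuous[OF gc gb])
  obtain c where c: "\<And>x. norm (C x) \<le> norm x * c" "0 \<le> c"
    using bounded_linear.nonneg_bounded[OF C] by blast
  have Zb: "\<exists>B. \<forall>t\<ge>0. norm (C (Z y t)) \<le> B" for y
  proof (intro exI allI impI)
    fix t :: real assume t: "0 \<le> t"
    let ?B = "\<nu> + L * norm y"
    have "C (Z y t) = C (\<Theta> t) + C (past (?g y) t) - C (future (?g y) t)"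
      unfolding Z_def using C by (simp add: C_minus linear_add bounded_linear.linear)
    then have "norm (C (Z y t)) \<le> norm (C (\<Theta> t)) + norm (C (past (?g y) t)) + norm (C (future (?g y) t))"
      using norm_triangle_ineq4[of "C (\<Theta> t) + C (past (?g y) t)" "C (future (?g y) t)"]
        norm_triangle_ineq[of "C (\<Theta> t)" "C (past (?g y) t)"] by simp
    also have "\<dots> \<le> b + (K * ?B / \<rho>) * c + (K * ?B / \<sigma>) * c"
      by (intro add_mono b t order_trans[OF c(1)] mult_right_mono c(2) past_bound[OF gc gb] future_bound[OF gc gb])
    finally show "norm (C (Z y t)) \<le> b + (K * ?B / \<rho>) * c + (K * ?B / \<sigma>) * c" .
  qed
  \<comment> \<open>Bounded continuous functions live on the whole line: extend by the value at \<open>0\<close>.\<close>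
  define \<Lambda> where "\<Lambda> y = Bcontfun (\<lambda>t. C (Z y (max 0 t)))" for y
  have app: "apply_bcontfun (\<Lambda> y) = (\<lambda>t. C (Z y (max 0 t)))" for y
  proof -
    obtain B where B: "\<forall>t\<ge>0. norm (C (Z y t)) \<le> B" using Zb by blast
    have "(\<lambda>t. C (Z y (max 0 t))) \<in> bcontfun"
      by (rule bcontfun_normI[where b = B])
        (auto intro!: bounded_linear.continuous_on[OF C] continuous_on_compose2[OF Zc] continuous_intros simp: B)
    then show ?thesis unfolding \<Lambda>_def by (rule Bcontfun_inverse)
  qed
  have k0: "0 \<le> \<kappa>" using nonneg V.rate T.rate by simp
  have "\<exists>!y. \<Lambda> y = y"
  proof (rule banach_fix_type[OF k0 gap], intro allI, rule dist_bound)
    fix x y :: "real \<Rightarrow>\<^sub>C 'x" and t :: real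
    have "dist (\<Lambda> x t) (\<Lambda> y t) = norm (C ((past (?g x) (max 0 t) - future (?g x) (max 0 t))
        - (past (?g y) (max 0 t) - future (?g y) (max 0 t))))"
      unfolding app dist_norm C_minus[symmetric] Z_def by (simp add: algebra_simps)
    also have "\<dots> \<le> \<kappa> * dist x y"
      by (rule nonlinear_terms_lipschitz(1)[OF adm adm])
        (auto simp: dist_norm[symmetric] dist_bounded)
    finally show "dist (\<Lambda> x t) (\<Lambda> y t) \<le> \<kappa> * dist x y" .
  qed
  then obtain y where y: "\<Lambda> y = y" by blast
  have yZ: "apply_bcontfun y t = C (Z y t)" if "0 \<le> t" for t
    using app[of y] y that by (simp add: max_def)
  have "admissible (\<lambda>r. N r (C (Z y r))) \<and>
      (\<forall>t\<ge>0. past (\<lambda>r. N r (C (Z y r))) t = past (?g y) t \<and> future (\<lambda>r. N r (C (Z y r))) t = future (?g y) t)"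
  proof -
    have "(\<lambda>r. V (t - r) (N r (C (Z y r)))) integrable_on {0..t} \<longleftrightarrow> (\<lambda>r. V (t - r) (?g y r)) integrable_on {0..t}"
      "past (\<lambda>r. N r (C (Z y r))) t = past (?g y) t" for t
      unfolding past_def
      by (rule integrable_cong, simp add: yZ, rule Henstock_Kurzweil_Integration.integral_cong, simp add: yZ)
    moreover have "(\<lambda>r. T r (N (t + r) (C (Z y (t + r))))) integrable_on {0..} \<longleftrightarrow> (\<lambda>r. T r (?g y (t + r))) integrable_on {0..}"
      "future (\<lambda>r. N r (C (Z y r))) t = future (?g y) t" if "0 \<le> t" for t
      unfolding future_def using that
      by - (rule integrable_cong, simp add: yZ, rule Henstock_Kurzweil_Integration.integral_cong, simp add: yZ)
    ultimately show ?thesis using adm[of y] by (simp add: admissible_def)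
  qed
  then have "solves \<Theta> (Z y)" by (simp add: solves_def Z_def)
  moreover obtain B where "\<forall>t\<ge>0. norm (C (Z y t)) \<le> B" using Zb by blast
  ultimately show thesis using that Zc by blast
qed

end

section \<open>Invariant manifolds in the presence of a spectral gap\<close>

definition tempered :: "(real \<Rightarrow> real) \<Rightarrow> bool" where
  "tempered \<zeta> \<longleftrightarrow> continuous_on UNIV \<zeta> \<and> (\<exists>A. \<forall>s. \<bar>\<zeta> s\<bar> \<le> A * (1 + \<bar>s\<bar>))"

lemma tempered_shift:
  assumes "tempered \<zeta>"
  shows "tempered (\<lambda>s. \<zeta> (t + s))"
proof -
  obtain A where A: "\<And>s. \<bar>\<zeta> s\<bar> \<le> A * (1 + \<bar>s\<bar>)" and c: "continuous_on UNIV \<zeta>"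
    using assms by (auto simp: tempered_def)
  have A0: "0 \<le> A" using A[of 0] by simp
  have "\<bar>\<zeta> (t + s)\<bar> \<le> (A * (1 + \<bar>t\<bar>)) * (1 + \<bar>s\<bar>)" for s
  proof -
    have "1 + \<bar>t + s\<bar> \<le> (1 + \<bar>t\<bar>) * (1 + \<bar>s\<bar>)" by (auto simp: algebra_simps intro: order_trans[OF abs_triangle_ineq])
    then show ?thesis using order_trans[OF A[of "t + s"] mult_left_mono[OF _ A0]] by (simp add: mult.assoc)
  qed
  moreover have "continuous_on UNIV (\<lambda>s. \<zeta> (t + s))"
    by (rule continuous_on_compose2[OF c]) (auto intro!: continuous_intros)
  ultimately show ?thesis unfolding tempered_def by blast
qed

lemma tempered_weighted_bounded:
  assumes "tempered \<zeta>" "0 < c"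
  obtains B where "\<And>s. exp (- (c * \<bar>s\<bar>)) * \<bar>\<zeta> s\<bar> \<le> B"
proof -
  obtain A where A: "\<And>s. \<bar>\<zeta> s\<bar> \<le> A * (1 + \<bar>s\<bar>)"
    using assms by (auto simp: tempered_def)
  have A0: "0 \<le> A" using A[of 0] by simp
  have "exp (- (c * \<bar>s\<bar>)) * \<bar>\<zeta> s\<bar> \<le> A * (1 + 1 / c)" for s
  proof -
    have "1 + c * \<bar>s\<bar> \<le> exp (c * \<bar>s\<bar>)" by (rule exp_ge_add_one_self)
    then have "c * \<bar>s\<bar> \<le> exp (c * \<bar>s\<bar>)" by linarith
    then have "\<bar>s\<bar> \<le> exp (c * \<bar>s\<bar>) / c" using assms(2) by (simp add: field_simps)
    moreover have "1 \<le> exp (c * \<bar>s\<bar>)" using assms(2) by simp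
    moreover have "(1 + 1 / c) * exp (c * \<bar>s\<bar>) = exp (c * \<bar>s\<bar>) + exp (c * \<bar>s\<bar>) / c"
      by (simp add: distrib_right)
    ultimately have "1 + \<bar>s\<bar> \<le> (1 + 1 / c) * exp (c * \<bar>s\<bar>)" by linarith
    then have "\<bar>\<zeta> s\<bar> \<le> A * ((1 + 1 / c) * exp (c * \<bar>s\<bar>))"
      using order_trans[OF A[of s] mult_left_mono[OF _ A0]] by blast
    then show ?thesis by (simp add: exp_minus field_simps)
  qed
  then show thesis by (rule that)
qed

text \<open>A semigroup \<open>S = R + T\<close> that splits into a group \<open>R\<close> on the range of the projection \<open>R 0\<close>, with
  backward rate \<open>\<alpha>\<close>, and a semigroup \<open>T\<close> on the complementary range with forward rate \<open>\<beta>\<close>. Both are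
  extended by \<open>0\<close> to the whole space. The forcing is \<open>\<zeta>(s) b + F(C U)\<close> with a scalar path \<open>\<zeta>\<close>. The
  constant \<open>l\<close> bounds the observed response to differences of \<open>F\<close>; together with the weight \<open>\<eta>\<close> it
  enters the gap condition, whereas \<open>K\<close> and \<open>L\<close> may be arbitrarily large.\<close>

locale spectral_gap_system =
  fixes R T :: "real \<Rightarrow> 'e::banach \<Rightarrow> 'e" and C :: "'e \<Rightarrow> 'x::banach" and F :: "'x \<Rightarrow> 'e" and b :: 'e
    and K L l \<alpha> \<eta> \<beta> :: real
  assumes R_linear: "bounded_linear (R t)" and R_cont: "continuous_on UNIV (\<lambda>t. R t x)"
    and R_group: "R (s + t) x = R s (R t x)"
    and R_backward: "t \<le> 0 \<Longrightarrow> norm (R t x) \<le> K * exp (\<alpha> * t) * norm x"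
    and R_forward: "0 \<le> t \<Longrightarrow> norm (R t x) \<le> K * norm x"
    and T_linear: "0 \<le> t \<Longrightarrow> bounded_linear (T t)" and T_cont: "continuous_on {0..} (\<lambda>t. T t x)"
    and T_semigroup: "0 \<le> s \<Longrightarrow> 0 \<le> t \<Longrightarrow> T (s + t) x = T s (T t x)"
    and T_decay: "0 \<le> t \<Longrightarrow> norm (T t x) \<le> K * exp (\<beta> * t) * norm x"
    and split: "R 0 x + T 0 x = x" and RT: "0 \<le> t \<Longrightarrow> R s (T t x) = 0" and TR: "0 \<le> t \<Longrightarrow> T t (R s x) = 0"
    and C: "bounded_linear C" and F_lip: "norm (F p - F q) \<le> L * norm (p - q)"
    and obs_R: "t \<le> 0 \<Longrightarrow> norm (C (R t (F p - F q))) \<le> l * exp (\<alpha> * t) * norm (p - q)"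
    and obs_T: "0 \<le> t \<Longrightarrow> norm (C (T t (F p - F q))) \<le> l * exp (\<beta> * t) * norm (p - q)"
    and const_nonneg: "0 \<le> K" "0 \<le> L" "0 \<le> l"
    and rates: "\<beta> < \<eta>" "\<eta> < \<alpha>" "\<alpha> < 0" and gap_condition: "l / (\<alpha> - \<eta>) + l / (\<eta> - \<beta>) < 1"
begin

definition S :: "real \<Rightarrow> 'e \<Rightarrow> 'e" where "S t x = R t x + T t x"

definition force :: "(real \<Rightarrow> real) \<Rightarrow> real \<Rightarrow> 'e \<Rightarrow> 'e" where
  "force \<zeta> s U = \<zeta> s *\<^sub>R b + F (C U)"

text \<open>The exponential weight \<open>e\<^sup>-\<^sup>\<mu>\<^sup>t\<close> turns the variation of constants formula on \<open>[0, \<infinity>)\<close> into a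
  contraction with constant at most \<open>1/2\<close>.\<close>

definition \<mu> :: real where "\<mu> = 4 * K * L * onorm C + 1"

lemma C_scaleR: "C (c *\<^sub>R x) = c *\<^sub>R C x" and C_diff: "C (x - y) = C x - C y"
  using C by (simp_all add: linear_diff linear_scale bounded_linear.linear)

lemma S_linear: "0 \<le> t \<Longrightarrow> bounded_linear (S t)"
  unfolding S_def by (intro bounded_linear_add R_linear T_linear)

lemma S_cont: "continuous_on {0..} (\<lambda>t. S t x)"
  unfolding S_def by (intro continuous_on_add T_cont continuous_on_subset[OF R_cont]) auto

lemma S_bound: "0 \<le> t \<Longrightarrow> norm (S t x) \<le> 2 * K * norm x"
proof -
  assume t: "0 \<le> t"
  have "norm (T t x) \<le> K * norm x"
  proof -
    have "K * exp (\<beta> * t) \<le> K * 1" using t rates const_nonneg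
      by (intro mult_left_mono) (auto simp: mult_nonpos_nonneg)
    then show ?thesis using order_trans[OF T_decay[OF t, of x] mult_right_mono[of _ _ "norm x"]] by simp
  qed
  then show ?thesis
    using R_forward[OF t, of x] norm_triangle_ineq[of "R t x" "T t x"] by (simp add: S_def)
qed

lemma RS: "0 \<le> t \<Longrightarrow> R s (S t x) = R (s + t) x"
  by (simp add: S_def R_group RT linear_add[OF bounded_linear.linear[OF R_linear]])

lemma F_continuous: "continuous_on UNIV F"
  unfolding continuous_on_iff dist_norm
proof (intro ballI allI impI)
  fix x :: 'x and e :: real assume "0 < e"
  moreover have "norm (F y - F x) < e" if "norm (y - x) < e / (L + 1)" for y
  proof -
    have "norm (F y - F x) \<le> (L + 1) * norm (y - x)"
      using F_lip[of y x] by (simp add: distrib_right add_increasing2)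
    then show ?thesis using that const_nonneg by (simp add: field_simps)
  qed
  ultimately show "\<exists>d>0. \<forall>y\<in>UNIV. norm (y - x) < d \<longrightarrow> norm (F y - F x) < e"
    using const_nonneg by (intro exI[of _ "e / (L + 1)"]) auto
qed

lemma onorm_nonneg: "0 \<le> onorm C" by (rule onorm_pos_le[OF C])

lemma mu: "1 \<le> \<mu>" "0 < \<mu>" "(2 * K * L * onorm C) / \<mu> \<le> 1 / 2"
proof -
  have "0 \<le> K * L * onorm C" using const_nonneg onorm_nonneg by simp
  then show "1 \<le> \<mu>" "0 < \<mu>" by (auto simp: \<mu>_def)
  then show "(2 * K * L * onorm C) / \<mu> \<le> 1 / 2" by (simp add: divide_le_eq \<mu>_def)
qed

lemma F_C_lip: "norm (F (C x) - F (C y)) \<le> L * onorm C * norm (x - y)"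
  using F_lip[of "C x" "C y"] mult_left_mono[OF onorm[OF C, of "x - y"] const_nonneg(2)]
  by (simp add: C_diff mult.assoc)

subsection \<open>The forward flow\<close>

sublocale fwd: decaying_family "\<lambda>t x. exp (- (\<mu> * t)) *\<^sub>R S t x" "2 * K" \<mu>
proof (rule decaying_family.intro)
  fix t :: real and x :: 'e
  show "bounded_linear (\<lambda>x. exp (- (\<mu> * t)) *\<^sub>R S t x)" if "0 \<le> t"
    using bounded_linear_compose[OF bounded_linear_scaleR_right S_linear[OF that]] .
  show "continuous_on {0..} (\<lambda>t. exp (- (\<mu> * t)) *\<^sub>R S t x)"
    by (intro continuous_intros S_cont)
  show "norm (exp (- (\<mu> * t)) *\<^sub>R S t x) \<le> 2 * K * exp (- (\<mu> * t)) * norm x" if "0 \<le> t"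
    using S_bound[OF that, of x] by (simp add: mult_ac mult_left_mono)
qed (use const_nonneg mu in auto)

sublocale zero: decaying_family "\<lambda>t x. 0 :: 'e" "2 * K" \<mu>
proof (rule decaying_family.intro)
  show "bounded_linear (\<lambda>x. 0 :: 'e)" by (rule bounded_linear_zero)
qed (use const_nonneg mu in auto)

text \<open>In the weighted unknown \<open>Z(t) = e\<^sup>-\<^sup>\<mu>\<^sup>t U(t)\<close> the mild formulation is a Lyapunov--Perron equation without
  future part.\<close>

sublocale flow: lyapunov_perron "\<lambda>t x. exp (- (\<mu> * t)) *\<^sub>R S t x" "\<lambda>t x. 0" "2 * K" \<mu> \<mu> "\<lambda>x. x"
  "\<lambda>t z. exp (- (\<mu> * t)) *\<^sub>R F (C (exp (\<mu> * t) *\<^sub>R z))" "L * onorm C" "2 * K * L * onorm C" 0 "norm (F 0)"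
proof (rule lyapunov_perron.intro[OF fwd.decaying_family_axioms zero.decaying_family_axioms lyapunov_perron_axioms.intro])
  have 0: "C 0 = 0" using C by (simp add: linear_0 bounded_linear.linear)
  show "continuous_on ({0..} \<times> UNIV) (\<lambda>(t, x). exp (- (\<mu> * t)) *\<^sub>R F (C (exp (\<mu> * t) *\<^sub>R x)))"
  proof -
    have FC: "continuous_on UNIV (\<lambda>z. F (C z))"
      by (rule continuous_on_compose2[OF F_continuous linear_continuous_on[OF C]]) simp
    have z: "continuous_on ({0..} \<times> UNIV) (\<lambda>p :: real \<times> 'e. exp (\<mu> * fst p) *\<^sub>R snd p)"
      by (intro continuous_intros)
    show ?thesis unfolding case_prod_beta
      by (intro continuous_on_scaleR continuous_on_compose2[OF FC z]) (auto intro!: continuous_intros)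
  qed
  fix t s :: real and x y :: 'e
  show lip: "norm (exp (- (\<mu> * t)) *\<^sub>R F (C (exp (\<mu> * t) *\<^sub>R x)) - exp (- (\<mu> * t)) *\<^sub>R F (C (exp (\<mu> * t) *\<^sub>R y)))
      \<le> L * onorm C * norm (x - y)" for t x y
  proof -
    have "norm (F (C (exp (\<mu> * t) *\<^sub>R x)) - F (C (exp (\<mu> * t) *\<^sub>R y))) \<le> L * onorm C * (exp (\<mu> * t) * norm (x - y))"
      using F_C_lip[of "exp (\<mu> * t) *\<^sub>R x" "exp (\<mu> * t) *\<^sub>R y"]
      by (simp add: scaleR_diff_right[symmetric])
    from mult_left_mono[OF this, of "exp (- (\<mu> * t))"]
    have "norm (exp (- (\<mu> * t)) *\<^sub>R F (C (exp (\<mu> * t) *\<^sub>R x)) - exp (- (\<mu> * t)) *\<^sub>R F (C (exp (\<mu> * t) *\<^sub>R y)))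
        \<le> (exp (- (\<mu> * t)) * exp (\<mu> * t)) * (L * onorm C * norm (x - y))"
      by (simp add: scaleR_diff_right[symmetric] mult_ac)
    then show ?thesis by (simp add: exp_add[symmetric])
  qed
  assume t: "0 \<le> t"
  have "exp (- (\<mu> * t)) \<le> 1" using t mu by simp
  then show "norm (exp (- (\<mu> * t)) *\<^sub>R F (C (exp (\<mu> * t) *\<^sub>R 0))) \<le> norm (F 0)"
    by (simp add: 0 mult_left_le_one_le)
  assume s: "0 \<le> s"
  show "norm (exp (- (\<mu> * s)) *\<^sub>R S s (exp (- (\<mu> * t)) *\<^sub>R F (C (exp (\<mu> * t) *\<^sub>R x)) -
      exp (- (\<mu> * t)) *\<^sub>R F (C (exp (\<mu> * t) *\<^sub>R y)))) \<le> 2 * K * L * onorm C * exp (- (\<mu> * s)) * norm (x - y)"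
    using order_trans[OF fwd.decay[OF s] mult_left_mono[OF lip[of t x y]]] const_nonneg
    by (simp add: mult_ac)
qed (use const_nonneg onorm_nonneg mu in auto)

text \<open>Uniqueness and Lipschitz dependence on initial value and path, by the same weight: the weighted
  difference attains its maximum \<open>m\<close> over \<open>[0, t]\<close> at some \<open>s\<close>, and the formula at \<open>s\<close> gives
  \<open>m \<le> m/2 + \<dots>\<close>.\<close>

lemma mild_close:
  assumes U: "mild_solution S (force \<zeta>) x U" and U': "mild_solution S (force \<zeta>') x' U'"
    and \<delta>: "\<And>s. 0 \<le> s \<Longrightarrow> \<bar>\<zeta> s - \<zeta>' s\<bar> \<le> \<delta> * exp (\<mu> * s)" and t: "0 \<le> t"
  shows "norm (U t - U' t) \<le> exp (\<mu> * t) * (4 * K * (norm (x - x') + \<delta> * norm b))"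
proof -
  define w where "w s = exp (- (\<mu> * s)) * norm (U s - U' s)" for s
  have Uc: "continuous_on {0..} U" "continuous_on {0..} U'" using U U' by (auto simp: mild_solution_def)
  have wc: "continuous_on {0..t} w" unfolding w_def
    by (intro continuous_intros continuous_on_subset[OF Uc(1)] continuous_on_subset[OF Uc(2)]) auto
  obtain s where s: "s \<in> {0..t}" "\<And>r. r \<in> {0..t} \<Longrightarrow> w r \<le> w s"
    using continuous_attains_sup[of "{0..t}" w] wc t by auto
  define m where "m = w s"
  have s0: "0 \<le> s" using s by simp
  have \<delta>0: "0 \<le> \<delta>" using order_trans[OF abs_ge_zero \<delta>[of 0]] by simp
  have m0: "0 \<le> m" by (simp add: m_def w_def)
  define f where "f r = S (s - r) (force \<zeta> r (U r) - force \<zeta>' r (U' r))" for r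
  define g where "g r = exp (- (\<mu> * s)) *\<^sub>R f r" for r
  let ?D = "U s - U' s - S s (x - x')"
  have f: "(f has_integral ?D) {0..s}"
  proof -
    have "((\<lambda>r. S (s - r) (force \<zeta> r (U r)) - S (s - r) (force \<zeta>' r (U' r))) has_integral
        (U s - S s x) - (U' s - S s x')) {0..s}"
      using U U' s0 by (intro has_integral_diff) (auto simp: mild_solution_def)
    moreover have "(U s - S s x) - (U' s - S s x') = ?D"
      by (simp add: linear_diff[OF bounded_linear.linear[OF S_linear[OF s0]]])
    ultimately show ?thesis
      by (metis (no_types, lifting) has_integral_eq f_def atLeastAtMost_iff diff_ge_0_iff_ge
          linear_diff[OF bounded_linear.linear[OF S_linear]])
  qed
  have g: "(g has_integral exp (- (\<mu> * s)) *\<^sub>R ?D) {0..s}"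
    unfolding g_def using has_integral_cmul[OF f] .
  have gb: "norm (g r) \<le> (2 * K * (\<delta> * norm b + L * onorm C * m)) * exp (- (\<mu> * (s - r)))"
    if r: "0 \<le> r" "r \<le> s" for r
  proof -
    have "force \<zeta> r (U r) - force \<zeta>' r (U' r) = (\<zeta> r - \<zeta>' r) *\<^sub>R b + (F (C (U r)) - F (C (U' r)))"
      by (simp add: force_def algebra_simps)
    then have "norm (force \<zeta> r (U r) - force \<zeta>' r (U' r)) \<le> \<bar>\<zeta> r - \<zeta>' r\<bar> * norm b + L * onorm C * norm (U r - U' r)"
      using norm_triangle_ineq[of "(\<zeta> r - \<zeta>' r) *\<^sub>R b" "F (C (U r)) - F (C (U' r))"] F_C_lip[of "U r" "U' r"]
      by simp
    also have "\<dots> \<le> (\<delta> * exp (\<mu> * r)) * norm b + L * onorm C * (exp (\<mu> * r) * m)"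
    proof -
      have "w r \<le> m" using s r by (auto simp: m_def)
      then have "norm (U r - U' r) \<le> exp (\<mu> * r) * m" by (simp add: w_def exp_minus field_simps)
      then show ?thesis using \<delta>[OF r(1)] const_nonneg onorm_nonneg
        by (intro add_mono mult_right_mono mult_left_mono) auto
    qed
    also have "\<dots> = exp (\<mu> * r) * (\<delta> * norm b + L * onorm C * m)" by (simp add: algebra_simps)
    finally have n: "norm (force \<zeta> r (U r) - force \<zeta>' r (U' r)) \<le> exp (\<mu> * r) * (\<delta> * norm b + L * onorm C * m)" .
    have "norm (f r) \<le> 2 * K * (exp (\<mu> * r) * (\<delta> * norm b + L * onorm C * m))"
      unfolding f_def using order_trans[OF S_bound mult_left_mono[OF n]] r const_nonneg by simp
    then have "norm (g r) \<le> exp (- (\<mu> * s)) * (2 * K * (exp (\<mu> * r) * (\<delta> * norm b + L * onorm C * m)))"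
      by (simp add: g_def mult_left_mono)
    also have "\<dots> = (2 * K * (\<delta> * norm b + L * onorm C * m)) * (exp (- (\<mu> * s)) * exp (\<mu> * r))"
      by (simp add: algebra_simps)
    also have "exp (- (\<mu> * s)) * exp (\<mu> * r) = exp (- (\<mu> * (s - r)))"
      by (simp add: exp_add[symmetric] algebra_simps)
    finally show ?thesis .
  qed
  have "norm (exp (- (\<mu> * s)) *\<^sub>R ?D) \<le> (2 * K * (\<delta> * norm b + L * onorm C * m)) / \<mu>"
    unfolding integral_unique[OF g, symmetric]
    by (rule norm_integral_past_le[OF has_integral_integrable[OF g] gb mu(2) _ s0])
      (use const_nonneg onorm_nonneg m0 \<delta>0 in auto)
  also have "\<dots> = 2 * K * \<delta> * norm b / \<mu> + (2 * K * L * onorm C) / \<mu> * m"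
    by (simp add: add_divide_distrib algebra_simps)
  also have "\<dots> \<le> 2 * K * \<delta> * norm b + 1 / 2 * m"
  proof (rule add_mono)
    show "2 * K * \<delta> * norm b / \<mu> \<le> 2 * K * \<delta> * norm b"
    proof -
      have "2 * K * \<delta> * norm b * 1 \<le> 2 * K * \<delta> * norm b * \<mu>"
        using mu const_nonneg \<delta>0 by (intro mult_left_mono) auto
      then show ?thesis using mu by (simp add: divide_le_eq)
    qed
    show "(2 * K * L * onorm C) / \<mu> * m \<le> 1 / 2 * m" by (rule mult_right_mono[OF mu(3) m0])
  qed
  finally have "norm (exp (- (\<mu> * s)) *\<^sub>R ?D) \<le> 2 * K * \<delta> * norm b + 1 / 2 * m" .
  moreover have "norm (exp (- (\<mu> * s)) *\<^sub>R S s (x - x')) \<le> 2 * K * norm (x - x')"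
    by (rule fwd.bound[OF s0])
  moreover have "m \<le> norm (exp (- (\<mu> * s)) *\<^sub>R ?D) + norm (exp (- (\<mu> * s)) *\<^sub>R S s (x - x'))"
  proof -
    have "m = norm (exp (- (\<mu> * s)) *\<^sub>R ?D + exp (- (\<mu> * s)) *\<^sub>R S s (x - x'))"
      unfolding scaleR_add_right[symmetric] by (simp add: m_def w_def)
    then show ?thesis using norm_triangle_ineq by metis
  qed
  ultimately have "m \<le> 4 * K * (norm (x - x') + \<delta> * norm b)" by (simp add: algebra_simps)
  moreover have "w t \<le> m" using s t by (auto simp: m_def)
  moreover have "norm (U t - U' t) = exp (\<mu> * t) * w t"
    unfolding w_def mult.assoc[symmetric] exp_add[symmetric] by simp
  ultimately show ?thesis by (simp add: mult_left_mono)
qed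

lemma mild_unique:
  assumes "mild_solution S (force \<zeta>) x U" "mild_solution S (force \<zeta>) x U'" "0 \<le> t"
  shows "U t = U' t"
  using mild_close[OF assms(1,2), of 0 t] assms(3) by simp

lemma mild_exists:
  assumes \<zeta>: "tempered \<zeta>"
  shows "\<exists>U. mild_solution S (force \<zeta>) x U"
proof -
  define g where "g r = (exp (- (\<mu> * r)) * \<zeta> r) *\<^sub>R b" for r
  obtain A where A: "\<And>s. exp (- (\<mu> * \<bar>s\<bar>)) * \<bar>\<zeta> s\<bar> \<le> A"
    using tempered_weighted_bounded[OF \<zeta> mu(2)] by blast
  have gb: "norm (g r) \<le> A * norm b" if "0 \<le> r" for r
    using mult_right_mono[OF A[of r], of "norm b"] that by (simp add: g_def abs_mult)
  have cz: "continuous_on UNIV \<zeta>" using \<zeta> by (simp add: tempered_def)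
  have gc: "continuous_on {0..} g"
    unfolding g_def by (intro continuous_intros continuous_on_subset[OF cz]) auto
  define \<Theta> where "\<Theta> t = exp (- (\<mu> * t)) *\<^sub>R S t x + flow.past g t" for t
  have \<Theta>c: "continuous_on {0..} \<Theta>"
    unfolding \<Theta>_def flow.past_def by (intro continuous_on_add fwd.cont fwd.past_continuous gc)
  have \<Theta>b: "norm (\<Theta> t) \<le> 2 * K * norm x + 2 * K * (A * norm b) / \<mu>" if "0 \<le> t" for t
    unfolding \<Theta>_def
    using norm_triangle_mono[OF fwd.bound[OF that, of x] flow.past_bound[OF gc gb that]] by simp
  obtain Z B where Z: "flow.solves \<Theta> Z" "continuous_on {0..} Z" "\<And>t. 0 \<le> t \<Longrightarrow> norm (Z t) \<le> B"
    by (rule flow.solution_exists[OF \<Theta>c \<Theta>b]) blast+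
  define U where "U t = exp (\<mu> * t) *\<^sub>R Z t" for t
  have Uc: "continuous_on {0..} U" unfolding U_def by (intro continuous_intros Z)
  have "((\<lambda>s. S (t - s) (force \<zeta> s (U s))) has_integral (U t - S t x)) {0..t}" if t: "0 \<le> t" for t
  proof -
    let ?h = "\<lambda>r. exp (- (\<mu> * r)) *\<^sub>R F (C (exp (\<mu> * r) *\<^sub>R Z r))"
    let ?V = "\<lambda>t x. exp (- (\<mu> * t)) *\<^sub>R S t x"
    have i1: "((\<lambda>r. ?V (t - r) (g r)) has_integral flow.past g t) {0..t}"
      unfolding flow.past_def by (rule integrable_integral[OF fwd.past_integrable[OF gc t]])
    have i2: "((\<lambda>r. ?V (t - r) (?h r)) has_integral flow.past ?h t) {0..t}"
      unfolding flow.past_def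
      using Z(1) t by (intro integrable_integral) (simp add: flow.solves_def flow.admissible_def)
    have Zt: "Z t = \<Theta> t + flow.past ?h t"
      using Z(1) t by (simp add: flow.solves_def flow.future_def)
    have "((\<lambda>r. exp (\<mu> * t) *\<^sub>R (?V (t - r) (g r) + ?V (t - r) (?h r))) has_integral
        exp (\<mu> * t) *\<^sub>R (flow.past g t + flow.past ?h t)) {0..t}"
      by (intro has_integral_cmul has_integral_add i1 i2)
    moreover have "exp (\<mu> * t) *\<^sub>R (flow.past g t + flow.past ?h t) = U t - S t x"
      by (simp add: U_def Zt \<Theta>_def scaleR_add_right exp_minus)
    ultimately have I: "((\<lambda>r. exp (\<mu> * t) *\<^sub>R (?V (t - r) (g r) + ?V (t - r) (?h r))) has_integral
        (U t - S t x)) {0..t}" by (simp only:)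
    have eq: "exp (\<mu> * t) *\<^sub>R (?V (t - r) (g r) + ?V (t - r) (?h r)) = S (t - r) (force \<zeta> r (U r))"
      if "r \<in> {0..t}" for r
    proof -
      have l: "linear (S (t - r))" by (rule bounded_linear.linear[OF S_linear]) (use that in simp)
      have "g r + ?h r = exp (- (\<mu> * r)) *\<^sub>R force \<zeta> r (U r)"
        by (simp add: g_def force_def U_def scaleR_add_right)
      moreover have "?V (t - r) (g r) + ?V (t - r) (?h r) = ?V (t - r) (g r + ?h r)"
        by (simp only: scaleR_add_right linear_add[OF l])
      ultimately have "?V (t - r) (g r) + ?V (t - r) (?h r)
          = (exp (- (\<mu> * (t - r))) * exp (- (\<mu> * r))) *\<^sub>R S (t - r) (force \<zeta> r (U r))"
        by (simp only: linear_scale[OF l] scaleR_scaleR)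
      then show ?thesis by (simp add: exp_add[symmetric] algebra_simps)
    qed
    show ?thesis by (rule has_integral_eq[OF eq I])
  qed
  then show ?thesis using Uc by (auto simp: mild_solution_def)
qed

definition flow_map :: "(real \<Rightarrow> real) \<Rightarrow> real \<Rightarrow> 'e \<Rightarrow> 'e" where
  "flow_map \<zeta> t x = (THE v. \<exists>U. mild_solution S (force \<zeta>) x U \<and> v = U t)"

lemma flow_map_eq:
  assumes "mild_solution S (force \<zeta>) x U" "0 \<le> t"
  shows "flow_map \<zeta> t x = U t"
  unfolding flow_map_def
proof (rule the_equality)
  show "\<exists>U'. mild_solution S (force \<zeta>) x U' \<and> U t = U' t" using assms(1) by blast
  fix v assume "\<exists>U'. mild_solution S (force \<zeta>) x U' \<and> v = U' t"
  then show "v = U t" using mild_unique[OF _ assms] by blast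
qed

lemma flow_map_mild:
  assumes "tempered \<zeta>"
  shows "mild_solution S (force \<zeta>) x (\<lambda>t. flow_map \<zeta> t x)"
proof -
  obtain U where U: "mild_solution S (force \<zeta>) x U" using mild_exists[OF assms] by blast
  have eq: "flow_map \<zeta> t x = U t" if "0 \<le> t" for t by (rule flow_map_eq[OF U that])
  have "continuous_on {0..} (\<lambda>t. flow_map \<zeta> t x)"
    using U by (subst continuous_on_cong[OF refl eq]) (auto simp: mild_solution_def)
  moreover have "((\<lambda>s. S (t - s) (force \<zeta> s (flow_map \<zeta> s x))) has_integral (flow_map \<zeta> t x - S t x)) {0..t}"
    if "0 \<le> t" for t
    unfolding eq[OF that]
    by (rule has_integral_eq[of _ "\<lambda>s. S (t - s) (force \<zeta> s (U s))"])
      (use U that in \<open>auto simp: eq mild_solution_def\<close>)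
  ultimately show ?thesis by (simp add: mild_solution_def)
qed

lemma flow_map_lipschitz:
  assumes "tempered \<zeta>" "tempered \<zeta>'" "\<And>s. 0 \<le> s \<Longrightarrow> \<bar>\<zeta> s - \<zeta>' s\<bar> \<le> \<delta> * exp (\<mu> * s)" "0 \<le> t"
  shows "norm (flow_map \<zeta> t x - flow_map \<zeta>' t x') \<le> exp (\<mu> * t) * (4 * K * (norm (x - x') + \<delta> * norm b))"
  by (rule mild_close[OF flow_map_mild[OF assms(1)] flow_map_mild[OF assms(2)] assms(3,4)])

lemma flow_map_0: "tempered \<zeta> \<Longrightarrow> flow_map \<zeta> 0 x = x"
proof -
  assume "tempered \<zeta>"
  from flow_map_mild[OF this, of x]
  have "((\<lambda>s. S (0 - s) (force \<zeta> s (flow_map \<zeta> s x))) has_integral (flow_map \<zeta> 0 x - S 0 x)) {0..0}"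
    unfolding mild_solution_def by blast
  then show ?thesis
    using has_integral_unique[OF _ has_integral_refl(2)] by (fastforce simp: S_def split)
qed

lemma S_semigroup: "0 \<le> s \<Longrightarrow> 0 \<le> t \<Longrightarrow> S (s + t) x = S s (S t x)"
  by (simp add: S_def R_group T_semigroup RT TR linear_add[OF bounded_linear.linear[OF R_linear]]
      linear_add[OF bounded_linear.linear[OF T_linear]])

text \<open>The shifted orbit is a mild solution for the shifted path: subtract from the variation of constants
  formula on \<open>[0, t + s]\<close> the image under \<open>S t\<close> of the formula on \<open>[0, s]\<close>.\<close>

lemma flow_map_cocycle:
  assumes \<zeta>: "tempered \<zeta>" and t: "0 \<le> t" and s: "0 \<le> s"
  shows "flow_map \<zeta> (t + s) x = flow_map (\<lambda>r. \<zeta> (s + r)) t (flow_map \<zeta> s x)"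
proof (rule flow_map_eq[where U = "\<lambda>t. flow_map \<zeta> (t + s) x", OF _ t, symmetric])
  let ?U = "\<lambda>t. flow_map \<zeta> t x"
  have M: "continuous_on {0..} ?U"
    "\<And>t. 0 \<le> t \<Longrightarrow> ((\<lambda>r. S (t - r) (force \<zeta> r (?U r))) has_integral (?U t - S t x)) {0..t}"
    using flow_map_mild[OF \<zeta>, of x] by (auto simp: mild_solution_def)
  have "((\<lambda>r. S (u - r) (force (\<lambda>r. \<zeta> (s + r)) r (?U (r + s)))) has_integral (?U (u + s) - S u (?U s))) {0..u}"
    if u: "0 \<le> u" for u
  proof -
    define f where "f r = S (u + s - r) (force \<zeta> r (?U r))" for r
    have f1: "(f has_integral (?U (u + s) - S (u + s) x)) {0..u + s}"
      unfolding f_def using M(2)[of "u + s"] u s by simp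
    have "((\<lambda>r. S u (S (s - r) (force \<zeta> r (?U r)))) has_integral S u (?U s - S s x)) {0..s}"
      using has_integral_linear[OF M(2)[OF s] S_linear[OF u]] by (simp add: o_def)
    moreover have "S u (S (s - r) y) = S (u + s - r) y" if "r \<in> {0..s}" for r y
      using S_semigroup[of u "s - r" y] u that by (simp add: add_diff_eq)
    ultimately have f2: "(f has_integral S u (?U s - S s x)) {0..s}"
      unfolding f_def by (rule has_integral_eq[rotated])
    have "f integrable_on {s..u + s}"
      by (rule integrable_subinterval_real[OF has_integral_integrable[OF f1]]) (use s in auto)
    then have "(f has_integral (?U (u + s) - S (u + s) x - S u (?U s - S s x))) {s..u + s}"
      using has_integral_combine[OF s _ f2 integrable_integral] u has_integral_unique[OF f1]
      by (metis (no_types, lifting) add_diff_cancel_left' integrable_integral le_add_same_cancel2)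
    from has_integral_translate_Icc[OF this, of s]
    have I: "((\<lambda>r. f (s + r)) has_integral (?U (u + s) - S (u + s) x - S u (?U s - S s x))) {0..u}" by simp
    have "S (u + s) x + S u (?U s - S s x) = S u (?U s)"
      by (simp add: S_semigroup[OF u s] linear_diff[OF bounded_linear.linear[OF S_linear[OF u]]])
    then have "?U (u + s) - S (u + s) x - S u (?U s - S s x) = ?U (u + s) - S u (?U s)"
      by (metis diff_diff_eq)
    from I[unfolded this] show ?thesis
      by (simp add: f_def force_def add.commute)
  qed
  moreover have "continuous_on {0..} (\<lambda>t. ?U (t + s))"
    by (rule continuous_on_compose2[OF M(1)]) (use s in \<open>auto intro!: continuous_intros\<close>)
  ultimately show "mild_solution S (force (\<lambda>r. \<zeta> (s + r))) (flow_map \<zeta> s x) (\<lambda>t. ?U (t + s))"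
    by (simp add: mild_solution_def)
qed

subsection \<open>Orbits on the negative half-line\<close>

text \<open>Orbits on \<open>(-\<infinity>, 0]\<close> are parametrised by \<open>t = -s \<ge> 0\<close> and weighted by \<open>e\<^sup>\<eta>\<^sup>t\<close>, so that growth at most
  \<open>e\<^sup>\<eta>\<^sup>s\<close> becomes boundedness. Time reversal exchanges the roles of the two parts: the slow group is
  integrated over the reversed past \<open>[0, t]\<close>, that is from time \<open>-t\<close> to \<open>0\<close>, and the fast semigroup
  over the whole history before \<open>-t\<close>.\<close>

sublocale unstable: decaying_family "\<lambda>t x. exp (\<eta> * t) *\<^sub>R R (- t) x" K "\<alpha> - \<eta>"
proof (rule decaying_family.intro)
  fix t :: real and x :: 'e
  show "bounded_linear (\<lambda>x. exp (\<eta> * t) *\<^sub>R R (- t) x)"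
    using bounded_linear_compose[OF bounded_linear_scaleR_right R_linear] .
  have "continuous_on {0..} (\<lambda>t. R (- t) x)"
    by (rule continuous_on_compose2[OF R_cont]) (auto intro!: continuous_intros)
  then show "continuous_on {0..} (\<lambda>t. exp (\<eta> * t) *\<^sub>R R (- t) x)"
    by (intro continuous_intros)
  assume t: "0 \<le> t"
  have "norm (exp (\<eta> * t) *\<^sub>R R (- t) x) \<le> exp (\<eta> * t) * (K * exp (\<alpha> * - t) * norm x)"
    using R_backward[of "- t" x] t by simp
  also have "\<dots> = K * (exp (\<eta> * t) * exp (\<alpha> * - t)) * norm x" by simp
  also have "exp (\<eta> * t) * exp (\<alpha> * - t) = exp (- ((\<alpha> - \<eta>) * t))"
    by (simp add: exp_add[symmetric] algebra_simps)
  finally show "norm (exp (\<eta> * t) *\<^sub>R R (- t) x) \<le> K * exp (- ((\<alpha> - \<eta>) * t)) * norm x" .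
qed (use const_nonneg rates in auto)

sublocale stable: decaying_family "\<lambda>t x. exp (- (\<eta> * t)) *\<^sub>R T t x" K "\<eta> - \<beta>"
proof (rule decaying_family.intro)
  fix t :: real and x :: 'e
  show "bounded_linear (\<lambda>x. exp (- (\<eta> * t)) *\<^sub>R T t x)" if "0 \<le> t"
    using bounded_linear_compose[OF bounded_linear_scaleR_right T_linear[OF that]] .
  show "continuous_on {0..} (\<lambda>t. exp (- (\<eta> * t)) *\<^sub>R T t x)"
    by (intro continuous_intros T_cont)
  assume t: "0 \<le> t"
  have "norm (exp (- (\<eta> * t)) *\<^sub>R T t x) \<le> exp (- (\<eta> * t)) * (K * exp (\<beta> * t) * norm x)"
    using T_decay[OF t, of x] by simp
  also have "\<dots> = K * (exp (- (\<eta> * t)) * exp (\<beta> * t)) * norm x" by simp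
  also have "exp (- (\<eta> * t)) * exp (\<beta> * t) = exp (- ((\<eta> - \<beta>) * t))"
    by (simp add: exp_add[symmetric] algebra_simps)
  finally show "norm (exp (- (\<eta> * t)) *\<^sub>R T t x) \<le> K * exp (- ((\<eta> - \<beta>) * t)) * norm x" .
qed (use const_nonneg rates in auto)

lemma weighted_F_lip:
  "norm (- (exp (\<eta> * t) *\<^sub>R F (exp (- (\<eta> * t)) *\<^sub>R x)) - - (exp (\<eta> * t) *\<^sub>R F (exp (- (\<eta> * t)) *\<^sub>R y)))
    \<le> L * norm (x - y)"
proof -
  have "norm (F (exp (- (\<eta> * t)) *\<^sub>R x) - F (exp (- (\<eta> * t)) *\<^sub>R y)) \<le> L * (exp (- (\<eta> * t)) * norm (x - y))"
    using F_lip[of "exp (- (\<eta> * t)) *\<^sub>R x" "exp (- (\<eta> * t)) *\<^sub>R y"]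
    by (simp add: scaleR_diff_right[symmetric])
  from mult_left_mono[OF this, of "exp (\<eta> * t)"]
  have "norm (exp (\<eta> * t) *\<^sub>R (F (exp (- (\<eta> * t)) *\<^sub>R x) - F (exp (- (\<eta> * t)) *\<^sub>R y)))
      \<le> (exp (\<eta> * t) * exp (- (\<eta> * t))) * (L * norm (x - y))"
    by (simp add: mult_ac)
  then show ?thesis by (simp add: exp_add[symmetric] scaleR_diff_right norm_minus_commute)
qed

text \<open>The minus sign in the nonlinearity is the Jacobian of the time reversal; it also makes the
  history integral of the fast part appear with the sign of a future term.\<close>

sublocale past_orbit: lyapunov_perron "\<lambda>t x. exp (\<eta> * t) *\<^sub>R R (- t) x" "\<lambda>t x. exp (- (\<eta> * t)) *\<^sub>R T t x"
  K "\<alpha> - \<eta>" "\<eta> - \<beta>" C "\<lambda>t z. - (exp (\<eta> * t) *\<^sub>R F (exp (- (\<eta> * t)) *\<^sub>R z))" L l l "norm (F 0)"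
proof (rule lyapunov_perron.intro[OF unstable.decaying_family_axioms stable.decaying_family_axioms lyapunov_perron_axioms.intro])
  show "bounded_linear C" by (rule C)
  show "continuous_on ({0..} \<times> UNIV) (\<lambda>(t, x). - (exp (\<eta> * t) *\<^sub>R F (exp (- (\<eta> * t)) *\<^sub>R x)))"
  proof -
    have z: "continuous_on ({0..} \<times> UNIV) (\<lambda>p :: real \<times> 'x. exp (- (\<eta> * fst p)) *\<^sub>R snd p)"
      by (intro continuous_intros)
    show ?thesis unfolding case_prod_beta
      by (intro continuous_on_minus continuous_on_scaleR continuous_on_compose2[OF F_continuous z])
        (auto intro!: continuous_intros)
  qed
  fix t s :: real and x y :: 'x
  show "norm (- (exp (\<eta> * t) *\<^sub>R F (exp (- (\<eta> * t)) *\<^sub>R x)) - - (exp (\<eta> * t) *\<^sub>R F (exp (- (\<eta> * t)) *\<^sub>R y)))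
    \<le> L * norm (x - y)" by (rule weighted_F_lip)
  show "norm (- (exp (\<eta> * t) *\<^sub>R F (exp (- (\<eta> * t)) *\<^sub>R 0))) \<le> norm (F 0)" if "0 \<le> t"
    using that rates by (simp add: mult_left_le_one_le mult_nonpos_nonneg)
  let ?p = "exp (- (\<eta> * t)) *\<^sub>R x" and ?q = "exp (- (\<eta> * t)) *\<^sub>R y"
  have E: "- (exp (\<eta> * t) *\<^sub>R F ?p) - - (exp (\<eta> * t) *\<^sub>R F ?q) = - (exp (\<eta> * t) *\<^sub>R (F ?p - F ?q))"
    by (simp add: scaleR_diff_right)
  have pq: "exp (\<eta> * t) * norm (?p - ?q) = norm (x - y)"
    by (simp add: scaleR_diff_right[symmetric] mult.assoc[symmetric] exp_add[symmetric])
  have Cneg: "C (- v) = - C v" for v using C by (simp add: linear_neg bounded_linear.linear)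
  assume s: "0 \<le> s" and t: "0 \<le> t"
  have lR: "R (- s) (- (exp (\<eta> * t) *\<^sub>R v)) = - (exp (\<eta> * t) *\<^sub>R R (- s) v)" for v
    by (simp add: linear_neg linear_scale bounded_linear.linear[OF R_linear])
  have "norm (C (exp (\<eta> * s) *\<^sub>R R (- s) (- (exp (\<eta> * t) *\<^sub>R (F ?p - F ?q)))))
      = exp (\<eta> * s) * (exp (\<eta> * t) * norm (C (R (- s) (F ?p - F ?q))))"
    unfolding lR by (simp add: Cneg C_scaleR)
  also have "\<dots> \<le> exp (\<eta> * s) * (exp (\<eta> * t) * (l * exp (\<alpha> * - s) * norm (?p - ?q)))"
    by (intro mult_left_mono obs_R) (use s in auto)
  also have "\<dots> = l * (exp (\<eta> * s) * exp (\<alpha> * - s)) * norm (x - y)"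
    unfolding pq[symmetric] by (simp only: mult_ac)
  also have "exp (\<eta> * s) * exp (\<alpha> * - s) = exp (- ((\<alpha> - \<eta>) * s))"
    by (simp add: exp_add[symmetric] algebra_simps)
  finally show "norm (C (exp (\<eta> * s) *\<^sub>R R (- s) (- (exp (\<eta> * t) *\<^sub>R F ?p) - - (exp (\<eta> * t) *\<^sub>R F ?q))))
      \<le> l * exp (- ((\<alpha> - \<eta>) * s)) * norm (x - y)" unfolding E .
  have lT: "T s (- (exp (\<eta> * t) *\<^sub>R v)) = - (exp (\<eta> * t) *\<^sub>R T s v)" for v
    by (simp add: linear_neg linear_scale bounded_linear.linear[OF T_linear[OF s]])
  have "norm (C (exp (- (\<eta> * s)) *\<^sub>R T s (- (exp (\<eta> * t) *\<^sub>R (F ?p - F ?q)))))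
      = exp (- (\<eta> * s)) * (exp (\<eta> * t) * norm (C (T s (F ?p - F ?q))))"
    unfolding lT by (simp add: Cneg C_scaleR)
  also have "\<dots> \<le> exp (- (\<eta> * s)) * (exp (\<eta> * t) * (l * exp (\<beta> * s) * norm (?p - ?q)))"
    by (intro mult_left_mono obs_T) (use s in auto)
  also have "\<dots> = l * (exp (- (\<eta> * s)) * exp (\<beta> * s)) * norm (x - y)"
    unfolding pq[symmetric] by (simp only: mult_ac)
  also have "exp (- (\<eta> * s)) * exp (\<beta> * s) = exp (- ((\<eta> - \<beta>) * s))"
    by (simp add: exp_add[symmetric] algebra_simps)
  finally show "norm (C (exp (- (\<eta> * s)) *\<^sub>R T s (- (exp (\<eta> * t) *\<^sub>R F ?p) - - (exp (\<eta> * t) *\<^sub>R F ?q))))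
      \<le> l * exp (- ((\<eta> - \<beta>) * s)) * norm (x - y)" unfolding E .
qed (use const_nonneg gap_condition in auto)

definition noise :: "(real \<Rightarrow> real) \<Rightarrow> real \<Rightarrow> 'e" where
  "noise \<zeta> r = - ((exp (\<eta> * r) * \<zeta> (- r)) *\<^sub>R b)"

text \<open>The inhomogeneity of the Lyapunov--Perron equation: the linear slow orbit through \<open>\<xi>\<close> together with
  the response to the noise, which does not depend on the solution.\<close>

definition driver :: "(real \<Rightarrow> real) \<Rightarrow> 'e \<Rightarrow> real \<Rightarrow> 'e" where
  "driver \<zeta> \<xi> t = exp (\<eta> * t) *\<^sub>R R (- t) \<xi> + past_orbit.past (noise \<zeta>) t - past_orbit.future (noise \<zeta>) t"

definition weighted_force :: "(real \<Rightarrow> real) \<Rightarrow> (real \<Rightarrow> 'e) \<Rightarrow> real \<Rightarrow> 'e" where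
  "weighted_force \<zeta> Z r = - (exp (\<eta> * r) *\<^sub>R force \<zeta> (- r) (exp (- (\<eta> * r)) *\<^sub>R Z r))"

text \<open>Weighted and time-reversed orbits with slow part \<open>\<xi>\<close> at time \<open>0\<close> whose observation grows at most
  like \<open>e\<^sup>\<eta>\<^sup>s\<close>.\<close>

definition backward_orbit :: "(real \<Rightarrow> real) \<Rightarrow> 'e \<Rightarrow> (real \<Rightarrow> 'e) \<Rightarrow> bool" where
  "backward_orbit \<zeta> \<xi> Z \<longleftrightarrow> past_orbit.solves (driver \<zeta> \<xi>) Z \<and> (\<exists>B. \<forall>t\<ge>0. norm (C (Z t)) \<le> B)"

definition orbit :: "(real \<Rightarrow> real) \<Rightarrow> 'e \<Rightarrow> real \<Rightarrow> 'e" where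
  "orbit \<zeta> \<xi> = (SOME Z. backward_orbit \<zeta> \<xi> Z)"

definition graph_map :: "(real \<Rightarrow> real) \<Rightarrow> 'e \<Rightarrow> 'e" where
  "graph_map \<zeta> \<xi> = orbit \<zeta> \<xi> 0 - R 0 \<xi>"

lemma noise_admissible:
  assumes "tempered \<zeta>"
  shows "continuous_on {0..} (noise \<zeta>)" "\<exists>B. \<forall>r\<ge>0. norm (noise \<zeta> r) \<le> B" "past_orbit.admissible (noise \<zeta>)"
proof -
  have cz: "continuous_on {0..} (\<lambda>r. \<zeta> (- r))"
  proof (rule continuous_on_compose2[of UNIV \<zeta>])
    show "continuous_on UNIV \<zeta>" using assms by (simp add: tempered_def)
  qed (auto intro: continuous_on_minus continuous_on_id)
  show c: "continuous_on {0..} (noise \<zeta>)"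
    unfolding noise_def by (intro continuous_intros cz)
  have "0 < - \<eta>" using rates by simp
  then obtain A where A: "\<And>s. exp (- (- \<eta> * \<bar>s\<bar>)) * \<bar>\<zeta> s\<bar> \<le> A"
    using tempered_weighted_bounded[OF assms] by blast
  have B: "norm (noise \<zeta> r) \<le> A * norm b" if "0 \<le> r" for r
    using mult_right_mono[OF A[of "- r"], of "norm b"] that by (simp add: noise_def abs_mult)
  then show "\<exists>B. \<forall>r\<ge>0. norm (noise \<zeta> r) \<le> B" by blast
  show "past_orbit.admissible (noise \<zeta>)" by (rule past_orbit.admissible_continuous[OF c B])
qed

lemma orbit_properties:
  assumes "tempered \<zeta>"
  shows "past_orbit.solves (driver \<zeta> \<xi>) (orbit \<zeta> \<xi>)" "\<exists>B. \<forall>t\<ge>0. norm (C (orbit \<zeta> \<xi> t)) \<le> B"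
proof -
  obtain B where B: "\<And>r. 0 \<le> r \<Longrightarrow> norm (noise \<zeta> r) \<le> B" using noise_admissible(2)[OF assms] by blast
  note c = noise_admissible(1)[OF assms]
  have cd: "continuous_on {0..} (driver \<zeta> \<xi>)"
    unfolding driver_def past_orbit.past_def past_orbit.future_def
    by (intro continuous_on_add continuous_on_diff unstable.cont unstable.past_continuous stable.future_continuous[OF c B] c)
  have bd: "norm (C (driver \<zeta> \<xi> t)) \<le> onorm C * (K * norm \<xi> + K * B / (\<alpha> - \<eta>) + K * B / (\<eta> - \<beta>))" if t: "0 \<le> t" for t
  proof -
    have "norm (driver \<zeta> \<xi> t) \<le> K * norm \<xi> + K * B / (\<alpha> - \<eta>) + K * B / (\<eta> - \<beta>)"
      unfolding driver_def
      by (rule order_trans[OF norm_triangle_ineq4 add_mono[OF norm_triangle_mono[OF unstable.bound[OF t] past_orbit.past_bound[OF c B t]]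
            past_orbit.future_bound[OF c B t]]])
    then show ?thesis using order_trans[OF onorm[OF C] mult_left_mono[OF _ onorm_nonneg]] by blast
  qed
  obtain Z B' where "past_orbit.solves (driver \<zeta> \<xi>) Z" "continuous_on {0..} Z" "\<And>t. 0 \<le> t \<Longrightarrow> norm (C (Z t)) \<le> B'"
    by (rule past_orbit.solution_exists[OF cd bd]) blast+
  then have "backward_orbit \<zeta> \<xi> Z" by (auto simp: backward_orbit_def)
  then have "backward_orbit \<zeta> \<xi> (orbit \<zeta> \<xi>)"
    unfolding orbit_def by (rule someI[of "backward_orbit \<zeta> \<xi>"])
  then show "past_orbit.solves (driver \<zeta> \<xi>) (orbit \<zeta> \<xi>)" "\<exists>B. \<forall>t\<ge>0. norm (C (orbit \<zeta> \<xi> t)) \<le> B"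
    by (simp_all add: backward_orbit_def)
qed

lemma weighted_force_eq:
  "weighted_force \<zeta> Z = (\<lambda>r. noise \<zeta> r + - (exp (\<eta> * r) *\<^sub>R F (exp (- (\<eta> * r)) *\<^sub>R C (Z r))))"
  by (rule ext) (simp add: weighted_force_def noise_def force_def C_scaleR scaleR_add_right)

text \<open>Noise and nonlinearity may be recombined into the total force along \<open>Z\<close>. The perturbation \<open>d\<close> is
  included because the glued function of the tracking argument satisfies the equation only up to such
  a term.\<close>

lemma solves_driver_iff:
  assumes "tempered \<zeta>"
  shows "past_orbit.solves (\<lambda>t. driver \<zeta> \<xi> t + d t) Z \<longleftrightarrow> past_orbit.admissible (weighted_force \<zeta> Z) \<and>
    (\<forall>t\<ge>0. Z t = exp (\<eta> * t) *\<^sub>R R (- t) \<xi> + d t + past_orbit.past (weighted_force \<zeta> Z) t - past_orbit.future (weighted_force \<zeta> Z) t)"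
proof -
  let ?N = "\<lambda>r. - (exp (\<eta> * r) *\<^sub>R F (exp (- (\<eta> * r)) *\<^sub>R C (Z r)))"
  note na = noise_admissible(3)[OF assms]
  have adm: "past_orbit.admissible ?N \<longleftrightarrow> past_orbit.admissible (weighted_force \<zeta> Z)"
    unfolding weighted_force_eq
    using past_orbit.past_future_add(1)[OF na, of ?N] past_orbit.admissible_diff[OF _ na, of "\<lambda>r. noise \<zeta> r + ?N r"] by auto
  have "driver \<zeta> \<xi> t + d t + past_orbit.past ?N t - past_orbit.future ?N t
      = exp (\<eta> * t) *\<^sub>R R (- t) \<xi> + d t + past_orbit.past (weighted_force \<zeta> Z) t - past_orbit.future (weighted_force \<zeta> Z) t"
    if "past_orbit.admissible ?N" "0 \<le> t" for t
    unfolding weighted_force_eq past_orbit.past_future_add(2,3)[OF na that] driver_def by simp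
  then show ?thesis unfolding past_orbit.solves_def adm[symmetric] by auto
qed

lemma orbit_formula:
  assumes "tempered \<zeta>"
  shows "past_orbit.admissible (weighted_force \<zeta> (orbit \<zeta> \<xi>))"
    "0 \<le> t \<Longrightarrow> orbit \<zeta> \<xi> t = exp (\<eta> * t) *\<^sub>R R (- t) \<xi> + past_orbit.past (weighted_force \<zeta> (orbit \<zeta> \<xi>)) t
      - past_orbit.future (weighted_force \<zeta> (orbit \<zeta> \<xi>)) t"
  using orbit_properties(1)[OF assms, of \<xi>] solves_driver_iff[OF assms, of \<xi> "\<lambda>_. 0" "orbit \<zeta> \<xi>"] by auto

text \<open>At time \<open>0\<close> the past integral is empty, so the graph map is the history integral of the fast part
  alone.\<close>

lemma graph_map_future:
  assumes "tempered \<zeta>"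
  shows "graph_map \<zeta> \<xi> = - past_orbit.future (weighted_force \<zeta> (orbit \<zeta> \<xi>)) 0"
  using orbit_formula(2)[OF assms, of 0 \<xi>] by (simp add: graph_map_def past_orbit.past_def)

lemma R_graph_map:
  assumes "tempered \<zeta>"
  shows "R s (graph_map \<zeta> \<xi>) = 0"
proof -
  let ?g = "weighted_force \<zeta> (orbit \<zeta> \<xi>)"
  have i: "(\<lambda>r. exp (- (\<eta> * r)) *\<^sub>R T r (?g (0 + r))) integrable_on {0..}"
    using orbit_formula(1)[OF assms, of \<xi>] unfolding past_orbit.admissible_def by (metis order_refl)
  have "R s (past_orbit.future ?g 0) = integral {0..} (\<lambda>r. R s (exp (- (\<eta> * r)) *\<^sub>R T r (?g (0 + r))))"
    unfolding past_orbit.future_def using integral_linear[OF i R_linear[of s]] by (simp add: o_def)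
  also have "\<dots> = integral {0..} (\<lambda>r :: real. 0 :: 'e)"
    by (rule Henstock_Kurzweil_Integration.integral_cong) (simp add: linear_scale bounded_linear.linear[OF R_linear] RT)
  finally show ?thesis
    by (simp add: graph_map_future[OF assms] linear_neg bounded_linear.linear[OF R_linear])
qed

text \<open>The factor by which a perturbation of the driver is amplified in the orbit; it combines the two
  estimates of \<open>solutions_close\<close>.\<close>

definition \<Lambda> :: real where "\<Lambda> = 1 + (K * L / (\<alpha> - \<eta>) + K * L / (\<eta> - \<beta>)) * onorm C / (1 - (l / (\<alpha> - \<eta>) + l / (\<eta> - \<beta>)))"

lemma \<Lambda>_ge_1: "1 \<le> \<Lambda>"
  unfolding \<Lambda>_def using const_nonneg rates gap_condition onorm_nonneg by simp

text \<open>The quantitative form of uniqueness. All regularity of the graph map and the tracking estimate are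
  instances of it, with different perturbations of the driver.\<close>

lemma orbit_perturbation:
  assumes \<zeta>: "tempered \<zeta>" and Z: "past_orbit.solves \<Theta> Z" and ZB: "\<And>t. 0 \<le> t \<Longrightarrow> norm (C (Z t)) \<le> B"
    and d: "\<And>t. 0 \<le> t \<Longrightarrow> norm (\<Theta> t - driver \<zeta> \<xi> t) \<le> \<delta>"
  shows "norm (Z 0 - orbit \<zeta> \<xi> 0) \<le> \<Lambda> * \<delta>"
proof -
  obtain B' where B': "\<And>t. 0 \<le> t \<Longrightarrow> norm (C (orbit \<zeta> \<xi> t)) \<le> B'" using orbit_properties(2)[OF \<zeta>] by blast
  have "norm (C (Z t) - C (orbit \<zeta> \<xi> t)) \<le> B + B'" if "0 \<le> t" for t
    by (rule order_trans[OF norm_triangle_ineq4 add_mono[OF ZB[OF that] B'[OF that]]])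
  moreover have "norm (C (\<Theta> t - driver \<zeta> \<xi> t)) \<le> onorm C * \<delta>" if "0 \<le> t" for t
    by (rule order_trans[OF onorm[OF C] mult_left_mono[OF d[OF that] onorm_nonneg]])
  ultimately have "norm (Z 0 - orbit \<zeta> \<xi> 0 - (\<Theta> 0 - driver \<zeta> \<xi> 0))
      \<le> (K * L / (\<alpha> - \<eta>) + K * L / (\<eta> - \<beta>)) * (onorm C * \<delta> / (1 - past_orbit.\<kappa>))"
    by (rule past_orbit.solutions_close(2)[OF Z orbit_properties(1)[OF \<zeta>]]) auto
  moreover define X q where "X = K * L / (\<alpha> - \<eta>) + K * L / (\<eta> - \<beta>)" and "q = 1 - past_orbit.\<kappa>"
  moreover have "\<Lambda> = 1 + X * onorm C / q" by (simp only: \<Lambda>_def X_def q_def)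
  then have "\<Lambda> * \<delta> = \<delta> + X * (onorm C * \<delta> / q)" by (simp add: algebra_simps)
  ultimately show ?thesis
    using norm_triangle_ineq[of "Z 0 - orbit \<zeta> \<xi> 0 - (\<Theta> 0 - driver \<zeta> \<xi> 0)" "\<Theta> 0 - driver \<zeta> \<xi> 0"] d[of 0]
    by simp
qed

lemma graph_map_lipschitz:
  assumes "tempered \<zeta>"
  shows "norm (graph_map \<zeta> \<xi> - graph_map \<zeta> \<xi>') \<le> (\<Lambda> * K + K) * norm (\<xi> - \<xi>')"
proof -
  obtain B where B: "\<And>t. 0 \<le> t \<Longrightarrow> norm (C (orbit \<zeta> \<xi> t)) \<le> B" using orbit_properties(2)[OF assms] by blast
  have "norm (driver \<zeta> \<xi> t - driver \<zeta> \<xi>' t) \<le> K * norm (\<xi> - \<xi>')" if "0 \<le> t" for t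
    using unstable.bound[OF that, of "\<xi> - \<xi>'"]
    by (simp add: driver_def linear_diff[OF bounded_linear.linear[OF R_linear]] scaleR_diff_right)
  from orbit_perturbation[OF assms orbit_properties(1)[OF assms] B this]
  have "norm (orbit \<zeta> \<xi> 0 - orbit \<zeta> \<xi>' 0) \<le> \<Lambda> * (K * norm (\<xi> - \<xi>'))" by auto
  moreover have "norm (R 0 (\<xi> - \<xi>')) \<le> K * norm (\<xi> - \<xi>')" using R_forward[of 0] by simp
  moreover have eq: "graph_map \<zeta> \<xi> - graph_map \<zeta> \<xi>' = (orbit \<zeta> \<xi> 0 - orbit \<zeta> \<xi>' 0) - R 0 (\<xi> - \<xi>')"
    by (simp add: graph_map_def linear_diff[OF bounded_linear.linear[OF R_linear]])
  ultimately show ?thesis unfolding eq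
    using norm_triangle_ineq4[of "orbit \<zeta> \<xi> 0 - orbit \<zeta> \<xi>' 0" "R 0 (\<xi> - \<xi>')"]
    unfolding distrib_right by linarith
qed

lemma graph_map_path_lipschitz:
  assumes \<zeta>: "tempered \<zeta>" "tempered \<zeta>'" and \<delta>: "\<And>s. s \<le> 0 \<Longrightarrow> \<bar>\<zeta> s - \<zeta>' s\<bar> \<le> \<delta> * exp (\<eta> * s)"
  shows "norm (graph_map \<zeta> \<xi> - graph_map \<zeta>' \<xi>) \<le> \<Lambda> * (K * (\<delta> * norm b) / (\<alpha> - \<eta>) + K * (\<delta> * norm b) / (\<eta> - \<beta>))"
proof -
  obtain B where B: "\<And>t. 0 \<le> t \<Longrightarrow> norm (C (orbit \<zeta> \<xi> t)) \<le> B" using orbit_properties(2)[OF \<zeta>(1)] by blast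
  let ?n = "\<lambda>r. noise \<zeta> r - noise \<zeta>' r"
  have c: "continuous_on {0..} ?n" by (intro continuous_on_diff noise_admissible \<zeta>)
  have n: "norm (?n r) \<le> \<delta> * norm b" if "0 \<le> r" for r
  proof -
    have "?n r = - ((exp (\<eta> * r) * (\<zeta> (- r) - \<zeta>' (- r))) *\<^sub>R b)" by (simp add: noise_def algebra_simps)
    moreover have le: "exp (\<eta> * r) * \<bar>\<zeta> (- r) - \<zeta>' (- r)\<bar> \<le> exp (\<eta> * r) * (\<delta> * exp (\<eta> * - r))"
      by (rule mult_left_mono[OF \<delta>]) (use that in auto)
    moreover have "exp (\<eta> * r) * (\<delta> * exp (\<eta> * - r)) = \<delta>" by (simp add: exp_minus)
    with le have le: "exp (\<eta> * r) * \<bar>\<zeta> (- r) - \<zeta>' (- r)\<bar> \<le> \<delta>" by linarith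
    ultimately have eq: "norm (?n r) = (exp (\<eta> * r) * \<bar>\<zeta> (- r) - \<zeta>' (- r)\<bar>) * norm b"
      by (simp add: abs_mult)
    show ?thesis unfolding eq by (intro mult_right_mono le) auto
  qed
  have "norm (driver \<zeta> \<xi> t - driver \<zeta>' \<xi> t) \<le> K * (\<delta> * norm b) / (\<alpha> - \<eta>) + K * (\<delta> * norm b) / (\<eta> - \<beta>)"
    if t: "0 \<le> t" for t
  proof -
    note D = past_orbit.past_future_diff(1,2)[OF noise_admissible(3)[OF \<zeta>(1)] noise_admissible(3)[OF \<zeta>(2)] t]
    have "driver \<zeta> \<xi> t - driver \<zeta>' \<xi> t = (past_orbit.past (noise \<zeta>) t - past_orbit.past (noise \<zeta>') t)
        - (past_orbit.future (noise \<zeta>) t - past_orbit.future (noise \<zeta>') t)"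
      by (simp add: driver_def)
    also have "\<dots> = past_orbit.past ?n t - past_orbit.future ?n t"
      unfolding D by (simp add: past_orbit.past_def past_orbit.future_def)
    finally show ?thesis
      using order_trans[OF norm_triangle_ineq4 add_mono[OF past_orbit.past_bound[OF c n t] past_orbit.future_bound[OF c n t]]] by simp
  qed
  from orbit_perturbation[OF \<zeta>(2) orbit_properties(1)[OF \<zeta>(1)] B this]
  show ?thesis by (simp add: graph_map_def)
qed

subsection \<open>Exponential tracking\<close>

text \<open>Follow the orbit \<open>U\<close> of \<open>x\<close> up to time \<open>t\<close> and look back from there: for \<open>\<tau> \<le> t\<close> the history is
  \<open>U(t - \<tau>)\<close>, and beyond that let it continue with the backward orbit \<open>Z\<close> that ends at time \<open>0\<close> with the
  slow part of \<open>x\<close>. The slow parts fit together, while the fast parts jump at the gluing time by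
  \<open>D = x - R 0 x - graph_map \<zeta> (R 0 x)\<close>. Inserting this history into the Lyapunov--Perron equation
  leaves the error \<open>T(t - \<tau>) D\<close> for \<open>\<tau> \<le> t\<close>, of weighted size \<open>K e\<^sup>\<eta>\<^sup>t |D|\<close>.\<close>

lemma exponential_tracking:
  fixes x :: 'e
  assumes \<zeta>: "tempered \<zeta>" and t: "0 \<le> t"
  defines "\<xi> \<equiv> R 0 (flow_map \<zeta> t x)"
  shows "norm (flow_map \<zeta> t x - (\<xi> + graph_map (\<lambda>s. \<zeta> (t + s)) \<xi>))
    \<le> \<Lambda> * (K * exp (\<eta> * t) * norm (x - R 0 x - graph_map \<zeta> (R 0 x)))"
proof -
  define \<zeta>' where "\<zeta>' = (\<lambda>s. \<zeta> (t + s))"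
  have \<zeta>': "tempered \<zeta>'" unfolding \<zeta>'_def by (rule tempered_shift[OF \<zeta>])
  define U where "U s = flow_map \<zeta> s x" for s
  define G where "G r = force \<zeta> r (U r)" for r
  define Z where "Z = orbit \<zeta> (R 0 x)"
  define H where "H = weighted_force \<zeta> Z"
  define h where "h = graph_map \<zeta> (R 0 x)"
  define D where "D = x - R 0 x - h"
  \<comment> \<open>The glued history in the reversed, weighted parametrisation, the force along it, and the error it leaves.\<close>
  define W where "W \<tau> = (if \<tau> \<le> t then exp (\<eta> * \<tau>) *\<^sub>R U (t - \<tau>) else exp (\<eta> * t) *\<^sub>R Z (\<tau> - t))" for \<tau>
  define GW where "GW = weighted_force \<zeta>' W"
  define d where "d \<tau> = (if \<tau> \<le> t then exp (\<eta> * \<tau>) *\<^sub>R T (t - \<tau>) D else 0)" for \<tau>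
  note linR = bounded_linear.linear[OF R_linear] and linT = bounded_linear.linear[OF T_linear]
  have ee: "exp (a * b) * exp (c * d) = exp (a * b + c * d)" for a b c d :: real by (simp add: exp_add)
  have GW1: "GW r = - (exp (\<eta> * r) *\<^sub>R G (t - r))" if "r \<le> t" for r
    using that by (simp add: GW_def weighted_force_def W_def G_def force_def \<zeta>'_def exp_minus)
  \<comment> \<open>At the gluing time itself (\<open>r = 0\<close>) the force belongs to the other piece; one point does not matter under the integral.\<close>
  have GW2: "GW (t + r) = exp (\<eta> * t) *\<^sub>R H r" if "0 < r" for r
  proof -
    have "exp (- (\<eta> * (t + r))) * exp (\<eta> * t) = exp (- (\<eta> * r))"
      by (simp add: exp_add[symmetric] algebra_simps)
    moreover have "exp (\<eta> * (t + r)) = exp (\<eta> * t) * exp (\<eta> * r)" by (simp add: exp_add[symmetric] algebra_simps)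
    ultimately show ?thesis using that
      by (simp add: GW_def weighted_force_def W_def H_def force_def \<zeta>'_def)
  qed
  have L0: "((\<lambda>r. S (s - r) (G r)) has_integral (U s - S s x)) {0..s}" if "0 \<le> s" for s
    using flow_map_mild[OF \<zeta>, of x] that by (simp add: mild_solution_def U_def G_def)
  \<comment> \<open>The slow and the fast component of the variation of constants formula; the group allows any time shift \<open>q\<close>.\<close>
  have L1: "((\<lambda>r. R (q + s - r) (G r)) has_integral (R q (U s) - R (q + s) x)) {0..s}" if s: "0 \<le> s" for q s
  proof -
    have I: "((\<lambda>r. R q (S (s - r) (G r))) has_integral R q (U s - S s x)) {0..s}"
      using has_integral_linear[OF L0[OF s] R_linear[of q]] by (simp add: o_def)
    have V: "R q (U s - S s x) = R q (U s) - R (q + s) x"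
      by (simp add: linear_diff[OF linR] RS[OF s])
    have "R q (S (s - r) (G r)) = R (q + s - r) (G r)" if "r \<in> {0..s}" for r
      using RS[of "s - r" q "G r"] that by (simp add: add_diff_eq)
    from has_integral_eq[OF this I] show ?thesis unfolding V .
  qed
  have L2: "((\<lambda>r. T (s - r) (G r)) has_integral (U s - R 0 (U s) - T s x)) {0..s}" if s: "0 \<le> s" for s
  proof -
    have "((\<lambda>r. S (s - r) (G r) - R (0 + s - r) (G r)) has_integral
        (U s - S s x - (R 0 (U s) - R (0 + s) x))) {0..s}"
      by (intro has_integral_diff L0 L1 s)
    then show ?thesis by (simp add: S_def algebra_simps)
  qed
  have adm: "((\<lambda>r. exp (\<eta> * (\<tau> - r)) *\<^sub>R R (- (\<tau> - r)) (H r)) has_integral past_orbit.past H \<tau>) {0..\<tau>}"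
    "((\<lambda>r. exp (- (\<eta> * r)) *\<^sub>R T r (H (\<tau> + r))) has_integral past_orbit.future H \<tau>) {0..}" if "0 \<le> \<tau>" for \<tau>
    using orbit_formula(1)[OF \<zeta>, of "R 0 x"] that
    unfolding past_orbit.past_def past_orbit.future_def H_def Z_def past_orbit.admissible_def
    by (blast intro: integrable_integral)+
  have hH: "past_orbit.future H 0 = - h"
    using graph_map_future[OF \<zeta>, of "R 0 x"] by (simp add: h_def H_def Z_def)
  \<comment> \<open>Reversing time in an integral along \<open>U\<close>.\<close>
  have P0: "((\<lambda>r. exp (\<eta> * (\<tau> - r)) *\<^sub>R R (- (\<tau> - r)) (GW r)) has_integral - (exp (\<eta> * \<tau>) *\<^sub>R I)) {0..a}"
    if I: "((\<lambda>r. R (t - \<tau> - r) (G r)) has_integral I) {t - a..t}" and a: "a \<le> t" for \<tau> a I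
  proof -
    have "((\<lambda>r. R (t - \<tau> - (t - r)) (G (t - r))) has_integral I) {0..a}"
      using has_integral_reverse_Icc[OF I, of t] by simp
    then have "((\<lambda>r. - (exp (\<eta> * \<tau>) *\<^sub>R R (t - \<tau> - (t - r)) (G (t - r)))) has_integral - (exp (\<eta> * \<tau>) *\<^sub>R I)) {0..a}"
      by (intro has_integral_neg has_integral_cmul)
    moreover have "- (exp (\<eta> * \<tau>) *\<^sub>R R (t - \<tau> - (t - r)) (G (t - r))) = exp (\<eta> * (\<tau> - r)) *\<^sub>R R (- (\<tau> - r)) (GW r)"
      if "r \<in> {0..a}" for r
    proof -
      have "exp (\<eta> * (\<tau> - r)) * exp (\<eta> * r) = exp (\<eta> * \<tau>)" by (simp add: exp_add[symmetric] algebra_simps)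
      then show ?thesis using that a by (simp add: GW1 linear_neg[OF linR] linear_scale[OF linR])
    qed
    ultimately show ?thesis by (metis (no_types, lifting) has_integral_eq)
  qed
  \<comment> \<open>Both integrals of the force along the glued history, split at the gluing time when they cross it.\<close>
  have past: "((\<lambda>r. exp (\<eta> * (\<tau> - r)) *\<^sub>R R (- (\<tau> - r)) (GW r)) has_integral
      (if \<tau> \<le> t then - (exp (\<eta> * \<tau>) *\<^sub>R (R (- \<tau>) (U t) - R 0 (U (t - \<tau>))))
       else - (exp (\<eta> * \<tau>) *\<^sub>R (R (- \<tau>) (U t) - R (t - \<tau>) x)) + exp (\<eta> * t) *\<^sub>R past_orbit.past H (\<tau> - t))) {0..\<tau>}"
    if \<tau>: "0 \<le> \<tau>" for \<tau>
  proof (cases "\<tau> \<le> t")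
    case True
    have f1: "((\<lambda>r. R (t - \<tau> - r) (G r)) has_integral (R (- \<tau>) (U t) - R (t - \<tau>) x)) {0..t}"
      using L1[OF t, of "- \<tau>"] by simp
    have f2: "((\<lambda>r. R (t - \<tau> - r) (G r)) has_integral (R 0 (U (t - \<tau>)) - R (t - \<tau>) x)) {0..t - \<tau>}"
      using L1[of "t - \<tau>" 0] True by simp
    have f3: "(\<lambda>r. R (t - \<tau> - r) (G r)) integrable_on {t - \<tau>..t}"
      by (rule integrable_subinterval_real[OF has_integral_integrable[OF f1]]) (use True in auto)
    have "((\<lambda>r. R (t - \<tau> - r) (G r)) has_integral (R (- \<tau>) (U t) - R 0 (U (t - \<tau>)))) {t - \<tau>..t}"
      using has_integral_unique[OF f1 has_integral_combine[OF _ _ f2 integrable_integral[OF f3]]]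
        integrable_integral[OF f3] True \<tau> by (simp add: algebra_simps)
    from P0[OF this True] True show ?thesis by simp
  next
    case False
    have "((\<lambda>r. R (t - \<tau> - r) (G r)) has_integral (R (- \<tau>) (U t) - R (t - \<tau>) x)) {t - t..t}"
      using L1[OF t, of "- \<tau>"] by simp
    note f1 = P0[OF this order_refl]
    have "((\<lambda>r. exp (\<eta> * t) *\<^sub>R (exp (\<eta> * (\<tau> - t - r)) *\<^sub>R R (- (\<tau> - t - r)) (H r))) has_integral
        exp (\<eta> * t) *\<^sub>R past_orbit.past H (\<tau> - t)) {0..\<tau> - t}"
      by (intro has_integral_cmul adm) (use False in simp)
    from has_integral_translate_Icc[OF this, of "- t"]
    have f2: "((\<lambda>r. exp (\<eta> * t) *\<^sub>R (exp (\<eta> * (\<tau> - r)) *\<^sub>R R (- (\<tau> - r)) (H (r - t)))) has_integral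
        exp (\<eta> * t) *\<^sub>R past_orbit.past H (\<tau> - t)) {t..\<tau>}"
      by (simp add: algebra_simps)
    have "((\<lambda>r. exp (\<eta> * (\<tau> - r)) *\<^sub>R R (- (\<tau> - r)) (GW r)) has_integral
        exp (\<eta> * t) *\<^sub>R past_orbit.past H (\<tau> - t)) {t..\<tau>}"
    proof (rule has_integral_spike_finite[OF _ _ f2])
      fix r assume "r \<in> {t..\<tau>} - {t}"
      then show "exp (\<eta> * (\<tau> - r)) *\<^sub>R R (- (\<tau> - r)) (GW r) =
          exp (\<eta> * t) *\<^sub>R (exp (\<eta> * (\<tau> - r)) *\<^sub>R R (- (\<tau> - r)) (H (r - t)))"
        using GW2[of "r - t"] by (simp add: linear_scale[OF linR] mult.commute)
    qed simp
    from has_integral_combine[OF t _ f1 this] False show ?thesis by simp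
  qed
  have future: "((\<lambda>r. exp (- (\<eta> * r)) *\<^sub>R T r (GW (\<tau> + r))) has_integral
      (if \<tau> \<le> t then - (exp (\<eta> * \<tau>) *\<^sub>R (U (t - \<tau>) - R 0 (U (t - \<tau>)) - T (t - \<tau>) x + T (t - \<tau>) h))
       else exp (\<eta> * t) *\<^sub>R past_orbit.future H (\<tau> - t))) {0..}"
    if \<tau>: "0 \<le> \<tau>" for \<tau>
  proof (cases "\<tau> \<le> t")
    case True
    define s where "s = t - \<tau>"
    have s: "0 \<le> s" using True by (simp add: s_def)
    have "((\<lambda>r. T (s - (s - r)) (G (s - r))) has_integral (U s - R 0 (U s) - T s x)) {0..s}"
      using has_integral_reverse_Icc[OF L2[OF s], of s] by simp
    then have "((\<lambda>r. - (exp (\<eta> * \<tau>) *\<^sub>R T (s - (s - r)) (G (s - r)))) has_integral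
        - (exp (\<eta> * \<tau>) *\<^sub>R (U s - R 0 (U s) - T s x))) {0..s}"
      by (intro has_integral_neg has_integral_cmul)
    moreover have "- (exp (\<eta> * \<tau>) *\<^sub>R T (s - (s - r)) (G (s - r))) = exp (- (\<eta> * r)) *\<^sub>R T r (GW (\<tau> + r))"
      if "r \<in> {0..s}" for r
    proof -
      have "exp (- (\<eta> * r)) * exp (\<eta> * (\<tau> + r)) = exp (\<eta> * \<tau>)" by (simp add: exp_add[symmetric] algebra_simps)
      then show ?thesis using that
        by (simp add: GW1 s_def diff_diff_eq linear_neg[OF linT] linear_scale[OF linT])
    qed
    ultimately have f1: "((\<lambda>r. exp (- (\<eta> * r)) *\<^sub>R T r (GW (\<tau> + r))) has_integral
        - (exp (\<eta> * \<tau>) *\<^sub>R (U s - R 0 (U s) - T s x))) {0..s}"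
      by (metis (no_types, lifting) has_integral_eq)
    have "((\<lambda>r. exp (\<eta> * \<tau>) *\<^sub>R T s (exp (- (\<eta> * r)) *\<^sub>R T r (H (0 + r)))) has_integral
        exp (\<eta> * \<tau>) *\<^sub>R T s (past_orbit.future H 0)) {0..}"
      using has_integral_cmul[OF has_integral_linear[OF adm(2)[OF order_refl] T_linear[OF s]]] by (simp add: o_def)
    then have f2: "((\<lambda>r. exp (- (\<eta> * (s + r))) *\<^sub>R T (s + r) (GW (\<tau> + (s + r)))) has_integral
        exp (\<eta> * \<tau>) *\<^sub>R T s (past_orbit.future H 0)) {0..}"
    proof (rule has_integral_spike_finite[of "{0}", rotated -1])
      fix r assume r: "r \<in> {0..} - {0 :: real}"
      have "exp (- (\<eta> * (s + r))) * exp (\<eta> * t) = exp (\<eta> * \<tau>) * exp (- (\<eta> * r))"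
        by (simp add: exp_add[symmetric] algebra_simps s_def)
      moreover have "GW (\<tau> + (s + r)) = exp (\<eta> * t) *\<^sub>R H r" using GW2[of r] r by (simp add: s_def)
      ultimately show "exp (- (\<eta> * (s + r))) *\<^sub>R T (s + r) (GW (\<tau> + (s + r)))
          = exp (\<eta> * \<tau>) *\<^sub>R T s (exp (- (\<eta> * r)) *\<^sub>R T r (H (0 + r)))"
        using r s by (simp add: T_semigroup linear_scale[OF linT])
    qed simp
    have "T s (past_orbit.future H 0) = - T s h" by (simp add: hH linear_neg[OF linT[OF s]])
    with has_integral_halfline_join[OF f1 f2 s] True show ?thesis
      by (simp add: s_def algebra_simps)
  next
    case False
    have I: "((\<lambda>r. exp (\<eta> * t) *\<^sub>R (exp (- (\<eta> * r)) *\<^sub>R T r (H (\<tau> - t + r)))) has_integral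
        exp (\<eta> * t) *\<^sub>R past_orbit.future H (\<tau> - t)) {0..}"
      by (intro has_integral_cmul adm) (use False in simp)
    have "exp (\<eta> * t) *\<^sub>R (exp (- (\<eta> * r)) *\<^sub>R T r (H (\<tau> - t + r))) = exp (- (\<eta> * r)) *\<^sub>R T r (GW (\<tau> + r))"
      if "r \<in> {0..}" for r
      using GW2[of "\<tau> - t + r"] that False by (simp add: linear_scale[OF linT] mult.commute)
    from has_integral_eq[OF this I] False show ?thesis by simp
  qed
  have "past_orbit.admissible GW"
    unfolding past_orbit.admissible_def using past future by blast
  moreover have "W \<tau> = exp (\<eta> * \<tau>) *\<^sub>R R (- \<tau>) \<xi> + d \<tau> + past_orbit.past GW \<tau> - past_orbit.future GW \<tau>"
    if \<tau>: "0 \<le> \<tau>" for \<tau>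
  proof -
    have \<xi>: "R (- \<tau>) \<xi> = R (- \<tau>) (U t)" by (simp add: \<xi>_def U_def R_group[symmetric])
    show ?thesis
    proof (cases "\<tau> \<le> t")
      case True
      have "T (t - \<tau>) D = T (t - \<tau>) x - T (t - \<tau>) h"
        using True by (simp add: D_def linear_diff[OF linT] TR)
      then show ?thesis
        using True unfolding \<xi> past_orbit.past_def past_orbit.future_def integral_unique[OF past[OF \<tau>]] integral_unique[OF future[OF \<tau>]]
        by (simp add: W_def d_def scaleR_add_right scaleR_diff_right)
    next
      case False
      have E: "exp (\<eta> * t) * exp (\<eta> * (\<tau> - t)) = exp (\<eta> * \<tau>)"
        by (simp add: exp_add[symmetric] algebra_simps)
      have Z: "Z (\<tau> - t) = exp (\<eta> * (\<tau> - t)) *\<^sub>R R (t - \<tau>) x + past_orbit.past H (\<tau> - t) - past_orbit.future H (\<tau> - t)"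
        using False orbit_formula(2)[OF \<zeta>, of "\<tau> - t" "R 0 x"] R_group[of "t - \<tau>" 0 x]
        by (simp add: Z_def[symmetric] H_def[symmetric])
      show ?thesis
        using False unfolding \<xi> past_orbit.past_def[of GW] past_orbit.future_def[of GW] integral_unique[OF past[OF \<tau>]] integral_unique[OF future[OF \<tau>]]
        by (simp add: W_def d_def Z E scaleR_add_right scaleR_diff_right)
    qed
  qed
  ultimately have sol: "past_orbit.solves (\<lambda>\<tau>. driver \<zeta>' \<xi> \<tau> + d \<tau>) W"
    unfolding solves_driver_iff[OF \<zeta>'] GW_def by blast
  \<comment> \<open>Boundedness of the glued history: compactness up to the gluing time, the bound of \<open>Z\<close> beyond it.\<close>
  obtain B where B: "\<And>\<tau>. 0 \<le> \<tau> \<Longrightarrow> norm (C (W \<tau>)) \<le> B"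
  proof -
    obtain B1 where B1: "\<And>\<tau>. 0 \<le> \<tau> \<Longrightarrow> norm (C (Z \<tau>)) \<le> B1"
      using orbit_properties(2)[OF \<zeta>] unfolding Z_def by blast
    have "continuous_on {0..t} (\<lambda>\<tau>. C (exp (\<eta> * \<tau>) *\<^sub>R U (t - \<tau>)))"
    proof -
      have "continuous_on {0..} U" using flow_map_mild[OF \<zeta>, of x] by (simp add: U_def mild_solution_def)
      then have "continuous_on {0..t} (\<lambda>\<tau>. U (t - \<tau>))"
        by (rule continuous_on_compose2) (auto intro: continuous_on_diff continuous_on_const continuous_on_id)
      then show ?thesis by (intro bounded_linear.continuous_on[OF C] continuous_intros)
    qed
    then have "bounded ((\<lambda>\<tau>. C (exp (\<eta> * \<tau>) *\<^sub>R U (t - \<tau>))) ` {0..t})"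
      by (intro compact_imp_bounded compact_continuous_image) auto
    then obtain B2 where "\<forall>y\<in>(\<lambda>\<tau>. C (exp (\<eta> * \<tau>) *\<^sub>R U (t - \<tau>))) ` {0..t}. norm y \<le> B2"
      unfolding bounded_iff by blast
    then have B2: "norm (C (exp (\<eta> * \<tau>) *\<^sub>R U (t - \<tau>))) \<le> B2" if "0 \<le> \<tau>" "\<tau> \<le> t" for \<tau>
      using that by auto
    have "norm (C (W \<tau>)) \<le> max B2 (exp (\<eta> * t) * B1)" if "0 \<le> \<tau>" for \<tau>
      using B1[of "\<tau> - t"] B2[OF that] by (auto simp: W_def C_scaleR le_max_iff_disj)
    then show thesis by (rule that)
  qed
  have "norm (driver \<zeta>' \<xi> \<tau> + d \<tau> - driver \<zeta>' \<xi> \<tau>) \<le> K * exp (\<eta> * t) * norm D" if \<tau>: "0 \<le> \<tau>" for \<tau>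
  proof (cases "\<tau> \<le> t")
    case True
    have "norm (d \<tau>) \<le> exp (\<eta> * \<tau>) * (K * exp (\<beta> * (t - \<tau>)) * norm D)"
      using T_decay[of "t - \<tau>" D] True by (simp add: d_def)
    also have "\<dots> = K * (exp (\<eta> * \<tau>) * exp (\<beta> * (t - \<tau>))) * norm D" by simp
    also have "exp (\<eta> * \<tau>) * exp (\<beta> * (t - \<tau>)) = exp (\<eta> * t + (\<beta> - \<eta>) * (t - \<tau>))"
      by (simp add: exp_add[symmetric] algebra_simps)
    also have "K * exp (\<eta> * t + (\<beta> - \<eta>) * (t - \<tau>)) * norm D \<le> K * exp (\<eta> * t) * norm D"
      using True rates const_nonneg by (intro mult_right_mono mult_left_mono) (auto simp: mult_nonpos_nonneg)
    finally show ?thesis by simp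
  qed (use const_nonneg in \<open>simp add: d_def\<close>)
  from orbit_perturbation[OF \<zeta>' sol B this]
  have "norm (W 0 - orbit \<zeta>' \<xi> 0) \<le> \<Lambda> * (K * exp (\<eta> * t) * norm D)" .
  moreover have "R 0 \<xi> = \<xi>" by (simp add: \<xi>_def R_group[symmetric])
  ultimately show ?thesis
    using t by (simp add: W_def U_def graph_map_def \<zeta>'_def[symmetric] D_def h_def)
qed

end

section \<open>Orthogonal decompositions of a Hilbert space\<close>

text \<open>An orthogonal decomposition of \<open>'h\<close> into countably many isometric copies of \<open>'k\<close>: \<open>j n\<close> embeds the
  \<open>n\<close>-th copy and \<open>c n\<close> reads off the \<open>n\<close>-th coordinate. With \<open>'k\<close> the reals this is an orthonormal basis;
  the phase space of the wave equation has two-dimensional modes.\<close>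

locale mode_decomposition =
  fixes c :: "nat \<Rightarrow> 'h::{real_inner, banach} \<Rightarrow> 'k::real_inner" and j :: "nat \<Rightarrow> 'k \<Rightarrow> 'h"
  assumes adjoint: "inner (j n k) x = inner k (c n x)"
    and c_j: "c m (j n k) = (if m = n then k else 0)"
    and complete: "(\<And>n. c n x = 0) \<Longrightarrow> x = 0"
begin

lemma eq_by_inner: "(\<And>k. inner k x = inner k y) \<Longrightarrow> x = (y :: 'z::real_inner)"
  using inner_eq_zero_iff[of "x - y"] by (simp add: inner_diff_right)

lemma c_linear: "linear (c n)"
proof (rule linearI)
  show "c n (x + y) = c n x + c n y" for x y
    by (rule eq_by_inner) (simp add: adjoint[symmetric] inner_add_right)
  show "c n (r *\<^sub>R x) = r *\<^sub>R c n x" for r x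
    by (rule eq_by_inner) (simp add: adjoint[symmetric])
qed

lemma adjoint': "inner x (j n k) = inner (c n x) k"
  by (metis adjoint inner_commute)

lemma j_linear: "linear (j n)"
proof (rule linearI)
  show "j n (x + y) = j n x + j n y" for x y
    by (rule eq_by_inner) (simp add: adjoint' inner_add_right)
  show "j n (r *\<^sub>R x) = r *\<^sub>R j n x" for r x
    by (rule eq_by_inner) (simp add: adjoint')
qed

lemma inner_j_j: "inner (j m k) (j n k') = (if m = n then inner k k' else 0)"
  by (simp add: adjoint c_j)

lemma norm_j: "norm (j n k) = norm k"
  by (simp add: norm_eq_sqrt_inner inner_j_j)

lemma norm_c_le: "norm (c n x) \<le> norm x"
proof -
  have "(norm (c n x))\<^sup>2 = inner (j n (c n x)) x"
    by (simp add: adjoint power2_norm_eq_inner)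
  also have "\<dots> \<le> norm (c n x) * norm x"
    using norm_cauchy_schwarz[of "j n (c n x)" x] by (simp add: norm_j)
  finally show ?thesis
    by (cases "c n x = 0") (auto simp: power2_eq_square)
qed

lemma c_bounded: "bounded_linear (c n)"
  using c_linear norm_c_le[of n] by (intro bounded_linear_intro[where K = 1]) (auto simp: linear_add linear_scale)

lemma j_bounded: "bounded_linear (j n)"
  using j_linear norm_j[of n] by (intro bounded_linear_intro[where K = 1]) (auto simp: linear_add linear_scale)

lemma norm_sum_j:
  assumes "finite A"
  shows "(norm (\<Sum>n\<in>A. j n (k n)))\<^sup>2 = (\<Sum>n\<in>A. (norm (k n))\<^sup>2)"
  using assms
  by (simp add: power2_norm_eq_inner inner_sum_left inner_sum_right inner_j_j if_distrib[of "\<lambda>x. inner _ x"]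
      sum.delta cong: if_cong)

definition part :: "nat \<Rightarrow> 'h \<Rightarrow> 'h" where "part m x = (\<Sum>n<m. j n (c n x))"

lemma c_sum_j: "finite A \<Longrightarrow> c m (\<Sum>n\<in>A. j n (k n)) = (if m \<in> A then k m else 0)"
  by (simp add: linear_sum[OF c_linear] c_j if_distrib sum.delta' cong: if_cong)

lemma bessel: "(\<Sum>n<m. (norm (c n x))\<^sup>2) \<le> (norm x)\<^sup>2"
proof -
  have i: "inner (part m x) x = (\<Sum>n<m. (norm (c n x))\<^sup>2)"
    by (simp add: part_def inner_sum_left adjoint power2_norm_eq_inner)
  have "0 \<le> (norm (x - part m x))\<^sup>2" by simp
  also have "\<dots> = (norm x)\<^sup>2 - 2 * inner (part m x) x + (norm (part m x))\<^sup>2"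
    by (simp add: power2_norm_eq_inner inner_diff_left inner_diff_right inner_commute)
  also have "(norm (part m x))\<^sup>2 = inner (part m x) x"
    unfolding i unfolding part_def by (rule norm_sum_j) simp
  finally show ?thesis unfolding i by simp
qed

lemma summable_c: "summable (\<lambda>n. (norm (c n x))\<^sup>2)"
  by (rule summableI_nonneg_bounded[of _ "(norm x)\<^sup>2"]) (auto simp: bessel)

lemma summable_j:
  assumes "summable (\<lambda>n. (norm (k n))\<^sup>2)"
  shows "summable (\<lambda>n. j n (k n))"
  unfolding summable_Cauchy
proof (intro allI impI)
  fix e :: real assume e: "0 < e"
  then obtain N where N: "\<And>m n. m \<ge> N \<Longrightarrow> norm (\<Sum>i\<in>{m..<n}. (norm (k i))\<^sup>2) < e\<^sup>2"
    using assms unfolding summable_Cauchy by (metis zero_less_power)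
  have "norm (\<Sum>i\<in>{m..<n}. j i (k i)) < e" if "m \<ge> N" for m n
  proof -
    have "(norm (\<Sum>i\<in>{m..<n}. j i (k i)))\<^sup>2 < e\<^sup>2"
      using N[OF that, of n] by (simp add: norm_sum_j sum_nonneg)
    then show ?thesis using e by (simp add: power2_less_imp_less)
  qed
  then show "\<exists>N. \<forall>m\<ge>N. \<forall>n. norm (\<Sum>i\<in>{m..<n}. j i (k i)) < e" by blast
qed

lemma c_suminf_j:
  assumes "summable (\<lambda>n. (norm (k n))\<^sup>2)"
  shows "c m (\<Sum>n. j n (k n)) = k m"
proof -
  have "(\<lambda>n. c m (j n (k n))) sums c m (\<Sum>n. j n (k n))"
    by (rule bounded_linear.sums[OF c_bounded summable_sums[OF summable_j[OF assms]]])
  moreover have "(\<lambda>n. c m (j n (k n))) sums k m"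
    using sums_single[of m k] by (simp add: c_j eq_commute[of m])
  ultimately show ?thesis by (rule sums_unique2)
qed

lemma eqI: "(\<And>n. c n x = c n y) \<Longrightarrow> x = y"
  using complete[of "x - y"] by (simp add: linear_diff[OF c_linear])

lemma expansion: "(\<lambda>n. j n (c n x)) sums x"
  using summable_sums[OF summable_j[OF summable_c[of x]]] eqI[OF c_suminf_j[OF summable_c[of x]]] by simp

lemma part_tendsto: "(\<lambda>m. part m x) \<longlonglongrightarrow> x"
  using expansion[of x] by (simp add: sums_def part_def)

lemma parseval: "(\<lambda>n. (norm (c n x))\<^sup>2) sums (norm x)\<^sup>2"
proof -
  have "(\<lambda>m. (norm (part m x))\<^sup>2) \<longlonglongrightarrow> (norm x)\<^sup>2"
    by (intro tendsto_intros part_tendsto)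
  then show ?thesis unfolding sums_def part_def by (simp add: norm_sum_j)
qed

text \<open>Parseval turns a bound that is uniform over the modes into a bound of the norm. The comparison
  sequence may come from another space, as for the observation of a phase space vector in \<open>L\<^sup>2\<close>.\<close>

lemma norm_le_by_modes:
  assumes a: "(\<lambda>n. (a n)\<^sup>2) sums s\<^sup>2" and le: "\<And>n. norm (c n x) \<le> B * a n" and "0 \<le> s" "0 \<le> B"
  shows "norm x \<le> B * s"
proof -
  have "(norm x)\<^sup>2 \<le> B\<^sup>2 * s\<^sup>2"
  proof (rule sums_le[OF _ parseval sums_mult[OF a]])
    show "(norm (c n x))\<^sup>2 \<le> B\<^sup>2 * (a n)\<^sup>2" for n
      using power_mono[OF le[of n], of 2] by (simp add: power_mult_distrib)
  qed
  then have "(norm x)\<^sup>2 \<le> (B * s)\<^sup>2" by (simp only: power_mult_distrib)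
  then show ?thesis by (rule power2_le_imp_le) (use assms(3,4) in simp)
qed

lemma zero_by_modes:
  assumes "bounded_linear f" "\<And>n k. f (j n k) = 0"
  shows "f x = 0"
proof -
  have "(\<lambda>n. f (j n (c n x))) sums f x" by (rule bounded_linear.sums[OF assms(1) expansion])
  then show ?thesis by (simp add: assms(2) sums_iff)
qed

definition multiplier :: "(nat \<Rightarrow> 'k \<Rightarrow> 'k) \<Rightarrow> 'h \<Rightarrow> 'h" where
  "multiplier M x = (\<Sum>n. j n (M n (c n x)))"

lemma c_multiplier:
  assumes "\<And>n k. norm (M n k) \<le> B * norm k"
  shows "c n (multiplier M x) = M n (c n x)"
  unfolding multiplier_def
proof (rule c_suminf_j, rule summable_comparison_test_ev[OF always_eventually summable_mult[OF summable_c]], rule allI)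
  fix n
  show "norm ((norm (M n (c n x)))\<^sup>2) \<le> B\<^sup>2 * (norm (c n x))\<^sup>2"
    using power_mono[OF assms[of n "c n x"], of 2] by (simp add: power_mult_distrib)
qed

lemma norm_multiplier:
  assumes "\<And>n k. norm (M n k) \<le> B * norm k" "0 \<le> B"
  shows "norm (multiplier M x) \<le> B * norm x"
  by (rule norm_le_by_modes[OF parseval]) (use assms in \<open>auto simp: c_multiplier[OF assms(1)]\<close>)

lemma multiplier_bounded:
  assumes "\<And>n k. norm (M n k) \<le> B * norm k" "0 \<le> B" "\<And>n. linear (M n)"
  shows "bounded_linear (multiplier M)"
proof (rule bounded_linear_intro[where K = B])
  show "multiplier M (x + y) = multiplier M x + multiplier M y" for x y
    by (rule eqI) (simp add: c_multiplier[OF assms(1)] linear_add[OF c_linear] linear_add[OF assms(3)])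
  show "multiplier M (r *\<^sub>R x) = r *\<^sub>R multiplier M x" for r x
    by (rule eqI) (simp add: c_multiplier[OF assms(1)] linear_scale[OF c_linear] linear_scale[OF assms(3)])
  show "norm (multiplier M x) \<le> norm x * B" for x
    using norm_multiplier[OF assms(1,2), where x = x] by (simp add: mult.commute)
qed

text \<open>Finitely many modes depend continuously on \<open>t\<close>, and the common bound \<open>B\<close> makes the remainder uniformly
  small.\<close>

lemma multiplier_continuous:
  fixes A :: "real set"
  assumes bd: "\<And>t n k. t \<in> A \<Longrightarrow> norm (M t n k) \<le> B * norm k" and B: "0 \<le> B"
    and lin: "\<And>t n. t \<in> A \<Longrightarrow> linear (M t n)" and cont: "\<And>n k. continuous_on A (\<lambda>t. M t n k)"
  shows "continuous_on A (\<lambda>t. multiplier (M t) x)"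
proof (rule uniform_limit_theorem)
  let ?p = "\<lambda>m t. \<Sum>n<m. j n (M t n (c n x))"
  show "\<forall>\<^sub>F m in sequentially. continuous_on A (?p m)"
    by (intro always_eventually allI continuous_on_sum bounded_linear.continuous_on[OF j_bounded] cont)
  have eq: "?p m t = multiplier (M t) (part m x)" if "t \<in> A" for m t
    by (rule eqI) (auto simp: c_multiplier[OF bd[OF that]] part_def c_sum_j linear_0[OF lin[OF that]])
  show "uniform_limit A ?p (\<lambda>t. multiplier (M t) x) sequentially"
  proof (rule uniform_limitI)
    fix e :: real assume "0 < e"
    then have "0 < e / (B + 1)" using B by simp
    then have "\<forall>\<^sub>F m in sequentially. dist (part m x) x < e / (B + 1)"
      by (rule tendstoD[OF part_tendsto])
    then show "\<forall>\<^sub>F m in sequentially. \<forall>t\<in>A. dist (?p m t) (multiplier (M t) x) < e"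
    proof eventually_elim
      case (elim m)
      show ?case
      proof
        fix t assume t: "t \<in> A"
        have "dist (?p m t) (multiplier (M t) x) = norm (multiplier (M t) (part m x - x))"
          unfolding eq[OF t] dist_norm
          by (simp add: linear_diff[OF bounded_linear.linear[OF multiplier_bounded[OF bd[OF t] B lin[OF t]]]])
        also have "\<dots> \<le> B * norm (part m x - x)" by (rule norm_multiplier[OF bd[OF t] B])
        also have "\<dots> \<le> (B + 1) * dist (part m x) x" by (simp add: dist_norm distrib_right)
        also have "\<dots> < e" using elim B by (simp add: field_simps)
        finally show "dist (?p m t) (multiplier (M t) x) < e" .
      qed
    qed
  qed
qed simp

end

lemma second_countable_if_dense:
  fixes D :: "'a::metric_space set"
  assumes D: "countable D" and dense: "\<And>x e. 0 < e \<Longrightarrow> \<exists>d\<in>D. dist x d < e"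
  shows "\<exists>B::'a set set. countable B \<and> open = generate_topology B"
proof (intro exI conjI ext iffI)
  define B where "B = (\<lambda>(d, n). ball d (1 / Suc n)) ` (D \<times> (UNIV :: nat set))"
  show "countable B" using D by (auto simp: B_def)
  show "open U" if "generate_topology B U" for U
    using that by induction (auto simp: B_def)
  show "generate_topology B U" if U: "open U" for U
  proof -
    have "\<exists>b\<in>B. x \<in> b \<and> b \<subseteq> U" if x: "x \<in> U" for x
    proof -
      obtain e where e: "e > 0" "ball x e \<subseteq> U" using U x open_contains_ball by blast
      obtain n where n: "1 / Suc n < e / 2"
        using reals_Archimedean[of "e / 2"] e(1) by (auto simp: inverse_eq_divide)
      obtain d where d: "d \<in> D" "dist x d < 1 / Suc n" using dense[of "1 / Suc n" x] by auto
      have "ball d (1 / Suc n) \<subseteq> ball x e"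
      proof
        fix y assume "y \<in> ball d (1 / Suc n)"
        then show "y \<in> ball x e" using dist_triangle[of x y d] d(2) n by (simp add: dist_commute)
      qed
      then have "x \<in> ball d (1 / Suc n) \<and> ball d (1 / Suc n) \<subseteq> U" using e d by (auto simp: dist_commute)
      then show ?thesis using d(1) unfolding B_def by (intro bexI[of _ "ball d (1 / Suc n)"]) auto
    qed
    then have "\<Union>{b \<in> B. b \<subseteq> U} = U" by blast
    moreover have "generate_topology B (\<Union>{b \<in> B. b \<subseteq> U})"
      by (rule generate_topology.UN) (blast intro: generate_topology.Basis)
    ultimately show ?thesis by (simp only:)
  qed
qed

text \<open>Rational combinations of the basis vectors are dense.\<close>

lemma (in mode_decomposition) separable:
  fixes e :: "nat \<Rightarrow> 'h"
  assumes e: "\<And>n x. \<exists>r. j n (c n x) = r *\<^sub>R e n"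
  shows "\<exists>D :: 'h set. countable D \<and> (\<forall>x. \<forall>\<epsilon>>0. \<exists>d\<in>D. dist x d < \<epsilon>)"
proof (intro exI conjI allI impI)
  let ?s = "\<lambda>qs :: rat list. \<Sum>n<length qs. of_rat (qs ! n) *\<^sub>R e n"
  show "countable (range ?s)" by simp
  fix x :: 'h and \<epsilon> :: real assume \<epsilon>: "0 < \<epsilon>"
  have "\<forall>\<^sub>F m in sequentially. dist (part m x) x < \<epsilon> / 2" using \<epsilon> by (intro tendstoD[OF part_tendsto]) simp
  then obtain m where m: "dist (part m x) x < \<epsilon> / 2" by (auto simp: eventually_sequentially)
  obtain r where r: "\<And>n. j n (c n x) = r n *\<^sub>R e n" using e[of _ x] choice[of "\<lambda>n r. j n (c n x) = r *\<^sub>R e n"] by blast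
  define \<delta> where "\<delta> = \<epsilon> / (2 * (1 + (\<Sum>n<m. norm (e n))))"
  have s0: "0 \<le> (\<Sum>n<m. norm (e n))" by (simp add: sum_nonneg)
  have \<delta>: "0 < \<delta>" using \<epsilon> s0 by (simp add: \<delta>_def)
  have "\<exists>q. \<bar>r n - of_rat q\<bar> < \<delta>" for n
  proof -
    obtain q where "r n - \<delta> < of_rat q" "of_rat q < r n + \<delta>"
      using of_rat_dense[of "r n - \<delta>" "r n + \<delta>"] \<delta> by auto
    then show ?thesis by (intro exI[of _ q]) linarith
  qed
  then obtain q where q: "\<And>n. \<bar>r n - of_rat (q n)\<bar> < \<delta>" by metis
  let ?d = "?s (map q [0..<m])"
  have "norm (part m x - ?d) = norm (\<Sum>n<m. (r n - of_rat (q n)) *\<^sub>R e n)"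
    by (simp add: part_def r sum_subtractf[symmetric] scaleR_diff_left)
  also have "\<dots> \<le> (\<Sum>n<m. \<delta> * norm (e n))"
    by (rule order_trans[OF norm_sum sum_mono]) (simp add: mult_right_mono less_imp_le[OF q])
  also have "\<dots> = \<delta> * (\<Sum>n<m. norm (e n))" by (simp add: sum_distrib_left)
  also have "\<dots> < \<delta> * (1 + (\<Sum>n<m. norm (e n)))" using \<delta> by simp
  also have "\<dots> = \<epsilon> / 2" using s0 by (simp add: \<delta>_def field_simps)
  finally have "dist x ?d < \<epsilon>"
    using m dist_triangle[of x ?d "part m x"] by (simp add: dist_norm norm_minus_commute)
  then show "\<exists>d\<in>range ?s. dist x d < \<epsilon>" by blast
qed

section \<open>Sine series in \<open>L\<^sup>2\<close> and \<open>H\<^sub>0\<^sup>1\<close>\<close>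

instance L2 :: banach ..
instance H10 :: banach ..

lemma interval_integral_FTC:
  assumes F: "\<And>x. (F has_real_derivative f x) (at x)" and f: "continuous_on UNIV f"
  shows "(\<integral>x. f x \<partial>interval_measure) = F pi - F 0"
proof -
  have m: "f \<in> borel_measurable borel" using f by (rule borel_measurable_continuous_onI)
  have "(\<integral>x. f x \<partial>interval_measure) = (\<integral>x. indicator {0<..<pi} x *\<^sub>R f x \<partial>lborel)"
    by (rule integral_restrict_space) simp
  also have "\<dots> = (\<integral>x. indicator {0..pi} x *\<^sub>R f x \<partial>lborel)"
  proof (rule integral_cong_AE)
    show "AE x in lborel. indicator {0<..<pi} x *\<^sub>R f x = indicator {0..pi} x *\<^sub>R f x"
      using AE_lborel_singleton[of 0] AE_lborel_singleton[of pi]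
      by eventually_elim (auto simp: indicator_def)
  qed (use m in measurable)
  also have "\<dots> = F pi - F 0"
    by (rule integral_FTC_Icc)
       (use F f in \<open>auto simp: has_real_derivative_iff_has_vector_derivative
          intro: has_vector_derivative_at_within continuous_on_subset\<close>)
  finally show ?thesis .
qed

lemma test_fun_endpoints: "test_fun \<phi> \<Longrightarrow> \<phi> 0 = 0" "test_fun \<phi> \<Longrightarrow> \<phi> pi = 0"
  by (auto simp: test_fun_def)

lemma weak_deriv_C1:
  assumes g: "\<And>x. (g has_real_derivative g' x) (at x)" and g': "continuous_on UNIV g'"
  shows "weak_deriv (abs_L2 g) (abs_L2 g')"
  unfolding weak_deriv_def
proof (intro allI impI)
  fix \<phi> assume \<phi>: "test_fun \<phi>"
  note D = test_fun_DERIV[OF \<phi>]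
  have gc: "continuous_on UNIV g" using g by (meson DERIV_continuous_on has_field_derivative_at_within)
  note sq = square_integrable_continuous[OF gc] square_integrable_continuous[OF g'] test_fun_sq[OF \<phi>]
  have "(\<integral>x. g x * deriv \<phi> x + g' x * \<phi> x \<partial>interval_measure) = g pi * \<phi> pi - g 0 * \<phi> 0"
  proof (rule interval_integral_FTC)
    show "((\<lambda>x. g x * \<phi> x) has_real_derivative g x * deriv \<phi> x + g' x * \<phi> x) (at x)" for x
      using DERIV_mult[OF g[of x] D(1)[of x]] by (simp add: algebra_simps)
    show "continuous_on UNIV (\<lambda>x. g x * deriv \<phi> x + g' x * \<phi> x)"
      by (intro continuous_intros gc g' D)
  qed
  then show "inner (abs_L2 g) (abs_L2 (deriv \<phi>)) = - inner (abs_L2 g') (abs_L2 \<phi>)"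
    by (simp add: inner_abs_L2 sq test_fun_endpoints[OF \<phi>] square_integrable_times)
qed

lemma abs_L2_scale: "square_integrable f \<Longrightarrow> abs_L2 (\<lambda>x. r * f x) = r *\<^sub>R abs_L2 f"
  by (simp add: scaleR_L2.abs_eq L2_eq_def)

text \<open>Bounded pointwise convergence implies convergence in \<open>L\<^sup>2(0,\<pi>)\<close>, by dominated convergence on a finite
  measure space.\<close>

lemma abs_L2_tendsto:
  assumes fn: "\<And>n::nat. square_integrable (f n)" and f: "square_integrable g"
    and lim: "\<And>x. 0 < x \<Longrightarrow> x < pi \<Longrightarrow> (\<lambda>n. f n x) \<longlonglongrightarrow> g x"
    and bd: "\<And>n x. 0 < x \<Longrightarrow> x < pi \<Longrightarrow> \<bar>f n x\<bar> \<le> B"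
  shows "(\<lambda>n. abs_L2 (f n)) \<longlonglongrightarrow> abs_L2 g"
proof -
  interpret finite_measure interval_measure by (rule finite_measure_interval)
  have gB: "\<bar>g x\<bar> \<le> B" if "0 < x" "x < pi" for x
    by (rule LIMSEQ_le_const2[OF tendsto_rabs[OF lim[OF that]]]) (use bd[OF that] in auto)
  have "(\<lambda>n. \<integral>x. (f n x - g x)\<^sup>2 \<partial>interval_measure) \<longlonglongrightarrow> (\<integral>x. 0 \<partial>interval_measure)"
  proof (rule integral_dominated_convergence[where w = "\<lambda>_. (2 * B)\<^sup>2"])
    show "(\<lambda>x. (f n x - g x)\<^sup>2) \<in> borel_measurable interval_measure" for n
      using square_integrable_diff[OF fn f] by (auto simp: square_integrable_def)
    show "AE x in interval_measure. (\<lambda>n. (f n x - g x)\<^sup>2) \<longlonglongrightarrow> 0"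
    proof (rule AE_I2)
      fix x assume "x \<in> space interval_measure"
      then have x: "0 < x" "x < pi" by (auto simp: space_restrict_space)
      have "(\<lambda>n. (f n x - g x)\<^sup>2) \<longlonglongrightarrow> (g x - g x)\<^sup>2" by (intro tendsto_intros lim x)
      then show "(\<lambda>n. (f n x - g x)\<^sup>2) \<longlonglongrightarrow> 0" by simp
    qed
    show "AE x in interval_measure. norm ((f n x - g x)\<^sup>2) \<le> (2 * B)\<^sup>2" for n
    proof (rule AE_I2)
      fix x assume "x \<in> space interval_measure"
      then have x: "0 < x" "x < pi" by (auto simp: space_restrict_space)
      have "\<bar>f n x - g x\<bar> \<le> 2 * B" using bd[OF x, of n] gB[OF x] by linarith
      from power_mono[OF this abs_ge_zero, of 2]
      show "norm ((f n x - g x)\<^sup>2) \<le> (2 * B)\<^sup>2" by simp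
    qed
  qed auto
  then have "(\<lambda>n. (norm (abs_L2 (f n) - abs_L2 g))\<^sup>2) \<longlonglongrightarrow> 0"
    by (simp add: minus_abs_L2 fn f norm_abs_L2 square_integrable_diff)
  then have "(\<lambda>n. sqrt ((norm (abs_L2 (f n) - abs_L2 g))\<^sup>2)) \<longlonglongrightarrow> sqrt 0"
    by (rule tendsto_real_sqrt)
  then show ?thesis by (simp add: LIM_zero_iff tendsto_norm_zero_iff)
qed

subsection \<open>The sine functions belong to \<open>H\<^sub>0\<^sup>1\<close>\<close>

definition sin_fun :: "nat \<Rightarrow> real \<Rightarrow> real" where "sin_fun n x = sin (real (Suc n) * x)"
definition cos_fun :: "nat \<Rightarrow> real \<Rightarrow> real" where "cos_fun n x = cos (real (Suc n) * x)"

lemma sin_fun_DERIV: "(sin_fun n has_real_derivative real (Suc n) * cos_fun n x) (at x)"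
  "(cos_fun n has_real_derivative - real (Suc n) * sin_fun n x) (at x)"
  unfolding sin_fun_def[abs_def] cos_fun_def[abs_def] by (auto intro!: derivative_eq_intros simp: algebra_simps)

lemma sin_fun_cont: "continuous_on A (sin_fun n)" "continuous_on A (cos_fun n)"
  unfolding sin_fun_def[abs_def] cos_fun_def[abs_def] by (intro continuous_intros)+

lemma sin_fun_sq: "square_integrable (sin_fun n)" "square_integrable (cos_fun n)"
  by (intro square_integrable_continuous sin_fun_cont)+

text \<open>With \<open>s = x (\<pi> - x)\<close> this is \<open>(s - \<kappa>)\<^sub>+\<^sup>2 / (s\<^sup>2 + \<kappa>\<^sup>2)\<close>: a \<open>C\<^sup>1\<close> cutoff in closed form that vanishes
  near the end points, tends to \<open>1\<close> inside as \<open>\<kappa> \<rightarrow> 0\<close>, and whose slope is at most of order \<open>1/s\<close>.\<close>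

definition cutoff :: "real \<Rightarrow> real \<Rightarrow> real" where
  "cutoff \<kappa> x = (max 0 (x * (pi - x) - \<kappa>))\<^sup>2 / ((x * (pi - x))\<^sup>2 + \<kappa>\<^sup>2)"

definition cutoff' :: "real \<Rightarrow> real \<Rightarrow> real" where
  "cutoff' \<kappa> x = (pi - 2 * x) * (2 * max 0 (x * (pi - x) - \<kappa>) * \<kappa> * (x * (pi - x) + \<kappa>))
     / ((x * (pi - x))\<^sup>2 + \<kappa>\<^sup>2)\<^sup>2"

lemma cutoff_DERIV:
  assumes "0 < \<kappa>"
  shows "(cutoff \<kappa> has_real_derivative cutoff' \<kappa> x) (at x)"
proof -
  define s where "s = x * (pi - x)"
  define m where "m = max 0 (s - \<kappa>)"
  have pos: "s\<^sup>2 + \<kappa>\<^sup>2 > 0" using assms by (simp add: add_nonneg_pos)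
  have nz: "(x * (pi - x))\<^sup>2 + \<kappa>\<^sup>2 \<noteq> 0"
    using pos unfolding s_def by (rule less_imp_neq[symmetric])
  have num: "((\<lambda>x. (max 0 (x * (pi - x) - \<kappa>))\<^sup>2) has_real_derivative (2 * m) * (pi - 2 * x)) (at x)"
    unfolding m_def s_def
    by (rule DERIV_chain2[OF DERIV_max_0_power2]) (auto intro!: derivative_eq_intros simp: algebra_simps)
  have den: "((\<lambda>x. (x * (pi - x))\<^sup>2 + \<kappa>\<^sup>2) has_real_derivative 2 * s * (pi - 2 * x)) (at x)"
    unfolding s_def by (auto intro!: derivative_eq_intros simp: algebra_simps)
  have alg: "m * (s\<^sup>2 + \<kappa>\<^sup>2) - m\<^sup>2 * s = m * \<kappa> * (s + \<kappa>)"
  proof (cases "s \<le> \<kappa>")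
    case False
    then have "m = s - \<kappa>" by (simp add: m_def)
    then show ?thesis by (simp only: power2_eq_square) (simp add: algebra_simps)
  qed (simp add: m_def)
  have "(cutoff \<kappa> has_real_derivative ((2 * m) * (pi - 2 * x) * (s\<^sup>2 + \<kappa>\<^sup>2) - m\<^sup>2 * (2 * s * (pi - 2 * x)))
      / ((s\<^sup>2 + \<kappa>\<^sup>2) * (s\<^sup>2 + \<kappa>\<^sup>2))) (at x)"
    unfolding cutoff_def[abs_def]
    using DERIV_divide[OF num den nz] unfolding m_def s_def .
  moreover have "(2 * m) * (pi - 2 * x) * (s\<^sup>2 + \<kappa>\<^sup>2) - m\<^sup>2 * (2 * s * (pi - 2 * x))
      = (pi - 2 * x) * 2 * (m * (s\<^sup>2 + \<kappa>\<^sup>2) - m\<^sup>2 * s)" by (simp add: algebra_simps)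
  moreover have "cutoff' \<kappa> x = (pi - 2 * x) * 2 * (m * \<kappa> * (s + \<kappa>)) / ((s\<^sup>2 + \<kappa>\<^sup>2) * (s\<^sup>2 + \<kappa>\<^sup>2))"
    by (simp only: cutoff'_def s_def[symmetric] m_def[symmetric] power2_eq_square[of "s\<^sup>2 + \<kappa>\<^sup>2"] mult_ac)
  ultimately show ?thesis by (simp only: alg)
qed

lemma cutoff_cont: "0 < \<kappa> \<Longrightarrow> continuous_on UNIV (cutoff \<kappa>)" "0 < \<kappa> \<Longrightarrow> continuous_on UNIV (cutoff' \<kappa>)"
proof -
  assume \<kappa>: "0 < \<kappa>"
  have nz: "(x * (pi - x))\<^sup>2 + \<kappa>\<^sup>2 \<noteq> 0" for x
    using \<kappa> by (metis add_nonneg_pos less_irrefl zero_le_power2 zero_less_power)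
  show "continuous_on UNIV (cutoff \<kappa>)"
    unfolding cutoff_def[abs_def] by (intro continuous_intros) (use nz in auto)
  show "continuous_on UNIV (cutoff' \<kappa>)"
    unfolding cutoff'_def[abs_def] by (intro continuous_intros) (use nz in auto)
qed

lemma test_fun_cutoff:
  assumes \<kappa>: "0 < \<kappa>"
  shows "test_fun (\<lambda>x. cutoff \<kappa> x * sin_fun n x)"
    "deriv (\<lambda>x. cutoff \<kappa> x * sin_fun n x) = (\<lambda>x. cutoff' \<kappa> x * sin_fun n x + cutoff \<kappa> x * (real (Suc n) * cos_fun n x))"
proof -
  let ?f' = "\<lambda>x. cutoff' \<kappa> x * sin_fun n x + cutoff \<kappa> x * (real (Suc n) * cos_fun n x)"
  have D: "((\<lambda>x. cutoff \<kappa> x * sin_fun n x) has_real_derivative ?f' x) (at x)" for x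
    using DERIV_mult[OF cutoff_DERIV[OF \<kappa>, of x] sin_fun_DERIV(1)[of n x]] by (simp add: algebra_simps)
  then show "deriv (\<lambda>x. cutoff \<kappa> x * sin_fun n x) = ?f'" by (intro ext DERIV_imp_deriv)
  have "continuous_on UNIV ?f'" by (intro continuous_intros cutoff_cont \<kappa> sin_fun_cont)
  then have "(\<lambda>x. cutoff \<kappa> x * sin_fun n x) C1_differentiable_on UNIV"
    unfolding C1_differentiable_on_def
    by (intro exI[of _ ?f']) (simp add: has_real_derivative_iff_has_vector_derivative[symmetric] D del: of_nat_Suc)
  moreover have "cutoff \<kappa> x * sin_fun n x = 0" if x: "x \<notin> {\<kappa> / pi..pi - \<kappa> / pi}" for x
  proof -
    have small: "y * (pi - y) \<le> \<kappa>" if "y < \<kappa> / pi" for y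
    proof (cases "0 \<le> y")
      case True
      have "y * (pi - y) \<le> y * pi" using True by (intro mult_left_mono) auto
      also have "\<dots> \<le> \<kappa>" using that by (simp add: field_simps)
      finally show ?thesis .
    next
      case False
      then have "y * (pi - y) \<le> 0" using pi_gt_zero by (intro mult_nonpos_nonneg) (use False pi_gt_zero in linarith)+
      then show ?thesis using \<kappa> by simp
    qed
    have "x < \<kappa> / pi \<or> pi - x < \<kappa> / pi" using x by auto
    then have "x * (pi - x) \<le> \<kappa>" using small[of x] small[of "pi - x"] by (auto simp: mult.commute)
    then show ?thesis by (simp add: cutoff_def)
  qed
  moreover have "0 < \<kappa> / pi" "pi - \<kappa> / pi < pi" using \<kappa> by auto
  ultimately show "test_fun (\<lambda>x. cutoff \<kappa> x * sin_fun n x)" unfolding test_fun_def by blast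
qed

lemma abs_sin_fun_le:
  assumes x: "0 < x" "x < pi"
  shows "\<bar>sin_fun n x\<bar> \<le> real (Suc n) * (x * (pi - x))"
proof -
  have a: "\<bar>sin_fun n x\<bar> \<le> real (Suc n) * x" using abs_sin_x_le_abs_x[of "real (Suc n) * x"] x
    by (simp add: sin_fun_def abs_mult)
  have "real (Suc n) * (pi - x) = real (Suc n) * pi - real (Suc n) * x" by (simp add: algebra_simps)
  then have "\<bar>sin (real (Suc n) * (pi - x))\<bar> = \<bar>sin_fun n x\<bar>"
    using sin_npi[of "Suc n"] cos_npi[of "Suc n"] by (simp add: sin_diff sin_fun_def abs_mult del: of_nat_Suc)
  then have b: "\<bar>sin_fun n x\<bar> \<le> real (Suc n) * (pi - x)"
    using abs_sin_x_le_abs_x[of "real (Suc n) * (pi - x)"] x by (simp add: abs_mult)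
  show ?thesis
  proof (cases "x \<le> pi / 2")
    case True
    then have "x * 1 \<le> x * (pi - x)" using x pi_gt3 by (intro mult_left_mono) auto
    then have "real (Suc n) * x \<le> real (Suc n) * (x * (pi - x))" by (intro mult_left_mono) auto
    then show ?thesis using a by linarith
  next
    case False
    then have "1 * (pi - x) \<le> x * (pi - x)" using x pi_gt3 by (intro mult_right_mono) auto
    then have "real (Suc n) * (pi - x) \<le> real (Suc n) * (x * (pi - x))" by (intro mult_left_mono) auto
    then show ?thesis using b by linarith
  qed
qed

text \<open>The slope of the cutoff blows up at the boundary like \<open>1/s\<close>, which is compensated by the zeros of
  the sine function; the bound is uniform in \<open>\<kappa>\<close>.\<close>

lemma cutoff_bounds:
  assumes \<kappa>: "0 < \<kappa>" and x: "0 < x" "x < pi"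
  shows "\<bar>cutoff \<kappa> x\<bar> \<le> 1" "\<bar>cutoff' \<kappa> x * sin_fun n x\<bar> \<le> 2 * pi * real (Suc n)"
proof -
  define s where "s = x * (pi - x)"
  define m where "m = max 0 (s - \<kappa>)"
  define q where "q = s\<^sup>2 + \<kappa>\<^sup>2"
  have s: "0 < s" using x by (simp add: s_def)
  have m: "0 \<le> m" "m \<le> s" using s \<kappa> by (auto simp: m_def)
  have q: "0 < q" using \<kappa> by (simp add: q_def add_nonneg_pos)
  have "m\<^sup>2 \<le> q" using power_mono[OF m(2,1), of 2] by (simp add: q_def add_increasing2)
  then show "\<bar>cutoff \<kappa> x\<bar> \<le> 1" using q by (simp add: cutoff_def s_def[symmetric] m_def[symmetric] q_def[symmetric])
  have 1: "s * \<kappa> \<le> q"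
    using sum_squares_bound[of s \<kappa>] s \<kappa> mult_pos_pos[OF s \<kappa>] unfolding q_def mult.assoc by linarith
  have 2: "m * (s + \<kappa>) \<le> q"
  proof (cases "s \<le> \<kappa>")
    case False
    then have "m * (s + \<kappa>) = s\<^sup>2 - \<kappa>\<^sup>2" by (simp add: m_def power2_eq_square algebra_simps)
    then show ?thesis by (simp add: q_def add_increasing2)
  qed (use q in \<open>simp add: m_def\<close>)
  have "\<bar>cutoff' \<kappa> x * sin_fun n x\<bar> = \<bar>pi - 2 * x\<bar> * (2 * (m * (s + \<kappa>)) * (\<kappa> * \<bar>sin_fun n x\<bar>)) / q\<^sup>2"
    using m s \<kappa> by (simp add: cutoff'_def s_def[symmetric] m_def[symmetric] q_def[symmetric] abs_mult mult_ac)
  also have "\<dots> \<le> pi * (2 * q * (real (Suc n) * q)) / q\<^sup>2"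
  proof (rule divide_right_mono)
    have "\<kappa> * \<bar>sin_fun n x\<bar> \<le> \<kappa> * (real (Suc n) * s)"
      using abs_sin_fun_le[OF x, of n] \<kappa> by (simp add: s_def mult_left_mono)
    also have "\<dots> = real (Suc n) * (s * \<kappa>)" by simp
    also have "\<dots> \<le> real (Suc n) * q" using 1 by (intro mult_left_mono) auto
    finally have 3: "\<kappa> * \<bar>sin_fun n x\<bar> \<le> real (Suc n) * q" .
    show "\<bar>pi - 2 * x\<bar> * (2 * (m * (s + \<kappa>)) * (\<kappa> * \<bar>sin_fun n x\<bar>)) \<le> pi * (2 * q * (real (Suc n) * q))"
      by (intro mult_mono mult_nonneg_nonneg 2 3) (use x m s \<kappa> q in auto)
  qed simp
  also have "\<dots> = 2 * pi * real (Suc n)" using q by (simp add: power2_eq_square)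
  finally show "\<bar>cutoff' \<kappa> x * sin_fun n x\<bar> \<le> 2 * pi * real (Suc n)" .
qed

text \<open>Membership in \<open>H\<^sub>0\<^sup>1\<close> asks for test functions that converge together with their derivatives in \<open>L\<^sup>2\<close>.
  The truncated sine functions do, by bounded pointwise convergence.\<close>

lemma sin_fun_H10: "abs_L2 (sin_fun n) \<in> H10_set"
  unfolding H10_set_iff
proof (intro exI conjI allI)
  define \<kappa> where "\<kappa> k = 1 / real (Suc k)" for k
  have \<kappa>: "0 < \<kappa> k" for k by (simp add: \<kappa>_def)
  have lim\<kappa>: "\<kappa> \<longlonglongrightarrow> 0" unfolding \<kappa>_def by (rule LIMSEQ_Suc[OF lim_1_over_n])
  let ?\<phi> = "\<lambda>k x. cutoff (\<kappa> k) x * sin_fun n x"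
  let ?g = "\<lambda>x. real (Suc n) * cos_fun n x"
  have gc: "continuous_on UNIV ?g" by (intro continuous_intros sin_fun_cont)
  show "weak_deriv (abs_L2 (sin_fun n)) (abs_L2 ?g)"
    by (rule weak_deriv_C1[OF sin_fun_DERIV(1) gc])
  show "test_fun (?\<phi> k)" for k by (rule test_fun_cutoff(1)[OF \<kappa>])
  have lims: "(\<lambda>k. cutoff (\<kappa> k) x) \<longlonglongrightarrow> 1" "(\<lambda>k. cutoff' (\<kappa> k) x) \<longlonglongrightarrow> 0" if x: "0 < x" "x < pi" for x
  proof -
    define s where "s = x * (pi - x)"
    have s: "0 < s" using x by (simp add: s_def)
    have "(\<lambda>k. cutoff (\<kappa> k) x) \<longlonglongrightarrow> (max 0 (s - 0))\<^sup>2 / (s\<^sup>2 + 0\<^sup>2)"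
      unfolding cutoff_def s_def[symmetric] by (intro tendsto_intros lim\<kappa>) (use s in auto)
    then show "(\<lambda>k. cutoff (\<kappa> k) x) \<longlonglongrightarrow> 1" using s by simp
    have "(\<lambda>k. cutoff' (\<kappa> k) x) \<longlonglongrightarrow> (pi - 2 * x) * (2 * max 0 (s - 0) * 0 * (s + 0)) / (s\<^sup>2 + 0\<^sup>2)\<^sup>2"
      unfolding cutoff'_def s_def[symmetric] by (intro tendsto_intros lim\<kappa>) (use s in auto)
    then show "(\<lambda>k. cutoff' (\<kappa> k) x) \<longlonglongrightarrow> 0" by simp
  qed
  have one: "\<bar>sin_fun n x\<bar> \<le> 1" "\<bar>cos_fun n x\<bar> \<le> 1" for x
    by (simp_all add: sin_fun_def cos_fun_def)
  show "(\<lambda>k. abs_L2 (?\<phi> k)) \<longlonglongrightarrow> abs_L2 (sin_fun n)"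
  proof (rule abs_L2_tendsto[where B = 1])
    fix x assume x: "0 < x" "x < pi"
    show "(\<lambda>k. ?\<phi> k x) \<longlonglongrightarrow> sin_fun n x"
      using tendsto_mult[OF lims(1)[OF x] tendsto_const[of "sin_fun n x"]] by simp
    show "\<bar>?\<phi> k x\<bar> \<le> 1" for k
      using mult_mono[OF cutoff_bounds(1)[OF \<kappa>[of k] x] one(1)[of x]] by (simp add: abs_mult)
  qed (use test_fun_sq(1)[OF test_fun_cutoff(1)[OF \<kappa>]] sin_fun_sq in auto)
  show "(\<lambda>k. abs_L2 (deriv (?\<phi> k))) \<longlonglongrightarrow> abs_L2 ?g"
  proof (rule abs_L2_tendsto[where B = "2 * pi * real (Suc n) + real (Suc n)"])
    fix x assume x: "0 < x" "x < pi"
    show "(\<lambda>k. deriv (?\<phi> k) x) \<longlonglongrightarrow> ?g x"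
      unfolding test_fun_cutoff(2)[OF \<kappa>]
      using tendsto_add[OF tendsto_mult[OF lims(2)[OF x] tendsto_const[of "sin_fun n x"]]
          tendsto_mult[OF lims(1)[OF x] tendsto_const[of "?g x"]]] by simp
    show "\<bar>deriv (?\<phi> k) x\<bar> \<le> 2 * pi * real (Suc n) + real (Suc n)" for k
    proof -
      have "\<bar>cutoff (\<kappa> k) x * ?g x\<bar> \<le> 1 * (real (Suc n) * 1)"
        unfolding abs_mult abs_of_nat by (intro mult_mono cutoff_bounds(1)[OF \<kappa> x] one) auto
      then show ?thesis
        unfolding test_fun_cutoff(2)[OF \<kappa>]
        using order_trans[OF abs_triangle_ineq add_mono[OF cutoff_bounds(2)[OF \<kappa>[of k] x, of n]]] by simp
    qed
  qed (use test_fun_sq(2)[OF test_fun_cutoff(1)[OF \<kappa>]] square_integrable_continuous[OF gc] in auto)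
qed

subsection \<open>Completeness and orthogonality\<close>

lemma grad_sin_fun: "grad (Abs_H10 (abs_L2 (sin_fun n))) = real (Suc n) *\<^sub>R abs_L2 (cos_fun n)"
proof -
  have "continuous_on UNIV (\<lambda>x. real (Suc n) * cos_fun n x)" by (intro continuous_intros sin_fun_cont)
  from wderiv_eqI[OF weak_deriv_C1[OF sin_fun_DERIV(1) this]] show ?thesis
    by (simp add: grad_def Abs_H10_inverse[OF sin_fun_H10] abs_L2_scale sin_fun_sq del: of_nat_Suc)
qed

lemma test_fun_approximation:
  obtains \<phi> where "\<And>k::nat. test_fun (\<phi> k)" "(\<lambda>k. abs_L2 (\<phi> k)) \<longlonglongrightarrow> H10_L2 u"
    "(\<lambda>k. abs_L2 (deriv (\<phi> k))) \<longlonglongrightarrow> grad u"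
  using H10_L2[of u] that unfolding H10_set_def grad_def by blast

text \<open>Integration by parts, extended from test functions to \<open>H\<^sub>0\<^sup>1\<close> by density.\<close>

lemma inner_grad_weak_deriv:
  assumes "weak_deriv w g"
  shows "inner w (grad u) = - inner g (H10_L2 u)"
proof -
  obtain \<phi> where \<phi>: "\<And>k::nat. test_fun (\<phi> k)" "(\<lambda>k. abs_L2 (\<phi> k)) \<longlonglongrightarrow> H10_L2 u"
    "(\<lambda>k. abs_L2 (deriv (\<phi> k))) \<longlonglongrightarrow> grad u" using test_fun_approximation[of u] by blast
  have a: "(\<lambda>k. inner w (abs_L2 (deriv (\<phi> k)))) \<longlonglongrightarrow> inner w (grad u)" by (intro tendsto_intros \<phi>)
  have b: "(\<lambda>k. - inner g (abs_L2 (\<phi> k))) \<longlonglongrightarrow> - inner g (H10_L2 u)" by (intro tendsto_intros \<phi>)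
  have "inner w (abs_L2 (deriv (\<phi> k))) = - inner g (abs_L2 (\<phi> k))" for k
    using assms \<phi>(1) by (simp add: weak_deriv_def)
  with a b show ?thesis by (simp add: LIMSEQ_unique)
qed

lemma inner_grad_sin_fun:
  "inner (grad u) (grad (Abs_H10 (abs_L2 (sin_fun n)))) = (real (Suc n))\<^sup>2 * inner (H10_L2 u) (abs_L2 (sin_fun n))"
proof -
  have "continuous_on UNIV (\<lambda>x. - real (Suc n) * sin_fun n x)" by (intro continuous_intros sin_fun_cont)
  from inner_grad_weak_deriv[OF weak_deriv_C1[OF sin_fun_DERIV(2) this], of u]
  show ?thesis
    unfolding grad_sin_fun
    by (simp only: abs_L2_scale[OF sin_fun_sq(1)] inner_scaleR_right inner_scaleR_left inner_commute[of "grad u"]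
        inner_commute[of "H10_L2 u"]) (simp add: power2_eq_square del: of_nat_Suc)
qed

text \<open>If the sine function vanished in \<open>L\<^sup>2\<close>, so would its derivative, contradicting \<open>sin\<^sup>2 + cos\<^sup>2 = 1\<close>.\<close>

lemma sin_fun_nonzero: "norm (abs_L2 (sin_fun n)) > 0"
proof (rule ccontr)
  assume "\<not> norm (abs_L2 (sin_fun n)) > 0"
  then have s0: "abs_L2 (sin_fun n) = 0" by simp
  then have "grad (Abs_H10 (abs_L2 (sin_fun n))) = 0" by (simp add: zero_H10_def[symmetric] grad_linear)
  then have c0: "abs_L2 (cos_fun n) = 0" by (simp add: grad_sin_fun del: of_nat_Suc)
  have "(\<integral>x. (sin_fun n x)\<^sup>2 + (cos_fun n x)\<^sup>2 \<partial>interval_measure) = (norm (abs_L2 (sin_fun n)))\<^sup>2 + (norm (abs_L2 (cos_fun n)))\<^sup>2"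
    using sin_fun_sq by (simp add: norm_abs_L2 square_integrable_def)
  also have "\<dots> = 0" by (simp add: s0 c0)
  finally have "(\<integral>x. 1 \<partial>interval_measure) = (0::real)" by (simp add: sin_fun_def cos_fun_def)
  moreover have "(\<integral>x. 1 \<partial>interval_measure) = pi - (0::real)"
    by (rule interval_integral_FTC) (auto intro!: derivative_eq_intros)
  ultimately show False by simp
qed

text \<open>Eigenfunctions of a symmetric form with different eigenvalues are orthogonal; no integral needs to be
  computed.\<close>

lemma sin_fun_orthogonal:
  assumes "m \<noteq> n"
  shows "inner (abs_L2 (sin_fun m)) (abs_L2 (sin_fun n)) = 0"
proof -
  let ?E = "\<lambda>n. Abs_H10 (abs_L2 (sin_fun n))"
  have "(real (Suc n))\<^sup>2 * inner (abs_L2 (sin_fun m)) (abs_L2 (sin_fun n)) = inner (grad (?E m)) (grad (?E n))"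
    by (simp add: inner_grad_sin_fun Abs_H10_inverse[OF sin_fun_H10] del: of_nat_Suc)
  moreover have "(real (Suc m))\<^sup>2 * inner (abs_L2 (sin_fun n)) (abs_L2 (sin_fun m)) = inner (grad (?E n)) (grad (?E m))"
    by (simp add: inner_grad_sin_fun Abs_H10_inverse[OF sin_fun_H10] del: of_nat_Suc)
  ultimately have "((real (Suc n))\<^sup>2 - (real (Suc m))\<^sup>2) * inner (abs_L2 (sin_fun m)) (abs_L2 (sin_fun n)) = 0"
    by (simp add: inner_commute left_diff_distrib del: of_nat_Suc)
  moreover have "(real (Suc n))\<^sup>2 \<noteq> (real (Suc m))\<^sup>2" using assms by (simp add: power2_eq_iff_nonneg)
  ultimately show ?thesis by simp
qed

text \<open>A function \<open>\<phi>\<close> supported inside \<open>(0, \<pi>)\<close> is \<open>sin x\<close> times a continuous function of \<open>cos x\<close>, and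
  the latter is approximated by Weierstrass.\<close>

lemma test_fun_sine_polynomial:
  assumes \<phi>: "test_fun \<phi>" and e: "0 < e"
  obtains p :: "nat \<Rightarrow> real" and N where "\<And>x. 0 < x \<Longrightarrow> x < pi \<Longrightarrow> \<bar>\<phi> x - sin x * (\<Sum>i\<le>N. p i * cos x ^ i)\<bar> < e"
proof -
  obtain a b where ab: "0 < a" "b < pi" "\<And>x. x \<notin> {a..b} \<Longrightarrow> \<phi> x = 0"
    using \<phi> by (auto simp: test_fun_def)
  obtain m where m: "0 < m" "\<And>x. x \<in> {a..b} \<Longrightarrow> m \<le> sin x"
  proof (cases "a \<le> b")
    case True
    have "continuous_on {a..b} sin" by (intro continuous_intros)
    then obtain y where y: "y \<in> {a..b}" "\<And>x. x \<in> {a..b} \<Longrightarrow> sin y \<le> sin x"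
      using continuous_attains_inf[of "{a..b}" sin] True by auto
    then show ?thesis using ab by (intro that[of "sin y"]) (auto intro!: sin_gt_zero)
  next
    case False
    then show ?thesis by (intro that[of 1]) auto
  qed
  \<comment> \<open>The maximum keeps the denominator away from \<open>0\<close>; on the support of \<open>\<phi>\<close> it is just the sine.\<close>
  define q where "q y = \<phi> (arccos y) / max (sin (arccos y)) m" for y
  have "continuous_on {-1..1} q"
    unfolding q_def using m(1)
    by (intro continuous_on_divide continuous_on_max continuous_on_const continuous_on_arccos'
        continuous_on_compose2[OF test_fun_DERIV(2)[OF \<phi>] continuous_on_arccos']
        continuous_on_compose2[OF continuous_on_sin[OF continuous_on_id] continuous_on_arccos']) (auto simp: max_def)
  then obtain P where P: "real_polynomial_function P" "\<And>y. y \<in> {-1..1} \<Longrightarrow> \<bar>q y - P y\<bar> < e"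
    using Stone_Weierstrass_real_polynomial_function[of "{-1..1::real}" q e] e by auto
  obtain p N where pN: "P = (\<lambda>x. \<Sum>i\<le>N. p i * x ^ i)" using P(1) by (auto simp: real_polynomial_function_iff_sum)
  have "\<bar>\<phi> x - sin x * (\<Sum>i\<le>N. p i * cos x ^ i)\<bar> < e" if x: "0 < x" "x < pi" for x
  proof -
    have s: "0 < sin x" "sin x \<le> 1" using sin_gt_zero[OF x] by auto
    have "\<phi> x = sin x * q (cos x)"
    proof (cases "x \<in> {a..b}")
      case True
      then show ?thesis using s m(2)[OF True] x by (simp add: q_def arccos_cos max_absorb1)
    qed (use ab x in \<open>auto simp: q_def arccos_cos\<close>)
    then have "\<phi> x - sin x * (\<Sum>i\<le>N. p i * cos x ^ i) = sin x * (q (cos x) - P (cos x))"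
      by (simp add: pN right_diff_distrib)
    then have "\<bar>\<phi> x - sin x * (\<Sum>i\<le>N. p i * cos x ^ i)\<bar> = sin x * \<bar>q (cos x) - P (cos x)\<bar>"
      using s by (simp add: abs_mult)
    also have "\<dots> \<le> 1 * \<bar>q (cos x) - P (cos x)\<bar>" using s by (intro mult_right_mono) auto
    also have "\<dots> < e" using P(2)[of "cos x"] by simp
    finally show ?thesis .
  qed
  then show thesis by (rule that)
qed

text \<open>The functions \<open>sin x cos\<^sup>i x\<close> are combinations of sine functions (by induction with the addition
  theorem), and their span is uniformly dense in the test functions.\<close>

lemma sin_fun_complete:
  assumes u: "\<And>n. inner u (abs_L2 (sin_fun n)) = 0"
  shows "u = 0"
proof (rule orthogonal_test_fun_imp_zero)
  define s where "s k i x = sin (real k * x) * cos x ^ i" for k i and x :: real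
  have sq: "square_integrable (s k i)" for k i
    unfolding s_def by (intro square_integrable_continuous continuous_intros)
  \<comment> \<open>\<open>sin (k x) cos x\<close> is the mean of \<open>sin ((k + 1) x)\<close> and \<open>sin ((k - 1) x)\<close>.\<close>
  have s0: "inner u (abs_L2 (s k i)) = 0" for k i
  proof (induction i arbitrary: k)
    case 0
    show ?case
    proof (cases k)
      case 0
      have "abs_L2 (\<lambda>x. 0) = 0" by (simp add: zero_L2_def)
      then show ?thesis using 0 by (simp add: s_def[abs_def])
    next
      case (Suc n)
      then show ?thesis using u[of n] by (simp add: s_def[abs_def] sin_fun_def[abs_def])
    qed
  next
    case (Suc i)
    show ?case
    proof (cases k)
      case 0
      have "abs_L2 (\<lambda>x. 0) = 0" by (simp add: zero_L2_def)
      then show ?thesis using 0 by (simp add: s_def[abs_def])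
    next
      case (Suc n)
      have e: "s k (Suc i) x = (1/2) * s (Suc k) i x + (1/2) * s n i x" for x
      proof -
        have "sin (real k * x) * cos x = (sin (real (Suc k) * x) + sin (real n * x)) / 2"
          using sin_times_cos[of "real k * x" x] Suc by (simp add: algebra_simps)
        then have "s k (Suc i) x = (sin (real (Suc k) * x) + sin (real n * x)) / 2 * cos x ^ i"
          unfolding s_def power_Suc mult.assoc[symmetric] by simp
        then show ?thesis by (simp add: s_def field_simps del: of_nat_Suc)
      qed
      have "s k (Suc i) = (\<lambda>x. (1/2) * s (Suc k) i x + (1/2) * s n i x)" using e by (rule ext)
      then have "abs_L2 (s k (Suc i)) = (1/2) *\<^sub>R abs_L2 (s (Suc k) i) + (1/2) *\<^sub>R abs_L2 (s n i)"
        using sq square_integrable_scale[OF sq, of "1/2"]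
        by (simp add: scaleR_L2.abs_eq plus_L2.abs_eq L2_eq_def)
      then show ?thesis using Suc.IH by (simp add: inner_add_right)
    qed
  qed
  fix \<phi> assume \<phi>: "test_fun \<phi>"
  note \<phi>sq = test_fun_sq(1)[OF \<phi>]
  have "\<bar>inner u (abs_L2 \<phi>)\<bar> \<le> e" if e: "0 < e" for e
  proof -
    define d where "d = e / ((1 + norm u) * (1 + sqrt pi))"
    have pos: "0 < (1 + norm u) * (1 + sqrt pi)" by (intro mult_pos_pos) (auto simp: add_pos_nonneg)
    then have d: "0 < d" using e by (simp add: d_def)
    obtain p N where p: "\<And>x. 0 < x \<Longrightarrow> x < pi \<Longrightarrow> \<bar>\<phi> x - sin x * (\<Sum>i\<le>N. p i * cos x ^ i)\<bar> < d"
      using test_fun_sine_polynomial[OF \<phi> d] by blast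
    define g where "g x = sin x * (\<Sum>i\<le>N. p i * cos x ^ i)" for x
    have gsq: "square_integrable g" unfolding g_def by (intro square_integrable_continuous continuous_intros)
    have "g = (\<lambda>x. \<Sum>i\<le>N. p i * s 1 i x)"
      by (simp add: g_def fun_eq_iff s_def sum_distrib_left mult_ac)
    moreover have "square_integrable (\<lambda>x. \<Sum>i\<le>n. p i * s 1 i x) \<and>
        inner u (abs_L2 (\<lambda>x. \<Sum>i\<le>n. p i * s 1 i x)) = 0" for n
    proof (induction n)
      case 0
      show ?case using s0 square_integrable_scale[OF sq] by (simp add: abs_L2_scale sq)
    next
      case (Suc n)
      then show ?case
        using s0 square_integrable_scale[OF sq, of "p (Suc n)" 1 "Suc n"]
          plus_L2.abs_eq[of "\<lambda>x. \<Sum>i\<le>n. p i * s 1 i x" "\<lambda>x. p (Suc n) * s 1 (Suc n) x", symmetric]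
        by (auto simp: L2_eq_def square_integrable_add abs_L2_scale sq inner_add_right)
    qed
    ultimately have g0: "inner u (abs_L2 g) = 0" by simp
    have "norm (abs_L2 \<phi> - abs_L2 g) \<le> d * sqrt pi"
    proof (rule power2_le_imp_le)
      interpret finite_measure interval_measure by (rule finite_measure_interval)
      have "(norm (abs_L2 \<phi> - abs_L2 g))\<^sup>2 = (\<integral>x. (\<phi> x - g x)\<^sup>2 \<partial>interval_measure)"
        by (simp add: minus_abs_L2 \<phi>sq gsq norm_abs_L2 square_integrable_diff)
      also have "\<dots> \<le> (\<integral>x. d\<^sup>2 \<partial>interval_measure)"
      proof (rule integral_mono_AE)
        show "integrable interval_measure (\<lambda>x. (\<phi> x - g x)\<^sup>2)"
          using square_integrable_diff[OF \<phi>sq gsq] by (simp add: square_integrable_def)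
        show "AE x in interval_measure. (\<phi> x - g x)\<^sup>2 \<le> d\<^sup>2"
        proof (rule AE_I2)
          fix x assume "x \<in> space interval_measure"
          then have "\<bar>\<phi> x - g x\<bar> \<le> d" using p[of x] by (auto simp: space_restrict_space g_def)
          from power_mono[OF this abs_ge_zero, of 2] show "(\<phi> x - g x)\<^sup>2 \<le> d\<^sup>2" by simp
        qed
      qed simp
      also have "\<dots> = d\<^sup>2 * pi - d\<^sup>2 * 0"
        by (rule interval_integral_FTC) (auto intro!: derivative_eq_intros)
      finally show "(norm (abs_L2 \<phi> - abs_L2 g))\<^sup>2 \<le> (d * sqrt pi)\<^sup>2" by (simp add: power_mult_distrib)
    qed (use d in simp)
    then have "\<bar>inner u (abs_L2 \<phi> - abs_L2 g)\<bar> \<le> norm u * (d * sqrt pi)"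
      by (rule order_trans[OF Cauchy_Schwarz_ineq2 mult_left_mono]) simp
    also have "\<dots> \<le> (1 + norm u) * (d * (1 + sqrt pi))"
      using d by (intro mult_mono) auto
    also have "\<dots> = ((1 + norm u) * (1 + sqrt pi)) * d" by (simp only: mult_ac)
    also have "\<dots> = e"
      by (simp only: d_def times_divide_eq_right nonzero_mult_div_cancel_left[OF less_imp_neq[OF pos, symmetric]])
    finally show ?thesis using g0 by (simp add: inner_diff_right)
  qed
  then have "\<bar>inner u (abs_L2 \<phi>)\<bar> \<le> 0" by (rule field_le_epsilon[of _ 0, simplified])
  then show "inner u (abs_L2 \<phi>) = 0" by simp
qed

definition sine_mode :: "nat \<Rightarrow> H10" where
  "sine_mode n = (1 / norm (abs_L2 (sin_fun n))) *\<^sub>R Abs_H10 (abs_L2 (sin_fun n))"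

abbreviation freq :: "nat \<Rightarrow> real" where "freq n \<equiv> real (Suc n)"

lemma H10_L2_sine_mode: "H10_L2 (sine_mode n) = (1 / norm (abs_L2 (sin_fun n))) *\<^sub>R abs_L2 (sin_fun n)"
  by (simp add: sine_mode_def H10_L2_linear Abs_H10_inverse[OF sin_fun_H10])

lemma sine_mode_orthonormal: "inner (H10_L2 (sine_mode m)) (H10_L2 (sine_mode n)) = (if m = n then 1 else 0)"
  using sin_fun_nonzero[of n] sin_fun_orthogonal[of m n]
  by (auto simp: H10_L2_sine_mode power2_norm_eq_inner[symmetric] power2_eq_square)

lemma sine_mode_complete: "(\<And>n. inner u (H10_L2 (sine_mode n)) = 0) \<Longrightarrow> u = 0"
  using sin_fun_nonzero by (intro sin_fun_complete) (simp add: H10_L2_sine_mode less_imp_neq[symmetric])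

lemma inner_grad_sine_mode: "inner (grad u) (grad (sine_mode n)) = (freq n)\<^sup>2 * inner (H10_L2 u) (H10_L2 (sine_mode n))"
  using inner_grad_sin_fun[of u n]
  by (simp add: sine_mode_def grad_linear H10_L2_linear Abs_H10_inverse[OF sin_fun_H10] del: of_nat_Suc)

lemma inner_H10_sine_mode: "inner u (sine_mode n) = (1 + (freq n)\<^sup>2) * inner (H10_L2 u) (H10_L2 (sine_mode n))"
  by (simp add: inner_H10_def inner_grad_sine_mode distrib_right del: of_nat_Suc)

subsection \<open>Fourier coordinates\<close>

definition L2_mode :: "nat \<Rightarrow> L2" where "L2_mode n = H10_L2 (sine_mode n)"

text \<open>The norm in \<open>H\<^sub>0\<^sup>1\<close> of a sine function that is normalised in \<open>L\<^sup>2\<close>.\<close>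

definition weight :: "nat \<Rightarrow> real" where "weight n = sqrt (1 + (freq n)\<^sup>2)"

definition H10_mode :: "nat \<Rightarrow> H10" where "H10_mode n = (1 / weight n) *\<^sub>R sine_mode n"

lemma weight_pos: "0 < weight n" and weight_sq: "(weight n)\<^sup>2 = 1 + (freq n)\<^sup>2"
proof -
  have "0 < 1 + (freq n)\<^sup>2" by (simp add: add_pos_nonneg del: of_nat_Suc)
  then show "0 < weight n" "(weight n)\<^sup>2 = 1 + (freq n)\<^sup>2" by (auto simp: weight_def simp del: of_nat_Suc)
qed

lemma inner_H10_mode: "inner u (H10_mode n) = weight n * inner (H10_L2 u) (L2_mode n)"
proof -
  have "inner u (H10_mode n) = (weight n)\<^sup>2 / weight n * inner (H10_L2 u) (L2_mode n)"
    by (simp add: H10_mode_def inner_H10_sine_mode weight_sq L2_mode_def del: of_nat_Suc)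
  then show ?thesis using weight_pos[of n] by (simp add: power2_eq_square)
qed

lemma H10_L2_H10_mode: "H10_L2 (H10_mode n) = (1 / weight n) *\<^sub>R L2_mode n"
  by (simp add: H10_mode_def H10_L2_linear L2_mode_def)

lemma L2_mode_orthonormal: "inner (L2_mode m) (L2_mode n) = (if m = n then 1 else 0)"
  by (simp add: L2_mode_def sine_mode_orthonormal)

lemma H10_mode_orthonormal: "inner (H10_mode m) (H10_mode n) = (if m = n then 1 else 0)"
  using weight_pos[of n] by (simp add: inner_H10_mode H10_L2_H10_mode L2_mode_orthonormal)

lemma H10_mode_complete:
  assumes "\<And>n. inner u (H10_mode n) = 0" shows "u = 0"
proof -
  have "inner (H10_L2 u) (H10_L2 (sine_mode n)) = 0" for n
    using assms[of n] weight_pos[of n] by (simp add: inner_H10_mode L2_mode_def)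
  then have "H10_L2 u = H10_L2 0" by (simp add: sine_mode_complete H10_L2_linear)
  then show ?thesis by (simp add: H10_L2_inject)
qed

interpretation L2: mode_decomposition "\<lambda>n v. inner v (L2_mode n)" "\<lambda>n r. r *\<^sub>R L2_mode n"
proof
  show "inner (r *\<^sub>R L2_mode n) v = inner r (inner v (L2_mode n))" for r n v
    by (simp add: inner_commute)
  show "inner (r *\<^sub>R L2_mode n) (L2_mode m) = (if m = n then r else 0)" for r m n
    by (simp add: L2_mode_orthonormal)
qed (rule sine_mode_complete[folded L2_mode_def])

interpretation H10: mode_decomposition "\<lambda>n u. inner u (H10_mode n)" "\<lambda>n r. r *\<^sub>R H10_mode n"
proof
  show "inner (r *\<^sub>R H10_mode n) v = inner r (inner v (H10_mode n))" for r n v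
    by (simp add: inner_commute)
  show "inner (r *\<^sub>R H10_mode n) (H10_mode m) = (if m = n then r else 0)" for r m n
    by (simp add: H10_mode_orthonormal)
qed (rule H10_mode_complete)

definition coord :: "nat \<Rightarrow> phase_space \<Rightarrow> real \<times> real" where
  "coord n x = (inner (fst x) (H10_mode n), inner (snd x) (L2_mode n))"

definition mode :: "nat \<Rightarrow> real \<times> real \<Rightarrow> phase_space" where
  "mode n k = (fst k *\<^sub>R H10_mode n, snd k *\<^sub>R L2_mode n)"

text \<open>The pair of the \<open>n\<close>-th coefficients of \<open>u\<close> and \<open>v\<close> forms one mode, since the wave equation couples them.\<close>

interpretation E: mode_decomposition coord mode
proof
  show "inner (mode n k) x = inner k (coord n x)" for n k x
    by (simp add: mode_def coord_def inner_prod_def inner_commute)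
  show "coord m (mode n k) = (if m = n then k else 0)" for m n k
    by (simp add: mode_def coord_def H10_mode_orthonormal L2_mode_orthonormal prod_eq_iff)
  fix x assume "\<And>n. coord n x = 0"
  then have "\<And>n. inner (fst x) (H10_mode n) = 0" "\<And>n. inner (snd x) (L2_mode n) = 0"
    by (simp_all add: coord_def prod_eq_iff)
  then show "x = 0" using H10_mode_complete[of "fst x"] L2.complete[of "snd x"] by (simp add: prod_eq_iff)
qed

instance L2 :: second_countable_topology
proof
  obtain D :: "L2 set" where "countable D" "\<And>x e. 0 < e \<Longrightarrow> \<exists>d\<in>D. dist x d < e"
    using L2.separable[of L2_mode] by blast
  then show "\<exists>B::L2 set set. countable B \<and> open = generate_topology B"
    by (rule second_countable_if_dense)
qed

instance H10 :: second_countable_topology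
proof
  obtain D :: "H10 set" where "countable D" "\<And>x e. 0 < e \<Longrightarrow> \<exists>d\<in>D. dist x d < e"
    using H10.separable[of H10_mode] by blast
  then show "\<exists>B::H10 set set. countable B \<and> open = generate_topology B"
    by (rule second_countable_if_dense)
qed

section \<open>The damped oscillator\<close>

text \<open>The solutions of \<open>y'' = q y\<close> with initial values \<open>(1, 0)\<close> and \<open>(0, 1)\<close>. Defining them for every sign of \<open>q\<close>
  treats the overdamped and the oscillating modes alike.\<close>

definition Cq :: "real \<Rightarrow> real \<Rightarrow> real" where
  "Cq q t = (if 0 \<le> q then cosh (sqrt q * t) else cos (sqrt (- q) * t))"

definition Sq :: "real \<Rightarrow> real \<Rightarrow> real" where
  "Sq q t = (if 0 < q then sinh (sqrt q * t) / sqrt q else if q = 0 then t else sin (sqrt (- q) * t) / sqrt (- q))"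

lemma Cq_Sq_0 [simp]: "Cq q 0 = 1" "Sq q 0 = 0"
  by (simp_all add: Cq_def Sq_def)

lemma DERIV_Cq: "(Cq q has_real_derivative q * Sq q t) (at t)"
  and DERIV_Sq: "(Sq q has_real_derivative Cq q t) (at t)"
proof -
  consider "q > 0" | "q = 0" | "q < 0" by linarith
  then have "(Cq q has_real_derivative q * Sq q t) (at t) \<and> (Sq q has_real_derivative Cq q t) (at t)"
  proof cases
    case 1
    then have e: "Cq q = (\<lambda>t. cosh (sqrt q * t))" "Sq q = (\<lambda>t. sinh (sqrt q * t) / sqrt q)"
      by (auto simp: Cq_def[abs_def] Sq_def[abs_def])
    define r where "r = sqrt q"
    have r: "r > 0" "q = r * r" using 1 by (auto simp: r_def)
    have "((\<lambda>t. cosh (r * t)) has_real_derivative q * (sinh (r * t) / r)) (at t)"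
      "((\<lambda>t. sinh (r * t) / r) has_real_derivative cosh (r * t)) (at t)"
      using r(1) by (auto intro!: derivative_eq_intros simp: r(2))
    then show ?thesis unfolding e r_def by blast
  next
    case 2
    then have e: "Cq q = (\<lambda>t. 1)" "Sq q = (\<lambda>t. t)" by (auto simp: Cq_def[abs_def] Sq_def[abs_def])
    show ?thesis unfolding e using 2 by (auto intro!: derivative_eq_intros)
  next
    case 3
    then have e: "Cq q = (\<lambda>t. cos (sqrt (- q) * t))" "Sq q = (\<lambda>t. sin (sqrt (- q) * t) / sqrt (- q))"
      by (auto simp: Cq_def[abs_def] Sq_def[abs_def])
    define r where "r = sqrt (- q)"
    have r: "r > 0" "r * r = - q" using 3 by (auto simp: r_def)
    then have q: "q = - (r * r)" by simp
    have "((\<lambda>t. cos (r * t)) has_real_derivative q * (sin (r * t) / r)) (at t)"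
      "((\<lambda>t. sin (r * t) / r) has_real_derivative cos (r * t)) (at t)"
      using r(1) by (auto intro!: derivative_eq_intros simp: q)
    then show ?thesis unfolding e r_def by blast
  qed
  then show "(Cq q has_real_derivative q * Sq q t) (at t)" "(Sq q has_real_derivative Cq q t) (at t)" by auto
qed

lemma Cq_Sq_add:
  "Cq q (s + t) = Cq q s * Cq q t + q * (Sq q s * Sq q t)"
  "Sq q (s + t) = Sq q s * Cq q t + Cq q s * Sq q t"
proof -
  consider "q > 0" | "q = 0" | "q < 0" by linarith
  then have "Cq q (s + t) = Cq q s * Cq q t + q * (Sq q s * Sq q t) \<and>
      Sq q (s + t) = Sq q s * Cq q t + Cq q s * Sq q t"
  proof cases
    case 1
    then have "q = sqrt q * sqrt q" "sqrt q > 0" by auto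
    then show ?thesis using 1
      by (simp add: Cq_def Sq_def distrib_left cosh_add sinh_add add_divide_distrib)
  next
    case 3
    then have r: "sqrt (- q) * sqrt (- q) = - q" "sqrt (- q) > 0" by auto
    then have "q * (x / sqrt (- q) * (y / sqrt (- q))) = - (x * y)" for x y
      using 3 by (simp add: field_simps)
    then show ?thesis using 3
      by (simp add: Cq_def Sq_def distrib_left cos_add sin_add add_divide_distrib)
  qed (simp add: Cq_def Sq_def)
  then show "Cq q (s + t) = Cq q s * Cq q t + q * (Sq q s * Sq q t)"
    "Sq q (s + t) = Sq q s * Cq q t + Cq q s * Sq q t" by auto
qed

lemma abs_Cq_le:
  assumes "q \<le> d\<^sup>2" "0 \<le> d" "0 \<le> t"
  shows "\<bar>Cq q t\<bar> \<le> cosh (d * t)"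
proof (cases "0 \<le> q")
  case True
  have "sqrt q \<le> d" using assms by (simp add: real_le_lsqrt)
  then have "cosh (sqrt q * t) \<le> cosh (d * t)"
    using assms True by (subst cosh_real_nonneg_le_iff) (auto intro: mult_right_mono)
  then show ?thesis using True by (simp add: Cq_def)
next
  case False
  then show ?thesis using order_trans[OF abs_cos_le_one cosh_real_ge_1] by (simp add: Cq_def)
qed

text \<open>Integrating the bound for \<open>Cq\<close>: both sides vanish at \<open>0\<close> and have the derivatives \<open>Cq q\<close> and \<open>cosh (d t)\<close>.\<close>

lemma abs_Sq_le:
  assumes q: "q \<le> d\<^sup>2" and d: "0 < d" and t: "0 \<le> t"
  shows "\<bar>Sq q t\<bar> \<le> sinh (d * t) / d"
proof -
  have D: "((\<lambda>t. sinh (d * t) / d) has_real_derivative cosh (d * t)) (at t)" for t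
    using d by (auto intro!: derivative_eq_intros)
  have "(\<lambda>t. sinh (d * t) / d - Sq q t) 0 \<le> (\<lambda>t. sinh (d * t) / d - Sq q t) t"
  proof (rule DERIV_nonneg_imp_nondecreasing[OF t])
    fix s assume "0 \<le> s" "s \<le> t"
    then show "\<exists>y. ((\<lambda>t. sinh (d * t) / d - Sq q t) has_real_derivative y) (at s) \<and> 0 \<le> y"
      using DERIV_diff[OF D DERIV_Sq] abs_Cq_le[OF q less_imp_le[OF d], of s]
      by (intro exI[of _ "cosh (d * s) - Cq q s"]) auto
  qed
  moreover have "(\<lambda>t. sinh (d * t) / d + Sq q t) 0 \<le> (\<lambda>t. sinh (d * t) / d + Sq q t) t"
  proof (rule DERIV_nonneg_imp_nondecreasing[OF t])
    fix s assume "0 \<le> s" "s \<le> t"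
    then show "\<exists>y. ((\<lambda>t. sinh (d * t) / d + Sq q t) has_real_derivative y) (at s) \<and> 0 \<le> y"
      using DERIV_add[OF D DERIV_Sq] abs_Cq_le[OF q less_imp_le[OF d], of s]
      by (intro exI[of _ "cosh (d * s) + Cq q s"]) auto
  qed
  ultimately show ?thesis by simp
qed

lemma Cq_Sq_exp_bounds:
  assumes "q \<le> d\<^sup>2" "0 < d" "0 \<le> t"
  shows "\<bar>Cq q t\<bar> \<le> exp (d * t)" "\<bar>Sq q t\<bar> \<le> exp (d * t) / (2 * d)"
proof -
  have "exp (- (d * t)) \<le> exp (d * t)" "0 < exp (- (d * t))" using assms by auto
  then have "cosh (d * t) \<le> exp (d * t)" "sinh (d * t) \<le> exp (d * t) / 2"
    unfolding cosh_def sinh_def by (auto simp: field_simps)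
  then show "\<bar>Cq q t\<bar> \<le> exp (d * t)" "\<bar>Sq q t\<bar> \<le> exp (d * t) / (2 * d)"
    using abs_Cq_le[of q d t] abs_Sq_le[of q d t] assms
      divide_right_mono[of "sinh (d * t)" "exp (d * t) / 2" d] by simp_all
qed

text \<open>The solution operator of \<open>\<epsilon>\<^sup>2 u'' + u' + \<nu>\<^sup>2 u = 0\<close> in the coordinates \<open>(w u, u')\<close>, where \<open>a = 1/(2\<epsilon>\<^sup>2)\<close>
  and \<open>B = \<nu>\<^sup>2/\<epsilon>\<^sup>2\<close>.\<close>

definition oscillator :: "real \<Rightarrow> real \<Rightarrow> real \<Rightarrow> real \<Rightarrow> real \<times> real \<Rightarrow> real \<times> real" where
  "oscillator a B w t k = (let q = a\<^sup>2 - B in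
     (exp (- (a * t)) * ((Cq q t + a * Sq q t) * fst k + w * Sq q t * snd k),
      exp (- (a * t)) * (- (B / w) * Sq q t * fst k + (Cq q t - a * Sq q t) * snd k)))"

definition oscillator_matrix :: "real \<Rightarrow> real \<Rightarrow> real \<Rightarrow> real \<times> real \<Rightarrow> real \<times> real" where
  "oscillator_matrix a B w k = (w * snd k, - (B / w) * fst k - 2 * a * snd k)"

lemma oscillator_linear: "linear (oscillator a B w t)" "linear (oscillator_matrix a B w)"
  by (auto intro!: linearI simp: oscillator_def oscillator_matrix_def Let_def algebra_simps add_divide_distrib)

lemma oscillator_0: "oscillator a B w 0 k = k"
  by (simp add: oscillator_def)

lemma oscillator_add:
  assumes "w \<noteq> 0"
  shows "oscillator a B w (s + t) k = oscillator a B w s (oscillator a B w t k)"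
proof -
  define q where "q = a\<^sup>2 - B"
  have B: "B = a\<^sup>2 - q" by (simp add: q_def)
  have e: "exp (- (a * (s + t))) = exp (- (a * s)) * exp (- (a * t))"
    by (simp add: exp_add[symmetric] algebra_simps)
  show ?thesis
    unfolding oscillator_def q_def[symmetric] Let_def Cq_Sq_add e fst_conv snd_conv prod.inject
    using assms by (simp add: B field_simps power2_eq_square)
qed

lemma oscillator_derivative:
  assumes "w \<noteq> 0"
  shows "((\<lambda>t. oscillator a B w t k) has_vector_derivative oscillator a B w t (oscillator_matrix a B w k)) (at t)"
    "oscillator a B w t (oscillator_matrix a B w k) = oscillator_matrix a B w (oscillator a B w t k)"
proof -
  define q where "q = a\<^sup>2 - B"
  have B: "B = a\<^sup>2 - q" by (simp add: q_def)
  show c: "oscillator a B w t (oscillator_matrix a B w k) = oscillator_matrix a B w (oscillator a B w t k)"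
    unfolding oscillator_def oscillator_matrix_def q_def[symmetric] Let_def fst_conv snd_conv prod.inject
    using assms by (simp add: B field_simps power2_eq_square)
  have 1: "((\<lambda>t. exp (- (a * t)) * ((Cq q t + a * Sq q t) * fst k + w * Sq q t * snd k)) has_real_derivative
      w * (exp (- (a * t)) * (- (B / w) * Sq q t * fst k + (Cq q t - a * Sq q t) * snd k))) (at t)"
    using assms
    by (auto intro!: derivative_eq_intros DERIV_Cq DERIV_Sq simp: B field_simps power2_eq_square)
  have 2: "((\<lambda>t. exp (- (a * t)) * (- (B / w) * Sq q t * fst k + (Cq q t - a * Sq q t) * snd k)) has_real_derivative
      - (B / w) * (exp (- (a * t)) * ((Cq q t + a * Sq q t) * fst k + w * Sq q t * snd k))
      - 2 * a * (exp (- (a * t)) * (- (B / w) * Sq q t * fst k + (Cq q t - a * Sq q t) * snd k))) (at t)"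
    using assms
    by (auto intro!: derivative_eq_intros DERIV_Cq DERIV_Sq simp: B field_simps power2_eq_square)
  show "((\<lambda>t. oscillator a B w t k) has_vector_derivative oscillator a B w t (oscillator_matrix a B w k)) (at t)"
    unfolding c
    using 1 2 unfolding oscillator_def oscillator_matrix_def q_def[symmetric] Let_def fst_conv snd_conv
      has_real_derivative_iff_has_vector_derivative
    by (rule has_vector_derivative_Pair)
qed

text \<open>The bound must be uniform over all \<open>\<nu>\<close>, but the entries contain the factor \<open>w \<approx> \<nu>\<close>. It is absorbed by
  the oscillation: when \<open>\<nu>\<close> is large, \<open>|Sq q t| \<le> 1 / sqrt (- q)\<close>, and \<open>sqrt (- q)\<close> is of order \<open>\<nu>/\<epsilon>\<close>;
  otherwise \<open>w\<close> itself is bounded.\<close>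

lemma oscillator_bound:
  assumes \<epsilon>: "0 < \<epsilon>" and a: "a = 1 / (2 * \<epsilon>\<^sup>2)" and B: "B = \<nu>\<^sup>2 / \<epsilon>\<^sup>2" and \<nu>: "1 \<le> \<nu>" and w: "w = sqrt (1 + \<nu>\<^sup>2)"
    and d: "0 < d" and q: "a\<^sup>2 - B \<le> d\<^sup>2" and t: "0 \<le> t"
  shows "norm (oscillator a B w t k) \<le>
    (2 * (1 + a / (2 * d)) + (2 * \<epsilon> + a * \<epsilon> / d) + (2 * \<epsilon> + a * \<epsilon> / d) / \<epsilon>\<^sup>2) * exp ((d - a) * t) * norm k"
proof -
  define q where "q = a\<^sup>2 - B"
  define W where "W = 2 * \<epsilon> + a * \<epsilon> / d"
  define x where "x = exp (d * t)"
  have a0: "0 < a" using \<epsilon> by (simp add: a)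
  have w0: "0 < w" "w\<^sup>2 = 1 + \<nu>\<^sup>2" using \<nu> by (auto simp: w add_pos_nonneg)
  have x1: "1 \<le> x" using d t by (simp add: x_def)
  have Cb: "\<bar>Cq q t\<bar> \<le> x" and Sb: "\<bar>Sq q t\<bar> \<le> x / (2 * d)"
    using Cq_Sq_exp_bounds[of q d t] assms by (auto simp: q_def x_def)
  have wS: "w * \<bar>Sq q t\<bar> \<le> W * x"
  proof (cases "2 * a\<^sup>2 * \<epsilon>\<^sup>2 \<le> \<nu>\<^sup>2")
    case True
    then have "2 * a\<^sup>2 \<le> B" using \<epsilon> by (simp add: B pos_le_divide_eq)
    then have qB: "B / 2 \<le> - q" by (simp add: q_def)
    have B0: "0 < B" using \<epsilon> \<nu> by (simp add: B)
    then have qn: "q < 0" using qB by linarith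
    define r where "r = sqrt (- q)"
    have r: "0 < r" "r\<^sup>2 = - q" using qn by (auto simp: r_def)
    have "w\<^sup>2 \<le> (2 * \<epsilon> * r)\<^sup>2"
    proof -
      have "1 \<le> \<nu>\<^sup>2" using \<nu> by (simp add: one_le_power)
      then have "w\<^sup>2 \<le> 2 * \<nu>\<^sup>2" using w0 by simp
      also have "\<dots> = 4 * \<epsilon>\<^sup>2 * (B / 2)" using \<epsilon> by (simp add: B)
      also have "\<dots> \<le> 4 * \<epsilon>\<^sup>2 * (- q)" using qB by (intro mult_left_mono) auto
      also have "\<dots> = (2 * \<epsilon> * r)\<^sup>2" by (simp add: power_mult_distrib r)
      finally show ?thesis .
    qed
    then have "w \<le> 2 * \<epsilon> * r" by (rule power2_le_imp_le) (use \<epsilon> r in simp)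
    moreover have "\<bar>Sq q t\<bar> \<le> 1 / r"
      using qn r by (simp add: Sq_def r_def[symmetric] abs_divide divide_right_mono)
    ultimately have "w * \<bar>Sq q t\<bar> \<le> (2 * \<epsilon> * r) * (1 / r)" using w0 \<epsilon> r by (intro mult_mono) auto
    also have "\<dots> = 2 * \<epsilon>" using r by simp
    also have "\<dots> \<le> W * 1" using \<epsilon> a0 d by (simp add: W_def)
    also have "\<dots> \<le> W * x" using x1 \<epsilon> a0 d by (intro mult_left_mono) (auto simp: W_def)
    finally show ?thesis .
  next
    case False
    have "1 \<le> \<nu>\<^sup>2" using \<nu> by (simp add: one_le_power)
    then have "w\<^sup>2 \<le> (2 * a * \<epsilon>)\<^sup>2" using False w0 by (simp add: power_mult_distrib)
    then have "w \<le> 2 * a * \<epsilon>" by (rule power2_le_imp_le) (use \<epsilon> a0 in simp)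
    then have "w * \<bar>Sq q t\<bar> \<le> (2 * a * \<epsilon>) * (x / (2 * d))" using Sb w0 \<epsilon> a0 by (intro mult_mono) auto
    also have "\<dots> = (a * \<epsilon> / d) * x" using d by simp
    also have "\<dots> \<le> W * x" using \<epsilon> x1 by (intro mult_right_mono) (auto simp: W_def)
    finally show ?thesis .
  qed
  have BwS: "B / w * \<bar>Sq q t\<bar> \<le> W / \<epsilon>\<^sup>2 * x"
  proof -
    have "B / w \<le> w / \<epsilon>\<^sup>2" using w0 \<epsilon> by (simp add: B field_simps power2_eq_square[symmetric])
    then have "B / w * \<bar>Sq q t\<bar> \<le> w / \<epsilon>\<^sup>2 * \<bar>Sq q t\<bar>" by (rule mult_right_mono) simp
    also have "\<dots> = (w * \<bar>Sq q t\<bar>) / \<epsilon>\<^sup>2" by simp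
    also have "\<dots> \<le> (W * x) / \<epsilon>\<^sup>2" by (rule divide_right_mono[OF wS]) simp
    finally show ?thesis by simp
  qed
  have diag: "\<bar>Cq q t + a * Sq q t\<bar> \<le> (1 + a / (2 * d)) * x" "\<bar>Cq q t - a * Sq q t\<bar> \<le> (1 + a / (2 * d)) * x"
  proof -
    have "\<bar>a * Sq q t\<bar> \<le> a * (x / (2 * d))" using mult_left_mono[OF Sb, of a] a0 by (simp add: abs_mult)
    moreover have "(1 + a / (2 * d)) * x = x + a * (x / (2 * d))" by (simp add: distrib_right)
    ultimately show "\<bar>Cq q t + a * Sq q t\<bar> \<le> (1 + a / (2 * d)) * x" "\<bar>Cq q t - a * Sq q t\<bar> \<le> (1 + a / (2 * d)) * x"
      using Cb by linarith+
  qed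
  have k: "\<bar>fst k\<bar> \<le> norm k" "\<bar>snd k\<bar> \<le> norm k"
    using norm_fst_le[of "fst k" "snd k"] norm_snd_le[where x = "fst k" and y = "snd k"] by auto
  have e0: "exp (- (a * t)) * x = exp ((d - a) * t)" by (simp add: x_def exp_add[symmetric] algebra_simps)
  have b1: "\<bar>(Cq q t + a * Sq q t) * fst k + w * Sq q t * snd k\<bar> \<le> (1 + a / (2 * d)) * x * norm k + W * x * norm k"
  proof (rule order_trans[OF abs_triangle_ineq add_mono])
    show "\<bar>(Cq q t + a * Sq q t) * fst k\<bar> \<le> (1 + a / (2 * d)) * x * norm k"
      unfolding abs_mult by (rule mult_mono[OF diag(1) k(1)]) (use a0 d x1 in auto)
    show "\<bar>w * Sq q t * snd k\<bar> \<le> W * x * norm k"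
      using mult_mono[OF wS k(2)] w0 wS by (simp add: abs_mult order_trans[OF _ wS])
  qed
  have b2: "\<bar>- (B / w) * Sq q t * fst k + (Cq q t - a * Sq q t) * snd k\<bar> \<le> W / \<epsilon>\<^sup>2 * x * norm k + (1 + a / (2 * d)) * x * norm k"
  proof (rule order_trans[OF abs_triangle_ineq add_mono])
    show "\<bar>- (B / w) * Sq q t * fst k\<bar> \<le> W / \<epsilon>\<^sup>2 * x * norm k"
    proof -
      have B0: "0 \<le> B" by (simp add: B)
      have "\<bar>- (B / w) * Sq q t * fst k\<bar> = (B / w * \<bar>Sq q t\<bar>) * \<bar>fst k\<bar>" using w0 B0 by (simp add: abs_mult)
      also have "\<dots> \<le> (W / \<epsilon>\<^sup>2 * x) * norm k"
        by (rule mult_mono[OF BwS k(1)]) (use x1 \<epsilon> a0 d in \<open>auto simp: W_def\<close>)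
      finally show ?thesis .
    qed
    show "\<bar>(Cq q t - a * Sq q t) * snd k\<bar> \<le> (1 + a / (2 * d)) * x * norm k"
      unfolding abs_mult by (rule mult_mono[OF diag(2) k(2)]) (use a0 d x1 in auto)
  qed
  have "norm (oscillator a B w t k) \<le> exp (- (a * t)) * \<bar>(Cq q t + a * Sq q t) * fst k + w * Sq q t * snd k\<bar>
      + exp (- (a * t)) * \<bar>- (B / w) * Sq q t * fst k + (Cq q t - a * Sq q t) * snd k\<bar>"
    unfolding oscillator_def q_def[symmetric] Let_def
    by (rule order_trans[OF norm_Pair_le]) (simp add: abs_mult)
  also have "\<dots> \<le> exp (- (a * t)) * ((1 + a / (2 * d)) * x * norm k + W * x * norm k)
      + exp (- (a * t)) * (W / \<epsilon>\<^sup>2 * x * norm k + (1 + a / (2 * d)) * x * norm k)"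
    by (intro add_mono mult_left_mono b1 b2) auto
  also have "\<dots> = (2 * (1 + a / (2 * d)) + W + W / \<epsilon>\<^sup>2) * (exp (- (a * t)) * x) * norm k"
    by (simp only: distrib_left distrib_right mult_ac) simp
  finally show ?thesis unfolding e0 W_def .
qed

section \<open>Semigroups are determined by their generators on modes\<close>

text \<open>Every ball of radius \<open>r\<close>, wherever it is centred, contains a point with a large image: one of \<open>T(x + z)\<close>
  and \<open>T(x - z)\<close> is at least as long as \<open>T z\<close>.\<close>

lemma bounded_linear_half_norm_attained:
  fixes T :: "'a::real_normed_vector \<Rightarrow> 'b::real_normed_vector"
  assumes T: "bounded_linear T" and r: "0 < r" and c: "\<not> (\<forall>y. norm (T y) \<le> c * norm y)" "0 \<le> c"
  shows "\<exists>x'. norm (x' - x) \<le> r \<and> c * r \<le> norm (T x')"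
proof -
  obtain y where y: "c * norm y < norm (T y)" using c by (auto simp: not_le)
  interpret T: bounded_linear T by fact
  have ny: "0 < norm y" using y c by (cases "y = 0") (auto simp: T.zero)
  define z where "z = (r / norm y) *\<^sub>R y"
  have z: "norm z = r" using ny r by (simp add: z_def)
  have "norm (T z) = r / norm y * norm (T y)" using r ny by (simp add: z_def T.scaleR)
  also have "\<dots> \<ge> r / norm y * (c * norm y)" using y r ny by (intro mult_left_mono) auto
  also have "r / norm y * (c * norm y) = c * r" using ny by simp
  finally have Tz: "c * r \<le> norm (T z)" .
  have "T (x + z) - T (x - z) = 2 *\<^sub>R T z" by (simp add: T.add T.diff scaleR_2)
  then have "2 * norm (T z) \<le> norm (T (x + z)) + norm (T (x - z))"
    by (metis norm_scaleR norm_triangle_ineq4 abs_numeral)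
  then have "c * r \<le> norm (T (x + z)) \<or> c * r \<le> norm (T (x - z))" using Tz by linarith
  then show ?thesis using z by (metis add_diff_cancel_left' diff_diff_eq2 norm_minus_commute order_refl add.commute diff_add_cancel)
qed

text \<open>The gliding hump argument without Baire's theorem: otherwise choose operators of norm above
  \<open>4\<^sup>k\<close> and move by at most \<open>3\<^sup>-\<^sup>k\<close> to a point with large image. The points converge, and the limit
  has unbounded images.\<close>

lemma uniform_boundedness:
  fixes T :: "nat \<Rightarrow> 'a::banach \<Rightarrow> 'b::real_normed_vector"
  assumes T: "\<And>n. bounded_linear (T n)" and pt: "\<And>x. \<exists>B. \<forall>n. norm (T n x) \<le> B"
  shows "\<exists>M. \<forall>n x. norm (T n x) \<le> M * norm x"
proof (rule ccontr)
  assume no: "\<not> ?thesis"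
  have "\<exists>n. 4 ^ k < onorm (T n)" for k :: nat
  proof (rule ccontr)
    assume "\<not> ?thesis"
    then have "\<forall>n x. norm (T n x) \<le> 4 ^ k * norm x"
      using order_trans[OF onorm[OF T] mult_right_mono[of _ "4 ^ k"]] by (simp add: not_less)
    then show False using no by blast
  qed
  then obtain s where s: "\<And>k :: nat. 4 ^ k < onorm (T (s k))" by metis
  have s0: "0 < onorm (T (s k))" for k using s[of k] less_trans[of 0 "4 ^ k :: real"] by auto
  define r where "r k = (1 / 3 :: real) ^ k" for k :: nat
  define c where "c k = 2 / 3 * onorm (T (s k))" for k
  have "\<not> (\<forall>y. norm (T (s k) y) \<le> c k * norm y)" for k
  proof
    assume "\<forall>y. norm (T (s k) y) \<le> c k * norm y"
    then have "onorm (T (s k)) \<le> c k" using s0[of k] by (intro onorm_bound) (auto simp: c_def)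
    then show False using s0[of k] by (simp add: c_def)
  qed
  then have "\<exists>x'. norm (x' - x) \<le> r k \<and> c k * r k \<le> norm (T (s k) x')" for k x
    using s0[of k] by (intro bounded_linear_half_norm_attained[OF T]) (auto simp: r_def c_def)
  note ex = this
  define g where "g k x = (SOME x'. norm (x' - x) \<le> r k \<and> c k * r k \<le> norm (T (s k) x'))" for k x
  have g: "norm (g k x - x) \<le> r k \<and> c k * r k \<le> norm (T (s k) (g k x))" for k x
    unfolding g_def by (rule someI_ex[OF ex])
  define X where "X = rec_nat 0 (\<lambda>k x. g (Suc k) x)"
  have X: "norm (X (Suc k) - X k) \<le> r (Suc k)" "c (Suc k) * r (Suc k) \<le> norm (T (s (Suc k)) (X (Suc k)))" for k
    using g[of "Suc k" "X k"] by (simp_all add: X_def)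
  have sr: "summable (\<lambda>k. r (Suc (k + n)))" for n unfolding r_def
    using summable_ignore_initial_segment[OF summable_geometric[of "1/3 :: real"], of "Suc n"] by simp
  have sX: "summable (\<lambda>k. X (Suc (k + n)) - X (k + n))" for n
    by (rule summable_comparison_test[OF _ sr[of n]]) (use X(1) in auto)
  have "(\<lambda>k. X (Suc (k + 0)) - X (k + 0)) sums (\<Sum>k. X (Suc (k + 0)) - X (k + 0))" by (rule summable_sums[OF sX])
  then have "(\<lambda>m. X m - X 0) \<longlonglongrightarrow> (\<Sum>k. X (Suc k) - X k)" by (simp add: sums_def sum_lessThan_telescope)
  from tendsto_add[OF this tendsto_const[of "X 0"]]
  obtain L where L: "X \<longlonglongrightarrow> L" by simp
  have close: "norm (L - X n) \<le> r n / 2" for n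
  proof (rule LIMSEQ_le_const2[OF tendsto_norm[OF tendsto_diff[OF LIMSEQ_ignore_initial_segment[OF L, of n] tendsto_const]]])
    have "norm (X (m + n) - X n) \<le> r n / 2 * (1 - (1/3) ^ m)" for m
    proof (induction m)
      case (Suc m)
      have "norm (X (Suc m + n) - X n) \<le> norm (X (Suc (m + n)) - X (m + n)) + norm (X (m + n) - X n)"
        using norm_triangle_ineq[of "X (Suc (m + n)) - X (m + n)" "X (m + n) - X n"] by simp
      also have "\<dots> \<le> r (Suc (m + n)) + r n / 2 * (1 - (1/3) ^ m)" by (rule add_mono[OF X(1) Suc])
      also have "\<dots> = r n / 2 * (1 - (1/3) ^ Suc m)" by (simp add: r_def power_add field_simps)
      finally show ?case .
    qed simp
    also have "\<And>m. r n / 2 * (1 - (1/3) ^ m) \<le> r n / 2" by (simp add: r_def mult_left_le)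
    finally show "\<exists>N. \<forall>m\<ge>N. norm (X (m + n) - X n) \<le> r n / 2" by blast
  qed
  obtain B where B: "\<And>n. norm (T n L) \<le> B" using pt by blast
  have "(4 / 3) ^ Suc k \<le> 6 * B" for k
  proof -
    let ?T = "T (s (Suc k))"
    have "norm (?T (L - X (Suc k))) \<le> onorm ?T * (r (Suc k) / 2)"
      by (rule order_trans[OF onorm[OF T] mult_left_mono[OF close]]) (use s0[of "Suc k"] in simp)
    moreover have "norm (?T (X (Suc k))) \<le> norm (?T L) + norm (?T (L - X (Suc k)))"
      using norm_triangle_ineq4[of "?T L" "?T (L - X (Suc k))"]
      by (simp add: linear_diff[OF bounded_linear.linear[OF T]])
    ultimately have "onorm ?T * r (Suc k) \<le> 6 * B"
      using X(2)[of k] B[of "s (Suc k)"] by (simp add: c_def)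
    moreover have "4 ^ Suc k * r (Suc k) \<le> onorm ?T * r (Suc k)"
      using s[of "Suc k"] by (intro mult_right_mono) (auto simp: r_def)
    moreover have "4 ^ Suc k * r (Suc k) = (4 / 3) ^ Suc k"
      unfolding r_def power_mult_distrib[symmetric] by simp
    ultimately show ?thesis by linarith
  qed
  moreover obtain k where "6 * B < (4 / 3 :: real) ^ k" using real_arch_pow[of "4/3" "6 * B"] by auto
  then have "6 * B < (4 / 3 :: real) ^ Suc k" by (rule less_le_trans) simp
  ultimately show False by (meson not_le)
qed

text \<open>Unbounded norms near \<open>0\<close> would occur along times \<open>t\<^sub>n \<rightarrow> 0\<close>, where strong continuity and the uniform
  boundedness principle exclude them.\<close>

lemma C0_semigroup_locally_bounded:
  fixes S :: "real \<Rightarrow> 'h::banach \<Rightarrow> 'h"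
  assumes S: "C0_semigroup S"
  shows "\<exists>\<delta>>0. \<exists>M. \<forall>t x. 0 \<le> t \<and> t \<le> \<delta> \<longrightarrow> norm (S t x) \<le> M * norm x"
proof (rule ccontr)
  assume no: "\<not> ?thesis"
  have "\<exists>t. 0 \<le> t \<and> t \<le> 1 / Suc n \<and> (\<exists>x. real n * norm x < norm (S t x))" for n
  proof (rule ccontr)
    assume "\<not> ?thesis"
    then have "\<forall>t x. 0 \<le> t \<and> t \<le> 1 / Suc n \<longrightarrow> norm (S t x) \<le> real n * norm x" by (meson not_less)
    moreover have "(0::real) < 1 / Suc n" by simp
    ultimately show False using no by blast
  qed
  then obtain t where t: "\<And>n. 0 \<le> t n" "\<And>n. t n \<le> 1 / Suc n" "\<And>n. \<exists>x. real n * norm x < norm (S (t n) x)"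
    by metis
  have t0: "t \<longlonglongrightarrow> 0"
    by (rule tendsto_sandwich[OF always_eventually always_eventually tendsto_const LIMSEQ_Suc[OF lim_1_over_n]])
      (use t in auto)
  have bl: "bounded_linear (S (t n))" for n using S t by (auto simp: C0_semigroup_def)
  have "\<exists>B. \<forall>n. norm (S (t n) x) \<le> B" for x
  proof -
    have S0: "S 0 x = x" and lim: "((\<lambda>t. S t x) \<longlongrightarrow> x) (at_right 0)" using S by (auto simp: C0_semigroup_def)
    have "((\<lambda>t. S t x) \<longlongrightarrow> S 0 x) (at 0 within {0..})"
      using lim S0 by (simp add: at_within_Ici_at_right)
    then have "continuous (at 0 within {0..}) (\<lambda>t. S t x)" by (simp add: continuous_within)
    then have "(\<lambda>n. S (t n) x) \<longlonglongrightarrow> S 0 x"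
      by (rule continuous_within_tendsto_compose'[OF _ _ t0]) (use t in auto)
    then have "Bseq (\<lambda>n. S (t n) x)" by (rule convergent_imp_Bseq[OF convergentI])
    then show ?thesis by (auto simp: Bseq_def)
  qed
  from uniform_boundedness[OF bl this]
  obtain M where M: "\<And>n x. norm (S (t n) x) \<le> M * norm x" by blast
  obtain n where n: "M \<le> real n" using real_arch_simple by blast
  obtain x where "real n * norm x < norm (S (t n) x)" using t(3) by blast
  then show False using M[of n x] mult_right_mono[OF n, of "norm x"] by simp
qed

text \<open>Telescoping: in \<open>S(h)\<^sup>N - S'(h)\<^sup>N\<close> one factor after the other is exchanged, and each exchange costs \<open>c\<close>, amplified
  by \<open>M\<close>.\<close>

lemma C0_semigroup_power_close:
  fixes S S' :: "real \<Rightarrow> 'h::real_normed_vector \<Rightarrow> 'h"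
  assumes S: "C0_semigroup S" and S': "C0_semigroup S'" and h: "0 \<le> h" "real N * h \<le> \<delta>"
    and M: "\<And>t x. 0 \<le> t \<Longrightarrow> t \<le> \<delta> \<Longrightarrow> norm (S t x) \<le> M * norm x" "0 \<le> M"
    and c: "\<And>j. norm (S h (S' (real j * h) x) - S' h (S' (real j * h) x)) \<le> c"
  shows "norm (S (real N * h) x - S' (real N * h) x) \<le> real N * (M * c)"
  using h(2) c
proof (induction N arbitrary: x)
  case 0
  then show ?case using S S' by (simp add: C0_semigroup_def)
next
  case (Suc N)
  have add: "S (t + s) y = S t (S s y)" "S' (t + s) y = S' t (S' s y)" if "0 \<le> t" "0 \<le> s" for t s y
    using S S' that unfolding C0_semigroup_def by blast+
  have Sl: "S (real (Suc j) * h) y = S (real j * h) (S h y)" "S' (real (Suc j) * h) y = S' (real j * h) (S' h y)" for j y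
  proof -
    have "real (Suc j) * h = real j * h + h" by (simp add: distrib_right)
    then show "S (real (Suc j) * h) y = S (real j * h) (S h y)" "S' (real (Suc j) * h) y = S' (real j * h) (S' h y)"
      using add[of "real j * h" h y] h(1) by simp_all
  qed
  have Nh: "real N * h \<le> \<delta>" "0 \<le> real N * h" using Suc.prems(1) h(1) by (auto simp: distrib_right)
  have bl: "linear (S (real N * h))"
    using S Nh(2) bounded_linear.linear unfolding C0_semigroup_def by blast
  have sh: "S' (real j * h) (S' h x) = S' (real (Suc j) * h) x" for j
    by (simp only: Sl)
  have "norm (S (real N * h) (S' h x) - S' (real N * h) (S' h x)) \<le> real N * (M * c)"
    by (rule Suc.IH[OF Nh(1)]) (unfold sh, rule Suc.prems(2))
  moreover have "norm (S (real N * h) (S h x - S' h x)) \<le> M * c"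
  proof -
    have "S' (real 0 * h) x = x" using S' by (simp add: C0_semigroup_def)
    then have "norm (S h x - S' h x) \<le> c" using Suc.prems(2)[of 0] by simp
    then show ?thesis using order_trans[OF M(1)[OF Nh(2,1)] mult_left_mono[OF _ M(2)]] by blast
  qed
  moreover have "S (real (Suc N) * h) x - S' (real (Suc N) * h) x
      = S (real N * h) (S h x - S' h x) + (S (real N * h) (S' h x) - S' (real N * h) (S' h x))"
    unfolding Sl by (simp add: linear_diff[OF bl])
  ultimately show ?case
    using norm_triangle_ineq[of "S (real N * h) (S h x - S' h x)" "S (real N * h) (S' h x) - S' (real N * h) (S' h x)"]
    by (simp add: distrib_right)
qed

text \<open>Two semigroups with the same derivative at \<open>0\<close> on every mode, one of which leaves the modes
  invariant. Cutting \<open>[0, t]\<close> into \<open>N\<close> steps, the errors of the single steps are \<open>o(1/N)\<close>, uniformly over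
  the bounded orbit inside the mode, because the mode is spanned by the images of \<open>b\<^sub>1\<close> and \<open>b\<^sub>2\<close>; so their
  sum vanishes in the limit.\<close>

lemma (in mode_decomposition) C0_semigroup_unique:
  fixes S S' :: "real \<Rightarrow> 'h \<Rightarrow> 'h" and \<Phi> :: "nat \<Rightarrow> real \<Rightarrow> 'k \<Rightarrow> 'k" and b\<^sub>1 b\<^sub>2 :: 'k and x\<^sub>1 x\<^sub>2 :: "'k \<Rightarrow> real"
  assumes S: "C0_semigroup S" and S': "C0_semigroup S'"
    and inv: "\<And>n t k. 0 \<le> t \<Longrightarrow> S' t (j n k) = j n (\<Phi> n t k)"
    and bd: "\<And>n t k. 0 \<le> t \<Longrightarrow> norm (\<Phi> n t k) \<le> B * norm k"
    and basis: "\<And>k. k = x\<^sub>1 k *\<^sub>R b\<^sub>1 + x\<^sub>2 k *\<^sub>R b\<^sub>2" "\<And>k. \<bar>x\<^sub>1 k\<bar> \<le> norm k" "\<And>k. \<bar>x\<^sub>2 k\<bar> \<le> norm k"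
    and tangent: "\<And>n k. ((\<lambda>h. (S h (j n k) - S' h (j n k)) /\<^sub>R h) \<longlongrightarrow> 0) (at_right 0)"
    and t: "0 \<le> t"
  shows "S t x = S' t x"
proof -
  obtain \<delta> M where \<delta>: "0 < \<delta>" and M: "\<And>t x. 0 \<le> t \<Longrightarrow> t \<le> \<delta> \<Longrightarrow> norm (S t x) \<le> M * norm x"
    using C0_semigroup_locally_bounded[OF S] by blast
  define M' where "M' = max M 0"
  have M': "norm (S t x) \<le> M' * norm x" if "0 \<le> t" "t \<le> \<delta>" for t x
    using order_trans[OF M[OF that] mult_right_mono[of M M' "norm x"]] by (simp add: M'_def)
  have M'0: "0 \<le> M'" by (simp add: M'_def)
  have lin: "linear (S t)" "linear (S' t)" if "0 \<le> t" for t
    using S S' that bounded_linear.linear by (auto simp: C0_semigroup_def)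
  have modes: "S t (j n k) = S' t (j n k)" if t: "0 \<le> t" "t \<le> \<delta>" for t n k
  proof (cases "t = 0")
    case False
    define e where "e h = norm (S h (j n b\<^sub>1) - S' h (j n b\<^sub>1)) + norm (S h (j n b\<^sub>2) - S' h (j n b\<^sub>2))" for h
    have e: "norm (S h (j n k) - S' h (j n k)) \<le> norm k * e h" if "0 \<le> h" for h k
    proof -
      have "S h (j n k) - S' h (j n k) = x\<^sub>1 k *\<^sub>R (S h (j n b\<^sub>1) - S' h (j n b\<^sub>1)) + x\<^sub>2 k *\<^sub>R (S h (j n b\<^sub>2) - S' h (j n b\<^sub>2))"
        by (subst (1 2) basis(1)[of k])
          (simp add: linear_add[OF j_linear] linear_scale[OF j_linear] linear_add[OF lin(1)[OF that]] linear_add[OF lin(2)[OF that]]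
            linear_scale[OF lin(1)[OF that]] linear_scale[OF lin(2)[OF that]] scaleR_diff_right)
      then have "norm (S h (j n k) - S' h (j n k)) \<le> \<bar>x\<^sub>1 k\<bar> * norm (S h (j n b\<^sub>1) - S' h (j n b\<^sub>1))
          + \<bar>x\<^sub>2 k\<bar> * norm (S h (j n b\<^sub>2) - S' h (j n b\<^sub>2))"
        by (metis norm_triangle_ineq norm_scaleR)
      also have "\<dots> \<le> norm k * norm (S h (j n b\<^sub>1) - S' h (j n b\<^sub>1)) + norm k * norm (S h (j n b\<^sub>2) - S' h (j n b\<^sub>2))"
        by (intro add_mono mult_right_mono basis) auto
      finally show ?thesis by (simp add: e_def distrib_left)
    qed
    have "((\<lambda>h. norm ((S h (j n b\<^sub>1) - S' h (j n b\<^sub>1)) /\<^sub>R h) + norm ((S h (j n b\<^sub>2) - S' h (j n b\<^sub>2)) /\<^sub>R h)) \<longlongrightarrow> 0 + 0) (at_right 0)"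
      by (intro tendsto_add tendsto_norm_zero tangent)
    then have "((\<lambda>h. e h / h) \<longlongrightarrow> 0) (at_right 0)"
      unfolding add_0_right
      by (rule Lim_transform_eventually, intro eventually_mono[OF eventually_at_right_less[of 0]])
        (simp add: e_def divide_inverse distrib_left mult.commute)
    moreover have "filterlim (\<lambda>N. t / real (Suc N)) (at_right 0) sequentially"
    proof -
      have "(\<lambda>N. t * (1 / real (Suc N))) \<longlonglongrightarrow> t * 0" by (intro tendsto_intros LIMSEQ_Suc[OF lim_1_over_n])
      then show ?thesis using t False by (simp add: filterlim_at)
    qed
    ultimately have lim: "(\<lambda>N. e (t / real (Suc N)) / (t / real (Suc N))) \<longlonglongrightarrow> 0"
      by (rule filterlim_compose)
    \<comment> \<open>\<open>e h\<close> is \<open>o(h)\<close>, so the right-hand side tends to \<open>0\<close> as the number of steps grows.\<close>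
    have le: "norm (S t (j n k) - S' t (j n k)) \<le> t * (M' * (B * norm k)) * (e (t / real (Suc N)) / (t / real (Suc N)))" for N
    proof -
      define h where "h = t / real (Suc N)"
      have h: "0 < h" "real (Suc N) * h = t" using t False by (auto simp: h_def)
      have "norm (S h (S' (real i * h) (j n k)) - S' h (S' (real i * h) (j n k))) \<le> (B * norm k) * e h" for i
        using order_trans[OF e[of h "\<Phi> n (real i * h) k"] mult_right_mono[OF bd[of "real i * h" n k]]] h
        by (simp add: inv e_def)
      from C0_semigroup_power_close[OF S S' less_imp_le[OF h(1)] _ M' M'0 this, of "Suc N"]
      have "norm (S t (j n k) - S' t (j n k)) \<le> real (Suc N) * (M' * (B * norm k * e h))"
        using t h by simp
      also have "\<dots> = t * (M' * (B * norm k)) * (e h / h)" using h by (simp add: h(2)[symmetric])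
      finally show ?thesis by (simp add: h_def)
    qed
    have "norm (S t (j n k) - S' t (j n k)) \<le> t * (M' * (B * norm k)) * 0"
      by (rule LIMSEQ_le_const[OF tendsto_mult[OF tendsto_const lim]]) (use le in blast)
    then show ?thesis by simp
  qed (use S S' in \<open>simp add: C0_semigroup_def\<close>)
  have small: "S t x = S' t x" if t: "0 \<le> t" "t \<le> \<delta>" for t x
  proof -
    have "bounded_linear (\<lambda>x. S t x - S' t x)"
      using S S' t by (intro bounded_linear_sub) (auto simp: C0_semigroup_def)
    then have "S t x - S' t x = 0" by (rule zero_by_modes) (simp add: modes[OF t])
    then show ?thesis by simp
  qed
  obtain N where N: "t / \<delta> \<le> real N" using real_arch_simple by blast
  define h where "h = t / real (Suc N)"
  have h: "0 \<le> h" "h \<le> \<delta>" "real (Suc N) * h = t"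
    using N t \<delta> by (auto simp: h_def field_simps)
  have "S (real m * h) x = S' (real m * h) x" for m
  proof (induction m)
    case (Suc m)
    have "S (real (Suc m) * h) x = S h (S (real m * h) x)" "S' (real (Suc m) * h) x = S' h (S' (real m * h) x)"
      using S S' h(1) by (auto simp: C0_semigroup_def distrib_right)
    then show ?case using Suc small[OF h(1,2)] by simp
  qed (use S S' in \<open>simp add: C0_semigroup_def\<close>)
  from this[of "Suc N"] show ?thesis by (simp only: h(3))
qed

section \<open>The semigroup of the damped wave equation\<close>

text \<open>In \<open>u'' + 2 damp u' + stiff u = 0\<close> the characteristic exponents are \<open>- damp \<plusminus> disc\<close>.\<close>

definition damp :: "real \<Rightarrow> real" where "damp \<epsilon> = 1 / (2 * \<epsilon>\<^sup>2)"
definition stiff :: "real \<Rightarrow> nat \<Rightarrow> real" where "stiff \<epsilon> n = (freq n)\<^sup>2 / \<epsilon>\<^sup>2"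
definition disc :: "real \<Rightarrow> nat \<Rightarrow> real" where "disc \<epsilon> n = sqrt ((damp \<epsilon>)\<^sup>2 - stiff \<epsilon> n)"

abbreviation osc :: "real \<Rightarrow> nat \<Rightarrow> real \<Rightarrow> real \<times> real \<Rightarrow> real \<times> real" where
  "osc \<epsilon> n \<equiv> oscillator (damp \<epsilon>) (stiff \<epsilon> n) (weight n)"

abbreviation mode_matrix :: "real \<Rightarrow> nat \<Rightarrow> real \<times> real \<Rightarrow> real \<times> real" where
  "mode_matrix \<epsilon> n \<equiv> oscillator_matrix (damp \<epsilon>) (stiff \<epsilon> n) (weight n)"

definition wave_group :: "real \<Rightarrow> real \<Rightarrow> phase_space \<Rightarrow> phase_space" where
  "wave_group \<epsilon> t = E.multiplier (\<lambda>n. osc \<epsilon> n t)"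

definition osc_const :: "real \<Rightarrow> real \<Rightarrow> real" where
  "osc_const \<epsilon> d = 2 * (1 + damp \<epsilon> / (2 * d)) + (2 * \<epsilon> + damp \<epsilon> * \<epsilon> / d) + (2 * \<epsilon> + damp \<epsilon> * \<epsilon> / d) / \<epsilon>\<^sup>2"

lemma disc_pos:
  assumes "0 < \<epsilon>" "2 * \<epsilon> * freq n < 1"
  shows "0 < disc \<epsilon> n" "(disc \<epsilon> n)\<^sup>2 = (damp \<epsilon>)\<^sup>2 - stiff \<epsilon> n" "disc \<epsilon> n < damp \<epsilon>" "0 < damp \<epsilon>"
proof -
  have "(2 * \<epsilon> * freq n)\<^sup>2 < 1\<^sup>2" using assms by (intro power_strict_mono) auto
  then have s: "4 * \<epsilon>\<^sup>2 * (freq n)\<^sup>2 < 1" by (simp add: power_mult_distrib)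
  have "stiff \<epsilon> n = (damp \<epsilon>)\<^sup>2 * (4 * \<epsilon>\<^sup>2 * (freq n)\<^sup>2)"
    using assms(1) by (simp add: stiff_def damp_def power2_eq_square field_simps del: of_nat_Suc)
  also have "\<dots> < (damp \<epsilon>)\<^sup>2 * 1" using assms(1) s by (intro mult_strict_left_mono) (auto simp: damp_def)
  finally have lt: "0 < (damp \<epsilon>)\<^sup>2 - stiff \<epsilon> n" by simp
  then show "0 < disc \<epsilon> n" "(disc \<epsilon> n)\<^sup>2 = (damp \<epsilon>)\<^sup>2 - stiff \<epsilon> n" by (auto simp: disc_def)
  show d: "0 < damp \<epsilon>" using assms by (simp add: damp_def)
  have "0 < stiff \<epsilon> n" using assms(1) by (simp add: stiff_def)
  then show "disc \<epsilon> n < damp \<epsilon>" using d unfolding disc_def by (intro real_less_lsqrt) auto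
qed

lemma osc_bound:
  assumes \<epsilon>: "0 < \<epsilon>" "2 * \<epsilon> * freq m < 1" and n: "m \<le> n" and t: "0 \<le> t"
  shows "norm (osc \<epsilon> n t k) \<le> osc_const \<epsilon> (disc \<epsilon> m) * exp ((disc \<epsilon> m - damp \<epsilon>) * t) * norm k"
  unfolding osc_const_def
proof (rule oscillator_bound[OF \<epsilon>(1)])
  have "stiff \<epsilon> m \<le> stiff \<epsilon> n"
    using n \<epsilon> unfolding stiff_def by (intro divide_right_mono power_mono) auto
  then show "(damp \<epsilon>)\<^sup>2 - stiff \<epsilon> n \<le> (disc \<epsilon> m)\<^sup>2" using disc_pos[OF \<epsilon>] by simp
qed (use disc_pos[OF \<epsilon>] t in \<open>auto simp: damp_def stiff_def weight_def\<close>)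

lemma osc_const_pos: "0 < \<epsilon> \<Longrightarrow> 0 < d \<Longrightarrow> 0 < osc_const \<epsilon> d"
  by (simp add: osc_const_def damp_def add_pos_nonneg)

lemma osc_bounded:
  assumes \<epsilon>: "0 < \<epsilon>" "2 * \<epsilon> < 1" and t: "0 \<le> t"
  shows "norm (osc \<epsilon> n t k) \<le> osc_const \<epsilon> (disc \<epsilon> 0) * norm k"
proof -
  have 0: "2 * \<epsilon> * freq 0 < 1" using \<epsilon> by simp
  have "(disc \<epsilon> 0 - damp \<epsilon>) * t \<le> 0" using disc_pos[OF \<epsilon>(1) 0] t by (intro mult_nonpos_nonneg) auto
  then have "osc_const \<epsilon> (disc \<epsilon> 0) * exp ((disc \<epsilon> 0 - damp \<epsilon>) * t) \<le> osc_const \<epsilon> (disc \<epsilon> 0) * 1"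
    using osc_const_pos[OF \<epsilon>(1) disc_pos(1)[OF \<epsilon>(1) 0]] by (intro mult_left_mono) auto
  then show ?thesis
    using order_trans[OF osc_bound[OF \<epsilon>(1) 0 le0 t, of n k] mult_right_mono[OF _ norm_ge_zero]] by simp
qed

lemma coord_wave_group:
  assumes "0 < \<epsilon>" "2 * \<epsilon> < 1" "0 \<le> t"
  shows "coord n (wave_group \<epsilon> t x) = osc \<epsilon> n t (coord n x)"
  unfolding wave_group_def by (rule E.c_multiplier[OF osc_bounded[OF assms]])

lemma weight_nz [simp]: "weight n \<noteq> 0" using weight_pos[of n] by simp

lemma wave_group_C0:
  assumes \<epsilon>: "0 < \<epsilon>" "2 * \<epsilon> < 1"
  shows "C0_semigroup (wave_group \<epsilon>)" "continuous_on {0..} (\<lambda>t. wave_group \<epsilon> t x)"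
proof -
  have K: "0 \<le> osc_const \<epsilon> (disc \<epsilon> 0)" using osc_const_pos disc_pos[of \<epsilon> 0] \<epsilon> by (auto intro: less_imp_le)
  show c: "continuous_on {0..} (\<lambda>t. wave_group \<epsilon> t x)" for x
    unfolding wave_group_def
  proof (rule E.multiplier_continuous[OF _ K])
    show "continuous_on {0..} (\<lambda>t. osc \<epsilon> n t k)" for n k
      by (rule continuous_at_imp_continuous_on)
        (blast intro: has_vector_derivative_continuous oscillator_derivative(1)[OF weight_nz])
  qed (use osc_bounded[OF \<epsilon>] oscillator_linear in auto)
  show "C0_semigroup (wave_group \<epsilon>)"
    unfolding C0_semigroup_def
  proof (intro conjI allI impI)
    show "bounded_linear (wave_group \<epsilon> t)" if "0 \<le> t" for t
      unfolding wave_group_def by (rule E.multiplier_bounded[OF osc_bounded[OF \<epsilon> that] K oscillator_linear(1)])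
    show 0: "wave_group \<epsilon> 0 x = x" for x
      by (rule E.eqI) (simp add: coord_wave_group[OF \<epsilon>] oscillator_0)
    show "wave_group \<epsilon> (t + s) x = wave_group \<epsilon> t (wave_group \<epsilon> s x)" if "0 \<le> t" "0 \<le> s" for t s x
      by (rule E.eqI) (simp add: coord_wave_group[OF \<epsilon>] that oscillator_add)
    show "((\<lambda>t. wave_group \<epsilon> t x) \<longlongrightarrow> x) (at_right 0)" for x
    proof -
      have "((\<lambda>t. wave_group \<epsilon> t x) \<longlongrightarrow> wave_group \<epsilon> 0 x) (at 0 within {0..})"
        using c[of x] unfolding continuous_on by (rule bspec) simp
      then show ?thesis by (simp only: at_within_Ici_at_right 0)
    qed
  qed
qed

lemma wave_group_mode:
  assumes "0 < \<epsilon>" "2 * \<epsilon> < 1" "0 \<le> t"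
  shows "wave_group \<epsilon> t (mode n k) = mode n (osc \<epsilon> n t k)"
  by (rule E.eqI) (auto simp: coord_wave_group[OF assms] E.c_j linear_0[OF oscillator_linear(1)])

text \<open>On the domain of the generator, two integrations by parts show that the operator acts on the
  \<open>n\<close>-th mode as the oscillator matrix.\<close>

lemma coord_wave_operator:
  assumes \<epsilon>: "0 < \<epsilon>" and x: "x \<in> wave_domain"
  shows "coord n (wave_operator \<epsilon> x) = mode_matrix \<epsilon> n (coord n x)"
proof -
  obtain u v where uv: "x = (u, v)" by (cases x)
  then have gu: "grad u \<in> H1" and v: "v \<in> H10_set" using x by (auto simp: wave_domain_def)
  let ?un = "inner (H10_L2 u) (L2_mode n)"
  have "inner (grad u) (grad (sine_mode n)) = - inner (wderiv (grad u)) (L2_mode n)"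
    using inner_grad_weak_deriv[OF weak_deriv_wderiv[OF gu]] by (simp add: L2_mode_def)
  then have nl: "inner (neg_laplacian u) (L2_mode n) = (freq n)\<^sup>2 * ?un"
    by (simp add: neg_laplacian_def inner_grad_sine_mode L2_mode_def del: of_nat_Suc)
  have b: "stiff \<epsilon> n / weight n * (weight n * ?un) = 1 / \<epsilon>\<^sup>2 * ((freq n)\<^sup>2 * ?un)"
    by (simp add: stiff_def del: of_nat_Suc)
  have "inner (- (1 / \<epsilon>\<^sup>2) *\<^sub>R neg_laplacian u - (1 / \<epsilon>\<^sup>2) *\<^sub>R v) (L2_mode n)
      = - (1 / \<epsilon>\<^sup>2 * ((freq n)\<^sup>2 * ?un)) - 1 / \<epsilon>\<^sup>2 * inner v (L2_mode n)"
    by (simp add: inner_diff_left nl del: of_nat_Suc)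
  then show ?thesis
    unfolding b[symmetric]
    by (simp add: uv coord_def wave_operator_def oscillator_matrix_def inner_H10_mode Abs_H10_inverse[OF v] damp_def
        del: of_nat_Suc)
qed

lemma test_fun_in_H10:
  assumes \<phi>: "test_fun \<phi>"
  shows "abs_L2 \<phi> \<in> H10_set" "grad (Abs_H10 (abs_L2 \<phi>)) = abs_L2 (deriv \<phi>)"
proof -
  have wd: "weak_deriv (abs_L2 \<phi>) (abs_L2 (deriv \<phi>))"
    by (rule weak_deriv_C1) (use test_fun_DERIV[OF \<phi>] in auto)
  then show H: "abs_L2 \<phi> \<in> H10_set"
    unfolding H10_set_iff by (intro exI[of _ "abs_L2 (deriv \<phi>)"] conjI exI[of _ "\<lambda>_. \<phi>"]) (auto simp: \<phi>)
  show "grad (Abs_H10 (abs_L2 \<phi>)) = abs_L2 (deriv \<phi>)"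
    by (simp add: grad_def Abs_H10_inverse[OF H] wderiv_eqI[OF wd])
qed

text \<open>The converse: if the oscillator matrices applied to the coordinates of \<open>x\<close> are the coordinates of some
  vector, then \<open>x\<close> lies in the domain. Testing against sine functions, and by density against all of
  \<open>H\<^sub>0\<^sup>1\<close>, shows that \<open>\<epsilon>\<^sup>2 y\<^sub>2 + v\<close> is the weak derivative of \<open>grad u\<close>.\<close>

lemma wave_domain_by_coords:
  assumes \<epsilon>: "0 < \<epsilon>" and y: "\<And>n. coord n y = mode_matrix \<epsilon> n (coord n x)"
  shows "x \<in> wave_domain" "y = wave_operator \<epsilon> x"
proof -
  obtain u v where uv: "x = (u, v)" by (cases x)
  obtain y1 y2 where y12: "y = (y1, y2)" by (cases y)
  have 1: "inner (H10_L2 y1) (L2_mode n) = inner v (L2_mode n)" for n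
    using y[of n] by (simp add: uv y12 coord_def oscillator_matrix_def inner_H10_mode)
  then have v: "H10_L2 y1 = v" by (rule L2.eqI)
  define g where "g = \<epsilon>\<^sup>2 *\<^sub>R y2 + v"
  have g: "inner g (L2_mode n) = - ((freq n)\<^sup>2 * inner (H10_L2 u) (L2_mode n))" for n
  proof -
    have "inner y2 (L2_mode n) = - (stiff \<epsilon> n / weight n) * (weight n * inner (H10_L2 u) (L2_mode n)) - 2 * damp \<epsilon> * inner v (L2_mode n)"
      using y[of n] by (simp add: uv y12 coord_def oscillator_matrix_def inner_H10_mode)
    then show ?thesis using \<epsilon>
      by (simp add: g_def inner_add_left stiff_def damp_def right_diff_distrib del: of_nat_Suc)
  qed
  have "bounded_linear (\<lambda>\<Phi>. inner (grad u) (grad \<Phi>) + inner g (H10_L2 \<Phi>))"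
  proof (rule bounded_linear_intro[where K = "norm (grad u) + norm g"])
    fix \<Phi> :: H10
    have "\<bar>inner (grad u) (grad \<Phi>)\<bar> \<le> norm (grad u) * norm \<Phi>"
      by (rule order_trans[OF Cauchy_Schwarz_ineq2 mult_left_mono[OF norm_grad_le]]) simp
    moreover have "\<bar>inner g (H10_L2 \<Phi>)\<bar> \<le> norm g * norm \<Phi>"
      by (rule order_trans[OF Cauchy_Schwarz_ineq2 mult_left_mono[OF norm_H10_L2_le]]) simp
    ultimately show "norm (inner (grad u) (grad \<Phi>) + inner g (H10_L2 \<Phi>)) \<le> norm \<Phi> * (norm (grad u) + norm g)"
      by (simp add: distrib_left mult.commute)
  qed (auto simp: grad_linear H10_L2_linear inner_add_right distrib_left)
  then have zero: "inner (grad u) (grad \<Phi>) + inner g (H10_L2 \<Phi>) = 0" for \<Phi>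
  proof (rule H10.zero_by_modes)
    fix n k
    have "inner (grad u) (grad (sine_mode n)) + inner g (H10_L2 (sine_mode n)) = 0"
      using g[of n] by (simp add: inner_grad_sine_mode L2_mode_def del: of_nat_Suc)
    then have "k * (1 / weight n) * (inner (grad u) (grad (sine_mode n)) + inner g (H10_L2 (sine_mode n))) = 0" by simp
    then show "inner (grad u) (grad (k *\<^sub>R H10_mode n)) + inner g (H10_L2 (k *\<^sub>R H10_mode n)) = 0"
      by (simp add: H10_mode_def grad_linear H10_L2_linear distrib_left del: of_nat_Suc)
  qed
  have wd: "weak_deriv (grad u) g"
    unfolding weak_deriv_def
  proof (intro allI impI)
    fix \<phi> assume "test_fun \<phi>"
    from test_fun_in_H10[OF this] zero[of "Abs_H10 (abs_L2 \<phi>)"]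
    show "inner (grad u) (abs_L2 (deriv \<phi>)) = - inner g (abs_L2 \<phi>)"
      by (simp add: Abs_H10_inverse)
  qed
  then show "x \<in> wave_domain" using H10_L2[of y1] by (auto simp: uv wave_domain_def H1_def v)
  have "neg_laplacian u = - g" by (simp add: neg_laplacian_def wderiv_eqI[OF wd])
  then show "y = wave_operator \<epsilon> x"
    using \<epsilon> by (simp add: uv y12 wave_operator_def v[symmetric] H10_L2_inverse g_def scaleR_diff_right)
qed

lemma vector_derivative_right_quotient:
  assumes "(f has_vector_derivative D) (at 0 within {0..1})"
  shows "((\<lambda>t. (f t - f 0) /\<^sub>R t) \<longlongrightarrow> D) (at_right (0 :: real))"
proof -
  have "((\<lambda>t. (1 / norm (t - 0)) *\<^sub>R (f t - (f 0 + (t - 0) *\<^sub>R D))) \<longlongrightarrow> 0) (at 0 within {0..1})"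
    using assms unfolding has_vector_derivative_def has_derivative_within by blast
  then have "((\<lambda>t. (1 / norm (t - 0)) *\<^sub>R (f t - (f 0 + (t - 0) *\<^sub>R D))) \<longlongrightarrow> 0) (at_right 0)"
    by (simp add: at_within_Icc_at_right)
  from tendsto_add[OF this tendsto_const[of D]]
  have "((\<lambda>t. (1 / norm (t - 0)) *\<^sub>R (f t - (f 0 + (t - 0) *\<^sub>R D)) + D) \<longlongrightarrow> D) (at_right 0)" by simp
  then show ?thesis
  proof (rule Lim_transform_eventually, intro eventually_mono[OF eventually_at_right_less[of 0]])
    fix t :: real assume "0 < t"
    then show "(1 / norm (t - 0)) *\<^sub>R (f t - (f 0 + (t - 0) *\<^sub>R D)) + D = (f t - f 0) /\<^sub>R t"
      by (simp add: scaleR_diff_right scaleR_add_right divide_inverse_commute algebra_simps)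
  qed
qed

lemma osc_quotient: "((\<lambda>t. (osc \<epsilon> n t k - k) /\<^sub>R t) \<longlongrightarrow> mode_matrix \<epsilon> n k) (at_right 0)"
  using vector_derivative_right_quotient[OF has_vector_derivative_at_within[OF oscillator_derivative(1)[of "weight n" "damp \<epsilon>" "stiff \<epsilon> n" k 0]]]
  by (simp add: oscillator_0)

text \<open>If the difference quotient converges, its coordinates identify the limit. Conversely, for \<open>x\<close> in the
  domain the orbit of \<open>x\<close> is the integral of the continuous orbit of \<open>y = A x\<close>, which is checked
  coordinatewise.\<close>

lemma wave_group_generates:
  assumes \<epsilon>: "0 < \<epsilon>" "2 * \<epsilon> < 1"
  shows "generates wave_domain (wave_operator \<epsilon>) (wave_group \<epsilon>)"
  unfolding generates_def
proof (intro conjI allI iffI)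
  show "C0_semigroup (wave_group \<epsilon>)" by (rule wave_group_C0[OF \<epsilon>])
  fix x y
  {
    assume lim: "((\<lambda>t. (wave_group \<epsilon> t x - x) /\<^sub>R t) \<longlongrightarrow> y) (at_right 0)"
    have "coord n y = mode_matrix \<epsilon> n (coord n x)" for n
    proof (rule tendsto_unique[OF _ _ osc_quotient])
      have "((\<lambda>t. coord n ((wave_group \<epsilon> t x - x) /\<^sub>R t)) \<longlongrightarrow> coord n y) (at_right 0)"
        by (rule bounded_linear.tendsto[OF E.c_bounded lim])
      then show "((\<lambda>t. (osc \<epsilon> n t (coord n x) - coord n x) /\<^sub>R t) \<longlongrightarrow> coord n y) (at_right 0)"
        by (rule Lim_transform_eventually, intro eventually_mono[OF eventually_at_right_less[of 0]])
          (simp add: coord_wave_group[OF \<epsilon>] linear_scale[OF E.c_linear] linear_diff[OF E.c_linear])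
    qed simp
    from wave_domain_by_coords[OF \<epsilon>(1) this]
    show "x \<in> wave_domain" "y = wave_operator \<epsilon> x" by auto
  }
  assume xy: "x \<in> wave_domain \<and> y = wave_operator \<epsilon> x"
  note c = wave_group_C0(2)[OF \<epsilon>, of y]
  have int: "wave_group \<epsilon> t x - x = integral {0..t} (\<lambda>s. wave_group \<epsilon> s y)" if t: "0 \<le> t" for t
  proof (rule E.eqI)
    fix n
    have i: "(\<lambda>s. wave_group \<epsilon> s y) integrable_on {0..t}"
      by (intro integrable_continuous_real continuous_on_subset[OF c]) auto
    have "((\<lambda>s. osc \<epsilon> n s (mode_matrix \<epsilon> n (coord n x))) has_integral
        osc \<epsilon> n t (coord n x) - osc \<epsilon> n 0 (coord n x)) {0..t}"
      by (rule fundamental_theorem_of_calculus[OF t])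
        (auto intro!: has_vector_derivative_at_within oscillator_derivative)
    then have "integral {0..t} (\<lambda>s. osc \<epsilon> n s (mode_matrix \<epsilon> n (coord n x))) = osc \<epsilon> n t (coord n x) - coord n x"
      by (simp add: integral_unique oscillator_0)
    moreover have "coord n (integral {0..t} (\<lambda>s. wave_group \<epsilon> s y)) = integral {0..t} (\<lambda>s. coord n (wave_group \<epsilon> s y))"
      using integral_linear[OF i E.c_bounded[of n]] by (simp add: o_def)
    moreover have "\<dots> = integral {0..t} (\<lambda>s. osc \<epsilon> n s (mode_matrix \<epsilon> n (coord n x)))"
      by (rule Henstock_Kurzweil_Integration.integral_cong)
        (use xy coord_wave_operator[OF \<epsilon>(1)] in \<open>simp add: coord_wave_group[OF \<epsilon>]\<close>)
    ultimately show "coord n (wave_group \<epsilon> t x - x) = coord n (integral {0..t} (\<lambda>s. wave_group \<epsilon> s y))"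
      using t by (simp add: coord_wave_group[OF \<epsilon>] linear_diff[OF E.c_linear])
  qed
  have "((\<lambda>t. integral {0..t} (\<lambda>s. wave_group \<epsilon> s y)) has_vector_derivative wave_group \<epsilon> 0 y) (at 0 within {0..1})"
    by (rule integral_has_vector_derivative) (auto intro: continuous_on_subset[OF c])
  from vector_derivative_right_quotient[OF this]
  have "((\<lambda>t. integral {0..t} (\<lambda>s. wave_group \<epsilon> s y) /\<^sub>R t) \<longlongrightarrow> y) (at_right 0)"
  proof -
    have "wave_group \<epsilon> 0 y = y" using wave_group_C0(1)[OF \<epsilon>] unfolding C0_semigroup_def by blast
    with \<open>((\<lambda>t. (integral {0..t} (\<lambda>s. wave_group \<epsilon> s y) - integral {0..0} (\<lambda>s. wave_group \<epsilon> s y)) /\<^sub>R t)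
        \<longlongrightarrow> wave_group \<epsilon> 0 y) (at_right 0)\<close>
    show ?thesis by simp
  qed
  then show "((\<lambda>t. (wave_group \<epsilon> t x - x) /\<^sub>R t) \<longlongrightarrow> y) (at_right 0)"
    by (rule Lim_transform_eventually, intro eventually_mono[OF eventually_at_right_less[of 0]]) (simp add: int)
qed

text \<open>The choice in \<open>wave_semigroup\<close> is harmless: on each mode all semigroups with this generator have the same
  derivative at \<open>0\<close>, and the modes are invariant under \<open>wave_group\<close>.\<close>

lemma wave_semigroup_eq:
  assumes \<epsilon>: "0 < \<epsilon>" "2 * \<epsilon> < 1" and t: "0 \<le> t"
  shows "wave_semigroup \<epsilon> t x = wave_group \<epsilon> t x"
proof -
  have G: "generates wave_domain (wave_operator \<epsilon>) (wave_semigroup \<epsilon>)"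
    unfolding wave_semigroup_def by (rule someI[of "generates wave_domain (wave_operator \<epsilon>)", OF wave_group_generates[OF \<epsilon>]])
  have "((\<lambda>h. (wave_semigroup \<epsilon> h (mode n k) - wave_group \<epsilon> h (mode n k)) /\<^sub>R h) \<longlongrightarrow> 0) (at_right 0)" for n k
  proof -
    define y where "y = mode n (mode_matrix \<epsilon> n k)"
    have "coord m y = mode_matrix \<epsilon> m (coord m (mode n k))" for m
      by (simp add: y_def E.c_j linear_0[OF oscillator_linear(2)])
    from wave_domain_by_coords[OF \<epsilon>(1) this]
    have "((\<lambda>h. (wave_semigroup \<epsilon> h (mode n k) - mode n k) /\<^sub>R h) \<longlongrightarrow> y) (at_right 0)"
      "((\<lambda>h. (wave_group \<epsilon> h (mode n k) - mode n k) /\<^sub>R h) \<longlongrightarrow> y) (at_right 0)"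
      using G wave_group_generates[OF \<epsilon>] unfolding generates_def by blast+
    from tendsto_diff[OF this] show ?thesis by (simp add: scaleR_diff_right)
  qed
  note tangent = this
  have SG: "C0_semigroup (wave_semigroup \<epsilon>)" using G unfolding generates_def by blast
  show ?thesis
  proof (rule E.C0_semigroup_unique[OF SG wave_group_C0(1)[OF \<epsilon>] wave_group_mode[OF \<epsilon>] osc_bounded[OF \<epsilon>] _ _ _ tangent t])
    show "k = fst k *\<^sub>R (1, 0) + snd k *\<^sub>R (0, 1)" for k :: "real \<times> real" by (simp add: prod_eq_iff)
    show "\<bar>fst k\<bar> \<le> norm k" "\<bar>snd k\<bar> \<le> norm k" for k :: "real \<times> real"
      using norm_fst_le[of "fst k" "snd k"] norm_snd_le[where x = "fst k" and y = "snd k"] by auto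
  qed
qed

section \<open>The spectral splitting of the wave semigroup\<close>

text \<open>On the range of \<open>R 0\<close> the semigroup is the group \<open>R\<close>, so its inverse is \<open>R(-t)\<close>.\<close>

lemma (in spectral_gap_system) dichotomy:
  assumes S': "\<And>t x. 0 \<le> t \<Longrightarrow> S' t x = S t x" and K: "0 < K"
  shows "pseudo_exponential_dichotomy S' (R 0)"
  unfolding pseudo_exponential_dichotomy_def
proof (intro conjI allI impI)
  show "bounded_linear (R 0)" by (rule R_linear)
  show "R 0 (R 0 x) = R 0 x" for x by (simp add: R_group[symmetric])
  have SR: "S t (R s x) = R (t + s) x" if "0 \<le> t" for t s x by (simp add: S_def R_group TR[OF that])
  show "R 0 (S' t x) = S' t (R 0 x)" if "0 \<le> t" for t x by (simp add: S' that RS SR)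
  have range: "y \<in> range (R 0) \<longleftrightarrow> R 0 y = y" for y
  proof
    assume "y \<in> range (R 0)"
    then show "R 0 y = y" by (auto simp: R_group[symmetric])
  next
    assume "R 0 y = y"
    then show "y \<in> range (R 0)" using rangeI[of "R 0" y] by simp
  qed
  have inj: "inj_on (S' t) (range (R 0))" if t: "0 \<le> t" for t
  proof (rule inj_on_inverseI)
    fix y assume "y \<in> range (R 0)"
    then have "S' t y = R t y" using SR[OF t, of 0 y] t by (simp add: S' range)
    then show "R (- t) (S' t y) = y" using \<open>y \<in> range (R 0)\<close> by (simp add: R_group[symmetric] range)
  qed
  have image: "S' t (R (- t) x) = R 0 x" if "0 \<le> t" for t x by (simp add: S' that SR)
  have inR: "R s x \<in> range (R 0)" for s x by (simp add: range R_group[symmetric])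
  show "bij_betw (S' t) (range (R 0)) (range (R 0))" if t: "0 \<le> t" for t
  proof (rule bij_betw_imageI[OF inj[OF t]], rule equalityI; rule subsetI)
    show "y \<in> range (R 0)" if "y \<in> S' t ` range (R 0)" for y using that t by (auto simp: S' SR inR)
    show "y \<in> S' t ` range (R 0)" if "y \<in> range (R 0)" for y
    proof (rule image_eqI[where x = "R (- t) y"])
      show "y = S' t (R (- t) y)" using that by (simp add: image[OF t] range)
    qed (rule inR)
  qed
  have inv: "inv_into (range (R 0)) (S' (- t)) (R 0 x) = R t x" if t: "t \<le> 0" for t x
  proof -
    have "inv_into (range (R 0)) (S' (- t)) (S' (- t) (R t x)) = R t x"
      by (rule inv_into_f_f[OF inj inR]) (use t in simp)
    moreover have "S' (- t) (R t x) = R 0 x" using image[of "- t" x] t by simp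
    ultimately show ?thesis by simp
  qed
  show "\<exists>\<alpha> \<beta> K. 0 > \<alpha> \<and> \<alpha> > \<beta> \<and> K > 0 \<and>
      (\<forall>t\<le>0. \<forall>x. norm (inv_into (range (R 0)) (S' (- t)) (R 0 x)) \<le> K * exp (\<alpha> * t) * norm x) \<and>
      (\<forall>t\<ge>0. \<forall>x. norm (S' t (x - R 0 x)) \<le> K * exp (\<beta> * t) * norm x)"
  proof (intro exI conjI allI impI)
    show "norm (inv_into (range (R 0)) (S' (- t)) (R 0 x)) \<le> K * exp (\<alpha> * t) * norm x" if "t \<le> 0" for t x
      unfolding inv[OF that] by (rule R_backward[OF that])
    show "norm (S' t (x - R 0 x)) \<le> K * exp (\<beta> * t) * norm x" if t: "0 \<le> t" for t x
    proof -
      have "S' t (x - R 0 x) = T t x"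
        using linear_diff[OF bounded_linear.linear[OF S_linear[OF t]], of x "R 0 x"] t
        by (simp add: S' SR) (simp add: S_def)
      then show ?thesis using T_decay[OF t, of x] by simp
    qed
  qed (use rates K in auto)
qed

definition slow :: "real \<Rightarrow> nat \<Rightarrow> real" where "slow \<epsilon> n = disc \<epsilon> n - damp \<epsilon>"
definition fast :: "real \<Rightarrow> nat \<Rightarrow> real" where "fast \<epsilon> n = - disc \<epsilon> n - damp \<epsilon>"

text \<open>The coordinates with respect to the eigenvectors \<open>slow_vec\<close> and \<open>fast_vec\<close> of the oscillator matrix.\<close>

definition slow_coeff :: "real \<Rightarrow> nat \<Rightarrow> real \<times> real \<Rightarrow> real" where
  "slow_coeff \<epsilon> n k = (snd k - fast \<epsilon> n * fst k / weight n) / (2 * disc \<epsilon> n)"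
definition fast_coeff :: "real \<Rightarrow> nat \<Rightarrow> real \<times> real \<Rightarrow> real" where
  "fast_coeff \<epsilon> n k = (slow \<epsilon> n * fst k / weight n - snd k) / (2 * disc \<epsilon> n)"

definition slow_vec :: "real \<Rightarrow> nat \<Rightarrow> real \<times> real" where "slow_vec \<epsilon> n = (weight n, slow \<epsilon> n)"
definition fast_vec :: "real \<Rightarrow> nat \<Rightarrow> real \<times> real" where "fast_vec \<epsilon> n = (weight n, fast \<epsilon> n)"

lemma coeff_linear: "linear (slow_coeff \<epsilon> n)" "linear (fast_coeff \<epsilon> n)"
  by (auto intro!: linearI simp: slow_coeff_def fast_coeff_def algebra_simps add_divide_distrib diff_divide_distrib)

lemma coeff_vec:
  assumes "0 < disc \<epsilon> n"
  shows "slow_coeff \<epsilon> n (slow_vec \<epsilon> n) = 1" "fast_coeff \<epsilon> n (slow_vec \<epsilon> n) = 0"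
    "slow_coeff \<epsilon> n (fast_vec \<epsilon> n) = 0" "fast_coeff \<epsilon> n (fast_vec \<epsilon> n) = 1"
  using assms by (simp_all add: slow_coeff_def fast_coeff_def slow_vec_def fast_vec_def slow_def fast_def)

lemma eigen_expansion:
  assumes "0 < disc \<epsilon> n"
  shows "slow_coeff \<epsilon> n k *\<^sub>R slow_vec \<epsilon> n + fast_coeff \<epsilon> n k *\<^sub>R fast_vec \<epsilon> n = k"
  using assms weight_pos[of n]
  by (simp add: prod_eq_iff slow_coeff_def fast_coeff_def slow_vec_def fast_vec_def slow_def fast_def field_simps)

lemma Cq_Sq_exp:
  assumes "0 < d"
  shows "Cq (d\<^sup>2) t + d * Sq (d\<^sup>2) t = exp (d * t)" "Cq (d\<^sup>2) t - d * Sq (d\<^sup>2) t = exp (- (d * t))"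
  using assms by (simp_all add: Cq_def Sq_def cosh_plus_sinh cosh_minus_sinh)

lemma osc_eigen:
  assumes "0 < \<epsilon>" "2 * \<epsilon> * freq n < 1"
  shows "osc \<epsilon> n t (slow_vec \<epsilon> n) = exp (slow \<epsilon> n * t) *\<^sub>R slow_vec \<epsilon> n"
    "osc \<epsilon> n t (fast_vec \<epsilon> n) = exp (fast \<epsilon> n * t) *\<^sub>R fast_vec \<epsilon> n"
proof -
  define d a where "d = disc \<epsilon> n" and "a = damp \<epsilon>"
  note D = disc_pos[OF assms]
  have d: "0 < d" using D by (simp add: d_def)
  have B: "stiff \<epsilon> n = a\<^sup>2 - d\<^sup>2" using D by (simp add: d_def a_def)
  define c s where "c = Cq (d\<^sup>2) t" and "s = Sq (d\<^sup>2) t"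
  have E: "exp (d * t) = c + d * s" "exp (- (d * t)) = c - d * s"
    using Cq_Sq_exp[OF d, of t] by (simp_all add: c_def s_def)
  have ex: "exp (slow \<epsilon> n * t) = exp (- (a * t)) * (c + d * s)" "exp (fast \<epsilon> n * t) = exp (- (a * t)) * (c - d * s)"
    unfolding E[symmetric] by (simp_all add: slow_def fast_def exp_add[symmetric] d_def a_def algebra_simps)
  have q: "a\<^sup>2 - stiff \<epsilon> n = d\<^sup>2" by (simp add: B)
  have o: "osc \<epsilon> n t k = (exp (- (a * t)) * ((c + a * s) * fst k + weight n * s * snd k),
      exp (- (a * t)) * (- ((a\<^sup>2 - d\<^sup>2) / weight n) * s * fst k + (c - a * s) * snd k))" for k
    unfolding oscillator_def Let_def a_def[symmetric] q c_def[symmetric] s_def[symmetric] unfolding B ..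
  show "osc \<epsilon> n t (slow_vec \<epsilon> n) = exp (slow \<epsilon> n * t) *\<^sub>R slow_vec \<epsilon> n"
    "osc \<epsilon> n t (fast_vec \<epsilon> n) = exp (fast \<epsilon> n * t) *\<^sub>R fast_vec \<epsilon> n"
    unfolding ex o using weight_pos[of n]
    by (simp_all add: slow_vec_def fast_vec_def slow_def fast_def d_def[symmetric] a_def[symmetric])
      (simp_all add: power2_eq_square algebra_simps)
qed

lemma osc_split:
  assumes "0 < \<epsilon>" "2 * \<epsilon> * freq n < 1"
  shows "osc \<epsilon> n t k = (exp (slow \<epsilon> n * t) * slow_coeff \<epsilon> n k) *\<^sub>R slow_vec \<epsilon> n
    + (exp (fast \<epsilon> n * t) * fast_coeff \<epsilon> n k) *\<^sub>R fast_vec \<epsilon> n"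
  by (subst eigen_expansion[OF disc_pos(1)[OF assms], of k, symmetric])
    (simp add: linear_add[OF oscillator_linear(1)] linear_scale[OF oscillator_linear(1)] osc_eigen[OF assms] mult.commute)

definition eigen_const :: "real \<Rightarrow> nat \<Rightarrow> real" where
  "eigen_const \<epsilon> n = (1 + \<bar>fast \<epsilon> n\<bar> / weight n) / (2 * disc \<epsilon> n) * norm (slow_vec \<epsilon> n)
     + (1 + \<bar>slow \<epsilon> n\<bar> / weight n) / (2 * disc \<epsilon> n) * norm (fast_vec \<epsilon> n)"

lemma eigen_projection_bound:
  assumes d: "0 < disc \<epsilon> n"
  shows "norm (slow_coeff \<epsilon> n k *\<^sub>R slow_vec \<epsilon> n) \<le> eigen_const \<epsilon> n * norm k"
    "norm (fast_coeff \<epsilon> n k *\<^sub>R fast_vec \<epsilon> n) \<le> eigen_const \<epsilon> n * norm k" "0 \<le> eigen_const \<epsilon> n"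
proof -
  have k: "\<bar>fst k\<bar> \<le> norm k" "\<bar>snd k\<bar> \<le> norm k"
    using norm_fst_le[of "fst k" "snd k"] norm_snd_le[where x = "fst k" and y = "snd k"] by auto
  have w: "0 < weight n" by (rule weight_pos)
  have aux: "\<bar>y + c * x / weight n\<bar> \<le> (1 + \<bar>c\<bar> / weight n) * norm k" if "\<bar>x\<bar> \<le> norm k" "\<bar>y\<bar> \<le> norm k" for x y c
  proof -
    have A: "\<bar>c * x / weight n\<bar> \<le> \<bar>c\<bar> / weight n * norm k"
      using mult_left_mono[OF that(1), of "\<bar>c\<bar> / weight n"] w by (simp add: abs_mult abs_divide)
    show ?thesis unfolding distrib_right mult_1
      using A abs_triangle_ineq[of y "c * x / weight n"] that(2) by linarith
  qed
  have s: "\<bar>slow_coeff \<epsilon> n k\<bar> \<le> (1 + \<bar>fast \<epsilon> n\<bar> / weight n) / (2 * disc \<epsilon> n) * norm k"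
    using divide_right_mono[OF aux[OF k, of "- fast \<epsilon> n"], of "2 * disc \<epsilon> n"] d by (simp add: slow_coeff_def)
  have "\<bar>- snd k\<bar> \<le> norm k" using k by simp
  then have f: "\<bar>fast_coeff \<epsilon> n k\<bar> \<le> (1 + \<bar>slow \<epsilon> n\<bar> / weight n) / (2 * disc \<epsilon> n) * norm k"
    using divide_right_mono[OF aux[OF k(1), of "- snd k" "slow \<epsilon> n"], of "2 * disc \<epsilon> n"] d
    by (simp add: fast_coeff_def)
  define a b where "a = (1 + \<bar>fast \<epsilon> n\<bar> / weight n) / (2 * disc \<epsilon> n)"
    and "b = (1 + \<bar>slow \<epsilon> n\<bar> / weight n) / (2 * disc \<epsilon> n)"
  have ab: "0 \<le> a" "0 \<le> b" using d w by (auto simp: a_def b_def)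
  have e: "eigen_const \<epsilon> n * norm k = a * norm k * norm (slow_vec \<epsilon> n) + b * norm k * norm (fast_vec \<epsilon> n)"
    unfolding eigen_const_def a_def[symmetric] b_def[symmetric] by (simp add: algebra_simps)
  have nn: "0 \<le> (1 + \<bar>fast \<epsilon> n\<bar> / weight n) / (2 * disc \<epsilon> n) * norm (slow_vec \<epsilon> n)"
    "0 \<le> (1 + \<bar>slow \<epsilon> n\<bar> / weight n) / (2 * disc \<epsilon> n) * norm (fast_vec \<epsilon> n)"
    using d w by auto
  then show "0 \<le> eigen_const \<epsilon> n" by (simp add: eigen_const_def)
  show "norm (slow_coeff \<epsilon> n k *\<^sub>R slow_vec \<epsilon> n) \<le> eigen_const \<epsilon> n * norm k"
    using mult_right_mono[OF s[folded a_def], of "norm (slow_vec \<epsilon> n)"] ab unfolding e by (simp add: add_increasing2)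
  show "norm (fast_coeff \<epsilon> n k *\<^sub>R fast_vec \<epsilon> n) \<le> eigen_const \<epsilon> n * norm k"
    using mult_right_mono[OF f[folded b_def], of "norm (fast_vec \<epsilon> n)"] ab unfolding e by (simp add: add_increasing)
qed

text \<open>The modes up to \<open>N\<close> contribute their slow directions to the finite-dimensional part. The bound on
  \<open>\<epsilon>\<close> makes the exponents of the modes up to \<open>N + 1\<close> real and well separated; the bound on \<open>L\<close> is the gap
  condition.\<close>

locale wave_gap =
  fixes \<epsilon> L :: real and N :: nat and f :: "L2 \<Rightarrow> L2" and \<phi> :: H10
  assumes eps: "0 < \<epsilon>" "4 * \<epsilon> * freq (Suc N) < 1" and f_lip: "L-lipschitz_on UNIV f"
    and L: "8 * L < 2 * real (Suc N) + 1"
begin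

lemma eps_small: "2 * \<epsilon> < 1" "n \<le> Suc N \<Longrightarrow> 2 * \<epsilon> * freq n < 1" "n \<le> Suc N \<Longrightarrow> 4 * \<epsilon> * freq n < 1"
proof -
  show 4: "4 * \<epsilon> * freq n < 1" if "n \<le> Suc N" for n
  proof -
    have "4 * \<epsilon> * freq n \<le> 4 * \<epsilon> * freq (Suc N)" using eps(1) that by (intro mult_left_mono) auto
    then show ?thesis using eps(2) by linarith
  qed
  show "2 * \<epsilon> * freq n < 1" if "n \<le> Suc N" for n
  proof -
    have "0 < \<epsilon> * freq n" using eps(1) by simp
    then show ?thesis using 4[OF that] unfolding mult.assoc by linarith
  qed
  from this[of 0] show "2 * \<epsilon> < 1" by simp
qed

lemmas d = disc_pos[OF eps(1) eps_small(2)]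

definition K :: real where "K = osc_const \<epsilon> (disc \<epsilon> (Suc N)) + (\<Sum>n\<le>N. eigen_const \<epsilon> n)"

lemma K_pos: "0 < K" and K_ge: "n \<le> N \<Longrightarrow> eigen_const \<epsilon> n \<le> K" "osc_const \<epsilon> (disc \<epsilon> (Suc N)) \<le> K"
proof -
  have e: "0 \<le> eigen_const \<epsilon> n" if "n \<le> N" for n using eigen_projection_bound(3)[OF d(1)] that by simp
  have o: "0 < osc_const \<epsilon> (disc \<epsilon> (Suc N))" by (rule osc_const_pos[OF eps(1) d(1)]) simp
  have s: "0 \<le> (\<Sum>n\<le>N. eigen_const \<epsilon> n)" using e by (intro sum_nonneg) auto
  show "0 < K" "osc_const \<epsilon> (disc \<epsilon> (Suc N)) \<le> K" using o s by (auto simp: K_def)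
  show "eigen_const \<epsilon> n \<le> K" if "n \<le> N"
    using member_le_sum[of n "{..N}" "eigen_const \<epsilon>"] e that o by (simp add: K_def)
qed

text \<open>The slow group lives on the slow eigenvectors of the modes up to \<open>N\<close>; the fast directions of these
  modes and all higher modes form the complement.\<close>

definition slow_mode :: "nat \<Rightarrow> real \<Rightarrow> real \<times> real \<Rightarrow> real \<times> real" where
  "slow_mode n t k = (if n \<le> N then (exp (slow \<epsilon> n * t) * slow_coeff \<epsilon> n k) *\<^sub>R slow_vec \<epsilon> n else 0)"

definition fast_mode :: "nat \<Rightarrow> real \<Rightarrow> real \<times> real \<Rightarrow> real \<times> real" where
  "fast_mode n t k = (if n \<le> N then (exp (fast \<epsilon> n * t) * fast_coeff \<epsilon> n k) *\<^sub>R fast_vec \<epsilon> n else osc \<epsilon> n t k)"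

definition slow_group :: "real \<Rightarrow> phase_space \<Rightarrow> phase_space" where
  "slow_group t x = (\<Sum>n\<le>N. mode n (slow_mode n t (coord n x)))"

definition fast_semigroup :: "real \<Rightarrow> phase_space \<Rightarrow> phase_space" where
  "fast_semigroup t = E.multiplier (\<lambda>n. fast_mode n t)"

abbreviation \<alpha> :: real where "\<alpha> \<equiv> slow \<epsilon> N"
abbreviation \<beta> :: real where "\<beta> \<equiv> slow \<epsilon> (Suc N)"

lemma coord_slow_group: "coord n (slow_group t x) = slow_mode n t (coord n x)"
  unfolding slow_group_def by (subst E.c_sum_j) (auto simp: slow_mode_def)

lemma disc_antimono: "m \<le> n \<Longrightarrow> disc \<epsilon> n \<le> disc \<epsilon> m"
  unfolding disc_def stiff_def using eps(1)
  by (intro real_sqrt_le_mono diff_left_mono divide_right_mono power_mono) auto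

lemma slow_neg: "n \<le> Suc N \<Longrightarrow> slow \<epsilon> n < 0" using d(3) by (simp add: slow_def)
lemma slow_antimono: "m \<le> n \<Longrightarrow> slow \<epsilon> n \<le> slow \<epsilon> m" using disc_antimono by (simp add: slow_def)
lemma fast_le: "n \<le> N \<Longrightarrow> fast \<epsilon> n \<le> \<beta>" using d(1)[of n] d(1)[of "Suc N"] by (simp add: fast_def slow_def)

lemma fast_mode_bound:
  assumes t: "0 \<le> t"
  shows "norm (fast_mode n t k) \<le> K * exp (\<beta> * t) * norm k"
proof (cases "n \<le> N")
  case True
  have "norm (fast_mode n t k) = exp (fast \<epsilon> n * t) * norm (fast_coeff \<epsilon> n k *\<^sub>R fast_vec \<epsilon> n)"
    using True by (simp add: fast_mode_def abs_mult)
  also have "\<dots> \<le> exp (\<beta> * t) * (K * norm k)"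
  proof (intro mult_mono)
    show "exp (fast \<epsilon> n * t) \<le> exp (\<beta> * t)" using fast_le[OF True] t by (simp add: mult_right_mono)
    show "norm (fast_coeff \<epsilon> n k *\<^sub>R fast_vec \<epsilon> n) \<le> K * norm k"
      using order_trans[OF eigen_projection_bound(2)[OF d(1)] mult_right_mono[OF K_ge(1)[OF True]]] True by simp
  qed auto
  finally show ?thesis by (simp add: mult_ac)
next
  case False
  then have "norm (osc \<epsilon> n t k) \<le> osc_const \<epsilon> (disc \<epsilon> (Suc N)) * exp (\<beta> * t) * norm k"
    using osc_bound[OF eps(1) eps_small(2)[OF order_refl], of n t k] t by (simp add: slow_def)
  also have "\<dots> \<le> K * exp (\<beta> * t) * norm k" using K_ge(2) by (intro mult_right_mono) auto
  finally show ?thesis using False by (simp add: fast_mode_def)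
qed

lemma fast_mode_bounded: "0 \<le> t \<Longrightarrow> norm (fast_mode n t k) \<le> K * norm k"
proof -
  assume t: "0 \<le> t"
  have "K * exp (\<beta> * t) * norm k \<le> K * 1 * norm k"
    using slow_neg[of "Suc N"] K_pos t by (intro mult_right_mono mult_left_mono) (auto simp: mult_nonpos_nonneg)
  then show ?thesis using fast_mode_bound[OF t, of n k] by simp
qed

lemma mode_linear: "linear (slow_mode n t)" "linear (fast_mode n t)"
proof -
  note lin = linear_add[OF coeff_linear(1)] linear_add[OF coeff_linear(2)] linear_scale[OF coeff_linear(1)]
    linear_scale[OF coeff_linear(2)] linear_add[OF oscillator_linear(1)] linear_scale[OF oscillator_linear(1)]
  show "linear (slow_mode n t)"
    by (rule linearI) (simp_all add: slow_mode_def lin distrib_left scaleR_add_left mult.left_commute)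
  show "linear (fast_mode n t)"
    by (rule linearI) (simp_all add: fast_mode_def lin distrib_left scaleR_add_left mult.left_commute)
qed

lemma coord_fast_semigroup: "0 \<le> t \<Longrightarrow> coord n (fast_semigroup t x) = fast_mode n t (coord n x)"
  unfolding fast_semigroup_def by (rule E.c_multiplier[OF fast_mode_bounded])

lemma slow_fast_sum: "slow_mode n t k + fast_mode n t k = osc \<epsilon> n t k"
  using osc_split[OF eps(1) eps_small(2), of n t k] by (simp add: slow_mode_def fast_mode_def)

lemma slow_fast_compose:
  "slow_mode n (s + t) k = slow_mode n s (slow_mode n t k)"
  "fast_mode n (s + t) k = fast_mode n s (fast_mode n t k)"
  "slow_mode n s (fast_mode n t k) = 0" "fast_mode n s (slow_mode n t k) = 0"
  using d(1)[of n]
  by (auto simp: slow_mode_def fast_mode_def linear_scale[OF coeff_linear(1)] linear_scale[OF coeff_linear(2)]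
      coeff_vec oscillator_add distrib_left exp_add linear_0[OF oscillator_linear(1)])

lemma slow_mode_bound:
  assumes "\<And>n. n \<le> N \<Longrightarrow> exp (slow \<epsilon> n * t) \<le> e" "0 \<le> e"
  shows "norm (slow_mode n t k) \<le> K * e * norm k"
proof (cases "n \<le> N")
  case True
  have "norm (slow_mode n t k) = exp (slow \<epsilon> n * t) * norm (slow_coeff \<epsilon> n k *\<^sub>R slow_vec \<epsilon> n)"
    using True by (simp add: slow_mode_def abs_mult)
  also have "\<dots> \<le> e * (K * norm k)"
    using assms(1)[OF True] assms(2) order_trans[OF eigen_projection_bound(1)[OF d(1)] mult_right_mono[OF K_ge(1)[OF True]]] True
    by (intro mult_mono) auto
  finally show ?thesis by (simp add: mult_ac)
qed (use K_pos assms(2) in \<open>simp add: slow_mode_def\<close>)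

definition obs :: "phase_space \<Rightarrow> L2" where "obs x = H10_L2 (fst x)"
definition nonlin :: "L2 \<Rightarrow> phase_space" where "nonlin p = (0, (1 / \<epsilon>\<^sup>2) *\<^sub>R f p)"

lemma inner_obs: "inner (obs x) (L2_mode n) = fst (coord n x) / weight n"
  by (simp add: obs_def coord_def inner_H10_mode)

text \<open>The distance \<open>2 disc\<close> of the two exponents of one mode is of order \<open>1/\<epsilon>\<^sup>2\<close>. This compensates the factor
  \<open>1/\<epsilon>\<^sup>2\<close> of the nonlinearity.\<close>

lemma disc_large: "n \<le> Suc N \<Longrightarrow> 1 / (2 * disc \<epsilon> n * \<epsilon>\<^sup>2) \<le> 2"
proof -
  assume n: "n \<le> Suc N"
  have "(4 * \<epsilon> * freq n)\<^sup>2 < 1\<^sup>2" using eps_small(3)[OF n] eps(1) by (intro power_strict_mono) auto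
  then have s: "16 * \<epsilon>\<^sup>2 * (freq n)\<^sup>2 < 1" by (simp add: power_mult_distrib)
  have "(4 * disc \<epsilon> n * \<epsilon>\<^sup>2)\<^sup>2 = 16 * (disc \<epsilon> n)\<^sup>2 * \<epsilon> ^ 4" by (simp add: power_mult_distrib power_mult[symmetric])
  also have "\<dots> = 16 * (damp \<epsilon>)\<^sup>2 * \<epsilon> ^ 4 - 16 * stiff \<epsilon> n * \<epsilon> ^ 4" by (simp add: d(2)[OF n] algebra_simps)
  also have "16 * (damp \<epsilon>)\<^sup>2 * \<epsilon> ^ 4 = 4" using eps(1) by (simp add: damp_def power_divide power_mult_distrib power_mult[symmetric])
  also have "16 * stiff \<epsilon> n * \<epsilon> ^ 4 = 16 * \<epsilon>\<^sup>2 * (freq n)\<^sup>2"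
    using eps(1) by (simp add: stiff_def eval_nat_numeral del: of_nat_Suc)
  finally have "1\<^sup>2 \<le> (4 * disc \<epsilon> n * \<epsilon>\<^sup>2)\<^sup>2" using s by simp
  then have "1 \<le> 4 * disc \<epsilon> n * \<epsilon>\<^sup>2" by (rule power2_le_imp_le) (use d(1)[OF n] in simp)
  then show ?thesis using d(1)[OF n] eps(1) by (simp add: divide_le_eq mult.assoc)
qed

lemma L_nonneg: "0 \<le> L" using f_lip by (rule lipschitz_on_nonneg)

lemma f_norm: "norm (f p - f q) \<le> L * norm (p - q)"
  using lipschitz_onD[OF f_lip, of p q] by (simp add: dist_norm)

text \<open>The estimate on which the gap condition rests: only the \<open>u\<close>-component of the response to a force
  \<open>(0, g/\<epsilon>\<^sup>2)\<close> matters, and in \<open>L\<^sup>2\<close> it is bounded uniformly in \<open>\<epsilon>\<close>.\<close>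

lemma observed_response:
  assumes c: "\<And>n r. \<bar>fst (M n (0, r / \<epsilon>\<^sup>2)) / weight n\<bar> \<le> 2 * e * \<bar>r\<bar>" and e: "0 \<le> e"
    and x: "\<And>n. coord n x = M n (coord n (nonlin p - nonlin q))"
  shows "norm (obs x) \<le> 2 * L * e * norm (p - q)"
proof -
  have "norm (obs x) \<le> (2 * e) * norm (f p - f q)"
  proof (rule L2.norm_le_by_modes[OF L2.parseval])
    fix n
    have "coord n (nonlin p - nonlin q) = (0, inner (f p - f q) (L2_mode n) / \<epsilon>\<^sup>2)"
      by (simp add: coord_def nonlin_def inner_diff_left diff_divide_distrib)
    then show "norm (inner (obs x) (L2_mode n)) \<le> 2 * e * norm (inner (f p - f q) (L2_mode n))"
      using c[of n "inner (f p - f q) (L2_mode n)"] by (simp add: inner_obs x)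
  qed (use e in auto)
  also have "\<dots> \<le> (2 * e) * (L * norm (p - q))" using f_norm e by (intro mult_left_mono) auto
  finally show ?thesis by (simp add: mult_ac)
qed

lemma coeff_force:
  assumes "n \<le> Suc N"
  shows "\<bar>slow_coeff \<epsilon> n (0, r / \<epsilon>\<^sup>2)\<bar> \<le> 2 * \<bar>r\<bar>" "\<bar>fast_coeff \<epsilon> n (0, r / \<epsilon>\<^sup>2)\<bar> \<le> 2 * \<bar>r\<bar>"
proof -
  have "1 / (2 * disc \<epsilon> n * \<epsilon>\<^sup>2) * \<bar>r\<bar> \<le> 2 * \<bar>r\<bar>" by (rule mult_right_mono[OF disc_large[OF assms]]) simp
  moreover have "\<bar>slow_coeff \<epsilon> n (0, r / \<epsilon>\<^sup>2)\<bar> = 1 / (2 * disc \<epsilon> n * \<epsilon>\<^sup>2) * \<bar>r\<bar>"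
    "\<bar>fast_coeff \<epsilon> n (0, r / \<epsilon>\<^sup>2)\<bar> = 1 / (2 * disc \<epsilon> n * \<epsilon>\<^sup>2) * \<bar>r\<bar>"
    using d(1)[OF assms] eps(1) by (simp_all add: slow_coeff_def fast_coeff_def abs_mult abs_divide mult_ac)
  ultimately show "\<bar>slow_coeff \<epsilon> n (0, r / \<epsilon>\<^sup>2)\<bar> \<le> 2 * \<bar>r\<bar>" "\<bar>fast_coeff \<epsilon> n (0, r / \<epsilon>\<^sup>2)\<bar> \<le> 2 * \<bar>r\<bar>" by simp_all
qed

text \<open>\<open>(a - b)(a + b) = (\<nu>'\<^sup>2 - \<nu>\<^sup>2)/\<epsilon>\<^sup>2\<close> for the discriminants \<open>a\<close>, \<open>b\<close> of two neighbouring modes with frequencies \<open>\<nu>\<close>, \<open>\<nu>'\<close>,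
  and \<open>a + b \<le> 1/\<epsilon>\<^sup>2\<close>.\<close>

lemma gap_size: "real (2 * Suc N + 1) \<le> \<alpha> - \<beta>"
proof -
  let ?a = "disc \<epsilon> N" and ?b = "disc \<epsilon> (Suc N)"
  have "?a\<^sup>2 - ?b\<^sup>2 = ((freq (Suc N))\<^sup>2 - (freq N)\<^sup>2) / \<epsilon>\<^sup>2"
    using d(2)[of N] d(2)[of "Suc N"] by (simp add: stiff_def diff_divide_distrib del: of_nat_Suc)
  also have "(freq (Suc N))\<^sup>2 - (freq N)\<^sup>2 = real (2 * Suc N + 1)" by (simp add: power2_eq_square algebra_simps)
  finally have e: "(?a - ?b) * (?a + ?b) = real (2 * Suc N + 1) / \<epsilon>\<^sup>2" by (simp add: power2_eq_square algebra_simps)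
  have "?a + ?b \<le> 1 / \<epsilon>\<^sup>2" using d(3)[of N] d(3)[of "Suc N"] by (simp add: damp_def)
  moreover have "0 \<le> ?a - ?b" using disc_antimono[of N "Suc N"] by simp
  ultimately have "real (2 * Suc N + 1) / \<epsilon>\<^sup>2 \<le> (?a - ?b) * (1 / \<epsilon>\<^sup>2)" unfolding e[symmetric] by (rule mult_left_mono)
  then have "real (2 * Suc N + 1) \<le> ?a - ?b" using eps(1) by (simp add: divide_le_cancel)
  then show ?thesis by (simp add: slow_def)
qed

text \<open>The observed responses are estimated mode by mode. In the modes up to \<open>N\<close> they come from single eigenvectors; in a
  higher mode, which may oscillate, \<open>|Sq|\<close> still obeys the exponential bound of mode \<open>N + 1\<close>. The weight \<open>\<eta>\<close> is the middle of the gap.\<close>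

sublocale spectral_gap_system slow_group fast_semigroup obs nonlin "(\<phi>, 0)" K "L / \<epsilon>\<^sup>2" "2 * L" \<alpha> "(\<alpha> + \<beta>) / 2" \<beta>
proof (rule spectral_gap_system.intro)
  fix s t :: real and x :: phase_space and p q :: L2
  have sb: "bounded_linear (slow_group t)" for t
  proof (rule bounded_linear_intro)
    let ?B = "K * (1 + exp (\<alpha> * t))"
    show "slow_group t (x + y) = slow_group t x + slow_group t y" for x y
      by (rule E.eqI) (simp add: coord_slow_group linear_add[OF E.c_linear] linear_add[OF mode_linear(1)])
    show "slow_group t (r *\<^sub>R x) = r *\<^sub>R slow_group t x" for r x
      by (rule E.eqI) (simp add: coord_slow_group linear_scale[OF E.c_linear] linear_scale[OF mode_linear(1)])
    show "norm (slow_group t x) \<le> norm x * ?B" for x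
    proof -
      have e: "exp (slow \<epsilon> n * t) \<le> 1 + exp (\<alpha> * t)" if "n \<le> N" for n
      proof (cases "0 \<le> t")
        case True
        then have "slow \<epsilon> n * t \<le> 0" using slow_neg[of n] that by (intro mult_nonpos_nonneg) auto
        then have "exp (slow \<epsilon> n * t) \<le> 1" by simp
        then show ?thesis using exp_gt_zero[of "\<alpha> * t"] by linarith
      next
        case False
        then have "exp (slow \<epsilon> n * t) \<le> exp (\<alpha> * t)" using slow_antimono[OF that] by (simp add: mult_right_mono_neg)
        then show ?thesis by linarith
      qed
      have "norm (slow_group t x) \<le> ?B * norm x"
        by (rule E.norm_le_by_modes[OF E.parseval])
          (use slow_mode_bound[of t "1 + exp (\<alpha> * t)", OF e] K_pos in \<open>auto simp: coord_slow_group add_nonneg_nonneg\<close>)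
      then show ?thesis by (simp add: mult.commute)
    qed
  qed
  show "bounded_linear (slow_group t)" by (rule sb)
  show "continuous_on UNIV (\<lambda>t. slow_group t x)"
    unfolding slow_group_def slow_mode_def
    by (intro continuous_on_sum bounded_linear.continuous_on[OF E.j_bounded]) (auto intro!: continuous_intros)
  show "slow_group (s + t) x = slow_group s (slow_group t x)"
    by (rule E.eqI) (simp add: coord_slow_group slow_fast_compose)
  show "norm (slow_group t x) \<le> K * exp (\<alpha> * t) * norm x" if "t \<le> 0"
  proof (rule E.norm_le_by_modes[OF E.parseval])
    show "norm (coord n (slow_group t x)) \<le> K * exp (\<alpha> * t) * norm (coord n x)" for n
      unfolding coord_slow_group
      by (rule slow_mode_bound) (use slow_antimono[of _ N] that in \<open>auto intro!: mult_right_mono_neg\<close>)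
  qed (use K_pos in auto)
  show "norm (slow_group t x) \<le> K * norm x" if "0 \<le> t"
  proof (rule E.norm_le_by_modes[OF E.parseval])
    show "norm (coord n (slow_group t x)) \<le> K * norm (coord n x)" for n
      unfolding coord_slow_group
      using slow_mode_bound[of t 1 n "coord n x"] slow_neg that by (simp add: mult_nonpos_nonneg less_imp_le)
  qed (use K_pos in auto)
  show "bounded_linear (fast_semigroup t)" if "0 \<le> t"
    unfolding fast_semigroup_def by (rule E.multiplier_bounded[OF fast_mode_bounded[OF that] less_imp_le[OF K_pos] mode_linear(2)])
  show "continuous_on {0..} (\<lambda>t. fast_semigroup t x)"
    unfolding fast_semigroup_def
  proof (rule E.multiplier_continuous[OF _ less_imp_le[OF K_pos]])
    show "continuous_on {0..} (\<lambda>t. fast_mode n t k)" for n k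
    proof (cases "n \<le> N")
      case False
      have "continuous_on {0..} (\<lambda>t. osc \<epsilon> n t k)"
        by (rule continuous_on_subset[of UNIV])
          (auto intro!: continuous_at_imp_continuous_on intro: has_vector_derivative_continuous oscillator_derivative(1)[OF weight_nz])
      then show ?thesis using False by (simp add: fast_mode_def)
    qed (auto simp: fast_mode_def intro!: continuous_intros)
  qed (use fast_mode_bounded mode_linear in auto)
  show "fast_semigroup (s + t) x = fast_semigroup s (fast_semigroup t x)" if "0 \<le> s" "0 \<le> t"
    by (rule E.eqI) (simp add: coord_fast_semigroup that slow_fast_compose)
  show "norm (fast_semigroup t x) \<le> K * exp (\<beta> * t) * norm x" if "0 \<le> t"
    by (rule E.norm_le_by_modes[OF E.parseval]) (use K_pos fast_mode_bound[OF that] that in \<open>auto simp: coord_fast_semigroup\<close>)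
  show "slow_group 0 x + fast_semigroup 0 x = x"
    by (rule E.eqI) (simp add: linear_add[OF E.c_linear] coord_slow_group coord_fast_semigroup slow_fast_sum oscillator_0)
  show "slow_group s (fast_semigroup t x) = 0" if "0 \<le> t"
    by (rule E.eqI) (simp add: coord_slow_group coord_fast_semigroup that slow_fast_compose linear_0[OF E.c_linear])
  show "fast_semigroup t (slow_group s x) = 0" if "0 \<le> t"
    by (rule E.eqI) (simp add: coord_slow_group coord_fast_semigroup that slow_fast_compose linear_0[OF E.c_linear])
  show "bounded_linear obs"
  proof (rule bounded_linear_intro[where K = 1])
    show "norm (obs x) \<le> norm x * 1" for x
      using order_trans[OF norm_H10_L2_le norm_fst_le[of "fst x" "snd x"]] by (simp add: obs_def)
  qed (simp_all add: obs_def H10_L2_linear)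
  show "norm (nonlin p - nonlin q) \<le> L / \<epsilon>\<^sup>2 * norm (p - q)"
  proof -
    have "norm (nonlin p - nonlin q) = norm (f p - f q) / \<epsilon>\<^sup>2"
      by (simp add: nonlin_def norm_Pair scaleR_diff_right[symmetric])
    then show ?thesis using divide_right_mono[OF f_norm[of p q], of "\<epsilon>\<^sup>2"] by simp
  qed
  show "norm (obs (slow_group t (nonlin p - nonlin q))) \<le> 2 * L * exp (\<alpha> * t) * norm (p - q)" if t: "t \<le> 0"
  proof (rule observed_response[where M = "\<lambda>n. slow_mode n t"])
    fix n r
    show "\<bar>fst (slow_mode n t (0, r / \<epsilon>\<^sup>2)) / weight n\<bar> \<le> 2 * exp (\<alpha> * t) * \<bar>r\<bar>"
    proof (cases "n \<le> N")
      case True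
      have "exp (slow \<epsilon> n * t) * \<bar>slow_coeff \<epsilon> n (0, r / \<epsilon>\<^sup>2)\<bar> \<le> exp (\<alpha> * t) * (2 * \<bar>r\<bar>)"
        using coeff_force(1)[of n r] True slow_antimono[OF True] t by (intro mult_mono) (auto intro: mult_right_mono_neg)
      then show ?thesis using True weight_pos[of n] by (simp add: slow_mode_def slow_vec_def abs_mult mult_ac)
    qed (simp add: slow_mode_def)
  qed (auto simp: coord_slow_group)
  show "norm (obs (fast_semigroup t (nonlin p - nonlin q))) \<le> 2 * L * exp (\<beta> * t) * norm (p - q)" if t: "0 \<le> t"
  proof (rule observed_response[where M = "\<lambda>n. fast_mode n t"])
    fix n r
    show "\<bar>fst (fast_mode n t (0, r / \<epsilon>\<^sup>2)) / weight n\<bar> \<le> 2 * exp (\<beta> * t) * \<bar>r\<bar>"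
    proof (cases "n \<le> N")
      case True
      have "exp (fast \<epsilon> n * t) * \<bar>fast_coeff \<epsilon> n (0, r / \<epsilon>\<^sup>2)\<bar> \<le> exp (\<beta> * t) * (2 * \<bar>r\<bar>)"
        using coeff_force(2)[of n r] True fast_le[OF True] t by (intro mult_mono) (auto intro: mult_right_mono)
      then show ?thesis using True weight_pos[of n] by (simp add: fast_mode_def fast_vec_def abs_mult mult_ac)
    next
      case False
      let ?d = "disc \<epsilon> (Suc N)"
      have "(damp \<epsilon>)\<^sup>2 - stiff \<epsilon> n \<le> ?d\<^sup>2"
        unfolding d(2)[OF order_refl] stiff_def using False eps(1)
        by (intro diff_left_mono divide_right_mono power_mono) auto
      from Cq_Sq_exp_bounds(2)[OF this d(1)[OF order_refl] t]
      have S: "\<bar>Sq ((damp \<epsilon>)\<^sup>2 - stiff \<epsilon> n) t\<bar> \<le> exp (?d * t) / (2 * ?d)" .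
      have "\<bar>fst (fast_mode n t (0, r / \<epsilon>\<^sup>2)) / weight n\<bar>
          = exp (- (damp \<epsilon> * t)) * (\<bar>Sq ((damp \<epsilon>)\<^sup>2 - stiff \<epsilon> n) t\<bar> * (\<bar>r\<bar> / \<epsilon>\<^sup>2))"
        using False weight_pos[of n] by (simp add: fast_mode_def oscillator_def Let_def abs_mult)
      also have "\<dots> \<le> exp (- (damp \<epsilon> * t)) * (exp (?d * t) / (2 * ?d) * (\<bar>r\<bar> / \<epsilon>\<^sup>2))"
        by (intro mult_left_mono mult_right_mono S) auto
      also have "\<dots> = (exp (- (damp \<epsilon> * t)) * exp (?d * t)) * (1 / (2 * ?d * \<epsilon>\<^sup>2)) * \<bar>r\<bar>" by simp
      also have "exp (- (damp \<epsilon> * t)) * exp (?d * t) = exp (\<beta> * t)"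
        by (simp add: slow_def exp_add[symmetric] algebra_simps)
      also have "exp (\<beta> * t) * (1 / (2 * ?d * \<epsilon>\<^sup>2)) * \<bar>r\<bar> \<le> exp (\<beta> * t) * 2 * \<bar>r\<bar>"
        by (intro mult_right_mono mult_left_mono disc_large) auto
      finally show ?thesis by (simp add: mult_ac)
    qed
  qed (auto simp: coord_fast_semigroup that)
  have g: "0 < \<alpha> - \<beta>" "8 * L < \<alpha> - \<beta>" using gap_size L by auto
  show "0 \<le> K" "0 \<le> L / \<epsilon>\<^sup>2" "0 \<le> 2 * L" using K_pos L_nonneg by auto
  show "\<beta> < (\<alpha> + \<beta>) / 2" "(\<alpha> + \<beta>) / 2 < \<alpha>" using g by auto
  show "\<alpha> < 0" by (rule slow_neg) simp
  define D where "D = \<alpha> - \<beta>"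
  have D: "\<alpha> - (\<alpha> + \<beta>) / 2 = D / 2" "(\<alpha> + \<beta>) / 2 - \<beta> = D / 2" by (auto simp: D_def field_simps)
  have "8 * L / D < 1" using g by (simp add: D_def[symmetric])
  then show "2 * L / (\<alpha> - (\<alpha> + \<beta>) / 2) + 2 * L / ((\<alpha> + \<beta>) / 2 - \<beta>) < 1" unfolding D by simp
qed

lemma S_eq_wave_semigroup: "0 \<le> t \<Longrightarrow> wave_semigroup \<epsilon> t x = S t x"
  unfolding wave_semigroup_eq[OF eps(1) eps_small(1)]
  by (rule E.eqI) (simp add: S_def coord_wave_group[OF eps(1) eps_small(1)] linear_add[OF E.c_linear]
      coord_slow_group coord_fast_semigroup slow_fast_sum)

lemma wave_dichotomy: "pseudo_exponential_dichotomy (wave_semigroup \<epsilon>) (slow_group 0)"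
  by (rule dichotomy[OF S_eq_wave_semigroup K_pos])

lemma finite_rank: "\<exists>B. finite B \<and> range (slow_group 0) = span B"
proof (intro exI conjI equalityI)
  let ?B = "(\<lambda>n. mode n (slow_vec \<epsilon> n)) ` {..N}"
  show "finite ?B" by simp
  show "range (slow_group 0) \<subseteq> span ?B"
  proof
    fix y assume "y \<in> range (slow_group 0)"
    then obtain x where "y = slow_group 0 x" by blast
    then have "y = (\<Sum>n\<le>N. slow_coeff \<epsilon> n (coord n x) *\<^sub>R mode n (slow_vec \<epsilon> n))"
      by (simp add: slow_group_def slow_mode_def linear_scale[OF E.j_linear])
    then show "y \<in> span ?B" by (simp only:) (intro span_sum span_scale span_base imageI)
  qed
  show "span ?B \<subseteq> range (slow_group 0)"
  proof (rule span_minimal)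
    show "subspace (range (slow_group 0))"
      by (rule linear_subspace_image[OF bounded_linear.linear[OF R_linear] subspace_UNIV])
    have "mode n (slow_vec \<epsilon> n) = slow_group 0 (mode n (slow_vec \<epsilon> n))" if "n \<le> N" for n
      by (rule E.eqI) (use that d(1)[of n] in \<open>auto simp: coord_slow_group E.c_j slow_mode_def coeff_vec linear_0[OF coeff_linear(1)]\<close>)
    then show "?B \<subseteq> range (slow_group 0)" by blast
  qed
qed

end

section \<open>Measurable dependence on paths\<close>

definition hat :: "real \<Rightarrow> real" where "hat x = max 0 (1 - \<bar>x\<bar>)"

text \<open>The \<open>2 (n + 1)\<^sup>2 + 1\<close> equidistant nodes of mesh \<open>1/(n + 1)\<close> in \<open>[-(n + 1), n + 1]\<close>.\<close>

definition grid :: "nat \<Rightarrow> nat \<Rightarrow> real" where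
  "grid n k = (real k - (real (Suc n))\<^sup>2) / real (Suc n)"

text \<open>The piecewise linear function with values \<open>a k\<close> at the nodes, which falls to \<open>0\<close> within one mesh width
  outside the grid.\<close>

definition hat_sum :: "nat \<Rightarrow> (nat \<Rightarrow> real) \<Rightarrow> real \<Rightarrow> real" where
  "hat_sum n a s = (\<Sum>k\<le>2 * (Suc n)\<^sup>2. a k * hat (real (Suc n) * (s - grid n k)))"

lemma hat_bounds: "0 \<le> hat x" "hat x \<le> 1" "1 \<le> \<bar>x\<bar> \<Longrightarrow> hat x = 0"
  by (auto simp: hat_def)

lemma hat_partition:
  "(\<Sum>k\<le>M. hat (x - real k)) \<le> 1" "0 \<le> x \<Longrightarrow> x \<le> real M \<Longrightarrow> (\<Sum>k\<le>M. hat (x - real k)) = 1"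
proof -
  have "(\<Sum>k\<le>M. hat (x - real k)) \<le> 1 \<and> (0 \<le> x \<longrightarrow> x \<le> real M \<longrightarrow> (\<Sum>k\<le>M. hat (x - real k)) = 1)"
  proof (induction M)
    case 0
    then show ?case by (auto simp: hat_def)
  next
    case (Suc M)
    show ?case
    proof (cases "x \<le> real M")
      case True
      then have "hat (x - real (Suc M)) = 0" by (intro hat_bounds) auto
      then show ?thesis using Suc True by simp
    next
      case False
      have "(\<Sum>k<M. hat (x - real k)) = 0"
      proof (intro sum.neutral ballI hat_bounds)
        fix k assume "k \<in> {..<M}"
        then have "real k + 1 \<le> real M" by auto
        then show "1 \<le> \<bar>x - real k\<bar>" using False by linarith
      qed
      then have "(\<Sum>k\<le>Suc M. hat (x - real k)) = hat (x - real M) + hat (x - real (Suc M))"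
        by (simp add: lessThan_Suc_atMost[symmetric])
      then show ?thesis using False by (auto simp: hat_def)
    qed
  qed
  then show "(\<Sum>k\<le>M. hat (x - real k)) \<le> 1" "0 \<le> x \<Longrightarrow> x \<le> real M \<Longrightarrow> (\<Sum>k\<le>M. hat (x - real k)) = 1" by auto
qed

lemma hat_grid: "hat (real (Suc n) * (s - grid n k)) = hat ((real (Suc n) * s + (real (Suc n))\<^sup>2) - real k)"
proof -
  have "real (Suc n) * (s - grid n k) = (real (Suc n) * s + (real (Suc n))\<^sup>2) - real k"
    by (simp add: grid_def field_simps power2_eq_square del: of_nat_Suc)
  then show ?thesis by simp
qed

lemma hat_grid_near: "hat (real (Suc n) * (s - grid n k)) \<noteq> 0 \<Longrightarrow> \<bar>grid n k - s\<bar> < 1 / real (Suc n)"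
proof -
  assume "hat (real (Suc n) * (s - grid n k)) \<noteq> 0"
  then have "\<bar>real (Suc n) * (s - grid n k)\<bar> < 1" using hat_bounds(3) by (meson not_le)
  then have "real (Suc n) * \<bar>grid n k - s\<bar> < 1" by (simp add: abs_mult abs_minus_commute del: of_nat_Suc)
  then show ?thesis by (simp add: field_simps del: of_nat_Suc)
qed

lemma hat_sum_tempered: "tempered (hat_sum n a)"
  unfolding tempered_def
proof
  show "continuous_on UNIV (hat_sum n a)"
    unfolding hat_sum_def[abs_def] hat_def by (intro continuous_intros)
  have "\<bar>hat_sum n a s\<bar> \<le> (\<Sum>k\<le>2 * (Suc n)\<^sup>2. \<bar>a k\<bar>) * (1 + \<bar>s\<bar>)" for s
  proof -
    have "\<bar>hat_sum n a s\<bar> \<le> (\<Sum>k\<le>2 * (Suc n)\<^sup>2. \<bar>a k\<bar>)"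
      unfolding hat_sum_def
      by (rule order_trans[OF sum_abs sum_mono]) (use hat_bounds in \<open>simp add: abs_mult mult_left_le\<close>)
    also have "\<dots> = (\<Sum>k\<le>2 * (Suc n)\<^sup>2. \<bar>a k\<bar>) * 1" by simp
    also have "\<dots> \<le> (\<Sum>k\<le>2 * (Suc n)\<^sup>2. \<bar>a k\<bar>) * (1 + \<bar>s\<bar>)" by (intro mult_left_mono sum_nonneg) auto
    finally show ?thesis .
  qed
  then show "\<exists>A. \<forall>s. \<bar>hat_sum n a s\<bar> \<le> A * (1 + \<bar>s\<bar>)" by blast
qed

lemma hat_sum_diff: "\<bar>hat_sum n a s - hat_sum n b s\<bar> \<le> (\<Sum>k\<le>2 * (Suc n)\<^sup>2. \<bar>a k - b k\<bar>)"
proof -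
  have "hat_sum n a s - hat_sum n b s = (\<Sum>k\<le>2 * (Suc n)\<^sup>2. (a k - b k) * hat (real (Suc n) * (s - grid n k)))"
    by (simp add: hat_sum_def sum_subtractf left_diff_distrib del: of_nat_Suc)
  also have "\<bar>\<dots>\<bar> \<le> (\<Sum>k\<le>2 * (Suc n)\<^sup>2. \<bar>a k - b k\<bar>)"
    by (rule order_trans[OF sum_abs sum_mono]) (use hat_bounds in \<open>simp add: abs_mult mult_left_le\<close>)
  finally show ?thesis .
qed

abbreviation interpolate :: "nat \<Rightarrow> (real \<Rightarrow> real) \<Rightarrow> real \<Rightarrow> real" where
  "interpolate n \<zeta> \<equiv> hat_sum n (\<lambda>k. \<zeta> (grid n k))"

lemma interpolate_local:
  assumes s: "\<bar>s\<bar> \<le> real (Suc n)" and e: "\<And>q. \<bar>q - s\<bar> < 1 / real (Suc n) \<Longrightarrow> \<bar>\<zeta> q - \<zeta> s\<bar> \<le> e"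
  shows "\<bar>interpolate n \<zeta> s - \<zeta> s\<bar> \<le> e"
proof -
  let ?h = "\<lambda>k. hat (real (Suc n) * (s - grid n k))" and ?m = "real (Suc n)"
  have "?m * s + ?m\<^sup>2 = ?m * (s + ?m)" by (simp add: power2_eq_square algebra_simps)
  moreover have "0 \<le> ?m * (s + ?m)" using s by (intro mult_nonneg_nonneg) auto
  moreover have "?m * (s + ?m) \<le> ?m * (2 * ?m)" using s by (intro mult_left_mono) auto
  moreover have "?m * (2 * ?m) = real (2 * (Suc n)\<^sup>2)"
    unfolding of_nat_mult of_nat_power by (simp add: power2_eq_square)
  ultimately have "0 \<le> ?m * s + ?m\<^sup>2" "?m * s + ?m\<^sup>2 \<le> real (2 * (Suc n)\<^sup>2)"
    by linarith+
  from hat_partition(2)[OF this] have one: "(\<Sum>k\<le>2 * (Suc n)\<^sup>2. ?h k) = 1" unfolding hat_grid .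
  have "interpolate n \<zeta> s - \<zeta> s = (\<Sum>k\<le>2 * (Suc n)\<^sup>2. (\<zeta> (grid n k) - \<zeta> s) * ?h k)"
    using one by (simp add: hat_sum_def left_diff_distrib sum_subtractf sum_distrib_left[symmetric] del: of_nat_Suc)
  also have "\<bar>\<dots>\<bar> \<le> (\<Sum>k\<le>2 * (Suc n)\<^sup>2. e * ?h k)"
  proof (rule order_trans[OF sum_abs sum_mono])
    fix k
    show "\<bar>(\<zeta> (grid n k) - \<zeta> s) * ?h k\<bar> \<le> e * ?h k"
      using e[OF hat_grid_near[of n s k]] hat_bounds(1)[of "?m * (s - grid n k)"]
      by (cases "?h k = 0") (auto simp: abs_mult intro: mult_right_mono)
  qed
  also have "\<dots> = e" using one by (simp add: sum_distrib_left[symmetric] del: of_nat_Suc)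
  finally show ?thesis .
qed

lemma interpolate_growth:
  assumes A: "\<And>s. \<bar>\<zeta> s\<bar> \<le> A * (1 + \<bar>s\<bar>)"
  shows "\<bar>interpolate n \<zeta> s\<bar> \<le> A * (2 + \<bar>s\<bar>)"
proof -
  let ?h = "\<lambda>k. hat (real (Suc n) * (s - grid n k))"
  have A0: "0 \<le> A" using A[of 0] by simp
  have "\<bar>interpolate n \<zeta> s\<bar> \<le> (\<Sum>k\<le>2 * (Suc n)\<^sup>2. A * (2 + \<bar>s\<bar>) * ?h k)"
    unfolding hat_sum_def
  proof (rule order_trans[OF sum_abs sum_mono])
    fix k
    show "\<bar>\<zeta> (grid n k) * ?h k\<bar> \<le> A * (2 + \<bar>s\<bar>) * ?h k"
    proof (cases "?h k = 0")
      case False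
      have "1 / real (Suc n) \<le> 1" by simp
      then have "1 + \<bar>grid n k\<bar> \<le> 2 + \<bar>s\<bar>" using hat_grid_near[OF False] by linarith
      then have "\<bar>\<zeta> (grid n k)\<bar> \<le> A * (2 + \<bar>s\<bar>)" using order_trans[OF A mult_left_mono[OF _ A0]] by blast
      then show ?thesis using hat_bounds(1)[of "real (Suc n) * (s - grid n k)"]
        unfolding abs_mult by (metis abs_of_nonneg mult_right_mono)
    qed simp
  qed
  also have "\<dots> = A * (2 + \<bar>s\<bar>) * (\<Sum>k\<le>2 * (Suc n)\<^sup>2. ?h k)" by (simp add: sum_distrib_left del: of_nat_Suc)
  also have "\<dots> \<le> A * (2 + \<bar>s\<bar>) * 1"
    using hat_partition(1) A0 unfolding hat_grid by (intro mult_left_mono) auto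
  finally show ?thesis by simp
qed

text \<open>Far out both the path and its interpolants are beaten by the exponential weight; on a bounded
  interval uniform continuity applies.\<close>

lemma interpolate_converges:
  assumes \<zeta>: "tempered \<zeta>" and c: "0 < c" and e: "0 < e"
  shows "\<exists>n0. \<forall>n\<ge>n0. \<forall>s. \<bar>interpolate n \<zeta> s - \<zeta> s\<bar> \<le> e * exp (c * \<bar>s\<bar>)"
proof -
  obtain A where A: "\<And>s. \<bar>\<zeta> s\<bar> \<le> A * (1 + \<bar>s\<bar>)" and cont: "continuous_on UNIV \<zeta>"
    using \<zeta> by (auto simp: tempered_def)
  have A0: "0 \<le> A" using A[of 0] by simp
  define Y where "Y = 3 * A * (1 + 2 / c) / e"
  define M where "M = 2 / c * Y"
  have Y0: "0 \<le> Y" using A0 c e by (simp add: Y_def)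
  have M0: "0 \<le> M" using Y0 c by (simp add: M_def)
  have far: "A * (2 + \<bar>s\<bar>) + A * (1 + \<bar>s\<bar>) \<le> e * exp (c * \<bar>s\<bar>)" if s: "M \<le> \<bar>s\<bar>" for s
  proof -
    define E where "E = exp (c / 2 * \<bar>s\<bar>)"
    have E: "1 + c / 2 * \<bar>s\<bar> \<le> E" unfolding E_def by (rule exp_ge_add_one_self)
    have "Y \<le> c / 2 * \<bar>s\<bar>" using s c by (simp add: M_def field_simps)
    then have YE: "Y \<le> E" using E by linarith
    have "\<bar>s\<bar> \<le> 2 / c * E" using E c by (simp add: field_simps)
    moreover have "1 \<le> E" using c by (simp add: E_def)
    ultimately have "1 + \<bar>s\<bar> \<le> (1 + 2 / c) * E" by (simp add: distrib_right)
    then have "3 * A * (1 + \<bar>s\<bar>) \<le> 3 * A * ((1 + 2 / c) * E)" using A0 by (intro mult_left_mono) auto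
    also have "\<dots> = e * Y * E" using e by (simp add: Y_def)
    also have "\<dots> \<le> e * E * E" using YE e by (intro mult_right_mono mult_left_mono) (auto simp: E_def)
    also have "\<dots> = e * exp (c * \<bar>s\<bar>)" by (simp add: E_def exp_add[symmetric])
    finally have "3 * A * (1 + \<bar>s\<bar>) \<le> e * exp (c * \<bar>s\<bar>)" .
    moreover have "A * (2 + \<bar>s\<bar>) + A * (1 + \<bar>s\<bar>) \<le> 3 * A * (1 + \<bar>s\<bar>)"
      using mult_nonneg_nonneg[OF A0 abs_ge_zero[of s]] by (simp add: algebra_simps)
    ultimately show ?thesis by linarith
  qed
  have "uniformly_continuous_on {- M - 1..M + 1} \<zeta>"
    by (rule compact_uniformly_continuous[OF continuous_on_subset[OF cont]]) auto
  then obtain d where d: "d > 0" "\<And>x y. x \<in> {- M - 1..M + 1} \<Longrightarrow> y \<in> {- M - 1..M + 1} \<Longrightarrow> \<bar>y - x\<bar> < d \<Longrightarrow> \<bar>\<zeta> y - \<zeta> x\<bar> < e"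
    using e unfolding uniformly_continuous_on_def dist_real_def by metis
  obtain n1 where n1: "1 / real (Suc n1) < d" using reals_Archimedean[OF d(1)] by (auto simp: inverse_eq_divide)
  obtain n2 where n2: "M \<le> real n2" using real_arch_simple by blast
  have "\<bar>interpolate n \<zeta> s - \<zeta> s\<bar> \<le> e * exp (c * \<bar>s\<bar>)" if n: "max n1 n2 \<le> n" for n s
  proof (cases "M \<le> \<bar>s\<bar>")
    case True
    then show ?thesis
      using far[OF True] interpolate_growth[OF A, of n s] A[of s]
        abs_triangle_ineq4[of "interpolate n \<zeta> s" "\<zeta> s"] by linarith
  next
    case False
    have "\<bar>interpolate n \<zeta> s - \<zeta> s\<bar> \<le> e"
    proof (rule interpolate_local)
      show "\<bar>s\<bar> \<le> real (Suc n)" using False n n2 by simp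
      fix q assume q: "\<bar>q - s\<bar> < 1 / real (Suc n)"
      have "1 / real (Suc n) \<le> 1 / real (Suc n1)" using n by (intro divide_left_mono) auto
      moreover have "1 / real (Suc n) \<le> 1" by simp
      ultimately have "\<bar>q - s\<bar> < d" "\<bar>q - s\<bar> < 1" using q n1 by linarith+
      then have "\<bar>\<zeta> q - \<zeta> s\<bar> < e" using False by (intro d(2)) auto
      then show "\<bar>\<zeta> q - \<zeta> s\<bar> \<le> e" by simp
    qed
    also have "e * 1 \<le> e * exp (c * \<bar>s\<bar>)" using e c by (intro mult_left_mono) auto
    finally show ?thesis by simp
  qed
  then show ?thesis by blast
qed

text \<open>The path space carries only the \<open>\<sigma>\<close>-algebra of the evaluations. Replacing the path by an interpolant
  makes the functional a continuous function of time, of finitely many path values and of the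
  state, hence measurable; as the mesh tends to \<open>0\<close> these functions converge pointwise by the
  Lipschitz bound in the weighted norm.\<close>

lemma path_functional_measurable:
  fixes \<Psi> :: "real \<Rightarrow> (real \<Rightarrow> real) \<Rightarrow> 'e::{real_normed_vector, second_countable_topology} \<Rightarrow> 'y::metric_space"
  assumes temp: "\<And>\<omega>. \<omega> \<in> space N \<Longrightarrow> tempered (Z \<omega>)"
    and meas: "\<And>s. (\<lambda>\<omega>. Z \<omega> s) \<in> borel_measurable N"
    and c: "0 < c" and B: "continuous_on {0..} B"
    and lip: "\<And>t \<zeta> \<zeta>' x x' \<delta>. 0 \<le> t \<Longrightarrow> tempered \<zeta> \<Longrightarrow> tempered \<zeta>' \<Longrightarrow>
        (\<And>s. \<bar>\<zeta> s - \<zeta>' s\<bar> \<le> \<delta> * exp (c * \<bar>s\<bar>)) \<Longrightarrow> dist (\<Psi> t \<zeta> x) (\<Psi> t \<zeta>' x') \<le> B t * (\<delta> + norm (x - x'))"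
    and cont: "\<And>\<zeta> x. tempered \<zeta> \<Longrightarrow> continuous_on {0..} (\<lambda>t. \<Psi> t \<zeta> x)"
  shows "(\<lambda>(t, \<omega>, x). \<Psi> t (Z \<omega>) x) \<in> borel_measurable (restrict_space borel {0..} \<Otimes>\<^sub>M N \<Otimes>\<^sub>M borel)"
proof (rule borel_measurable_LIMSEQ_metric)
  let ?M = "restrict_space borel {0 :: real..} \<Otimes>\<^sub>M N \<Otimes>\<^sub>M (borel :: 'e measure)"
  define G where "G n = (\<lambda>(t, a :: nat \<Rightarrow> real, x). \<Psi> t (hat_sum n a) x)" for n
  \<comment> \<open>Continuity in \<open>(t, a, x)\<close>: move \<open>a\<close> and \<open>x\<close> first, by the Lipschitz bound, then \<open>t\<close>.\<close>
  have G: "continuous_on ({0..} \<times> UNIV) (G n)" for n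
    unfolding continuous_on_def
  proof
    fix p :: "real \<times> (nat \<Rightarrow> real) \<times> 'e" assume "p \<in> {0..} \<times> UNIV"
    then obtain t a x where p: "p = (t, a, x)" "0 \<le> t" by (cases p) auto
    let ?F = "at p within {0..} \<times> UNIV"
    let ?D = "\<lambda>q. B (fst q) * ((\<Sum>k\<le>2 * (Suc n)\<^sup>2. \<bar>fst (snd q) k - a k\<bar>) + norm (snd (snd q) - x))
        + dist (\<Psi> (fst q) (hat_sum n a) x) (\<Psi> t (hat_sum n a) x)"
    have cF: "continuous_on ({0..} \<times> UNIV) ?D"
    proof (intro continuous_on_add continuous_on_mult continuous_on_dist continuous_on_norm continuous_on_diff
        continuous_on_sum continuous_on_rabs continuous_on_const)
      show "continuous_on ({0..} \<times> UNIV) (\<lambda>q :: real \<times> (nat \<Rightarrow> real) \<times> 'e. B (fst q))"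
        by (rule continuous_on_compose2[OF B]) (auto intro: continuous_on_fst continuous_on_id)
      show "continuous_on ({0..} \<times> UNIV) (\<lambda>q :: real \<times> (nat \<Rightarrow> real) \<times> 'e. \<Psi> (fst q) (hat_sum n a) x)"
        by (rule continuous_on_compose2[OF cont[OF hat_sum_tempered]]) (auto intro: continuous_on_fst continuous_on_id)
      show "continuous_on ({0..} \<times> UNIV) (\<lambda>q :: real \<times> (nat \<Rightarrow> real) \<times> 'e. fst (snd q) k)" for k
        by (rule continuous_on_compose2[OF continuous_on_product_coordinates[of k]
            continuous_on_fst[OF continuous_on_snd[OF continuous_on_id]]]) auto
      show "continuous_on ({0..} \<times> UNIV) (\<lambda>q :: real \<times> (nat \<Rightarrow> real) \<times> 'e. snd (snd q))"
        by (rule continuous_on_snd[OF continuous_on_snd[OF continuous_on_id]])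
    qed
    have "(?D \<longlongrightarrow> ?D p) ?F"
      using cF p unfolding continuous_on_def by blast
    then have D0: "(?D \<longlongrightarrow> 0) ?F" by (simp add: p)
    have "\<forall>\<^sub>F q in ?F. dist (G n q) (G n p) \<le> ?D q"
      unfolding eventually_at_filter
    proof (rule always_eventually, intro allI impI)
      fix q :: "real \<times> (nat \<Rightarrow> real) \<times> 'e" assume "q \<in> {0..} \<times> UNIV"
      then obtain t' a' x' where q: "q = (t', a', x')" "0 \<le> t'" by (cases q) auto
      have "\<bar>hat_sum n a' s - hat_sum n a s\<bar> \<le> (\<Sum>k\<le>2 * (Suc n)\<^sup>2. \<bar>a' k - a k\<bar>) * exp (c * \<bar>s\<bar>)" for s
      proof -
        have "(\<Sum>k\<le>2 * (Suc n)\<^sup>2. \<bar>a' k - a k\<bar>) * 1 \<le> (\<Sum>k\<le>2 * (Suc n)\<^sup>2. \<bar>a' k - a k\<bar>) * exp (c * \<bar>s\<bar>)"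
          using c by (intro mult_left_mono sum_nonneg) auto
        then show ?thesis using hat_sum_diff[of n a' s a] by linarith
      qed
      from lip[OF q(2) hat_sum_tempered hat_sum_tempered this, of x' x]
      have "dist (G n q) (\<Psi> t' (hat_sum n a) x) \<le> B t' * ((\<Sum>k\<le>2 * (Suc n)\<^sup>2. \<bar>a' k - a k\<bar>) + norm (x' - x))"
        by (simp add: G_def q del: of_nat_Suc power_Suc)
      moreover have "dist (G n q) (G n p) \<le> dist (G n q) (\<Psi> t' (hat_sum n a) x) + dist (\<Psi> t' (hat_sum n a) x) (G n p)"
        by (rule dist_triangle)
      moreover have "G n p = \<Psi> t (hat_sum n a) x" by (simp add: G_def p)
      ultimately show "dist (G n q) (G n p) \<le> ?D q" by (simp add: q)
    qed
    then have "((\<lambda>q. dist (G n q) (G n p)) \<longlongrightarrow> 0) ?F"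
      by (intro Lim_null_comparison[OF _ D0]) simp
    then show "(G n \<longlongrightarrow> G n p) ?F" by (rule tendsto_dist_iff[THEN iffD2])
  qed
  show "(\<lambda>(t, \<omega>, x). \<Psi> t (interpolate n (Z \<omega>)) x) \<in> borel_measurable ?M" for n
  proof -
    have a: "(\<lambda>p. \<lambda>k. Z (fst (snd p)) (grid n k)) \<in> borel_measurable ?M"
      by (rule measurable_coordinatewise_then_product) (rule measurable_compose[OF _ meas], measurable)
    have t: "fst \<in> measurable ?M (restrict_space borel {0..})" by measurable
    have t': "fst \<in> borel_measurable ?M"
      using measurable_compose[OF t measurable_restrict_space1[OF measurable_ident, of borel "{0..}"]] by (simp add: measurable_def comp_def id_def)
    have "(\<lambda>p. (fst p, (\<lambda>k. Z (fst (snd p)) (grid n k)), snd (snd p))) \<in> borel_measurable ?M"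
      by (rule borel_measurable_Pair[OF t' borel_measurable_Pair[OF a]]) measurable
    then have "(\<lambda>p. (fst p, (\<lambda>k. Z (fst (snd p)) (grid n k)), snd (snd p))) \<in> measurable ?M (restrict_space borel ({0..} \<times> UNIV))"
      by (rule measurable_restrict_space2[rotated]) (auto simp: space_pair_measure space_restrict_space)
    from measurable_compose[OF this borel_measurable_continuous_on_restrict[OF G[of n]]]
    show ?thesis by (simp add: G_def case_prod_beta')
  qed
  fix p assume "p \<in> space ?M"
  then obtain t \<omega> x where p: "p = (t, \<omega>, x)" "0 \<le> t" "\<omega> \<in> space N"
    by (auto simp: space_pair_measure space_restrict_space)
  have "(\<lambda>n. \<Psi> t (interpolate n (Z \<omega>)) x) \<longlonglongrightarrow> \<Psi> t (Z \<omega>) x"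
  proof (rule metric_LIMSEQ_I)
    fix r :: real assume r: "0 < r"
    define e where "e = r / (2 * (\<bar>B t\<bar> + 1))"
    have e: "0 < e" using r by (simp add: e_def)
    obtain n0 where n0: "\<And>n s. n0 \<le> n \<Longrightarrow> \<bar>interpolate n (Z \<omega>) s - Z \<omega> s\<bar> \<le> e * exp (c * \<bar>s\<bar>)"
      using interpolate_converges[OF temp[OF p(3)] c e] by blast
    have "dist (\<Psi> t (interpolate n (Z \<omega>)) x) (\<Psi> t (Z \<omega>) x) < r" if "n0 \<le> n" for n
    proof -
      have "dist (\<Psi> t (interpolate n (Z \<omega>)) x) (\<Psi> t (Z \<omega>) x) \<le> B t * (e + norm (x - x))"
        by (rule lip[OF p(2) hat_sum_tempered temp[OF p(3)] n0[OF that]])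
      also have "\<dots> \<le> (\<bar>B t\<bar> + 1) * e" using e by (simp add: mult_right_mono)
      also have "\<dots> = r / 2" by (simp add: e_def field_simps add_nonneg_eq_0_iff)
      finally show ?thesis using r by linarith
    qed
    then show "\<exists>no. \<forall>n\<ge>no. dist (\<Psi> t (interpolate n (Z \<omega>)) x) (\<Psi> t (Z \<omega>) x) < r" by blast
  qed
  then show "(\<lambda>n. (\<lambda>(t, \<omega>, x). \<Psi> t (interpolate n (Z \<omega>)) x) p) \<longlonglongrightarrow> (\<lambda>(t, \<omega>, x). \<Psi> t (Z \<omega>) x) p"
    by (simp add: p)
qed

section \<open>The Ornstein--Uhlenbeck path\<close>

lemma integrable_exp_Iic:
  fixes c :: real
  assumes c: "0 < c"
  shows "integrable lborel (\<lambda>\<tau>. indicator {..0} \<tau> *\<^sub>R exp (c * \<tau>))"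
proof -
  have "(\<integral>\<^sup>+x. ennreal (exp (- c * x)) * indicator {0..} x \<partial>lborel) = ennreal (0 - (- exp (- c * 0) / c))"
  proof (rule nn_integral_FTC_atLeast)
    show "((\<lambda>x. - exp (- c * x) / c) has_real_derivative exp (- c * x)) (at x)" for x
      using c by (auto intro!: derivative_eq_intros)
    have "((\<lambda>x. exp (- c * x)) \<longlongrightarrow> 0) at_top"
      using c by (intro filterlim_compose[OF exp_at_bot] filterlim_tendsto_neg_mult_at_bot[OF tendsto_const]) (auto simp: filterlim_ident)
    from tendsto_divide[OF tendsto_minus[OF this] tendsto_const[of c]] c
    show "((\<lambda>x. - exp (- c * x) / c) \<longlongrightarrow> 0) at_top" by simp
  qed auto
  then have n: "(\<integral>\<^sup>+x. ennreal (exp (- c * x)) * indicator {0..} x \<partial>lborel) < \<infinity>" by simp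
  have "integrable lborel (\<lambda>x. indicator {0..} x *\<^sub>R exp (- c * x))"
  proof (rule integrableI_bounded)
    have "(\<integral>\<^sup>+x. ennreal (norm (indicator {0..} x *\<^sub>R exp (- c * x))) \<partial>lborel)
        = (\<integral>\<^sup>+x. ennreal (exp (- c * x)) * indicator {0..} x \<partial>lborel)"
      by (intro nn_integral_cong) (simp split: split_indicator)
    then show "(\<integral>\<^sup>+x. ennreal (norm (indicator {0..} x *\<^sub>R exp (- c * x))) \<partial>lborel) < \<infinity>" using n by simp
  qed measurable
  from lborel_integrable_real_affine[OF this, of "-1" 0]
  have "integrable lborel (\<lambda>x. indicator {0..} (- x) *\<^sub>R exp (c * x))" by simp
  moreover have "indicator {0..} (- x) = (indicator {..0} x :: real)" for x :: real by (auto simp: indicator_def)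
  ultimately show ?thesis by simp
qed

lemma sublinear_tempered:
  assumes cont: "continuous_on UNIV \<omega>" and top: "((\<lambda>t. \<omega> t / t) \<longlongrightarrow> 0) at_top" and bot: "((\<lambda>t. \<omega> t / t) \<longlongrightarrow> 0) at_bot"
  shows "tempered \<omega>"
proof -
  have "\<forall>\<^sub>F t in at_top. \<bar>\<omega> t / t\<bar> < 1" using tendstoD[OF top, of 1] by simp
  then obtain T1 where T1: "\<And>t. T1 \<le> t \<Longrightarrow> \<bar>\<omega> t / t\<bar> < 1" by (auto simp: eventually_at_top_linorder)
  have "\<forall>\<^sub>F t in at_bot. \<bar>\<omega> t / t\<bar> < 1" using tendstoD[OF bot, of 1] by simp
  then obtain T2 where T2: "\<And>t. t \<le> T2 \<Longrightarrow> \<bar>\<omega> t / t\<bar> < 1" by (auto simp: eventually_at_bot_linorder)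
  define T where "T = max 1 (max T1 (- T2))"
  have "bounded (\<omega> ` {- T..T})"
    by (intro compact_imp_bounded compact_continuous_image continuous_on_subset[OF cont]) auto
  then obtain B where "\<forall>y\<in>\<omega> ` {- T..T}. norm y \<le> B" unfolding bounded_iff by blast
  then have B: "\<bar>\<omega> t\<bar> \<le> B" if "\<bar>t\<bar> \<le> T" for t using that by (auto simp: abs_le_iff)
  have B0: "0 \<le> B" using order_trans[OF abs_ge_zero B[of 0]] by (simp add: T_def)
  have "\<bar>\<omega> t\<bar> \<le> (1 + B) * (1 + \<bar>t\<bar>)" for t
  proof (cases "\<bar>t\<bar> \<le> T")
    case True
    have "B * 1 \<le> (1 + B) * (1 + \<bar>t\<bar>)" using B0 by (intro mult_mono) auto
    then show ?thesis using B[OF True] by linarith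
  next
    case False
    then have "t \<noteq> 0" "T1 \<le> t \<or> t \<le> T2" by (auto simp: T_def)
    then have "\<bar>\<omega> t\<bar> \<le> \<bar>t\<bar>" using T1[of t] T2[of t] by (auto simp: abs_divide)
    also have "\<dots> \<le> 1 * (1 + \<bar>t\<bar>)" by simp
    also have "\<dots> \<le> (1 + B) * (1 + \<bar>t\<bar>)" using B0 by (intro mult_right_mono) auto
    finally show ?thesis .
  qed
  then show ?thesis using cont unfolding tempered_def by blast
qed

definition ou_path :: "real \<Rightarrow> (real \<Rightarrow> real) \<Rightarrow> real \<Rightarrow> real" where
  "ou_path \<epsilon> \<omega> s = ou \<epsilon> (wiener_shift s \<omega>)"

lemma ou_path_eq: "ou_path \<epsilon> \<omega> s = - (1 / \<epsilon> ^ 4) *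
    (\<integral>\<tau>. indicator {..0} \<tau> *\<^sub>R (exp (\<tau> / \<epsilon>\<^sup>2) * (\<omega> (s + \<tau>) - \<omega> s)) \<partial>lborel)"
  by (simp add: ou_path_def ou_def wiener_shift_def set_lebesgue_integral_def)

text \<open>Linear growth of \<open>\<omega>\<close> bounds the integrand by \<open>(1 + |s|)\<close> times \<open>exp (\<tau>/(2\<epsilon>\<^sup>2))\<close>, half of the exponential weight
  being spent on the growth in \<open>\<tau>\<close>. This majorant gives the growth of the path and, by dominated
  convergence, its continuity.\<close>

lemma ou_path_tempered:
  assumes \<omega>: "tempered \<omega>" and \<epsilon>: "0 < \<epsilon>"
  shows "tempered (ou_path \<epsilon> \<omega>)"
proof -
  obtain A where A: "\<And>s. \<bar>\<omega> s\<bar> \<le> A * (1 + \<bar>s\<bar>)" and cont: "continuous_on UNIV \<omega>"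
    using \<omega> by (auto simp: tempered_def)
  have A0: "0 \<le> A" using A[of 0] by simp
  define c where "c = 1 / (2 * \<epsilon>\<^sup>2)"
  have c: "0 < c" using \<epsilon> by (simp add: c_def)
  have "tempered (\<lambda>s. 1 + \<bar>s\<bar>)" unfolding tempered_def by (auto intro!: exI[of _ 1] continuous_intros)
  then obtain D where D: "\<And>s. exp (- (c * \<bar>s\<bar>)) * \<bar>1 + \<bar>s\<bar>\<bar> \<le> D" using tempered_weighted_bounded[OF _ c] by blast
  define w where "w \<tau> = indicator {..0} \<tau> *\<^sub>R exp (c * \<tau>)" for \<tau> :: real
  have w: "integrable lborel w" "\<And>\<tau>. 0 \<le> w \<tau>" unfolding w_def by (rule integrable_exp_Iic[OF c]) (simp split: split_indicator)
  let ?g = "\<lambda>s \<tau>. indicator {..0} \<tau> *\<^sub>R (exp (\<tau> / \<epsilon>\<^sup>2) * (\<omega> (s + \<tau>) - \<omega> s))"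
  have om: "\<omega> \<in> borel_measurable borel" using cont by (rule borel_measurable_continuous_onI)
  have gm: "?g s \<in> borel_measurable lborel" for s using om by measurable
  have gb: "\<bar>?g s \<tau>\<bar> \<le> (2 * A * D * (1 + \<bar>s\<bar>)) * w \<tau>" for s \<tau>
  proof (cases "\<tau> \<le> 0")
    case True
    have D0: "(1 + \<bar>\<tau>\<bar>) \<le> D * exp (- (c * \<tau>))"
      using D[of \<tau>] True by (simp add: exp_minus field_simps)
    have "1 + \<bar>s + \<tau>\<bar> \<le> (1 + \<bar>s\<bar>) * (1 + \<bar>\<tau>\<bar>)" by (auto simp: algebra_simps intro: order_trans[OF abs_triangle_ineq])
    moreover have "1 + \<bar>s\<bar> \<le> (1 + \<bar>s\<bar>) * (1 + \<bar>\<tau>\<bar>)" by (simp add: algebra_simps)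
    ultimately have "\<bar>\<omega> (s + \<tau>)\<bar> \<le> A * ((1 + \<bar>s\<bar>) * (1 + \<bar>\<tau>\<bar>))" "\<bar>\<omega> s\<bar> \<le> A * ((1 + \<bar>s\<bar>) * (1 + \<bar>\<tau>\<bar>))"
      using order_trans[OF A mult_left_mono[OF _ A0]] by blast+
    then have "\<bar>\<omega> (s + \<tau>) - \<omega> s\<bar> \<le> 2 * A * (1 + \<bar>s\<bar>) * (1 + \<bar>\<tau>\<bar>)"
      using abs_triangle_ineq4[of "\<omega> (s + \<tau>)" "\<omega> s"] by simp
    also have "\<dots> \<le> 2 * A * (1 + \<bar>s\<bar>) * (D * exp (- (c * \<tau>)))" using D0 A0 by (intro mult_left_mono) auto
    finally have "exp (\<tau> / \<epsilon>\<^sup>2) * \<bar>\<omega> (s + \<tau>) - \<omega> s\<bar> \<le> exp (\<tau> / \<epsilon>\<^sup>2) * (2 * A * (1 + \<bar>s\<bar>) * (D * exp (- (c * \<tau>))))"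
      by (rule mult_left_mono) simp
    also have "\<dots> = (2 * A * D * (1 + \<bar>s\<bar>)) * (exp (\<tau> / \<epsilon>\<^sup>2) * exp (- (c * \<tau>)))" by simp
    also have "exp (\<tau> / \<epsilon>\<^sup>2) * exp (- (c * \<tau>)) = exp (c * \<tau>)" by (simp add: exp_add[symmetric] c_def field_simps)
    finally show ?thesis using True by (simp add: w_def abs_mult)
  qed (simp add: w_def)
  have "continuous_on UNIV (ou_path \<epsilon> \<omega>)"
  proof (rule continuous_at_imp_continuous_on, rule ballI)
    fix s :: real
    show "isCont (ou_path \<epsilon> \<omega>) s"
      unfolding continuous_at_sequentially comp_def
    proof (intro allI impI)
      fix u :: "nat \<Rightarrow> real" assume u: "u \<longlonglongrightarrow> s"
      then have "Bseq u" by (rule convergent_imp_Bseq[OF convergentI])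
      then obtain M where M: "\<And>n. \<bar>u n\<bar> \<le> M" by (auto simp: Bseq_def)
      have wc: "isCont \<omega> x" for x using cont by (simp add: continuous_on_eq_continuous_at)
      have "(\<lambda>n. \<integral>\<tau>. ?g (u n) \<tau> \<partial>lborel) \<longlonglongrightarrow> (\<integral>\<tau>. ?g s \<tau> \<partial>lborel)"
      proof (rule integral_dominated_convergence[where w = "\<lambda>\<tau>. (2 * A * D * (1 + M)) * w \<tau>"])
        show "integrable lborel (\<lambda>\<tau>. (2 * A * D * (1 + M)) * w \<tau>)" using w by simp
        show "AE \<tau> in lborel. (\<lambda>n. ?g (u n) \<tau>) \<longlonglongrightarrow> ?g s \<tau>"
          by (intro AE_I2 tendsto_intros isCont_tendsto_compose[OF wc] u)
        show "AE \<tau> in lborel. norm (?g (u n) \<tau>) \<le> (2 * A * D * (1 + M)) * w \<tau>" for n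
        proof (rule AE_I2)
          fix \<tau>
          have D0: "0 \<le> D" using order_trans[OF _ D[of 0]] by simp
          have "(2 * A * D * (1 + \<bar>u n\<bar>)) * w \<tau> \<le> (2 * A * D * (1 + M)) * w \<tau>"
            using M[of n] A0 D0 w(2) by (intro mult_right_mono mult_left_mono) auto
          then show "norm (?g (u n) \<tau>) \<le> (2 * A * D * (1 + M)) * w \<tau>" using gb[where s = "u n" and \<tau> = \<tau>] by simp
        qed
      qed (use gm in auto)
      then show "(\<lambda>n. ou_path \<epsilon> \<omega> (u n)) \<longlonglongrightarrow> ou_path \<epsilon> \<omega> s"
        unfolding ou_path_eq by (intro tendsto_intros)
    qed
  qed
  moreover have "\<bar>ou_path \<epsilon> \<omega> s\<bar> \<le> (1 / \<epsilon> ^ 4 * (2 * A * D * (\<integral>\<tau>. w \<tau> \<partial>lborel))) * (1 + \<bar>s\<bar>)" for s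
  proof -
    have "\<bar>\<integral>\<tau>. ?g s \<tau> \<partial>lborel\<bar> \<le> (\<integral>\<tau>. (2 * A * D * (1 + \<bar>s\<bar>)) * w \<tau> \<partial>lborel)"
    proof (rule order_trans[OF integral_abs_bound integral_mono'])
      show "integrable lborel (\<lambda>\<tau>. (2 * A * D * (1 + \<bar>s\<bar>)) * w \<tau>)" using w by simp
      show "\<bar>?g s \<tau>\<bar> \<le> (2 * A * D * (1 + \<bar>s\<bar>)) * w \<tau>" for \<tau> by (rule gb)
      then show "0 \<le> (2 * A * D * (1 + \<bar>s\<bar>)) * w \<tau>" for \<tau> by (rule order_trans[OF abs_ge_zero])
    qed
    then have "1 / \<epsilon> ^ 4 * \<bar>\<integral>\<tau>. ?g s \<tau> \<partial>lborel\<bar> \<le> 1 / \<epsilon> ^ 4 * ((2 * A * D * (1 + \<bar>s\<bar>)) * (\<integral>\<tau>. w \<tau> \<partial>lborel))"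
      by (intro mult_left_mono) auto
    then show ?thesis unfolding ou_path_eq by (simp add: abs_mult mult_ac)
  qed
  ultimately show ?thesis unfolding tempered_def by blast
qed

text \<open>Evaluation at a continuous path is jointly measurable in path and time, as a limit of evaluations at
  times rounded down to a grid; so the parameter integral is measurable.\<close>

lemma ou_path_measurable:
  assumes ev: "\<And>t. (\<lambda>\<omega>. \<omega> t) \<in> borel_measurable N" and cont: "\<And>\<omega>. \<omega> \<in> space N \<Longrightarrow> continuous_on UNIV \<omega>"
  shows "(\<lambda>\<omega>. ou_path \<epsilon> \<omega> s) \<in> borel_measurable N"
proof -
  have joint: "(\<lambda>p :: (real \<Rightarrow> real) \<times> real. fst p (s + snd p)) \<in> borel_measurable (N \<Otimes>\<^sub>M lborel)" for s
  proof (rule borel_measurable_LIMSEQ_real)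
    let ?r = "\<lambda>n (p :: (real \<Rightarrow> real) \<times> real). \<lfloor>real (Suc n) * (s + snd p)\<rfloor>"
    show "(\<lambda>p. fst p (real_of_int (?r n p) / real (Suc n))) \<in> borel_measurable (N \<Otimes>\<^sub>M lborel)" for n
    proof (rule measurable_compose_countable[where f = "\<lambda>i p. fst p (real_of_int i / real (Suc n))" and g = "?r n"])
      show "(\<lambda>p. fst p (real_of_int i / real (Suc n))) \<in> borel_measurable (N \<Otimes>\<^sub>M lborel)" for i
        by (rule measurable_compose[OF measurable_fst ev])
      show "?r n \<in> measurable (N \<Otimes>\<^sub>M lborel) (count_space UNIV)" by measurable
    qed
    fix p :: "(real \<Rightarrow> real) \<times> real" assume "p \<in> space (N \<Otimes>\<^sub>M lborel)"
    then have "isCont (fst p) x" for x using cont by (auto simp: space_pair_measure continuous_on_eq_continuous_at)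
    moreover have "(\<lambda>n. real_of_int (?r n p) / real (Suc n)) \<longlonglongrightarrow> s + snd p"
    proof (rule tendsto_sandwich[OF always_eventually always_eventually])
      have "(\<lambda>n. (s + snd p) - 1 / real (Suc n)) \<longlonglongrightarrow> (s + snd p) - 0"
        by (intro tendsto_intros LIMSEQ_Suc[OF lim_1_over_n])
      then show "(\<lambda>n. (s + snd p) - 1 / real (Suc n)) \<longlonglongrightarrow> s + snd p" by simp
      show "\<forall>n. (s + snd p) - 1 / real (Suc n) \<le> real_of_int (?r n p) / real (Suc n)"
      proof
        fix n
        have "real (Suc n) * (s + snd p) - 1 \<le> real_of_int (?r n p)" by linarith
        then have "(real (Suc n) * (s + snd p) - 1) / real (Suc n) \<le> real_of_int (?r n p) / real (Suc n)" by (rule divide_right_mono) simp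
        then show "(s + snd p) - 1 / real (Suc n) \<le> real_of_int (?r n p) / real (Suc n)"
          by (simp add: diff_divide_distrib del: of_nat_Suc)
      qed
      show "\<forall>n. real_of_int (?r n p) / real (Suc n) \<le> s + snd p"
      proof
        fix n
        have "real_of_int (?r n p) \<le> real (Suc n) * (s + snd p)" by linarith
        then have "real_of_int (?r n p) / real (Suc n) \<le> (real (Suc n) * (s + snd p)) / real (Suc n)" by (rule divide_right_mono) simp
        then show "real_of_int (?r n p) / real (Suc n) \<le> s + snd p" by simp
      qed
    qed simp
    ultimately show "(\<lambda>n. fst p (real_of_int (?r n p) / real (Suc n))) \<longlonglongrightarrow> fst p (s + snd p)"
      by (rule isCont_tendsto_compose)
  qed
  have "(\<lambda>(\<omega>, \<tau>). indicator {..0} \<tau> *\<^sub>R (exp (\<tau> / \<epsilon>\<^sup>2) * (\<omega> (s + \<tau>) - \<omega> s))) \<in> borel_measurable (N \<Otimes>\<^sub>M lborel)"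
    unfolding case_prod_beta
    by (intro borel_measurable_scaleR borel_measurable_times borel_measurable_diff joint measurable_compose[OF measurable_fst ev]) measurable
  from lborel.borel_measurable_lebesgue_integral[OF this]
  show ?thesis unfolding ou_path_eq by (intro borel_measurable_times borel_measurable_const) simp
qed

section \<open>The random dynamical system and its inertial manifold\<close>

text \<open>Reduces the distance to the manifold to countably many points, as needed for its measurability.\<close>

lemma infdist_range_dense:
  fixes g :: "'a::topological_space \<Rightarrow> 'b::metric_space"
  assumes g: "continuous_on UNIV g" and D: "\<And>X. open X \<Longrightarrow> X \<noteq> {} \<Longrightarrow> \<exists>d\<in>D. d \<in> X"
  shows "infdist x (range g) = infdist x (g ` D)"
proof -
  have "range g \<subseteq> closure (g ` D)"
  proof
    fix y assume "y \<in> range g"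
    then obtain a where y: "y = g a" by blast
    show "y \<in> closure (g ` D)"
      unfolding closure_iff_nhds_not_empty
    proof (intro allI impI)
      fix A V assume V: "V \<subseteq> A" "open V" "y \<in> V"
      have "open (g -` V)" using continuous_on_open_vimage[OF open_UNIV, of g] g V(2) by auto
      then obtain d where "d \<in> D" "g d \<in> V" using D[of "g -` V"] V(3) y by blast
      then show "g ` D \<inter> A \<noteq> {}" using V(1) by blast
    qed
  qed
  moreover have "g ` D \<subseteq> range g" by blast
  ultimately have "closure (g ` D) = closure (range g)"
    by (meson closed_closure closure_minimal closure_mono subset_antisym)
  then show ?thesis by (metis infdist_eq_setdist setdist_closure_2)
qed

text \<open>The random path \<open>Z\<close> is stationary along the base flow \<open>\<theta>\<close>. The vector \<open>e\<close> describes the transformation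
  \<open>x \<mapsto> x - Z(\<omega>)(0) e\<close> between the states of the stochastic equation and those of the equation with random
  coefficients.\<close>

locale random_spectral_gap_system = spectral_gap_system R T C F b K L l \<alpha> \<eta> \<beta>
  for R T :: "real \<Rightarrow> 'e::{real_inner, banach, second_countable_topology} \<Rightarrow> 'e"
    and C :: "'e \<Rightarrow> 'x::banach" and F :: "'x \<Rightarrow> 'e" and b :: 'e and K L l \<alpha> \<eta> \<beta> :: real +
  fixes N :: "'w measure" and \<theta> :: "real \<Rightarrow> 'w \<Rightarrow> 'w" and Z :: "'w \<Rightarrow> real \<Rightarrow> real" and e :: 'e
  assumes Z_tempered: "\<omega> \<in> space N \<Longrightarrow> tempered (Z \<omega>)" and Z_measurable: "(\<lambda>\<omega>. Z \<omega> s) \<in> borel_measurable N"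
    and Z_shift: "\<omega> \<in> space N \<Longrightarrow> Z (\<theta> t \<omega>) = (\<lambda>s. Z \<omega> (t + s))"
    and shift_space: "\<omega> \<in> space N \<Longrightarrow> \<theta> t \<omega> \<in> space N"
begin

text \<open>Flow and graph in the original, untransformed coordinates. The projection acts on the translation
  vector as well, so the base point of the graph is shifted by the slow part of \<open>e\<close> and its value by
  the fast part.\<close>

definition path_flow :: "real \<Rightarrow> (real \<Rightarrow> real) \<Rightarrow> 'e \<Rightarrow> 'e" where
  "path_flow t \<zeta> x = flow_map \<zeta> t (x - \<zeta> 0 *\<^sub>R e) + \<zeta> t *\<^sub>R e"

definition path_graph :: "(real \<Rightarrow> real) \<Rightarrow> 'e \<Rightarrow> 'e" where
  "path_graph \<zeta> \<xi> = graph_map \<zeta> (\<xi> - \<zeta> 0 *\<^sub>R R 0 e) + \<zeta> 0 *\<^sub>R (e - R 0 e)"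

definition manifold :: "'w \<Rightarrow> 'e set" where
  "manifold \<omega> = {\<xi> + path_graph (Z \<omega>) \<xi> |\<xi>. \<xi> \<in> range (R 0)}"

lemma R0_idem: "R 0 (R 0 x) = R 0 x" using R_group[of 0 0 x] by simp

lemma R0_diff: "R 0 (x - y) = R 0 x - R 0 y" and R0_add: "R 0 (x + y) = R 0 x + R 0 y"
  and R0_scaleR: "R 0 (c *\<^sub>R x) = c *\<^sub>R R 0 x"
  using bounded_linear.linear[OF R_linear[of 0]] by (auto simp: linear_diff linear_add linear_scale)

lemma R_path_graph: "tempered \<zeta> \<Longrightarrow> R 0 (path_graph \<zeta> \<xi>) = 0"
  by (simp add: path_graph_def R0_add R0_diff R0_scaleR R0_idem R_graph_map)

lemma path_graph_lipschitz: "tempered \<zeta> \<Longrightarrow> (\<Lambda> * K + K)-lipschitz_on A (path_graph \<zeta>)"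
proof (rule lipschitz_onI)
  assume \<zeta>: "tempered \<zeta>"
  fix x y
  show "dist (path_graph \<zeta> x) (path_graph \<zeta> y) \<le> (\<Lambda> * K + K) * dist x y"
    using graph_map_lipschitz[OF \<zeta>, of "x - \<zeta> 0 *\<^sub>R R 0 e" "y - \<zeta> 0 *\<^sub>R R 0 e"]
    by (simp add: path_graph_def dist_norm)
qed (use const_nonneg \<Lambda>_ge_1 in simp)

text \<open>Closedness and invariance of the manifold are read off from this equation for the transformed state.\<close>

lemma mem_manifold_iff:
  assumes "\<omega> \<in> space N"
  shows "x \<in> manifold \<omega> \<longleftrightarrow>
    x - Z \<omega> 0 *\<^sub>R e - R 0 (x - Z \<omega> 0 *\<^sub>R e) = graph_map (Z \<omega>) (R 0 (x - Z \<omega> 0 *\<^sub>R e))" (is "_ \<longleftrightarrow> ?r x")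
proof
  assume "x \<in> manifold \<omega>"
  then obtain y where x: "x = R 0 y + path_graph (Z \<omega>) (R 0 y)" unfolding manifold_def by blast
  have "R 0 x = R 0 y" by (simp add: x R0_add R0_idem R_path_graph Z_tempered assms)
  then show "?r x" by (simp add: R0_diff R0_scaleR) (simp add: x path_graph_def scaleR_diff_right)
next
  assume r: "?r x"
  have "x = R 0 x + path_graph (Z \<omega>) (R 0 x)"
    using r by (simp add: path_graph_def R0_diff R0_scaleR) (simp add: algebra_simps)
  then show "x \<in> manifold \<omega>" unfolding manifold_def by blast
qed

lemma path_flow_measurable:
  "(\<lambda>(t, \<omega>, x). path_flow t (Z \<omega>) x) \<in> borel_measurable (restrict_space borel {0..} \<Otimes>\<^sub>M N \<Otimes>\<^sub>M borel)"
proof (rule path_functional_measurable[OF Z_tempered Z_measurable mu(2),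
      where B = "\<lambda>t. exp (\<mu> * t) * (4 * K * (1 + norm e + norm b) + norm e)"])
  show "continuous_on {0..} (\<lambda>t. exp (\<mu> * t) * (4 * K * (1 + norm e + norm b) + norm e))"
    by (intro continuous_intros)
  fix \<zeta> x assume \<zeta>: "tempered \<zeta>"
  then have "continuous_on UNIV \<zeta>" by (simp add: tempered_def)
  then have "continuous_on {0..} \<zeta>" by (rule continuous_on_subset) simp
  moreover have "continuous_on {0..} (\<lambda>t. flow_map \<zeta> t y)" for y
    using flow_map_mild[OF \<zeta>] by (simp add: mild_solution_def)
  ultimately show "continuous_on {0..} (\<lambda>t. path_flow t \<zeta> x)"
    unfolding path_flow_def by (intro continuous_intros)
next
  fix t \<delta> :: real and \<zeta> \<zeta>' :: "real \<Rightarrow> real" and x x' :: 'e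
  assume t: "0 \<le> t" and \<zeta>: "tempered \<zeta>" "tempered \<zeta>'" and \<delta>: "\<And>s. \<bar>\<zeta> s - \<zeta>' s\<bar> \<le> \<delta> * exp (\<mu> * \<bar>s\<bar>)"
  have \<delta>0: "\<bar>\<zeta> 0 - \<zeta>' 0\<bar> \<le> \<delta>" using \<delta>[of 0] by simp
  have \<delta>t: "\<bar>\<zeta> t - \<zeta>' t\<bar> \<le> \<delta> * exp (\<mu> * t)" using \<delta>[of t] t by simp
  have nn: "0 \<le> \<delta>" using \<delta>0 by linarith
  let ?E = "exp (\<mu> * t)" and ?d = "norm (x - x')"
  have "norm ((x - \<zeta> 0 *\<^sub>R e) - (x' - \<zeta>' 0 *\<^sub>R e)) \<le> ?d + \<delta> * norm e"
  proof -
    have "(x - \<zeta> 0 *\<^sub>R e) - (x' - \<zeta>' 0 *\<^sub>R e) = (x - x') - (\<zeta> 0 - \<zeta>' 0) *\<^sub>R e" by (simp add: algebra_simps)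
    moreover have "norm ((\<zeta> 0 - \<zeta>' 0) *\<^sub>R e) \<le> \<delta> * norm e"
      using mult_right_mono[OF \<delta>0, of "norm e"] by simp
    ultimately show ?thesis by (simp only: order_trans[OF norm_triangle_ineq4 add_left_mono])
  qed
  then have "?E * (4 * K * (norm ((x - \<zeta> 0 *\<^sub>R e) - (x' - \<zeta>' 0 *\<^sub>R e)) + \<delta> * norm b))
      \<le> ?E * (4 * K * ((?d + \<delta> * norm e) + \<delta> * norm b))"
    using const_nonneg by (intro mult_left_mono add_right_mono) auto
  moreover have "norm (flow_map \<zeta> t (x - \<zeta> 0 *\<^sub>R e) - flow_map \<zeta>' t (x' - \<zeta>' 0 *\<^sub>R e))
      \<le> ?E * (4 * K * (norm ((x - \<zeta> 0 *\<^sub>R e) - (x' - \<zeta>' 0 *\<^sub>R e)) + \<delta> * norm b))"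
  proof (rule flow_map_lipschitz[OF \<zeta> _ t])
    show "\<bar>\<zeta> s - \<zeta>' s\<bar> \<le> \<delta> * exp (\<mu> * s)" if "0 \<le> s" for s using \<delta>[of s] that by simp
  qed
  ultimately have 1: "norm (flow_map \<zeta> t (x - \<zeta> 0 *\<^sub>R e) - flow_map \<zeta>' t (x' - \<zeta>' 0 *\<^sub>R e))
      \<le> ?E * (4 * K * ((?d + \<delta> * norm e) + \<delta> * norm b))"
    by linarith
  have 2: "norm (\<zeta> t *\<^sub>R e - \<zeta>' t *\<^sub>R e) \<le> \<delta> * ?E * norm e"
    using mult_right_mono[OF \<delta>t, of "norm e"] by (simp add: scaleR_diff_left[symmetric])
  have "dist (path_flow t \<zeta> x) (path_flow t \<zeta>' x')
      \<le> ?E * (4 * K * ((?d + \<delta> * norm e) + \<delta> * norm b)) + \<delta> * ?E * norm e"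
    unfolding path_flow_def dist_norm using norm_diff_triangle_ineq add_mono[OF 1 2] order_trans by blast
  also have "\<dots> = ?E * (4 * K * (?d + \<delta> * (norm e + norm b)) + \<delta> * norm e)" by (simp add: algebra_simps)
  also have "\<dots> \<le> ?E * (4 * K * ((\<delta> + ?d) * (1 + norm e + norm b)) + (\<delta> + ?d) * norm e)"
  proof (intro mult_left_mono add_mono)
    have "0 \<le> \<delta> + ?d * (norm e + norm b)" using nn by simp
    then show "?d + \<delta> * (norm e + norm b) \<le> (\<delta> + ?d) * (1 + norm e + norm b)" by (simp add: algebra_simps)
  qed (use const_nonneg nn in \<open>auto intro: mult_right_mono\<close>)
  also have "\<dots> = ?E * (4 * K * (1 + norm e + norm b) + norm e) * (\<delta> + ?d)" by (simp add: algebra_simps)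
  finally show "dist (path_flow t \<zeta> x) (path_flow t \<zeta>' x')
      \<le> ?E * (4 * K * (1 + norm e + norm b) + norm e) * (\<delta> + ?d)" .
qed

theorem random_dynamical_system_path_flow: "random_dynamical_system N \<theta> (\<lambda>t \<omega>. path_flow t (Z \<omega>))"
  unfolding random_dynamical_system_def
proof (intro conjI path_flow_measurable allI ballI impI)
  fix \<omega> x assume \<omega>: "\<omega> \<in> space N"
  show "path_flow 0 (Z \<omega>) x = x" by (simp add: path_flow_def flow_map_0 Z_tempered \<omega>)
  fix t s :: real assume "0 \<le> t" "0 \<le> s"
  then show "path_flow (t + s) (Z \<omega>) x = path_flow t (Z (\<theta> s \<omega>)) (path_flow s (Z \<omega>) x)"
    using flow_map_cocycle[OF Z_tempered[OF \<omega>], of t s] by (simp add: path_flow_def Z_shift \<omega> add.commute)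
qed

text \<open>The graph depends on the path only through its values at times \<open>s \<le> 0\<close>, where \<open>e\<^sup>\<eta>\<^sup>s\<close> is the growing
  weight \<open>e\<^sup>-\<^sup>\<eta>\<^sup>|\<^sup>s\<^sup>|\<close>.\<close>

lemma path_graph_measurable: "(\<lambda>\<omega>. R 0 x + path_graph (Z \<omega>) (R 0 x)) \<in> borel_measurable N"
proof -
  let ?\<Psi> = "\<lambda>(t :: real) \<zeta> x. R 0 x + path_graph \<zeta> (R 0 x)"
  let ?c = "\<Lambda> * (K * norm b / (\<alpha> - \<eta>) + K * norm b / (\<eta> - \<beta>)) + norm (e - R 0 e)"
  let ?H = "\<Lambda> * K + K"
  let ?B = "K + ?H * (K * (1 + norm e)) + ?c"
  have H0: "0 \<le> ?H" using const_nonneg \<Lambda>_ge_1 by simp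
  have c0: "0 \<le> ?c" using const_nonneg \<Lambda>_ge_1 rates by simp
  have m: "(\<lambda>(t, \<omega>, x). ?\<Psi> t (Z \<omega>) x) \<in> borel_measurable (restrict_space borel {0..} \<Otimes>\<^sub>M N \<Otimes>\<^sub>M borel)"
  proof (rule path_functional_measurable[OF Z_tempered Z_measurable, where c = "- \<eta>" and B = "\<lambda>_. ?B"])
    show "0 < - \<eta>" using rates by simp
    fix t \<delta> :: real and \<zeta> \<zeta>' :: "real \<Rightarrow> real" and x x' :: 'e
    assume \<zeta>: "tempered \<zeta>" "tempered \<zeta>'" and \<delta>: "\<And>s. \<bar>\<zeta> s - \<zeta>' s\<bar> \<le> \<delta> * exp (- \<eta> * \<bar>s\<bar>)"
    have \<delta>0: "\<bar>\<zeta> 0 - \<zeta>' 0\<bar> \<le> \<delta>" using \<delta>[of 0] by simp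
    have nn: "0 \<le> \<delta>" using \<delta>0 by linarith
    have \<delta>s: "\<bar>\<zeta> s - \<zeta>' s\<bar> \<le> \<delta> * exp (\<eta> * s)" if "s \<le> 0" for s using \<delta>[of s] that by simp
    let ?d = "norm (x - x')"
    let ?u = "R 0 x - \<zeta> 0 *\<^sub>R R 0 e" and ?u' = "R 0 x' - \<zeta>' 0 *\<^sub>R R 0 e"
    have R0: "norm (R 0 y) \<le> K * norm y" for y using R_forward[of 0 y] by simp
    have "?u - ?u' = R 0 ((x - x') - (\<zeta> 0 - \<zeta>' 0) *\<^sub>R e)" by (simp add: R0_diff R0_scaleR scaleR_diff_left)
    then have "norm (?u - ?u') \<le> K * norm ((x - x') - (\<zeta> 0 - \<zeta>' 0) *\<^sub>R e)" using R0 by simp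
    also have "\<dots> \<le> K * (?d + \<delta> * norm e)"
      using norm_triangle_ineq4[of "x - x'" "(\<zeta> 0 - \<zeta>' 0) *\<^sub>R e"] mult_right_mono[OF \<delta>0, of "norm e"] const_nonneg
      by (intro mult_left_mono) auto
    also have "\<dots> \<le> K * ((\<delta> + ?d) * (1 + norm e))"
      using nn const_nonneg by (intro mult_left_mono) (auto simp: algebra_simps)
    finally have u: "norm (?u - ?u') \<le> K * ((\<delta> + ?d) * (1 + norm e))" .
    have 1: "norm (graph_map \<zeta> ?u - graph_map \<zeta> ?u') \<le> ?H * (K * ((\<delta> + ?d) * (1 + norm e)))"
      by (rule order_trans[OF graph_map_lipschitz[OF \<zeta>(1)] mult_left_mono[OF u H0]])
    have 2: "norm (graph_map \<zeta> ?u' - graph_map \<zeta>' ?u') \<le> \<Lambda> * (K * (\<delta> * norm b) / (\<alpha> - \<eta>) + K * (\<delta> * norm b) / (\<eta> - \<beta>))"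
      by (rule graph_map_path_lipschitz[OF \<zeta> \<delta>s])
    have 3: "norm ((\<zeta> 0 - \<zeta>' 0) *\<^sub>R (e - R 0 e)) \<le> \<delta> * norm (e - R 0 e)"
      using mult_right_mono[OF \<delta>0, of "norm (e - R 0 e)"] by simp
    have 4: "norm (R 0 (x - x')) \<le> K * (\<delta> + ?d)"
      using order_trans[OF R0 mult_left_mono[of _ "\<delta> + ?d" K]] nn const_nonneg by simp
    have "?\<Psi> t \<zeta> x - ?\<Psi> t \<zeta>' x' = R 0 (x - x') + ((graph_map \<zeta> ?u - graph_map \<zeta> ?u')
        + ((graph_map \<zeta> ?u' - graph_map \<zeta>' ?u') + (\<zeta> 0 - \<zeta>' 0) *\<^sub>R (e - R 0 e)))"
      by (simp add: path_graph_def R0_diff scaleR_diff_left)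
    then have "dist (?\<Psi> t \<zeta> x) (?\<Psi> t \<zeta>' x') \<le> K * (\<delta> + ?d) + (?H * (K * ((\<delta> + ?d) * (1 + norm e)))
        + (\<Lambda> * (K * (\<delta> * norm b) / (\<alpha> - \<eta>) + K * (\<delta> * norm b) / (\<eta> - \<beta>)) + \<delta> * norm (e - R 0 e)))"
      unfolding dist_norm by (simp only:) (intro norm_triangle_mono 1 2 3 4)
    also have "\<Lambda> * (K * (\<delta> * norm b) / (\<alpha> - \<eta>) + K * (\<delta> * norm b) / (\<eta> - \<beta>)) + \<delta> * norm (e - R 0 e) = \<delta> * ?c"
      by (simp add: algebra_simps)
    also have "K * (\<delta> + ?d) + (?H * (K * ((\<delta> + ?d) * (1 + norm e))) + \<delta> * ?c)
        \<le> K * (\<delta> + ?d) + (?H * (K * ((\<delta> + ?d) * (1 + norm e))) + (\<delta> + ?d) * ?c)"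
      using c0 by (intro add_left_mono mult_right_mono) auto
    also have "\<dots> = ?B * (\<delta> + ?d)" by (simp add: algebra_simps)
    finally show "dist (?\<Psi> t \<zeta> x) (?\<Psi> t \<zeta>' x') \<le> ?B * (\<delta> + ?d)" .
  qed auto
  have "(\<lambda>\<omega>. (0, \<omega>, x)) \<in> measurable N (restrict_space borel {0 :: real..} \<Otimes>\<^sub>M N \<Otimes>\<^sub>M borel)"
    by (intro measurable_Pair measurable_ident_sets measurable_const) (auto simp: space_restrict_space)
  from measurable_compose[OF this m] show ?thesis by (simp only: prod.case)
qed

lemma manifold_eq_range: "manifold \<omega> = range (\<lambda>x. R 0 x + path_graph (Z \<omega>) (R 0 x))"
  unfolding manifold_def by auto

text \<open>The manifold is closed as the solution set of an equation between continuous functions, and the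
  distance to it is an infimum over a countable dense set of base points.\<close>

lemma random_set_manifold: "random_set N manifold"
  unfolding random_set_def
proof (intro conjI ballI allI)
  fix \<omega> assume \<omega>: "\<omega> \<in> space N"
  have R0: "continuous_on A (R 0)" for A by (rule linear_continuous_on[OF R_linear])
  have "continuous_on UNIV (graph_map (Z \<omega>))"
  proof (rule lipschitz_on_continuous_on)
    show "(\<Lambda> * K + K)-lipschitz_on UNIV (graph_map (Z \<omega>))"
      using graph_map_lipschitz[OF Z_tempered[OF \<omega>]] const_nonneg \<Lambda>_ge_1 by (intro lipschitz_onI) (auto simp: dist_norm)
  qed
  then have g: "continuous_on UNIV (\<lambda>x. graph_map (Z \<omega>) (R 0 (x - Z \<omega> 0 *\<^sub>R e)))"
    by (rule continuous_on_compose2[OF _ continuous_on_compose2[OF R0[of UNIV]]])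
      (rule continuous_on_diff[OF continuous_on_id continuous_on_const], simp_all)
  have "continuous_on UNIV (\<lambda>x. x - Z \<omega> 0 *\<^sub>R e - R 0 (x - Z \<omega> 0 *\<^sub>R e))"
    by (intro continuous_on_diff continuous_on_compose2[OF R0[of UNIV]] continuous_on_id continuous_on_const subset_UNIV)
  from closed_Collect_eq[OF this g]
  have "closed {x. x \<in> manifold \<omega>}" unfolding mem_manifold_iff[OF \<omega>] .
  then show "closed (manifold \<omega>)" by simp
  show "manifold \<omega> \<noteq> {}" unfolding manifold_eq_range by blast
next
  fix x :: 'e
  obtain D :: "'e set" where D: "countable D" "\<And>X. open X \<Longrightarrow> X \<noteq> {} \<Longrightarrow> \<exists>d\<in>D. d \<in> X"
    using countable_dense_setE by blast
  have ne: "D \<noteq> {}" using D(2)[of UNIV] by auto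
  have "infdist x (manifold \<omega>) = (INF a\<in>D. dist x (R 0 a + path_graph (Z \<omega>) (R 0 a)))" if "\<omega> \<in> space N" for \<omega>
  proof -
    have "continuous_on UNIV (\<lambda>x. R 0 x + path_graph (Z \<omega>) (R 0 x))"
      by (intro continuous_on_add linear_continuous_on[OF R_linear]
          continuous_on_compose2[OF lipschitz_on_continuous_on[OF path_graph_lipschitz[OF Z_tempered[OF that], of UNIV]]
            linear_continuous_on[OF R_linear]] subset_UNIV)
    from infdist_range_dense[OF this D(2)] ne
    show ?thesis by (simp add: manifold_eq_range infdist_notempty image_comp o_def)
  qed
  moreover have "(\<lambda>\<omega>. INF a\<in>D. dist x (R 0 a + path_graph (Z \<omega>) (R 0 a))) \<in> borel_measurable N"
    by (intro borel_measurable_cINF_real D(1) borel_measurable_dist path_graph_measurable borel_measurable_const)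
  ultimately show "(\<lambda>\<omega>. infdist x (manifold \<omega>)) \<in> borel_measurable N"
    by (subst measurable_cong) auto
qed

text \<open>Exponential tracking in the original coordinates; the translations at time \<open>t\<close> cancel in the difference.\<close>

lemma manifold_tracking:
  fixes x :: 'e
  assumes \<omega>: "\<omega> \<in> space N" and t: "0 \<le> t"
  defines "y \<equiv> x - Z \<omega> 0 *\<^sub>R e"
  shows "\<exists>m\<in>manifold (\<theta> t \<omega>). norm (path_flow t (Z \<omega>) x - m)
    \<le> \<Lambda> * (K * exp (\<eta> * t) * norm (y - R 0 y - graph_map (Z \<omega>) (R 0 y)))"
proof
  let ?\<xi> = "R 0 (flow_map (Z \<omega>) t y)" and ?\<zeta> = "\<lambda>s. Z \<omega> (t + s)"
  have \<zeta>: "tempered ?\<zeta>" by (rule tempered_shift[OF Z_tempered[OF \<omega>]])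
  let ?m = "?\<xi> + graph_map ?\<zeta> ?\<xi> + Z \<omega> t *\<^sub>R e"
  show "norm (path_flow t (Z \<omega>) x - ?m) \<le> \<Lambda> * (K * exp (\<eta> * t) * norm (y - R 0 y - graph_map (Z \<omega>) (R 0 y)))"
    using exponential_tracking[OF Z_tempered[OF \<omega>] t, of y] by (simp add: path_flow_def y_def)
  show "?m \<in> manifold (\<theta> t \<omega>)"
    unfolding mem_manifold_iff[OF shift_space[OF \<omega>]]
    using R_graph_map[OF \<zeta>] by (simp add: Z_shift[OF \<omega>] R0_add R0_idem)
qed

lemma manifold_lipschitz_invariant:
  "lipschitz_invariant_manifold N \<theta> (R 0) (\<lambda>t \<omega>. path_flow t (Z \<omega>)) manifold"
  unfolding lipschitz_invariant_manifold_def
proof (intro conjI ballI allI impI exI[of _ "\<lambda>\<omega>. path_graph (Z \<omega>)"] random_set_manifold)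
  fix \<omega> assume \<omega>: "\<omega> \<in> space N"
  show "path_graph (Z \<omega>) \<in> range (R 0) \<rightarrow> range (\<lambda>x. x - R 0 x)"
  proof
    fix \<xi>
    show "path_graph (Z \<omega>) \<xi> \<in> range (\<lambda>x. x - R 0 x)"
      by (rule range_eqI[of _ _ "path_graph (Z \<omega>) \<xi>"]) (simp add: R_path_graph Z_tempered \<omega>)
  qed
  show "\<exists>L. L-lipschitz_on (range (R 0)) (path_graph (Z \<omega>))" using path_graph_lipschitz[OF Z_tempered[OF \<omega>]] by blast
  show "manifold \<omega> = {\<xi> + path_graph (Z \<omega>) \<xi> |\<xi>. \<xi> \<in> range (R 0)}" by (rule manifold_def)
  fix t :: real assume t: "0 \<le> t"
  show "path_flow t (Z \<omega>) ` manifold \<omega> \<subseteq> manifold (\<theta> t \<omega>)"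
  proof (rule image_subsetI)
    fix x assume "x \<in> manifold \<omega>"
    then have "x - Z \<omega> 0 *\<^sub>R e - R 0 (x - Z \<omega> 0 *\<^sub>R e) - graph_map (Z \<omega>) (R 0 (x - Z \<omega> 0 *\<^sub>R e)) = 0"
      by (simp only: mem_manifold_iff[OF \<omega>] right_minus_eq)
    with manifold_tracking[OF \<omega> t, of x]
    show "path_flow t (Z \<omega>) x \<in> manifold (\<theta> t \<omega>)" by (simp only: norm_zero mult_zero_right norm_le_zero_iff right_minus_eq) blast
  qed
qed

lemma manifold_attracts:
  assumes \<omega>: "\<omega> \<in> space N"
  shows "\<exists>C \<gamma>. \<gamma> > 0 \<and> (\<forall>t\<ge>0. infdist (path_flow t (Z \<omega>) x) (manifold (\<theta> t \<omega>)) \<le> C * exp (- \<gamma> * t))"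
proof -
  define y where "y = x - Z \<omega> 0 *\<^sub>R e"
  have "infdist (path_flow t (Z \<omega>) x) (manifold (\<theta> t \<omega>))
      \<le> \<Lambda> * K * norm (y - R 0 y - graph_map (Z \<omega>) (R 0 y)) * exp (- (- \<eta>) * t)" if t: "0 \<le> t" for t
  proof -
    obtain m where m: "m \<in> manifold (\<theta> t \<omega>)" "norm (path_flow t (Z \<omega>) x - m)
        \<le> \<Lambda> * (K * exp (\<eta> * t) * norm (y - R 0 y - graph_map (Z \<omega>) (R 0 y)))"
      using manifold_tracking[OF \<omega> t, of x] unfolding y_def by blast
    show ?thesis by (rule infdist_le2[OF m(1)]) (use m(2) in \<open>simp add: dist_norm mult_ac\<close>)
  qed
  moreover have "- \<eta> > 0" using rates by simp
  ultimately show ?thesis by blast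
qed

end

lemma sublinear_base_properties:
  assumes "wiener_measure P" "sublinear_base P \<Omega>"
  shows "space (restrict_space P \<Omega>) = \<Omega>" "\<Omega> \<subseteq> wiener_paths"
    "(\<lambda>\<omega>. \<omega> t) \<in> borel_measurable (restrict_space P \<Omega>)"
proof -
  let ?Q = "restrict_space (\<Pi>\<^sub>M t\<in>(UNIV :: real set). (borel :: real measure)) wiener_paths"
  have sets: "sets P = sets ?Q" using assms(1) by (simp add: wiener_measure_def)
  have sp: "space P = wiener_paths" using sets_eq_imp_space_eq[OF sets] by (simp add: space_restrict_space space_PiM)
  have "\<Omega> \<in> sets P" using assms(2) by (simp add: sublinear_base_def)
  then show "space (restrict_space P \<Omega>) = \<Omega>" "\<Omega> \<subseteq> wiener_paths"
    using sets.sets_into_space sp by (fastforce simp: space_restrict_space)+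
  have "(\<lambda>\<omega>. \<omega> t) \<in> borel_measurable ?Q" by (intro measurable_restrict_space1 measurable_component_singleton) simp
  then have "(\<lambda>\<omega>. \<omega> t) \<in> borel_measurable P" using measurable_cong_sets[OF sets refl] by blast
  then show "(\<lambda>\<omega>. \<omega> t) \<in> borel_measurable (restrict_space P \<Omega>)" by (rule measurable_restrict_space1)
qed

lemma tempered_scale: "tempered \<zeta> \<Longrightarrow> tempered (\<lambda>s. c * \<zeta> s)"
proof -
  assume \<zeta>: "tempered \<zeta>"
  then obtain A where "\<And>s. \<bar>\<zeta> s\<bar> \<le> A * (1 + \<bar>s\<bar>)" by (auto simp: tempered_def)
  then have "\<bar>c * \<zeta> s\<bar> \<le> (\<bar>c\<bar> * A) * (1 + \<bar>s\<bar>)" for s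
    using mult_left_mono[OF _ abs_ge_zero[of c]] by (simp add: abs_mult mult.assoc)
  moreover have "continuous_on UNIV (\<lambda>s. c * \<zeta> s)" using \<zeta> unfolding tempered_def by (intro continuous_intros) simp
  ultimately show ?thesis unfolding tempered_def by blast
qed

lemma ou_path_shift: "ou_path \<epsilon> (wiener_shift t \<omega>) s = ou_path \<epsilon> \<omega> (t + s)"
proof -
  have "wiener_shift s (wiener_shift t \<omega>) = wiener_shift (t + s) \<omega>"
    by (simp add: wiener_shift_def fun_eq_iff add.assoc)
  then show ?thesis by (simp add: ou_path_def)
qed

context wave_gap
begin

text \<open>The abstract flow uses a semigroup that agrees with \<open>wave_semigroup\<close> at times \<open>t \<ge> 0\<close> only, and the mild
  formulation evaluates it only there.\<close>

lemma wave_flow_eq: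
  assumes "tempered (ou_path \<epsilon> \<omega>)" "0 \<le> t"
  shows "wave_flow f \<phi> \<delta> \<epsilon> t \<omega> x = flow_map (\<lambda>s. \<delta> * ou_path \<epsilon> \<omega> s) t x"
proof -
  have F: "wave_nonlinearity f \<phi> \<delta> \<epsilon> (wiener_shift s \<omega>) = force (\<lambda>s. \<delta> * ou_path \<epsilon> \<omega> s) s" for s
    by (simp add: fun_eq_iff wave_nonlinearity_def force_def nonlin_def obs_def ou_path_def)
  have "((\<lambda>s. wave_semigroup \<epsilon> (t - s) (G s (U s))) has_integral (U t - wave_semigroup \<epsilon> t x)) {0..t}
      \<longleftrightarrow> ((\<lambda>s. S (t - s) (G s (U s))) has_integral (U t - S t x)) {0..t}" if "0 \<le> t" for t and G U :: "real \<Rightarrow> _"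
    unfolding S_eq_wave_semigroup[OF that]
    by (rule has_integral_cong) (simp add: S_eq_wave_semigroup)
  then have "mild_solution (wave_semigroup \<epsilon>) G x U \<longleftrightarrow> mild_solution S G x U" for G U
    unfolding mild_solution_def by blast
  then show ?thesis unfolding wave_flow_def flow_map_def F by simp
qed

end

theorem theorem3p1:
  fixes P :: "(real \<Rightarrow> real) measure" and \<Omega> :: "(real \<Rightarrow> real) set"
    and f :: "L2 \<Rightarrow> L2" and \<phi> :: H10 and \<delta> :: real
  assumes "wiener_measure P" and "sublinear_base P \<Omega>"
    and "\<exists>L. L-lipschitz_on UNIV f" and "\<delta> > 0"
  shows "\<exists>\<epsilon>\<^sub>0>0. \<forall>\<epsilon>. 0 < \<epsilon> \<and> \<epsilon> < \<epsilon>\<^sub>0 \<longrightarrow>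
    random_dynamical_system (restrict_space P \<Omega>) wiener_shift (wave_rds f \<phi> \<delta> \<epsilon>) \<and>
    (\<exists>M. stochastic_inertial_manifold (restrict_space P \<Omega>) wiener_shift (wave_semigroup \<epsilon>)
           (wave_rds f \<phi> \<delta> \<epsilon>) M)"
proof -
  obtain L where L: "L-lipschitz_on UNIV f" using assms(3) by blast
  obtain N where N: "8 * L < real N" using reals_Archimedean2 by blast
  let ?W = "restrict_space P \<Omega>"
  note space = sublinear_base_properties(1)[OF assms(1,2)]
  show ?thesis
  proof (intro exI[of _ "1 / (4 * freq (Suc N))"] conjI allI impI)
    show "1 / (4 * freq (Suc N)) > 0" by simp
    fix \<epsilon> :: real assume "0 < \<epsilon> \<and> \<epsilon> < 1 / (4 * freq (Suc N))"
    then have \<epsilon>: "0 < \<epsilon>" "4 * \<epsilon> * freq (Suc N) < 1" by (auto simp: field_simps)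
    \<comment> \<open>Any \<open>N > 8 L\<close> satisfies the gap condition, since the gap exceeds \<open>N\<close>.\<close>
    interpret wave_gap \<epsilon> L N f \<phi>
      by (rule wave_gap.intro[OF \<epsilon> L]) (use N in simp)
    define Z where "Z \<omega> = (\<lambda>s. \<delta> * ou_path \<epsilon> \<omega> s)" for \<omega>
    have cont: "continuous_on UNIV \<omega>" if "\<omega> \<in> \<Omega>" for \<omega>
      using sublinear_base_properties(2)[OF assms(1,2)] that by (auto simp: wiener_paths_def)
    have temp: "tempered (ou_path \<epsilon> \<omega>)" if "\<omega> \<in> \<Omega>" for \<omega>
      using assms(2) that by (intro ou_path_tempered sublinear_tempered cont \<epsilon>(1)) (auto simp: sublinear_base_def)
    have tempZ: "tempered (Z \<omega>)" if "\<omega> \<in> \<Omega>" for \<omega>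
      unfolding Z_def by (rule tempered_scale[OF temp[OF that]])
    interpret random_spectral_gap_system slow_group fast_semigroup obs nonlin "(\<phi>, 0)" K "L / \<epsilon>\<^sup>2" "2 * L" \<alpha> "(\<alpha> + \<beta>) / 2" \<beta>
      ?W wiener_shift Z "(0, H10_L2 \<phi>)"
    proof (rule random_spectral_gap_system.intro[OF spectral_gap_system_axioms random_spectral_gap_system_axioms.intro])
      show "tempered (Z \<omega>)" if "\<omega> \<in> space ?W" for \<omega> using tempZ that space by blast
      show "(\<lambda>\<omega>. Z \<omega> s) \<in> borel_measurable ?W" for s
        unfolding Z_def using cont space
        by (intro borel_measurable_times borel_measurable_const ou_path_measurable sublinear_base_properties(3)[OF assms(1,2)]) auto
      show "Z (wiener_shift t \<omega>) = (\<lambda>s. Z \<omega> (t + s))" for t \<omega> by (simp add: Z_def ou_path_shift)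
      show "wiener_shift t \<omega> \<in> space ?W" if "\<omega> \<in> space ?W" for t \<omega>
        using assms(2) that space by (simp add: sublinear_base_def)
    qed
    have rds: "wave_rds f \<phi> \<delta> \<epsilon> t \<omega> x = path_flow t (Z \<omega>) x" if "\<omega> \<in> space ?W" "0 \<le> t" for t \<omega> x
    proof -
      have tr: "wave_transform \<phi> \<delta> \<epsilon> (wiener_shift t \<omega>) = (\<lambda>U. U - Z \<omega> t *\<^sub>R (0, H10_L2 \<phi>))" for t
        by (simp add: fun_eq_iff wave_transform_def Z_def ou_path_def)
      have 0: "wiener_shift 0 \<omega> = \<omega>"
        using that(1) sublinear_base_properties(2)[OF assms(1,2)] by (auto simp: space wiener_shift_def wiener_paths_def)
      have "inv (\<lambda>U. U - c) y = y + c" for c y :: phase_space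
        by (rule inv_f_eq) (auto intro: injI)
      then show ?thesis
        unfolding wave_rds_def tr tr[of 0, unfolded 0] path_flow_def
        by (simp only: wave_flow_eq[OF temp[OF that(1)[unfolded space]] that(2)] Z_def)
    qed
    show "random_dynamical_system ?W wiener_shift (wave_rds f \<phi> \<delta> \<epsilon>)"
    proof -
      have "(\<lambda>(t, \<omega>, x). wave_rds f \<phi> \<delta> \<epsilon> t \<omega> x) \<in> borel_measurable (restrict_space borel {0..} \<Otimes>\<^sub>M ?W \<Otimes>\<^sub>M borel)"
        by (subst measurable_cong[where g = "\<lambda>(t, \<omega>, x). path_flow t (Z \<omega>) x"])
          (use path_flow_measurable in \<open>auto simp: space_pair_measure space_restrict_space[of borel] rds\<close>)
      then show ?thesis
        using random_dynamical_system_path_flow space shift_space unfolding random_dynamical_system_def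
        by (auto simp: rds)
    qed
    have "stochastic_inertial_manifold ?W wiener_shift (wave_semigroup \<epsilon>) (wave_rds f \<phi> \<delta> \<epsilon>) manifold"
      unfolding stochastic_inertial_manifold_def
    proof (intro conjI exI[of _ "slow_group 0"] wave_dichotomy finite_rank ballI allI)
      show "lipschitz_invariant_manifold ?W wiener_shift (slow_group 0) (wave_rds f \<phi> \<delta> \<epsilon>) manifold"
        using manifold_lipschitz_invariant unfolding lipschitz_invariant_manifold_def by (simp add: rds image_subset_iff)
      fix \<omega> x assume "\<omega> \<in> space ?W"
      with manifold_attracts[OF this, of x]
      show "\<exists>C \<gamma>. \<gamma> > 0 \<and> (\<forall>t\<ge>0. infdist (wave_rds f \<phi> \<delta> \<epsilon> t \<omega> x) (manifold (wiener_shift t \<omega>)) \<le> C * exp (- \<gamma> * t))"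
        by (simp add: rds)
    qed
    then show "\<exists>M. stochastic_inertial_manifold ?W wiener_shift (wave_semigroup \<epsilon>) (wave_rds f \<phi> \<delta> \<epsilon>) M" by blast
  qed
qed

end
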